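(* Let $A$ be a brick-finite finite dimensional algebra over a field $k$. The following are equivalent: (1) $A$ is brick-directed; (2) $K_0(\operatorname{proj} A)_{\mathbb{R}}$ admits a consistent sequence; (3) $K_0(\operatorname{proj} A)_{\mathbb{R}}$ admits a weakly consistent sequence.
   Context: $\operatorname{mod} A$ is the category of finitely generated left $A$-modules and $\operatorname{proj} A$ the category of finitely generated projective modules. A brick is a module $X\in\operatorname{mod} A$ such that $\operatorname{End}_A(X)$ is a division algebra; $\operatorname{brick} A$ is the set of isomorphism classes of bricks; $A$ is brick-finite if $\operatorname{brick} A$ is finite. A brick-cycle is a sequence $X_0\xrightarrow{f_1}X_1\to\cdots\xrightarrow{f_m}X_m$ with $m\ge 1$, all $X_i$ bricks, $X_0\simeq X_m$, and each $f_j$ non-zero and non-invertible. $A$ is brick-directed if $\operatorname{mod} A$ contains no brick-cycle. Let $S_1,\dots,S_n$ be the simple $A$-modules up to isomorphism and $P_i$ the projective cover of $S_i$. Set $K_0(\operatorname{proj} A)_{\mathbb{R}}=\bigoplus_{i}\mathbb{R}[P_i]$ and $K_0(\operatorname{mod} A)_{\mathbb{R}}=\bigoplus_i\mathbb{R}[S_i]$. Via the Euler bilinear form $K_0(\operatorname{proj} A)_{\mathbb{R}}\times K_0(\operatorname{mod} A)_{\mathbb{R}}\to\mathbb{R}$, $([P_i],[S_j])\mapsto\delta_{ij}\dim_k\operatorname{End}_A(S_j)$, each $\theta\in K_0(\operatorname{proj} A)_{\mathbb{R}}$ is viewed as a linear form on $K_0(\operatorname{mod} A)_{\mathbb{R}}$,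 and $\theta(M):=\theta([M])$. A module $M$ is $\theta$-stable if $\theta(M)=0$ and $\theta(N)>0$ for every non-zero proper quotient module $N$ of $M$. For a totally ordered set $J$, a sequence $\{\theta_j\}_{j\in J}$ of elements of $K_0(\operatorname{proj} A)_{\mathbb{R}}$ is called consistent (respectively weakly consistent) if there is an ordering $\operatorname{brick} A=\{X_j\}_{j\in J}$ (a bijective indexing of the bricks by $J$) such that: (i) for $i<j$, $\theta_i(X_j)<0$; (ii) for $i>j$, $\theta_i(X_j)>0$ (respectively $\theta_i(X_j)\ge 0$); (iii) for each $i$, the brick $X_i$ is $\theta_i$-stable. *)

theory Defs
  imports
    Complex_Main
    "HOL-Algebra.AbelCoset"
    "Jordan_Normal_Form.Missing_VectorSpace"
    "HOL-Library.FuncSet"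
begin

section \<open>Finite-dimensional algebras and their modules\<close>

(* HOL-Algebra's locales module and algebra require commutative rings, so both notions are restated
   here without commutativity.  Of the record type module, a left module uses only the fields carrier,
   zero, add and smult; for an algebra A over K, the field smult of A is the action of K on A. *)

locale fd_algebra = vectorspace K A + ring A
  for K :: "'k ring" and A :: "('k, 'a) module" +
  assumes smult_mult_left:
      "\<lbrakk>c \<in> carrier K; x \<in> carrier A; y \<in> carrier A\<rbrakk> \<Longrightarrow>
        (c \<odot>\<^bsub>A\<^esub> x) \<otimes>\<^bsub>A\<^esub> y = c \<odot>\<^bsub>A\<^esub> (x \<otimes>\<^bsub>A\<^esub> y)"
    and smult_mult_right:
      "\<lbrakk>c \<in> carrier K; x \<in> carrier A; y \<in> carrier A\<rbrakk> \<Longrightarrow>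
        x \<otimes>\<^bsub>A\<^esub> (c \<odot>\<^bsub>A\<^esub> y) = c \<odot>\<^bsub>A\<^esub> (x \<otimes>\<^bsub>A\<^esub> y)"
    and finite_dimensional: "vectorspace.fin_dim K A"

locale left_module = R?: ring R + M?: abelian_group M
  for R :: "('a, 'r) ring_scheme" (structure) and M :: "('a, 'm) module" (structure) +
  assumes smult_closed:
      "\<lbrakk>a \<in> carrier R; x \<in> carrier M\<rbrakk> \<Longrightarrow> a \<odot>\<^bsub>M\<^esub> x \<in> carrier M"
    and smult_l_distr:
      "\<lbrakk>a \<in> carrier R; b \<in> carrier R; x \<in> carrier M\<rbrakk> \<Longrightarrow>
        (a \<oplus>\<^bsub>R\<^esub> b) \<odot>\<^bsub>M\<^esub> x = a \<odot>\<^bsub>M\<^esub> x \<oplus>\<^bsub>M\<^esub> b \<odot>\<^bsub>M\<^esub> x"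
    and smult_r_distr:
      "\<lbrakk>a \<in> carrier R; x \<in> carrier M; y \<in> carrier M\<rbrakk> \<Longrightarrow>
        a \<odot>\<^bsub>M\<^esub> (x \<oplus>\<^bsub>M\<^esub> y) = a \<odot>\<^bsub>M\<^esub> x \<oplus>\<^bsub>M\<^esub> a \<odot>\<^bsub>M\<^esub> y"
    and smult_assoc:
      "\<lbrakk>a \<in> carrier R; b \<in> carrier R; x \<in> carrier M\<rbrakk> \<Longrightarrow>
        (a \<otimes>\<^bsub>R\<^esub> b) \<odot>\<^bsub>M\<^esub> x = a \<odot>\<^bsub>M\<^esub> (b \<odot>\<^bsub>M\<^esub> x)"
    and smult_one: "x \<in> carrier M \<Longrightarrow> \<one>\<^bsub>R\<^esub> \<odot>\<^bsub>M\<^esub> x = x"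

(* Jordan_Normal_Form's own locale submodule (with another argument order) asks for a commutative
   base ring; the one of HOL-Algebra, used below, does not. *)
abbreviation is_submodule :: "('a, 'r) ring_scheme \<Rightarrow> 'm set \<Rightarrow> ('a, 'm) module \<Rightarrow> bool" where
  "is_submodule A L M \<equiv> Module.submodule L A M"

(* The fields mult and one of the record are not used by modules. *)
definition quotient_module :: "('a, 'm) module \<Rightarrow> 'm set \<Rightarrow> ('a, 'm set) module" where
  "quotient_module M L =
    \<lparr>carrier = a_rcosets\<^bsub>M\<^esub> L, mult = undefined, one = undefined, zero = L, add = set_add M,
     smult = (\<lambda>a C. \<Union>x\<in>C. L +>\<^bsub>M\<^esub> (a \<odot>\<^bsub>M\<^esub> x))\<rparr>"

definition finitely_generated :: "('a, 'r) ring_scheme \<Rightarrow> ('a, 'm) module \<Rightarrow> bool" where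
  "finitely_generated A M \<longleftrightarrow>
    (\<exists>B. finite B \<and> B \<subseteq> carrier M \<and> (\<forall>L. is_submodule A L M \<and> B \<subseteq> L \<longrightarrow> L = carrier M))"

definition module_isos ::
  "('a, 'r) ring_scheme \<Rightarrow> ('a, 'm) module \<Rightarrow> ('a, 'n) module \<Rightarrow> ('m \<Rightarrow> 'n) set" where
  "module_isos A M N = {f \<in> module_hom A M N. bij_betw f (carrier M) (carrier N)}"

definition isomorphic :: "('a, 'r) ring_scheme \<Rightarrow> ('a, 'm) module \<Rightarrow> ('a, 'n) module \<Rightarrow> bool" where
  "isomorphic A M N \<longleftrightarrow> module_isos A M N \<noteq> {}"

definition simple_module :: "('a, 'r) ring_scheme \<Rightarrow> ('a, 'm) module \<Rightarrow> bool" where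
  "simple_module A M \<longleftrightarrow>
    left_module A M \<and> carrier M \<noteq> {\<zero>\<^bsub>M\<^esub>} \<and>
    (\<forall>L. is_submodule A L M \<longrightarrow> L = {\<zero>\<^bsub>M\<^esub>} \<or> L = carrier M)"

(* The objects of mod A.  Carriers are taken inside the type nat => 'k: a finitely generated A-module
   has finite dimension d over K, hence its underlying set is in bijection with K^d, and so it is
   isomorphic to an object of this universe. *)
definition mod_cat :: "('k, 'a) module \<Rightarrow> ('a, nat \<Rightarrow> 'k) module set" where
  "mod_cat A = {M. left_module A M \<and> finitely_generated A M}"

definition iso_class ::
  "('k, 'a) module \<Rightarrow> ('a, nat \<Rightarrow> 'k) module \<Rightarrow> ('a, nat \<Rightarrow> 'k) module set" where
  "iso_class A M = {N \<in> mod_cat A. isomorphic A M N}"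

section \<open>Bricks\<close>

(* c in K acts on an A-module as c . 1_A; functions are extensional so that two endomorphisms are
   equal iff they agree on the carrier of X. *)
definition End_alg ::
  "('k, 'a) module \<Rightarrow> ('a, 'm) module \<Rightarrow> ('k, 'm \<Rightarrow> 'm) module" where
  "End_alg A X =
    \<lparr>carrier = module_hom A X X \<inter> extensional (carrier X),
     mult = compose (carrier X),
     one = (\<lambda>x\<in>carrier X. x),
     zero = (\<lambda>x\<in>carrier X. \<zero>\<^bsub>X\<^esub>),
     add = (\<lambda>f g. \<lambda>x\<in>carrier X. f x \<oplus>\<^bsub>X\<^esub> g x),
     smult = (\<lambda>c f. \<lambda>x\<in>carrier X. (c \<odot>\<^bsub>A\<^esub> \<one>\<^bsub>A\<^esub>) \<odot>\<^bsub>X\<^esub> f x)\<rparr>"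

definition division_algebra :: "('k, 'd) module \<Rightarrow> bool" where
  "division_algebra D \<longleftrightarrow> ring D \<and> \<one>\<^bsub>D\<^esub> \<noteq> \<zero>\<^bsub>D\<^esub> \<and> Units D = carrier D - {\<zero>\<^bsub>D\<^esub>}"

definition bricks :: "('k, 'a) module \<Rightarrow> ('a, nat \<Rightarrow> 'k) module set" where
  "bricks A = {X \<in> mod_cat A. division_algebra (End_alg A X)}"

definition brick_classes :: "('k, 'a) module \<Rightarrow> ('a, nat \<Rightarrow> 'k) module set set" where
  "brick_classes A = iso_class A ` bricks A"

definition brick_finite :: "('k, 'a) module \<Rightarrow> bool" where
  "brick_finite A \<longleftrightarrow> finite (brick_classes A)"

definition brick_cycle ::
  "('k, 'a) module \<Rightarrow> nat \<Rightarrow> (nat \<Rightarrow> ('a, nat \<Rightarrow> 'k) module)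
    \<Rightarrow> (nat \<Rightarrow> (nat \<Rightarrow> 'k) \<Rightarrow> (nat \<Rightarrow> 'k)) \<Rightarrow> bool" where
  "brick_cycle A m X f \<longleftrightarrow>
    1 \<le> m \<and> (\<forall>i\<in>{0..m}. X i \<in> bricks A) \<and> isomorphic A (X 0) (X m) \<and>
    (\<forall>j\<in>{1..m}. f j \<in> module_hom A (X (j - 1)) (X j) \<and>
       (\<exists>x\<in>carrier (X (j - 1)). f j x \<noteq> \<zero>\<^bsub>X j\<^esub>) \<and>
       f j \<notin> module_isos A (X (j - 1)) (X j))"

definition brick_directed :: "('k, 'a) module \<Rightarrow> bool" where
  "brick_directed A \<longleftrightarrow> (\<nexists>m X f. brick_cycle A m X f)"

section \<open>Simple modules, projective covers and Grothendieck groups\<close>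

definition projective :: "('k, 'a) module \<Rightarrow> ('a, nat \<Rightarrow> 'k) module \<Rightarrow> bool" where
  "projective A P \<longleftrightarrow> P \<in> mod_cat A \<and>
    (\<forall>M\<in>mod_cat A. \<forall>N\<in>mod_cat A. \<forall>g\<in>module_hom A M N. \<forall>h\<in>module_hom A P N.
       g ` carrier M = carrier N \<longrightarrow>
       (\<exists>l\<in>module_hom A P M. \<forall>x\<in>carrier P. g (l x) = h x))"

(* Projective with an epimorphism onto S whose kernel is superfluous. *)
definition projective_cover ::
  "('k, 'a) module \<Rightarrow> ('a, nat \<Rightarrow> 'k) module \<Rightarrow> ('a, nat \<Rightarrow> 'k) module \<Rightarrow> bool" where
  "projective_cover A P S \<longleftrightarrow> projective A P \<and>
    (\<exists>p\<in>module_hom A P S. p ` carrier P = carrier S \<and>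
       (\<forall>L. is_submodule A L P \<and> set_add P (a_kernel P S p) L = carrier P \<longrightarrow> L = carrier P))"

(* S 1, ..., S n are the simple modules up to isomorphism, and P i is the projective cover of S i. *)
definition simples_with_covers ::
  "('k, 'a) module \<Rightarrow> nat \<Rightarrow> (nat \<Rightarrow> ('a, nat \<Rightarrow> 'k) module)
    \<Rightarrow> (nat \<Rightarrow> ('a, nat \<Rightarrow> 'k) module) \<Rightarrow> bool" where
  "simples_with_covers A n S P \<longleftrightarrow>
    (\<forall>i\<in>{1..n}. S i \<in> mod_cat A \<and> simple_module A (S i) \<and> projective_cover A (P i) (S i)) \<and>
    (\<forall>i\<in>{1..n}. \<forall>j\<in>{1..n}. isomorphic A (S i) (S j) \<longrightarrow> i = j) \<and>
    (\<forall>M\<in>mod_cat A. simple_module A M \<longrightarrow> (\<exists>i\<in>{1..n}. isomorphic A M (S i)))"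

definition composition_series :: "('a, 'r) ring_scheme \<Rightarrow> ('a, 'm) module \<Rightarrow> 'm set list \<Rightarrow> bool" where
  "composition_series A M Ls \<longleftrightarrow>
    Ls \<noteq> [] \<and> hd Ls = {\<zero>\<^bsub>M\<^esub>} \<and> last Ls = carrier M \<and> (\<forall>L\<in>set Ls. is_submodule A L M) \<and>
    (\<forall>i. Suc i < length Ls \<longrightarrow> Ls ! i \<subset> Ls ! Suc i \<and>
       simple_module A (quotient_module (M\<lparr>carrier := Ls ! Suc i\<rparr>) (Ls ! i)))"

(* The multiplicity [M : T] of the simple module T in M; by Jordan-Hoelder the number of factors
   isomorphic to T is the same for all composition series of M. *)
definition jh_mult :: "('a, 'r) ring_scheme \<Rightarrow> ('a, 'm) module \<Rightarrow> ('a, 'n) module \<Rightarrow> nat" where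
  "jh_mult A M T = (THE r. \<exists>Ls. composition_series A M Ls \<and>
     r = card {i. Suc i < length Ls \<and>
       isomorphic A (quotient_module (M\<lparr>carrier := Ls ! Suc i\<rparr>) (Ls ! i)) T})"

(* K_0(proj A)_R and K_0(mod A)_R are the real vector spaces with bases [P 1], ..., [P n] and
   [S 1], ..., [S n]: an element of either is the family of its coefficients, indexed by isomorphism
   classes and zero outside the basis. *)
definition K0_proj ::
  "('k, 'a) module \<Rightarrow> nat \<Rightarrow> (nat \<Rightarrow> ('a, nat \<Rightarrow> 'k) module)
    \<Rightarrow> (('a, nat \<Rightarrow> 'k) module set \<Rightarrow> real) set" where
  "K0_proj A n P = {\<theta>. \<forall>c. c \<notin> (\<lambda>i. iso_class A (P i)) ` {1..n} \<longrightarrow> \<theta> c = 0}"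

(* [M] = sum_i [M : S i] [S i] in K_0(mod A)_R; the carrier type of M is arbitrary, so that this also
   applies to quotient_module M L. *)
definition K0_class ::
  "('k, 'a) module \<Rightarrow> nat \<Rightarrow> (nat \<Rightarrow> ('a, nat \<Rightarrow> 'k) module) \<Rightarrow> ('a, 'm) module
    \<Rightarrow> (('a, nat \<Rightarrow> 'k) module set \<Rightarrow> real)" where
  "K0_class A n S M =
    (\<lambda>c. \<Sum>i\<in>{1..n}. real (jh_mult A M (S i)) * (if c = iso_class A (S i) then 1 else 0))"

(* The bilinear extension of ([P i], [S j]) |-> delta_ij dim_K End_A(S j). *)
definition euler_form ::
  "'k ring \<Rightarrow> ('k, 'a) module \<Rightarrow> nat \<Rightarrow> (nat \<Rightarrow> ('a, nat \<Rightarrow> 'k) module)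
    \<Rightarrow> (nat \<Rightarrow> ('a, nat \<Rightarrow> 'k) module)
    \<Rightarrow> (('a, nat \<Rightarrow> 'k) module set \<Rightarrow> real) \<Rightarrow> (('a, nat \<Rightarrow> 'k) module set \<Rightarrow> real) \<Rightarrow> real" where
  "euler_form K A n S P \<theta> x =
    (\<Sum>i\<in>{1..n}. \<Sum>j\<in>{1..n}. \<theta> (iso_class A (P i)) * x (iso_class A (S j)) *
       (if i = j then real (vectorspace.dim K (End_alg A (S j))) else 0))"

definition theta_value ::
  "'k ring \<Rightarrow> ('k, 'a) module \<Rightarrow> nat \<Rightarrow> (nat \<Rightarrow> ('a, nat \<Rightarrow> 'k) module)
    \<Rightarrow> (nat \<Rightarrow> ('a, nat \<Rightarrow> 'k) module)
    \<Rightarrow> (('a, nat \<Rightarrow> 'k) module set \<Rightarrow> real) \<Rightarrow> ('a, 'm) module \<Rightarrow> real" where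
  "theta_value K A n S P \<theta> M = euler_form K A n S P \<theta> (K0_class A n S M)"

section \<open>Stability and consistent sequences\<close>

definition stable ::
  "'k ring \<Rightarrow> ('k, 'a) module \<Rightarrow> nat \<Rightarrow> (nat \<Rightarrow> ('a, nat \<Rightarrow> 'k) module)
    \<Rightarrow> (nat \<Rightarrow> ('a, nat \<Rightarrow> 'k) module)
    \<Rightarrow> (('a, nat \<Rightarrow> 'k) module set \<Rightarrow> real) \<Rightarrow> ('a, 'm) module \<Rightarrow> bool" where
  "stable K A n S P \<theta> M \<longleftrightarrow>
    theta_value K A n S P \<theta> M = 0 \<and>
    (\<forall>L. is_submodule A L M \<and> L \<noteq> {\<zero>\<^bsub>M\<^esub>} \<and> L \<noteq> carrier M \<longrightarrow>
       theta_value K A n S P \<theta> (quotient_module M L) > 0)"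

(* A totally ordered set J is given by its underlying set J and its reflexive order relation r. *)

definition consistent ::
  "'k ring \<Rightarrow> ('k, 'a) module \<Rightarrow> nat \<Rightarrow> (nat \<Rightarrow> ('a, nat \<Rightarrow> 'k) module)
    \<Rightarrow> (nat \<Rightarrow> ('a, nat \<Rightarrow> 'k) module) \<Rightarrow> 'j set \<Rightarrow> 'j rel
    \<Rightarrow> ('j \<Rightarrow> ('a, nat \<Rightarrow> 'k) module set \<Rightarrow> real) \<Rightarrow> bool" where
  "consistent K A n S P J r \<theta> \<longleftrightarrow>
    (\<exists>X. X \<in> J \<rightarrow> bricks A \<and> bij_betw (\<lambda>j. iso_class A (X j)) J (brick_classes A) \<and>
      (\<forall>i\<in>J. \<forall>j\<in>J. (i, j) \<in> r \<and> i \<noteq> j \<longrightarrow> theta_value K A n S P (\<theta> i) (X j) < 0) \<and>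
      (\<forall>i\<in>J. \<forall>j\<in>J. (j, i) \<in> r \<and> i \<noteq> j \<longrightarrow> theta_value K A n S P (\<theta> i) (X j) > 0) \<and>
      (\<forall>i\<in>J. stable K A n S P (\<theta> i) (X i)))"

definition weakly_consistent ::
  "'k ring \<Rightarrow> ('k, 'a) module \<Rightarrow> nat \<Rightarrow> (nat \<Rightarrow> ('a, nat \<Rightarrow> 'k) module)
    \<Rightarrow> (nat \<Rightarrow> ('a, nat \<Rightarrow> 'k) module) \<Rightarrow> 'j set \<Rightarrow> 'j rel
    \<Rightarrow> ('j \<Rightarrow> ('a, nat \<Rightarrow> 'k) module set \<Rightarrow> real) \<Rightarrow> bool" where
  "weakly_consistent K A n S P J r \<theta> \<longleftrightarrow>
    (\<exists>X. X \<in> J \<rightarrow> bricks A \<and> bij_betw (\<lambda>j. iso_class A (X j)) J (brick_classes A) \<and>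
      (\<forall>i\<in>J. \<forall>j\<in>J. (i, j) \<in> r \<and> i \<noteq> j \<longrightarrow> theta_value K A n S P (\<theta> i) (X j) < 0) \<and>
      (\<forall>i\<in>J. \<forall>j\<in>J. (j, i) \<in> r \<and> i \<noteq> j \<longrightarrow> theta_value K A n S P (\<theta> i) (X j) \<ge> 0) \<and>
      (\<forall>i\<in>J. stable K A n S P (\<theta> i) (X i)))"

(* The index set J of a (weakly) consistent sequence is in bijection with the set of isomorphism
   classes of bricks, so it is no restriction to take J inside the type of isomorphism classes; the
   order r on J is arbitrary. *)

definition admits_consistent_sequence ::
  "'k ring \<Rightarrow> ('k, 'a) module \<Rightarrow> nat \<Rightarrow> (nat \<Rightarrow> ('a, nat \<Rightarrow> 'k) module)
    \<Rightarrow> (nat \<Rightarrow> ('a, nat \<Rightarrow> 'k) module) \<Rightarrow> bool" where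
  "admits_consistent_sequence K A n S P \<longleftrightarrow>
    (\<exists>(J :: ('a, nat \<Rightarrow> 'k) module set set) r \<theta>. linear_order_on J r \<and> \<theta> \<in> J \<rightarrow> K0_proj A n P \<and>
       consistent K A n S P J r \<theta>)"

definition admits_weakly_consistent_sequence ::
  "'k ring \<Rightarrow> ('k, 'a) module \<Rightarrow> nat \<Rightarrow> (nat \<Rightarrow> ('a, nat \<Rightarrow> 'k) module)
    \<Rightarrow> (nat \<Rightarrow> ('a, nat \<Rightarrow> 'k) module) \<Rightarrow> bool" where
  "admits_weakly_consistent_sequence K A n S P \<longleftrightarrow>
    (\<exists>(J :: ('a, nat \<Rightarrow> 'k) module set set) r \<theta>. linear_order_on J r \<and> \<theta> \<in> J \<rightarrow> K0_proj A n P \<and>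
       weakly_consistent K A n S P J r \<theta>)"

end

theory Submission
  imports Defs
begin

text \<open>
  If \<open>f : X i \<rightarrow> X j\<close> is a nonzero non-isomorphism of bricks, some nonzero endomorphism of its image has
  a brick \<open>X c\<close> as image, which is a quotient of \<open>X i\<close> and a submodule of \<open>X j\<close>. Stability
  gives \<open>\<theta> i (X c) > 0\<close> unless \<open>c = i\<close> and \<open>\<theta> j (X c) < 0\<close> unless \<open>c = j\<close>; hence \<open>j < i\<close> in a weakly consistent
  ordering, and there are no brick-cycles.

  Conversely, number the bricks so that nonzero maps \<open>X i \<rightarrow> X j\<close>, \<open>i \<noteq> j\<close>, exist only for \<open>j < i\<close>, and let
  \<open>T k\<close> be the torsion class of the modules without nonzero maps to \<open>X i\<close>, \<open>i \<ge> k\<close>. Starting from all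
  modules, one descends from \<open>T (k + 1)\<close> to \<open>T k\<close>, keeping an Ext-projective generator and an Ext-projective
  left approximation of \<open>A\<close>. A presentation of the latter yields a linear form that is positive on
  \<open>T k\<close> and negative on the modules without maps from \<open>T k\<close>. The positive
  combination of the forms of \<open>T k\<close> and \<open>T (k + 1)\<close> vanishing on \<open>X k\<close> is the required \<open>\<theta> k\<close>.
\<close>

subsection \<open>Left modules and homomorphisms\<close>

text \<open>Support tau-tilting modules and their g-vectors are the usual source of such linear
  forms; here neither Auslander-Reiten translates nor Ext groups appear. Ext-projectivity is a
  lifting property, and the difference of the two projectives in a presentation plays the part of
  the g-vector. The obstacle is that every \<open>T k\<close> must carry enough Ext-projective
  modules for an approximation of A to exist. This is where directedness acts: among the bricks of
  \<open>T (k + 1)\<close> only the copies of \<open>X k\<close> have nonzero maps to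
  \<open>X k\<close>. Hence every nonzero map from a module of \<open>T (k + 1)\<close> to
  \<open>X k\<close> is onto with kernel in \<open>T (k + 1)\<close>, and Ext-projective modules
  lift along it. Brick-finiteness gives the numbering a last brick, so that the descent can start
  from all modules. The two forms have opposite signs on \<open>X k\<close>, which lies in
  \<open>T (k + 1)\<close> and is torsion-free for \<open>T k\<close>; this is why a positive
  combination of them can vanish there. The combination stays positive on the nonzero modules of
  \<open>T k\<close>, and \<open>T k\<close> contains every proper quotient of \<open>X k\<close>,
  which gives stability.\<close>

abbreviation sub :: "('a, 'm) module \<Rightarrow> 'm set \<Rightarrow> ('a, 'm) module" where
  "sub M L \<equiv> M\<lparr>carrier := L\<rparr>"

abbreviation kern :: "('a, 'm) module \<Rightarrow> ('a, 'n) module \<Rightarrow> ('m \<Rightarrow> 'n) \<Rightarrow> 'm set" where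
  "kern M N f \<equiv> {x \<in> carrier M. f x = \<zero>\<^bsub>N\<^esub>}"

lemma left_moduleI:
  fixes R (structure) and M (structure)
  assumes "ring R" and "abelian_group M"
    and "\<And>a x. \<lbrakk>a \<in> carrier R; x \<in> carrier M\<rbrakk> \<Longrightarrow> a \<odot>\<^bsub>M\<^esub> x \<in> carrier M"
    and "\<And>a b x. \<lbrakk>a \<in> carrier R; b \<in> carrier R; x \<in> carrier M\<rbrakk> \<Longrightarrow>
      (a \<oplus> b) \<odot>\<^bsub>M\<^esub> x = a \<odot>\<^bsub>M\<^esub> x \<oplus>\<^bsub>M\<^esub> b \<odot>\<^bsub>M\<^esub> x"
    and "\<And>a x y. \<lbrakk>a \<in> carrier R; x \<in> carrier M; y \<in> carrier M\<rbrakk> \<Longrightarrow>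
      a \<odot>\<^bsub>M\<^esub> (x \<oplus>\<^bsub>M\<^esub> y) = a \<odot>\<^bsub>M\<^esub> x \<oplus>\<^bsub>M\<^esub> a \<odot>\<^bsub>M\<^esub> y"
    and "\<And>a b x. \<lbrakk>a \<in> carrier R; b \<in> carrier R; x \<in> carrier M\<rbrakk> \<Longrightarrow>
      (a \<otimes> b) \<odot>\<^bsub>M\<^esub> x = a \<odot>\<^bsub>M\<^esub> (b \<odot>\<^bsub>M\<^esub> x)"
    and "\<And>x. x \<in> carrier M \<Longrightarrow> \<one> \<odot>\<^bsub>M\<^esub> x = x"
  shows "left_module R M"
  using assms by (simp add: left_module_def left_module_axioms_def)

lemma hom_closed: "f \<in> module_hom R M N \<Longrightarrow> x \<in> carrier M \<Longrightarrow> f x \<in> carrier N"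
  by (auto simp: module_hom_def)

lemma homI:
  assumes "\<And>x. x \<in> carrier M \<Longrightarrow> f x \<in> carrier N"
    and "\<And>x y. x \<in> carrier M \<Longrightarrow> y \<in> carrier M \<Longrightarrow> f (x \<oplus>\<^bsub>M\<^esub> y) = f x \<oplus>\<^bsub>N\<^esub> f y"
    and "\<And>a x. a \<in> carrier R \<Longrightarrow> x \<in> carrier M \<Longrightarrow> f (a \<odot>\<^bsub>M\<^esub> x) = a \<odot>\<^bsub>N\<^esub> f x"
  shows "f \<in> module_hom R M N"
  using assms by (auto simp: module_hom_def)

lemma hom_comp: "f \<in> module_hom R M N \<Longrightarrow> g \<in> module_hom R N L \<Longrightarrow> (\<lambda>x. g (f x)) \<in> module_hom R M L"
  by (auto simp: module_hom_def Pi_def)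

lemma hom_id: "(\<lambda>x. x) \<in> module_hom R M M"
  by (auto simp: module_hom_def)

text \<open>Membership in \<open>module_hom\<close> depends on the values on the carrier only. This
  is what allows a homomorphism to be replaced by its extensional restriction, the form in which it
  belongs to a Hom space.\<close>

lemma hom_cong: "f \<in> module_hom R M N \<Longrightarrow> left_module R M \<Longrightarrow> (\<And>x. x \<in> carrier M \<Longrightarrow> g x = f x)
  \<Longrightarrow> g \<in> module_hom R M N"
  by (intro homI) (auto simp: module_hom_def left_module.smult_closed abelian_monoid.a_closed
      left_module_def abelian_group_def)

context left_module begin

lemma smult_zero_left [simp]: "x \<in> carrier M \<Longrightarrow> \<zero>\<^bsub>R\<^esub> \<odot>\<^bsub>M\<^esub> x = \<zero>\<^bsub>M\<^esub>"
proof -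
  assume x: "x \<in> carrier M"
  have "\<zero>\<^bsub>R\<^esub> \<odot>\<^bsub>M\<^esub> x = \<zero>\<^bsub>R\<^esub> \<odot>\<^bsub>M\<^esub> x \<oplus>\<^bsub>M\<^esub> \<zero>\<^bsub>R\<^esub> \<odot>\<^bsub>M\<^esub> x"
    using smult_l_distr[of "\<zero>\<^bsub>R\<^esub>" "\<zero>\<^bsub>R\<^esub>" x] x by simp
  then show ?thesis using smult_closed[of "\<zero>\<^bsub>R\<^esub>" x] x by (metis M.add.r_cancel_one' R.zero_closed)
qed

lemma smult_zero_right [simp]: "a \<in> carrier R \<Longrightarrow> a \<odot>\<^bsub>M\<^esub> \<zero>\<^bsub>M\<^esub> = \<zero>\<^bsub>M\<^esub>"
proof -
  assume a: "a \<in> carrier R"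
  have "a \<odot>\<^bsub>M\<^esub> \<zero>\<^bsub>M\<^esub> = a \<odot>\<^bsub>M\<^esub> \<zero>\<^bsub>M\<^esub> \<oplus>\<^bsub>M\<^esub> a \<odot>\<^bsub>M\<^esub> \<zero>\<^bsub>M\<^esub>"
    using smult_r_distr[of a "\<zero>\<^bsub>M\<^esub>" "\<zero>\<^bsub>M\<^esub>"] a by simp
  then show ?thesis using smult_closed[of a "\<zero>\<^bsub>M\<^esub>"] a by (metis M.add.r_cancel_one' M.zero_closed)
qed

lemma smult_minus_right: "a \<in> carrier R \<Longrightarrow> x \<in> carrier M \<Longrightarrow> a \<odot>\<^bsub>M\<^esub> (\<ominus>\<^bsub>M\<^esub> x) = \<ominus>\<^bsub>M\<^esub> (a \<odot>\<^bsub>M\<^esub> x)"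
  using smult_r_distr[of a "\<ominus>\<^bsub>M\<^esub> x" x] M.minus_equality[of "a \<odot>\<^bsub>M\<^esub> (\<ominus>\<^bsub>M\<^esub> x)" "a \<odot>\<^bsub>M\<^esub> x"]
  by (simp add: smult_closed M.l_neg)

lemma smult_minus_left: "a \<in> carrier R \<Longrightarrow> x \<in> carrier M \<Longrightarrow> (\<ominus>\<^bsub>R\<^esub> a) \<odot>\<^bsub>M\<^esub> x = \<ominus>\<^bsub>M\<^esub> (a \<odot>\<^bsub>M\<^esub> x)"
  using smult_l_distr[of "\<ominus>\<^bsub>R\<^esub> a" a x] M.minus_equality[of "(\<ominus>\<^bsub>R\<^esub> a) \<odot>\<^bsub>M\<^esub> x" "a \<odot>\<^bsub>M\<^esub> x"]
  by (simp add: smult_closed R.l_neg)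

declare smult_closed [simp] smult_one [simp]

lemma minus_self: "x \<in> carrier M \<Longrightarrow> x \<ominus>\<^bsub>M\<^esub> x = \<zero>\<^bsub>M\<^esub>"
  by (simp add: a_minus_def M.r_neg)

lemma minus_eq_zeroD: "x \<in> carrier M \<Longrightarrow> y \<in> carrier M \<Longrightarrow> x \<ominus>\<^bsub>M\<^esub> y = \<zero>\<^bsub>M\<^esub> \<Longrightarrow> x = y"
  using M.minus_equality[of x "\<ominus>\<^bsub>M\<^esub> y"] by (simp add: a_minus_def)

lemma minus_add_cancel: "x \<in> carrier M \<Longrightarrow> y \<in> carrier M \<Longrightarrow> (x \<ominus>\<^bsub>M\<^esub> y) \<oplus>\<^bsub>M\<^esub> y = x"
  by (simp add: a_minus_def M.a_assoc M.l_neg)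

lemma minus_zero: "x \<in> carrier M \<Longrightarrow> x \<ominus>\<^bsub>M\<^esub> \<zero>\<^bsub>M\<^esub> = x"
  by (simp add: a_minus_def)

text \<open>Closure under negation comes from the action of minus one.\<close>

lemma submodI:
  assumes "L \<subseteq> carrier M" "\<zero>\<^bsub>M\<^esub> \<in> L"
    and "\<And>x y. x \<in> L \<Longrightarrow> y \<in> L \<Longrightarrow> x \<oplus>\<^bsub>M\<^esub> y \<in> L"
    and "\<And>a x. a \<in> carrier R \<Longrightarrow> x \<in> L \<Longrightarrow> a \<odot>\<^bsub>M\<^esub> x \<in> L"
  shows "is_submodule R L M"
proof (intro Module.submodule.intro subgroup.intro Module.submodule_axioms.intro)
  show "L \<subseteq> carrier (add_monoid M)" "\<one>\<^bsub>add_monoid M\<^esub> \<in> L" using assms(1,2) by simp_all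
  show "x \<otimes>\<^bsub>add_monoid M\<^esub> y \<in> L" if "x \<in> L" "y \<in> L" for x y using assms(3)[OF that] by simp
  show "inv\<^bsub>add_monoid M\<^esub> x \<in> L" if "x \<in> L" for x
    using that subsetD[OF assms(1) that] assms(4)[of "\<ominus>\<^bsub>R\<^esub> \<one>\<^bsub>R\<^esub>" x] smult_minus_left[of "\<one>\<^bsub>R\<^esub>" x]
    by (simp add: a_inv_def[symmetric])
qed (rule assms(4))

lemma submodD:
  assumes "is_submodule R L M"
  shows "L \<subseteq> carrier M" "\<zero>\<^bsub>M\<^esub> \<in> L"
    and "\<And>x y. x \<in> L \<Longrightarrow> y \<in> L \<Longrightarrow> x \<oplus>\<^bsub>M\<^esub> y \<in> L"
    and "\<And>a x. a \<in> carrier R \<Longrightarrow> x \<in> L \<Longrightarrow> a \<odot>\<^bsub>M\<^esub> x \<in> L"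
    and "\<And>x. x \<in> L \<Longrightarrow> \<ominus>\<^bsub>M\<^esub> x \<in> L"
    and "\<And>x y. x \<in> L \<Longrightarrow> y \<in> L \<Longrightarrow> x \<ominus>\<^bsub>M\<^esub> y \<in> L"
proof -
  interpret s: subgroup L "add_monoid M" using assms by (simp add: Module.submodule_def)
  show 1: "L \<subseteq> carrier M" "\<zero>\<^bsub>M\<^esub> \<in> L" using s.subset s.one_closed by simp_all
  show 2: "\<And>x y. x \<in> L \<Longrightarrow> y \<in> L \<Longrightarrow> x \<oplus>\<^bsub>M\<^esub> y \<in> L" using s.m_closed by simp
  show "\<And>a x. a \<in> carrier R \<Longrightarrow> x \<in> L \<Longrightarrow> a \<odot>\<^bsub>M\<^esub> x \<in> L"
    by (rule Module.submodule.smult_closed[OF assms])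
  show 3: "\<And>x. x \<in> L \<Longrightarrow> \<ominus>\<^bsub>M\<^esub> x \<in> L" using s.m_inv_closed by (simp add: a_inv_def)
  show "\<And>x y. x \<in> L \<Longrightarrow> y \<in> L \<Longrightarrow> x \<ominus>\<^bsub>M\<^esub> y \<in> L" unfolding a_minus_def using 2 3 by blast
qed

lemma submod_carrier: "is_submodule R (carrier M) M"
  by (rule submodI) auto

lemma submod_zero: "is_submodule R {\<zero>\<^bsub>M\<^esub>} M"
  by (rule submodI) auto

lemma submod_Int: "is_submodule R L M \<Longrightarrow> is_submodule R L' M \<Longrightarrow> is_submodule R (L \<inter> L') M"
  using submodD[of L] submodD[of L'] by (intro submodI) auto

lemma left_module_sub:
  assumes L: "is_submodule R L M"
  shows "left_module R (sub M L)"
proof -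
  note D = submodD[OF L]
  have Lc: "\<And>x. x \<in> L \<Longrightarrow> x \<in> carrier M" using D(1) by auto
  show ?thesis
  proof (rule left_moduleI)
    show "ring R" ..
    show "abelian_group (sub M L)"
    proof (rule abelian_groupI)
      show "\<exists>y\<in>carrier (sub M L). y \<oplus>\<^bsub>sub M L\<^esub> x = \<zero>\<^bsub>sub M L\<^esub>"
        if "x \<in> carrier (sub M L)" for x
        using that D(5)[of x] Lc by (auto intro!: bexI[of _ "\<ominus>\<^bsub>M\<^esub> x"] M.l_neg)
    qed (use D Lc in \<open>auto simp: M.a_assoc intro: M.a_comm\<close>)
  qed (use D Lc in \<open>auto simp: smult_l_distr smult_r_distr smult_assoc\<close>)
qed

lemma submod_trans:
  assumes L: "is_submodule R L M" and "is_submodule R L' (sub M L)"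
  shows "is_submodule R L' M"
proof -
  interpret L: left_module R "sub M L" by (rule left_module_sub[OF L])
  show ?thesis using L.submodD[OF assms(2)] submodD[OF L] by (intro submodI) auto
qed

lemma submod_sub:
  assumes L: "is_submodule R L M" and "is_submodule R L' M" "L' \<subseteq> L"
  shows "is_submodule R L' (sub M L)"
proof -
  interpret L: left_module R "sub M L" by (rule left_module_sub[OF L])
  show ?thesis using submodD[OF assms(2)] submodD[OF L] assms(3) by (intro L.submodI) auto
qed

lemma hom_incl: "is_submodule R L M \<Longrightarrow> (\<lambda>x. x) \<in> module_hom R (sub M L) M"
  by (frule submodD(1)) (auto intro!: homI)

lemma hom_restrict_dom: "is_submodule R L M \<Longrightarrow> f \<in> module_hom R M N \<Longrightarrow> f \<in> module_hom R (sub M L) N"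
  by (frule submodD(1)) (auto simp: module_hom_def subset_iff Pi_def)

lemma hom_into_sub: "f \<in> module_hom R N M \<Longrightarrow> f ` carrier N \<subseteq> L \<Longrightarrow> f \<in> module_hom R N (sub M L)"
  by (auto simp: module_hom_def)

end

text \<open>Each module law of \<open>Q\<close> is the image under \<open>p\<close> of the same law
  of \<open>M\<close>. Quotient modules and modules transported along an injection both obtain their
  structure from here.\<close>

lemma left_module_image:
  assumes M: "left_module R M" and c: "carrier Q = p ` carrier M"
    and a: "\<And>x y. x \<in> carrier M \<Longrightarrow> y \<in> carrier M \<Longrightarrow> p (x \<oplus>\<^bsub>M\<^esub> y) = p x \<oplus>\<^bsub>Q\<^esub> p y"
    and s: "\<And>r x. r \<in> carrier R \<Longrightarrow> x \<in> carrier M \<Longrightarrow> p (r \<odot>\<^bsub>M\<^esub> x) = r \<odot>\<^bsub>Q\<^esub> p x"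
    and z: "\<zero>\<^bsub>Q\<^esub> = p \<zero>\<^bsub>M\<^esub>"
  shows "left_module R Q" "p \<in> module_hom R M Q"
proof -
  interpret left_module R M by fact
  show "p \<in> module_hom R M Q" by (rule homI) (auto simp: a s c)
  show "left_module R Q"
  proof (rule left_moduleI)
    show "ring R" ..
    show "abelian_group Q"
    proof (rule abelian_groupI)
      show "\<exists>y\<in>carrier Q. y \<oplus>\<^bsub>Q\<^esub> x = \<zero>\<^bsub>Q\<^esub>" if x: "x \<in> carrier Q" for x
      proof -
        from x c obtain u where u: "u \<in> carrier M" "x = p u" by auto
        show ?thesis using u c z by (intro bexI[of _ "p (\<ominus>\<^bsub>M\<^esub> u)"]) (simp_all add: M.l_neg flip: a)
      qed
    qed (auto simp: c z a[symmetric] M.a_ac)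
  qed (auto simp: c z a[symmetric] s[symmetric] smult_l_distr smult_r_distr smult_assoc)
qed

context
  fixes R :: "('a, 'r) ring_scheme" and M :: "('a, 'm) module" and N :: "('a, 'n) module" and f
  assumes M: "left_module R M" and N: "left_module R N" and f: "f \<in> module_hom R M N"
begin

interpretation M: left_module R M by (rule M)
interpretation N: left_module R N by (rule N)

lemma hom_zero: "f \<zero>\<^bsub>M\<^esub> = \<zero>\<^bsub>N\<^esub>"
  using module_hom_smult[OF f M.R.zero_closed M.M.zero_closed] hom_closed[OF f] by simp

lemma hom_neg: "x \<in> carrier M \<Longrightarrow> f (\<ominus>\<^bsub>M\<^esub> x) = \<ominus>\<^bsub>N\<^esub> f x"
  using module_hom_add[OF f, of "\<ominus>\<^bsub>M\<^esub> x" x] hom_closed[OF f]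
  N.M.minus_equality[of "f (\<ominus>\<^bsub>M\<^esub> x)" "f x"]
  by (simp add: M.M.l_neg hom_zero)

lemma hom_minus: "x \<in> carrier M \<Longrightarrow> y \<in> carrier M \<Longrightarrow> f (x \<ominus>\<^bsub>M\<^esub> y) = f x \<ominus>\<^bsub>N\<^esub> f y"
  by (simp add: a_minus_def module_hom_add[OF f] hom_neg)

lemma submod_kern: "is_submodule R (kern M N f) M"
  by (rule M.submodI) (auto simp: hom_zero module_hom_add[OF f] module_hom_smult[OF f])

lemma submod_image:
  assumes "is_submodule R L M"
  shows "is_submodule R (f ` L) N"
proof (rule N.submodI)
  note D = M.submodD[OF assms]
  show "f ` L \<subseteq> carrier N" using D(1) hom_closed[OF f] by auto
  show "\<zero>\<^bsub>N\<^esub> \<in> f ` L" using D(2) hom_zero by force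
  show "x \<oplus>\<^bsub>N\<^esub> y \<in> f ` L" if xy: "x \<in> f ` L" "y \<in> f ` L" for x y
  proof -
    obtain u v where uv: "u \<in> L" "v \<in> L" "x = f u" "y = f v" using xy by auto
    then have "x \<oplus>\<^bsub>N\<^esub> y = f (u \<oplus>\<^bsub>M\<^esub> v)" using subsetD[OF D(1)] module_hom_add[OF f, of u v] uv by simp
    then show ?thesis using D(3)[of u v] uv by simp
  qed
  show "a \<odot>\<^bsub>N\<^esub> x \<in> f ` L" if ax: "a \<in> carrier R" "x \<in> f ` L" for a x
  proof -
    obtain u where uv: "u \<in> L" "x = f u" using ax by auto
    then have "a \<odot>\<^bsub>N\<^esub> x = f (a \<odot>\<^bsub>M\<^esub> u)" using subsetD[OF D(1)] ax module_hom_smult[OF f, of a u] uv by simp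
    then show ?thesis using D(4)[of a u] uv ax by simp
  qed
qed

lemma submod_im: "is_submodule R (f ` carrier M) N"
  by (rule submod_image[OF M.submod_carrier])

lemma submod_vimage:
  assumes "is_submodule R L N"
  shows "is_submodule R {x \<in> carrier M. f x \<in> L} M"
  using N.submodD(2-4)[OF assms]
  by (intro M.submodI) (simp_all add: hom_zero module_hom_add[OF f] module_hom_smult[OF f] subset_iff)

lemma inj_on_kern: "(\<And>x. x \<in> carrier M \<Longrightarrow> f x = \<zero>\<^bsub>N\<^esub> \<Longrightarrow> x = \<zero>\<^bsub>M\<^esub>) \<Longrightarrow> inj_on f (carrier M)"
proof (rule inj_onI)
  fix x y assume k: "\<And>x. x \<in> carrier M \<Longrightarrow> f x = \<zero>\<^bsub>N\<^esub> \<Longrightarrow> x = \<zero>\<^bsub>M\<^esub>"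
    and xy: "x \<in> carrier M" "y \<in> carrier M" "f x = f y"
  have "f (x \<ominus>\<^bsub>M\<^esub> y) = \<zero>\<^bsub>N\<^esub>"
    using xy hom_minus[of x y] N.minus_self[of "f y"] hom_closed[OF f] by simp
  then have "x \<ominus>\<^bsub>M\<^esub> y = \<zero>\<^bsub>M\<^esub>" by (intro k) (use xy in simp_all)
  then show "x = y" by (rule M.minus_eq_zeroD[OF xy(1,2)])
qed

end

context left_module begin

lemma hom_const_zero: "left_module R N \<Longrightarrow> (\<lambda>x. \<zero>\<^bsub>M\<^esub>) \<in> module_hom R N M"
  by (rule homI) auto

lemma hom_plus: "f \<in> module_hom R N M \<Longrightarrow> g \<in> module_hom R N M \<Longrightarrow> (\<lambda>x. f x \<oplus>\<^bsub>M\<^esub> g x) \<in> module_hom R N M"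
  by (auto simp: module_hom_def Pi_def smult_r_distr M.a_ac)

lemma hom_uminus: "f \<in> module_hom R N M \<Longrightarrow> (\<lambda>x. \<ominus>\<^bsub>M\<^esub> f x) \<in> module_hom R N M"
  by (auto simp: module_hom_def Pi_def smult_minus_right M.minus_add)

lemma hom_diff: "f \<in> module_hom R N M \<Longrightarrow> g \<in> module_hom R N M \<Longrightarrow> (\<lambda>x. f x \<ominus>\<^bsub>M\<^esub> g x) \<in> module_hom R N M"
  unfolding a_minus_def by (intro hom_plus hom_uminus)

end

text \<open>The induced map evaluates \<open>f\<close> at an arbitrary preimage under
  \<open>p\<close>. Two preimages differ by an element of the kernel of \<open>p\<close>, which
  \<open>f\<close> kills, so the choice has no effect on the value.\<close>

lemma hom_factor:
  assumes L: "left_module R M" "left_module R Q" "left_module R N"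
    and f: "f \<in> module_hom R M N" and p: "p \<in> module_hom R M Q" "p ` carrier M = carrier Q"
    and k: "\<And>x. x \<in> carrier M \<Longrightarrow> p x = \<zero>\<^bsub>Q\<^esub> \<Longrightarrow> f x = \<zero>\<^bsub>N\<^esub>"
  obtains g where "g \<in> module_hom R Q N" "\<And>x. x \<in> carrier M \<Longrightarrow> g (p x) = f x"
proof -
  interpret M: left_module R M by fact
  interpret N: left_module R N by fact
  interpret Q: left_module R Q by fact
  define g where "g q = f (SOME x. x \<in> carrier M \<and> p x = q)" for q
  have gp: "g (p x) = f x" if x: "x \<in> carrier M" for x
  proof -
    define y where "y = (SOME y. y \<in> carrier M \<and> p y = p x)"
    have "y \<in> carrier M \<and> p y = p x" unfolding y_def by (rule someI[of _ x]) (use x in simp)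
    then have y: "y \<in> carrier M" "p y = p x" by simp_all
    have "p (y \<ominus>\<^bsub>M\<^esub> x) = \<zero>\<^bsub>Q\<^esub>"
      using x y hom_closed[OF p(1), of x] by (simp add: hom_minus[OF L(1,2) p(1)] Q.minus_self)
    then have "f (y \<ominus>\<^bsub>M\<^esub> x) = \<zero>\<^bsub>N\<^esub>" by (intro k) (use x y in simp_all)
    then have "f y \<ominus>\<^bsub>N\<^esub> f x = \<zero>\<^bsub>N\<^esub>" using x y by (simp add: hom_minus[OF L(1,3) f])
    then have "f y = f x" by (rule N.minus_eq_zeroD[OF hom_closed[OF f y(1)] hom_closed[OF f x]])
    then show ?thesis by (simp add: g_def y_def)
  qed
  have "g \<in> module_hom R Q N"
  proof (rule homI)
    fix q assume "q \<in> carrier Q"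
    then obtain x where x: "x \<in> carrier M" "q = p x" using p(2)[symmetric] by auto
    show "g q \<in> carrier N" using x gp hom_closed[OF f] by auto
    fix a assume a: "a \<in> carrier R"
    have "a \<odot>\<^bsub>Q\<^esub> q = p (a \<odot>\<^bsub>M\<^esub> x)" using x a module_hom_smult[OF p(1)] by auto
    then show "g (a \<odot>\<^bsub>Q\<^esub> q) = a \<odot>\<^bsub>N\<^esub> g q" using x a gp module_hom_smult[OF f] by auto
  next
    fix q q' assume "q \<in> carrier Q" "q' \<in> carrier Q"
    then obtain x x' where x: "x \<in> carrier M" "q = p x" "x' \<in> carrier M" "q' = p x'" using p(2)[symmetric] by auto
    have "q \<oplus>\<^bsub>Q\<^esub> q' = p (x \<oplus>\<^bsub>M\<^esub> x')" using x module_hom_add[OF p(1)] by auto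
    then show "g (q \<oplus>\<^bsub>Q\<^esub> q') = g q \<oplus>\<^bsub>N\<^esub> g q'" using x gp module_hom_add[OF f] by auto
  qed
  then show ?thesis using gp that by blast
qed

lemma hom_inverse:
  assumes f: "f \<in> module_hom R M N" "bij_betw f (carrier M) (carrier N)" and M: "left_module R M"
  shows "inv_into (carrier M) f \<in> module_hom R N M"
proof (rule homI)
  interpret M: left_module R M by fact
  let ?g = "inv_into (carrier M) f"
  have g: "?g y \<in> carrier M" "f (?g y) = y" if "y \<in> carrier N" for y
    using f(2) that by (auto simp: bij_betw_def inv_into_into f_inv_into_f)
  have gf: "?g (f x) = x" if "x \<in> carrier M" for x using f(2) that by (auto simp: bij_betw_def)
  show "?g x \<in> carrier M" if "x \<in> carrier N" for x using g that by auto
  show "?g (x \<oplus>\<^bsub>N\<^esub> y) = ?g x \<oplus>\<^bsub>M\<^esub> ?g y" if "x \<in> carrier N" "y \<in> carrier N" for x y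
    using gf[of "?g x \<oplus>\<^bsub>M\<^esub> ?g y"] g that module_hom_add[OF f(1), of "?g x" "?g y"] by auto
  show "?g (a \<odot>\<^bsub>N\<^esub> x) = a \<odot>\<^bsub>M\<^esub> ?g x" if "a \<in> carrier R" "x \<in> carrier N" for x a
    using gf[of "a \<odot>\<^bsub>M\<^esub> ?g x"] g that module_hom_smult[OF f(1), of a "?g x"] by auto
qed

lemma isomorphic_refl: "isomorphic R M M"
  unfolding isomorphic_def module_isos_def using hom_id[of R M] bij_betw_id[of "carrier M"] unfolding id_def by blast

lemma isomorphic_sym: "isomorphic R M N \<Longrightarrow> left_module R M \<Longrightarrow> isomorphic R N M"
  unfolding isomorphic_def module_isos_def using hom_inverse[of _ R M N] bij_betw_inv_into by blast

lemma isomorphic_trans: "isomorphic R M N \<Longrightarrow> isomorphic R N L \<Longrightarrow> isomorphic R M L"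
  unfolding isomorphic_def module_isos_def using hom_comp bij_betw_trans unfolding comp_def by blast

section \<open>Quotient modules\<close>

lemma (in left_module) quotient_module:
  assumes L: "is_submodule R L M"
  shows "left_module R (quotient_module M L)"
    and "(\<lambda>x. L +>\<^bsub>M\<^esub> x) \<in> module_hom R M (quotient_module M L)"
    and "(\<lambda>x. L +>\<^bsub>M\<^esub> x) ` carrier M = carrier (quotient_module M L)"
    and "kern M (quotient_module M L) (\<lambda>x. L +>\<^bsub>M\<^esub> x) = L"
proof -
  note D = submodD[OF L]
  interpret S: abelian_subgroup L M
    using L by (intro abelian_subgroupI3 additive_subgroup.intro) (auto simp: Module.submodule_def intro: M.abelian_group_axioms)
  let ?p = "\<lambda>x. L +>\<^bsub>M\<^esub> x"
  have c: "carrier (quotient_module M L) = ?p ` carrier M"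
    by (auto simp: quotient_module_def A_RCOSETS_def' )
  have eq: "?p x = ?p y \<longleftrightarrow> x \<ominus>\<^bsub>M\<^esub> y \<in> L" if "x \<in> carrier M" "y \<in> carrier M" for x y
    using that S.a_rcos_module[of y x] S.a_rcos_self[of x] S.a_repr_independence'[of x y]
    unfolding a_minus_def by metis
  \<comment> \<open>The action on a coset is defined as a union over all its representatives. Any
    two representatives give the same coset after multiplication by \<open>a\<close>, so the union
    consists of copies of one set.\<close>
  have sm: "?p (a \<odot>\<^bsub>M\<^esub> x) = a \<odot>\<^bsub>quotient_module M L\<^esub> ?p x" if ax: "a \<in> carrier R" "x \<in> carrier M" for a x
  proof -
    have "?p (a \<odot>\<^bsub>M\<^esub> y) = ?p (a \<odot>\<^bsub>M\<^esub> x)" if "y \<in> ?p x" for y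
    proof -
      have y: "y \<in> carrier M" using that ax M.a_r_coset_subset_G[OF D(1) ax(2)] by blast
      have "y \<ominus>\<^bsub>M\<^esub> x \<in> L" using S.a_repr_independence'[OF that ax(2)] eq[OF y ax(2)] by simp
      then have "a \<odot>\<^bsub>M\<^esub> y \<ominus>\<^bsub>M\<^esub> a \<odot>\<^bsub>M\<^esub> x \<in> L"
        using D(4)[OF ax(1), of "y \<ominus>\<^bsub>M\<^esub> x"] ax y by (simp add: a_minus_def smult_minus_right smult_r_distr)
      then show ?thesis using eq[of "a \<odot>\<^bsub>M\<^esub> y" "a \<odot>\<^bsub>M\<^esub> x"] ax y by simp
    qed
    moreover have "x \<in> ?p x" using ax S.a_rcos_self by auto
    ultimately have "(\<Union>y\<in>?p x. ?p (a \<odot>\<^bsub>M\<^esub> y)) = ?p (a \<odot>\<^bsub>M\<^esub> x)" by blast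
    then show ?thesis by (simp add: quotient_module_def)
  qed
  have ad: "?p (x \<oplus>\<^bsub>M\<^esub> y) = ?p x \<oplus>\<^bsub>quotient_module M L\<^esub> ?p y" if "x \<in> carrier M" "y \<in> carrier M" for x y
    using that S.a_rcos_sum by (simp add: quotient_module_def)
  have z: "\<zero>\<^bsub>quotient_module M L\<^esub> = ?p \<zero>\<^bsub>M\<^esub>"
    using M.a_coset_join2[OF M.zero_closed _ D(2)] S.a_subgroup
    by (simp add: quotient_module_def)
  from left_module_image[OF left_module_axioms c ad sm z]
  show "left_module R (quotient_module M L)" "?p \<in> module_hom R M (quotient_module M L)" by auto
  show "?p ` carrier M = carrier (quotient_module M L)" using c by simp
  show "kern M (quotient_module M L) ?p = L"
    using eq[of _ "\<zero>\<^bsub>M\<^esub>"] D(1) minus_zero z by auto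
qed

subsection \<open>Finite dimension\<close>

text \<open>Independent subsets of \<open>W\<close> stay independent in \<open>V\<close>, so the
  dimension of \<open>V\<close> bounds their size. A maximal one therefore exists, and it is a
  basis.\<close>

lemma (in vectorspace) fin_dim_subspace:
  assumes W: "subspace K W V" and fd: "fin_dim"
  shows "vectorspace.fin_dim K (vs W)"
proof -
  interpret w: vectorspace K "vs W" by (rule subspace_is_vs[OF W])
  have sm: "LinearCombinations.submodule K W V" using W by (rule is_module)
  have WV: "W \<subseteq> carrier V" using sm by (simp add: LinearCombinations.submodule_def)
  let ?P = "\<lambda>A. A \<subseteq> carrier (vs W) \<and> w.lin_indpt A"
  have b: "finite A \<and> card A \<le> dim" if "?P A" for A
  proof -
    have A: "A \<subseteq> W" using that by simp
    have "lin_indpt A" using that span_li_not_depend(2)[OF A sm] by simp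
    then show ?thesis using li_le_dim[OF fd subset_trans[OF A WV]] by blast
  qed
  have "?P {}" unfolding w.lin_dep_def by simp
  from maximal_exists[of ?P, OF b this] obtain A where A: "finite A" "maximal A ?P" by blast
  have "w.basis A" by (rule w.max_li_is_basis[OF A(2)])
  then show ?thesis unfolding w.fin_dim_def using A(1) w.basis_def by blast
qed

lemma (in vectorspace) subspaceI:
  assumes "W \<subseteq> carrier V" "\<zero>\<^bsub>V\<^esub> \<in> W"
    and "\<And>v w. v \<in> W \<Longrightarrow> w \<in> W \<Longrightarrow> v \<oplus>\<^bsub>V\<^esub> w \<in> W"
    and "\<And>c v. c \<in> carrier K \<Longrightarrow> v \<in> W \<Longrightarrow> c \<odot>\<^bsub>V\<^esub> v \<in> W"
  shows "subspace K W V"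
proof -
  have "LinearCombinations.submodule K W V"
    by (rule LinearCombinations.submodule.intro[OF module_axioms assms(1) assms(3) assms(2) assms(4)])
  moreover have "vectorspace K V" ..
  ultimately show ?thesis by (simp add: subspace_def)
qed

text \<open>Generators of the kernel together with preimages of generators of the image generate
  \<open>V\<close>. This direction of rank-nullity is what makes Hom spaces finite-dimensional,
  where the dimension of \<open>V\<close> is not known beforehand.\<close>

lemma fin_dim_of_kernel:
  assumes lin: "linear_map K V W T" and W: "vectorspace.fin_dim K W"
    and ker: "vectorspace.fin_dim K (V\<lparr>carrier := mod_hom.ker V W T\<rparr>)"
  shows "vectorspace.fin_dim K V"
proof -
  interpret V: vectorspace K V using lin by (simp add: linear_map_def)
  interpret W: vectorspace K W using lin by (simp add: linear_map_def)
  interpret T: linear_map K V W T by fact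
  interpret k: vectorspace K "V.vs T.kerT" by (rule V.subspace_is_vs[OF T.kerT_is_subspace])
  interpret i: vectorspace K "W.vs T.imT" by (rule W.subspace_is_vs[OF T.imT_is_subspace])
  have im: "LinearCombinations.submodule K T.imT W" using T.imT_is_subspace by (rule W.is_module)
  have ke: "LinearCombinations.submodule K T.kerT V" using T.kerT_is_subspace by (rule V.is_module)
  obtain B where B: "finite B" "B \<subseteq> T.kerT" "k.span B = T.kerT"
    using ker unfolding k.fin_dim_def by auto
  obtain C where C: "finite C" "C \<subseteq> T.imT" "i.span C = T.imT"
    using W.fin_dim_subspace[OF T.imT_is_subspace W] unfolding i.fin_dim_def by auto
  have "\<forall>c\<in>C. \<exists>v. v \<in> carrier V \<and> T v = c" using C(2) unfolding T.im_def by blast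
  then obtain g where g: "\<And>c. c \<in> C \<Longrightarrow> g c \<in> carrier V \<and> T (g c) = c" by metis
  let ?G = "B \<union> g ` C"
  have kV: "T.kerT \<subseteq> carrier V" by (auto simp: T.ker_def)
  have G: "?G \<subseteq> carrier V" using B(2) kV g by blast
  have sp: "LinearCombinations.submodule K (V.span ?G) V" by (rule V.span_is_submodule[OF G])
  note S = LinearCombinations.submodule.m_closed[OF sp] LinearCombinations.submodule.smult_closed[OF sp]
    LinearCombinations.submodule.subset[OF sp] LinearCombinations.submodule.zero_closed[OF sp]
  have kS: "T.kerT \<subseteq> V.span ?G"
    using V.span_li_not_depend(1)[OF B(2) ke] B(3) V.span_is_monotone[of B ?G] by simp
  have TS: "subspace K (T ` V.span ?G) W"
  proof (rule W.subspaceI)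
    show "T ` V.span ?G \<subseteq> carrier W" using S(3) T.f_im by blast
    show "\<zero>\<^bsub>W\<^esub> \<in> T ` V.span ?G" using S(4) T.f0_is_0 by (metis imageI)
    show "v \<oplus>\<^bsub>W\<^esub> w \<in> T ` V.span ?G" if vw: "v \<in> T ` V.span ?G" "w \<in> T ` V.span ?G" for v w
    proof -
      obtain a b where ab: "a \<in> V.span ?G" "b \<in> V.span ?G" "v = T a" "w = T b" using vw by blast
      then have "v \<oplus>\<^bsub>W\<^esub> w = T (a \<oplus>\<^bsub>V\<^esub> b)" using subsetD[OF S(3)] T.f_add by simp
      then show ?thesis using S(1)[OF ab(1,2)] by blast
    qed
    show "c \<odot>\<^bsub>W\<^esub> v \<in> T ` V.span ?G" if c: "c \<in> carrier K" and v: "v \<in> T ` V.span ?G" for c v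
    proof -
      obtain a where a: "a \<in> V.span ?G" "v = T a" using v by blast
      then have "c \<odot>\<^bsub>W\<^esub> v = T (c \<odot>\<^bsub>V\<^esub> a)" using subsetD[OF S(3)] T.f_smult c by simp
      then show ?thesis using S(2)[OF c a(1)] by blast
    qed
  qed
  have "C \<subseteq> T ` V.span ?G"
  proof
    fix c assume c: "c \<in> C"
    then have "g c \<in> V.span ?G" using V.in_own_span[OF G] by blast
    then show "c \<in> T ` V.span ?G" using g[OF c] by (metis imageI)
  qed
  then have "W.span C \<subseteq> T ` V.span ?G"
    by (intro W.span_is_subset W.is_module[OF TS])
  then have iS: "T.imT \<subseteq> T ` V.span ?G"
    using W.span_li_not_depend(1)[OF C(2) im] C(3) by simp
  have "carrier V \<subseteq> V.span ?G"
  proof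
    fix x assume x: "x \<in> carrier V"
    then have "T x \<in> T.imT" by (simp add: T.im_def)
    then obtain s where s: "s \<in> V.span ?G" "T x = T s" using iS by blast
    have sV: "s \<in> carrier V" using s S(3) by blast
    have "T (x \<ominus>\<^bsub>V\<^esub> s) = \<zero>\<^bsub>W\<^esub>" using x sV s(2) T.f_im[OF sV] by (simp add: W.M.r_neg a_minus_def)
    then have "x \<ominus>\<^bsub>V\<^esub> s \<in> T.kerT" using x sV by (simp add: T.ker_def)
    then have "(x \<ominus>\<^bsub>V\<^esub> s) \<oplus>\<^bsub>V\<^esub> s \<in> V.span ?G" using kS s(1) by (intro S(1)) blast+
    then show "x \<in> V.span ?G" using x sV by (simp add: a_minus_def V.M.a_assoc V.M.l_neg)
  qed
  then have "V.gen_set ?G" using V.span_is_subset2[OF G] by blast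
  then show ?thesis unfolding V.fin_dim_def using B(1) C(1) G by (intro exI[of _ ?G]) simp
qed

lemma (in vectorspace) dim_zero_iff:
  assumes "fin_dim"
  shows "dim = 0 \<longleftrightarrow> carrier V = {\<zero>\<^bsub>V\<^esub>}"
proof -
  obtain b where b: "finite b" "basis b" using finite_basis_exists[OF assms] by blast
  have d: "dim = card b" by (rule dim_basis[OF b])
  show ?thesis
  proof
    assume "dim = 0"
    then have "b = {}" using d b(1) by simp
    then show "carrier V = {\<zero>\<^bsub>V\<^esub>}" using b(2) span_empty by (simp add: basis_def)
  next
    assume c: "carrier V = {\<zero>\<^bsub>V\<^esub>}"
    have "b = {}"
      using b(2) c vs_zero_lin_dep[of b] unfolding basis_def by auto
    then show "dim = 0" using d by simp
  qed
qed

text \<open>Injectivity needs no uniqueness of coordinates: any choice of coefficients with respect to a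
  finite generating set determines the vector.\<close>

lemma (in vectorspace) coordinates_inj:
  assumes "fin_dim"
  obtains g :: "'c \<Rightarrow> nat \<Rightarrow> 'a" where "inj_on g (carrier V)"
proof -
  obtain B where B: "finite B" "B \<subseteq> carrier V" "gen_set B" using assms unfolding fin_dim_def by blast
  obtain e where e: "bij_betw e {0..<card B} B" using ex_bij_betw_nat_finite[OF B(1)] by blast
  have "\<exists>a. a \<in> B \<rightarrow> carrier K \<and> lincomb a B = v" if "v \<in> carrier V" for v
    using finite_in_span[OF B(1,2)] B(3) that by blast
  then obtain c where c: "\<And>v. v \<in> carrier V \<Longrightarrow> c v \<in> B \<rightarrow> carrier K \<and> lincomb (c v) B = v" by metis
  define g where "g v = (\<lambda>i. if i < card B then c v (e i) else undefined)" for v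
  have "inj_on g (carrier V)"
  proof (rule inj_onI)
    fix v w assume v: "v \<in> carrier V" and w: "w \<in> carrier V" and eq: "g v = g w"
    have "c v b = c w b" if "b \<in> B" for b
    proof -
      have "b \<in> e ` {0..<card B}" unfolding bij_betw_imp_surj_on[OF e] by fact
      then obtain i where i: "i < card B" "b = e i" by auto
      show ?thesis using fun_cong[OF eq, of i] i by (simp add: g_def)
    qed
    then have "restrict (c v) B = restrict (c w) B" by (rule restrict_ext)
    then have "lincomb (c v) B = lincomb (c w) B"
      by (rule lincomb_restrict[OF B(2) conjunct1[OF c[OF v]]])
    then show "v = w" using conjunct2[OF c[OF v]] conjunct2[OF c[OF w]] by simp
  qed
  then show ?thesis using that by blast
qed

section \<open>Finitely generated modules\<close>

text \<open>In contrast to \<open>mod_cat\<close>, the type of the elements is arbitrary. Products,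
  quotients and the regular module live on other types and are treated in this form before copies of
  them are taken in \<open>mod_cat\<close>.\<close>

definition fg_module :: "('a, 'r) ring_scheme \<Rightarrow> ('a, 'm) module \<Rightarrow> bool" where
  "fg_module R M \<longleftrightarrow> left_module R M \<and> finitely_generated R M"

lemma fg_moduleD: "fg_module R M \<Longrightarrow> left_module R M"
  by (simp add: fg_module_def)

lemma mod_cat_iff: "M \<in> mod_cat A \<longleftrightarrow> fg_module A M"
  by (simp add: mod_cat_def fg_module_def)

lemma fg_image:
  assumes M: "fg_module R M" and N: "left_module R N"
    and f: "f \<in> module_hom R M N" "f ` carrier M = carrier N"
  shows "fg_module R N"
proof -
  interpret M: left_module R M by (rule fg_moduleD[OF M])
  obtain B where B: "finite B" "B \<subseteq> carrier M"
    "\<And>L. is_submodule R L M \<Longrightarrow> B \<subseteq> L \<Longrightarrow> L = carrier M"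
    using M unfolding fg_module_def finitely_generated_def by blast
  have "L = carrier N" if L: "is_submodule R L N" "f ` B \<subseteq> L" for L
  proof -
    have "{x \<in> carrier M. f x \<in> L} = carrier M"
      by (intro B(3) submod_vimage[OF fg_moduleD[OF M] N f(1) L(1)]) (use B(2) L(2) in blast)
    then have "f ` carrier M \<subseteq> L" by blast
    then show ?thesis using f(2) left_module.submodD(1)[OF N L(1)] by blast
  qed
  then show ?thesis unfolding fg_module_def finitely_generated_def
    using N B(1,2) f(2) by (intro conjI exI[of _ "f ` B"]) auto
qed

text \<open>The generators are those of the kernel together with preimages of generators of the
  quotient.\<close>

lemma fg_extension:
  assumes M: "left_module R M" and N: "fg_module R N"
    and f: "f \<in> module_hom R M N" "f ` carrier M = carrier N"
    and k: "fg_module R (sub M (kern M N f))"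
  shows "fg_module R M"
proof -
  interpret M: left_module R M by (rule M)
  interpret N: left_module R N by (rule fg_moduleD[OF N])
  let ?k = "kern M N f"
  note sk = submod_kern[OF M fg_moduleD[OF N] f(1)]
  obtain B where B: "finite B" "B \<subseteq> ?k" "\<And>L. is_submodule R L (sub M ?k) \<Longrightarrow> B \<subseteq> L \<Longrightarrow> L = ?k"
    using k unfolding fg_module_def finitely_generated_def by auto
  obtain C where C: "finite C" "C \<subseteq> carrier N"
    "\<And>L. is_submodule R L N \<Longrightarrow> C \<subseteq> L \<Longrightarrow> L = carrier N"
    using N unfolding fg_module_def finitely_generated_def by blast
  obtain D where D: "finite D" "D \<subseteq> carrier M" "C = f ` D"
    using C(1,2) f(2) finite_subset_image[of C f "carrier M"] by metis
  have "L = carrier M" if L: "is_submodule R L M" "B \<union> D \<subseteq> L" for L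
  proof -
    note LD = M.submodD[OF L(1)]
    have "L \<inter> ?k = ?k"
      by (intro B(3) M.submod_sub[OF sk] M.submod_Int[OF L(1) sk]) (use B(2) L(2) in auto)
    then have kL: "?k \<subseteq> L" by blast
    have fL: "f ` L = carrier N"
      by (intro C(3) submod_image[OF M fg_moduleD[OF N] f(1) L(1)]) (use D L(2) in blast)
    have "x \<in> L" if x: "x \<in> carrier M" for x
    proof -
      have "f x \<in> f ` L" using fL f(2) x by blast
      then obtain l where l: "l \<in> L" "f x = f l" by blast
      have lM: "l \<in> carrier M" using l LD(1) by blast
      have "f (x \<ominus>\<^bsub>M\<^esub> l) = \<zero>\<^bsub>N\<^esub>"
        using hom_minus[OF M fg_moduleD[OF N] f(1) x lM] l(2) hom_closed[OF f(1) lM] N.minus_self by simp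
      then have "x \<ominus>\<^bsub>M\<^esub> l \<in> L" using kL x lM by blast
      then have "(x \<ominus>\<^bsub>M\<^esub> l) \<oplus>\<^bsub>M\<^esub> l \<in> L" using LD(3) l(1) by blast
      then show ?thesis using M.minus_add_cancel[OF x lM] by simp
    qed
    then show ?thesis using LD(1) by blast
  qed
  then show ?thesis unfolding fg_module_def finitely_generated_def
    using M B(1,2) D(1,2) by (intro conjI exI[of _ "B \<union> D"]) auto
qed

section \<open>Direct products and transport of structure\<close>

definition prod_module :: "('a, 'm) module \<Rightarrow> ('a, 'n) module \<Rightarrow> ('a, 'm \<times> 'n) module" where
  "prod_module M N =
    \<lparr>carrier = carrier M \<times> carrier N, mult = undefined, one = undefined, zero = (\<zero>\<^bsub>M\<^esub>, \<zero>\<^bsub>N\<^esub>),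
     add = (\<lambda>x y. (fst x \<oplus>\<^bsub>M\<^esub> fst y, snd x \<oplus>\<^bsub>N\<^esub> snd y)),
     smult = (\<lambda>a x. (a \<odot>\<^bsub>M\<^esub> fst x, a \<odot>\<^bsub>N\<^esub> snd x))\<rparr>"

lemma prod_module:
  assumes M: "left_module R M" and N: "left_module R N"
  shows "left_module R (prod_module M N)"
    and "fst \<in> module_hom R (prod_module M N) M" "snd \<in> module_hom R (prod_module M N) N"
    and "(\<lambda>x. (x, \<zero>\<^bsub>N\<^esub>)) \<in> module_hom R M (prod_module M N)"
    and "(\<lambda>y. (\<zero>\<^bsub>M\<^esub>, y)) \<in> module_hom R N (prod_module M N)"
proof -
  interpret M: left_module R M by fact
  interpret N: left_module R N by fact
  show "left_module R (prod_module M N)"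
  proof (rule left_moduleI)
    show "ring R" ..
    show "abelian_group (prod_module M N)"
    proof (rule abelian_groupI)
      show "\<exists>y\<in>carrier (prod_module M N). y \<oplus>\<^bsub>prod_module M N\<^esub> x = \<zero>\<^bsub>prod_module M N\<^esub>"
        if "x \<in> carrier (prod_module M N)" for x
        using that
        by (intro bexI[of _ "(\<ominus>\<^bsub>M\<^esub> fst x, \<ominus>\<^bsub>N\<^esub> snd x)"]) (auto simp: prod_module_def M.M.l_neg N.M.l_neg)
    qed (auto simp: prod_module_def M.M.a_ac N.M.a_ac)
  qed (auto simp: prod_module_def M.smult_l_distr N.smult_l_distr M.smult_r_distr N.smult_r_distr
      M.smult_assoc N.smult_assoc)
qed (auto simp: prod_module_def module_hom_def left_module.smult_zero_right[OF M] left_module.smult_zero_right[OF N]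
    abelian_monoid.zero_closed abelian_monoid.l_zero M[unfolded left_module_def abelian_group_def]
     N[unfolded left_module_def abelian_group_def])

lemma fg_prod:
  assumes M: "fg_module R M" and N: "fg_module R N"
  shows "fg_module R (prod_module M N)"
proof (rule fg_extension)
  note P = prod_module[OF fg_moduleD[OF M] fg_moduleD[OF N]]
  interpret M: left_module R M by (rule fg_moduleD[OF M])
  interpret N: left_module R N by (rule fg_moduleD[OF N])
  let ?k = "kern (prod_module M N) M fst"
  show "left_module R (prod_module M N)" "fst \<in> module_hom R (prod_module M N) M" by (fact P(1), fact P(2))
  show "fg_module R M" by fact
  show "fst ` carrier (prod_module M N) = carrier M"
    using N.M.zero_closed by (auto simp: prod_module_def image_iff)
  have k: "is_submodule R ?k (prod_module M N)" by (rule submod_kern[OF P(1) fg_moduleD[OF M] P(2)])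
  show "fg_module R (sub (prod_module M N) ?k)"
  proof (rule fg_image[OF N left_module.left_module_sub[OF P(1) k]])
    show "(\<lambda>y. (\<zero>\<^bsub>M\<^esub>, y)) \<in> module_hom R N (sub (prod_module M N) ?k)"
      by (rule left_module.hom_into_sub[OF P(1) P(5)]) (auto simp: prod_module_def)
    show "(\<lambda>y. (\<zero>\<^bsub>M\<^esub>, y)) ` carrier N = carrier (sub (prod_module M N) ?k)"
      by (auto simp: prod_module_def)
  qed
qed

lemma transport_module:
  fixes M :: "('b, 'c) module" and g :: "'c \<Rightarrow> 'd"
  assumes M: "left_module R M" and g: "inj_on g (carrier M)"
  shows "\<exists>N. left_module R N \<and> g \<in> module_isos R M N"
proof -
  interpret M: left_module R M by fact
  let ?i = "inv_into (carrier M) g"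
  define N :: "('b, 'd) module" where "N = \<lparr>carrier = g ` carrier M, mult = undefined, one = undefined, zero = g \<zero>\<^bsub>M\<^esub>,
     add = (\<lambda>x y. g (?i x \<oplus>\<^bsub>M\<^esub> ?i y)), smult = (\<lambda>a x. g (a \<odot>\<^bsub>M\<^esub> ?i x))\<rparr>"
  have c: "carrier N = g ` carrier M" by (simp add: N_def)
  have "left_module R N" "g \<in> module_hom R M N"
    by (rule left_module_image[OF M c]; simp add: N_def g inv_into_f_f)+
  moreover have "bij_betw g (carrier M) (carrier N)" using g c by (simp add: bij_betw_def)
  ultimately show ?thesis by (auto simp: module_isos_def)
qed

section \<open>The action of the ground field\<close>

definition scalar_module :: "('k, 'a) module \<Rightarrow> ('a, 'm) module \<Rightarrow> ('k, 'm) module" where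
  "scalar_module A M =
    \<lparr>carrier = carrier M, mult = undefined, one = undefined, zero = \<zero>\<^bsub>M\<^esub>, add = add M,
     smult = (\<lambda>c x. (c \<odot>\<^bsub>A\<^esub> \<one>\<^bsub>A\<^esub>) \<odot>\<^bsub>M\<^esub> x)\<rparr>"

text \<open>The linear structure of \<open>End_alg\<close> carried over to two different modules:
  for equal modules carrier, addition and scalar action agree with those of
  \<open>End_alg\<close>.\<close>

definition hom_space :: "('k, 'a) module \<Rightarrow> ('a, 'm) module \<Rightarrow> ('a, 'n) module \<Rightarrow> ('k, 'm \<Rightarrow> 'n) module" where
  "hom_space A M N =
    \<lparr>carrier = module_hom A M N \<inter> extensional (carrier M), mult = undefined, one = undefined,
     zero = (\<lambda>x\<in>carrier M. \<zero>\<^bsub>N\<^esub>), add = (\<lambda>f g. \<lambda>x\<in>carrier M. f x \<oplus>\<^bsub>N\<^esub> g x),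
     smult = (\<lambda>c f. \<lambda>x\<in>carrier M. (c \<odot>\<^bsub>A\<^esub> \<one>\<^bsub>A\<^esub>) \<odot>\<^bsub>N\<^esub> f x)\<rparr>"

definition regular_module :: "('k, 'a) module \<Rightarrow> ('a, 'a) module" where
  "regular_module A =
    \<lparr>carrier = carrier A, mult = undefined, one = undefined, zero = \<zero>\<^bsub>A\<^esub>, add = add A, smult = mult A\<rparr>"

lemma linear_mapI:
  assumes "vectorspace K V" "vectorspace K W"
    and "\<And>x. x \<in> carrier V \<Longrightarrow> f x \<in> carrier W"
    and "\<And>x y. x \<in> carrier V \<Longrightarrow> y \<in> carrier V \<Longrightarrow> f (x \<oplus>\<^bsub>V\<^esub> y) = f x \<oplus>\<^bsub>W\<^esub> f y"
    and "\<And>a x. a \<in> carrier K \<Longrightarrow> x \<in> carrier V \<Longrightarrow> f (a \<odot>\<^bsub>V\<^esub> x) = a \<odot>\<^bsub>W\<^esub> f x"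
  shows "linear_map K V W f"
  using assms by (simp add: linear_map_def mod_hom_def mod_hom_axioms_def vectorspace_def homI)

context fd_algebra begin

abbreviation sc :: "'k \<Rightarrow> 'a" where "sc c \<equiv> c \<odot>\<^bsub>A\<^esub> \<one>\<^bsub>A\<^esub>"

lemma ring_A: "ring A" ..

lemma sc_closed: "c \<in> carrier K \<Longrightarrow> sc c \<in> carrier A"
  by simp

lemma sc_mult_left: "c \<in> carrier K \<Longrightarrow> a \<in> carrier A \<Longrightarrow> sc c \<otimes>\<^bsub>A\<^esub> a = c \<odot>\<^bsub>A\<^esub> a"
  using smult_mult_left[of c "\<one>\<^bsub>A\<^esub>" a] by simp

lemma sc_mult_right: "c \<in> carrier K \<Longrightarrow> a \<in> carrier A \<Longrightarrow> a \<otimes>\<^bsub>A\<^esub> sc c = c \<odot>\<^bsub>A\<^esub> a"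
  using smult_mult_right[of c a "\<one>\<^bsub>A\<^esub>"] by simp

lemma sc_mult: "c \<in> carrier K \<Longrightarrow> d \<in> carrier K \<Longrightarrow> sc (c \<otimes>\<^bsub>K\<^esub> d) = sc c \<otimes>\<^bsub>A\<^esub> sc d"
  by (simp add: sc_mult_left smult_assoc1)

lemma sc_add: "c \<in> carrier K \<Longrightarrow> d \<in> carrier K \<Longrightarrow> sc (c \<oplus>\<^bsub>K\<^esub> d) = sc c \<oplus>\<^bsub>A\<^esub> sc d"
  by (simp add: smult_l_distr)

lemma sc_commute:
  assumes "left_module A M" "c \<in> carrier K" "a \<in> carrier A" "x \<in> carrier M"
  shows "sc c \<odot>\<^bsub>M\<^esub> (a \<odot>\<^bsub>M\<^esub> x) = a \<odot>\<^bsub>M\<^esub> (sc c \<odot>\<^bsub>M\<^esub> x)"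
  using left_module.smult_assoc[OF assms(1), of "sc c" a x] left_module.smult_assoc[OF assms(1), of a "sc c" x] assms
  by (simp add: sc_mult_left sc_mult_right)

lemma scalar_vectorspace:
  assumes M: "left_module A M"
  shows "vectorspace K (scalar_module A M)"
proof -
  interpret M: left_module A M by fact
  have "module K (scalar_module A M)"
  proof (rule moduleI)
    show "cring K" ..
    show "abelian_group (scalar_module A M)"
    proof (rule abelian_groupI)
      show "\<exists>y\<in>carrier (scalar_module A M). y \<oplus>\<^bsub>scalar_module A M\<^esub> x = \<zero>\<^bsub>scalar_module A M\<^esub>"
        if "x \<in> carrier (scalar_module A M)" for x
        using that M.M.l_neg by (intro bexI[of _ "\<ominus>\<^bsub>M\<^esub> x"]) (simp_all add: scalar_module_def)
    qed (simp_all add: scalar_module_def M.M.a_ac)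
  qed (simp_all add: scalar_module_def M.smult_l_distr M.smult_r_distr M.smult_assoc sc_mult sc_add)
  moreover have "field K" ..
  ultimately show ?thesis by (rule vectorspace.intro)
qed

text \<open>The products of a spanning set \<open>E\<close> of the algebra with a generating set
  \<open>B\<close> of the module span the module over the field.\<close>

lemma fg_fin_dim:
  assumes M: "fg_module A M"
  shows "vectorspace.fin_dim K (scalar_module A M)"
proof -
  interpret M: left_module A M by (rule fg_moduleD[OF M])
  interpret V: vectorspace K "scalar_module A M" by (rule scalar_vectorspace[OF fg_moduleD[OF M]])
  obtain B where B: "finite B" "B \<subseteq> carrier M"
    "\<And>L. is_submodule A L M \<Longrightarrow> B \<subseteq> L \<Longrightarrow> L = carrier M"
    using M unfolding fg_module_def finitely_generated_def by blast
  obtain E where E: "finite E" "E \<subseteq> carrier A" "gen_set E"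
    using finite_dimensional unfolding fin_dim_def by blast
  define G where "G = (\<lambda>(e, b). e \<odot>\<^bsub>M\<^esub> b) ` (E \<times> B)"
  have cV: "carrier (scalar_module A M) = carrier M" by (simp add: scalar_module_def)
  have G: "finite G" "G \<subseteq> carrier (scalar_module A M)"
  proof -
    have "e \<odot>\<^bsub>M\<^esub> b \<in> carrier M" if "e \<in> E" "b \<in> B" for e b
      using that E(2) B(2) by (intro M.smult_closed) blast+
    then show "G \<subseteq> carrier (scalar_module A M)" unfolding G_def cV by auto
    show "finite G" unfolding G_def using E(1) B(1) by simp
  qed
  define Z where "Z = V.span G"
  have sZ: "LinearCombinations.submodule K Z (scalar_module A M)"
    unfolding Z_def by (rule V.span_is_submodule[OF G(2)])
  have Z1: "x \<oplus>\<^bsub>M\<^esub> y \<in> Z" if "x \<in> Z" "y \<in> Z" for x y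
    using LinearCombinations.submodule.m_closed[OF sZ that] by (simp add: scalar_module_def)
  have Z2: "sc c \<odot>\<^bsub>M\<^esub> x \<in> Z" if "c \<in> carrier K" "x \<in> Z" for c x
    using LinearCombinations.submodule.smult_closed[OF sZ that] by (simp add: scalar_module_def)
  have Z3: "\<zero>\<^bsub>M\<^esub> \<in> Z"
    using LinearCombinations.submodule.zero_closed[OF sZ] by (simp add: scalar_module_def)
  have Z4: "Z \<subseteq> carrier M" using LinearCombinations.submodule.subset[OF sZ] cV by simp
  have AZ: "a \<odot>\<^bsub>M\<^esub> b \<in> Z" if b: "b \<in> B" and a: "a \<in> carrier A" for a b
  proof -
    \<comment> \<open>For a fixed generator \<open>b\<close> the coefficients that send
      \<open>b\<close> into \<open>Z\<close> form a subspace of A. It contains the spanning set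
      \<open>E\<close>, hence is all of A.\<close>
    let ?W = "{a \<in> carrier A. a \<odot>\<^bsub>M\<^esub> b \<in> Z}"
    have bM: "b \<in> carrier M" using b B(2) by blast
    have "subspace K ?W A"
    proof (rule subspaceI)
      fix c v assume c: "c \<in> carrier K" and v: "v \<in> ?W"
      have "(c \<odot>\<^bsub>A\<^esub> v) \<odot>\<^bsub>M\<^esub> b = sc c \<odot>\<^bsub>M\<^esub> (v \<odot>\<^bsub>M\<^esub> b)"
        using M.smult_assoc[of "sc c" v b] c v bM by (simp add: sc_mult_left)
      then show "c \<odot>\<^bsub>A\<^esub> v \<in> ?W" using c v Z2 by simp
    next
      show "\<zero>\<^bsub>A\<^esub> \<in> ?W" using bM Z3 by simp
      show "v \<oplus>\<^bsub>A\<^esub> w \<in> ?W" if "v \<in> ?W" "w \<in> ?W" for v w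
        using that bM Z1 by (simp add: M.smult_l_distr)
    qed blast
    moreover have "E \<subseteq> ?W"
      using E(2) b V.in_own_span[OF G(2)] unfolding Z_def G_def by blast
    ultimately have "span E \<subseteq> ?W" by (intro span_is_subset is_module)
    then show ?thesis using E(3) a by blast
  qed
  \<comment> \<open>\<open>Z\<close> is known to be a subspace over the field, while the generators
    \<open>B\<close> control A-submodules. The elements whose whole A-orbit lies in \<open>Z\<close>
    do form an A-submodule.\<close>
  let ?Y = "{m \<in> carrier M. \<forall>a\<in>carrier A. a \<odot>\<^bsub>M\<^esub> m \<in> Z}"
  have "is_submodule A ?Y M"
    by (rule M.submodI) (use Z1 Z3 in \<open>auto simp: M.smult_r_distr simp flip: M.smult_assoc\<close>)
  moreover have "B \<subseteq> ?Y" using B(2) AZ by blast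
  ultimately have Y: "?Y = carrier M" by (rule B(3))
  have "x \<in> Z" if x: "x \<in> carrier M" for x
  proof -
    have "\<one>\<^bsub>A\<^esub> \<odot>\<^bsub>M\<^esub> x \<in> Z" using Y x monoid.one_closed[OF ring.is_monoid[OF ring_A]] by blast
    then show ?thesis using x by simp
  qed
  then have "V.gen_set G" using Z4 unfolding cV Z_def by blast
  then show ?thesis unfolding V.fin_dim_def using G by blast
qed

lemma fin_dim_fg:
  assumes M: "left_module A M" and fd: "vectorspace.fin_dim K (scalar_module A M)"
  shows "fg_module A M"
proof -
  interpret M: left_module A M by fact
  interpret V: vectorspace K "scalar_module A M" by (rule scalar_vectorspace[OF M])
  have cV: "carrier (scalar_module A M) = carrier M" by (simp add: scalar_module_def)
  obtain B where B: "finite B" "B \<subseteq> carrier M" "V.span B = carrier M"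
    using fd cV unfolding V.fin_dim_def by auto
  have "L = carrier M" if L: "is_submodule A L M" "B \<subseteq> L" for L
  proof -
    note D = M.submodD[OF L(1)]
    have "subspace K L (scalar_module A M)"
      by (rule V.subspaceI) (use D in \<open>simp_all add: scalar_module_def\<close>)
    then have "V.span B \<subseteq> L" by (intro V.span_is_subset L(2) V.is_module)
    then show ?thesis using B(3) D(1) by blast
  qed
  then show ?thesis unfolding fg_module_def finitely_generated_def using M B(1,2) by blast
qed

text \<open>A finite-dimensional algebra is noetherian: finite generation and finite dimension
  agree, and the latter passes to subspaces.\<close>

lemma fg_sub:
  assumes M: "fg_module A M" and L: "is_submodule A L M"
  shows "fg_module A (sub M L)"
proof (rule fin_dim_fg)
  interpret M: left_module A M by (rule fg_moduleD[OF M])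
  interpret V: vectorspace K "scalar_module A M" by (rule scalar_vectorspace[OF fg_moduleD[OF M]])
  show "left_module A (sub M L)" by (rule M.left_module_sub[OF L])
  note D = M.submodD[OF L]
  have "subspace K L (scalar_module A M)"
    by (rule V.subspaceI) (use D in \<open>simp_all add: scalar_module_def\<close>)
  from V.fin_dim_subspace[OF this fg_fin_dim[OF M]]
  show "vectorspace.fin_dim K (scalar_module A (sub M L))" by (simp add: scalar_module_def)
qed

text \<open>Coefficients with respect to a finite generating set over the field inject the carrier
  into the type \<open>nat => 'k\<close>, and the module structure is moved along this injection.
  All constructions enter \<open>mod_cat\<close> in this way.\<close>

lemma mod_cat_transport:
  assumes M: "fg_module A M"
  obtains N f where "N \<in> mod_cat A" "f \<in> module_isos A M N"
proof -
  interpret V: vectorspace K "scalar_module A M" by (rule scalar_vectorspace[OF fg_moduleD[OF M]])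
  obtain g :: "'b \<Rightarrow> nat \<Rightarrow> 'k" where "inj_on g (carrier (scalar_module A M))"
    using V.coordinates_inj[OF fg_fin_dim[OF M]] by blast
  then have "inj_on g (carrier M)" by (simp add: scalar_module_def)
  from transport_module[OF fg_moduleD[OF M] this] obtain N where N: "left_module A N" "g \<in> module_isos A M N"
    by blast
  have "fg_module A N"
    by (rule fg_image[OF M N(1), of g]) (use N(2) in \<open>simp_all add: module_isos_def bij_betw_def\<close>)
  then show ?thesis using that N(2) mod_cat_iff by blast
qed

section \<open>Spaces of homomorphisms\<close>

lemma hom_space_vectorspace:
  assumes M: "left_module A M" and N: "left_module A N"
  shows "vectorspace K (hom_space A M N)"
proof -
  interpret M: left_module A M by fact
  interpret N: left_module A N by fact
  let ?H = "hom_space A M N"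
  have cl: "f x \<in> carrier N" if "f \<in> module_hom A M N" "x \<in> carrier M" for f x
    using hom_closed[OF that] .
  have ext: "f = (\<lambda>x\<in>carrier M. f x)" if "f \<in> extensional (carrier M)" for f :: "'b \<Rightarrow> 'c"
    using that by (simp add: extensional_restrict)
  have "module K ?H"
  proof (rule moduleI)
    show "cring K" ..
    show "abelian_group ?H"
    proof (rule abelian_groupI)
      fix f g h assume fgh: "f \<in> carrier ?H" "g \<in> carrier ?H" "h \<in> carrier ?H"
      show "f \<oplus>\<^bsub>?H\<^esub> g \<in> carrier ?H"
        using fgh hom_cong[OF N.hom_plus[of f M g] M, of "\<lambda>x\<in>carrier M. f x \<oplus>\<^bsub>N\<^esub> g x"]
        by (simp add: hom_space_def)
      show "(f \<oplus>\<^bsub>?H\<^esub> g) \<oplus>\<^bsub>?H\<^esub> h = f \<oplus>\<^bsub>?H\<^esub> (g \<oplus>\<^bsub>?H\<^esub> h)"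
        using fgh by (auto simp: hom_space_def N.M.a_assoc cl)
      show "f \<oplus>\<^bsub>?H\<^esub> g = g \<oplus>\<^bsub>?H\<^esub> f"
        using fgh by (auto simp: hom_space_def N.M.a_comm cl)
    next
      show "\<zero>\<^bsub>?H\<^esub> \<in> carrier ?H"
        using hom_cong[OF N.hom_const_zero[OF M] M, of "\<lambda>x\<in>carrier M. \<zero>\<^bsub>N\<^esub>"]
        by (simp add: hom_space_def)
    next
      fix f assume f: "f \<in> carrier ?H"
      show "\<zero>\<^bsub>?H\<^esub> \<oplus>\<^bsub>?H\<^esub> f = f"
        using f by (auto simp: hom_space_def cl extensional_def)
      have "(\<lambda>x\<in>carrier M. \<ominus>\<^bsub>N\<^esub> f x) \<in> carrier ?H"
        using f hom_cong[OF N.hom_uminus[of f M] M, of "\<lambda>x\<in>carrier M. \<ominus>\<^bsub>N\<^esub> f x"]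
        by (simp add: hom_space_def)
      moreover have "(\<lambda>x\<in>carrier M. \<ominus>\<^bsub>N\<^esub> f x) \<oplus>\<^bsub>?H\<^esub> f = \<zero>\<^bsub>?H\<^esub>"
        using f by (auto simp: hom_space_def N.M.l_neg cl)
      ultimately show "\<exists>g\<in>carrier ?H. g \<oplus>\<^bsub>?H\<^esub> f = \<zero>\<^bsub>?H\<^esub>" by blast
    qed
  next
    fix c f assume c: "c \<in> carrier K" and f: "f \<in> carrier ?H"
    have fh: "f \<in> module_hom A M N" using f by (simp add: hom_space_def)
    have "(\<lambda>x. sc c \<odot>\<^bsub>N\<^esub> f x) \<in> module_hom A M N"
      using c cl[OF fh] module_hom_add[OF fh] module_hom_smult[OF fh]
      by (intro homI) (simp_all add: N.smult_r_distr sc_commute[OF N])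
    from hom_cong[OF this M, of "\<lambda>x\<in>carrier M. sc c \<odot>\<^bsub>N\<^esub> f x"]
    show "c \<odot>\<^bsub>?H\<^esub> f \<in> carrier ?H" by (simp add: hom_space_def)
  next
    fix c d f assume "c \<in> carrier K" "d \<in> carrier K" and f: "f \<in> carrier ?H"
    then show "(c \<oplus>\<^bsub>K\<^esub> d) \<odot>\<^bsub>?H\<^esub> f = c \<odot>\<^bsub>?H\<^esub> f \<oplus>\<^bsub>?H\<^esub> d \<odot>\<^bsub>?H\<^esub> f"
      and "(c \<otimes>\<^bsub>K\<^esub> d) \<odot>\<^bsub>?H\<^esub> f = c \<odot>\<^bsub>?H\<^esub> (d \<odot>\<^bsub>?H\<^esub> f)"
      by (auto simp: hom_space_def sc_add sc_mult N.smult_l_distr N.smult_assoc cl)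
  next
    fix c f g assume "c \<in> carrier K" "f \<in> carrier ?H" "g \<in> carrier ?H"
    then show "c \<odot>\<^bsub>?H\<^esub> (f \<oplus>\<^bsub>?H\<^esub> g) = c \<odot>\<^bsub>?H\<^esub> f \<oplus>\<^bsub>?H\<^esub> c \<odot>\<^bsub>?H\<^esub> g"
      by (auto simp: hom_space_def N.smult_r_distr cl)
  next
    fix f assume "f \<in> carrier ?H"
    then show "\<one>\<^bsub>K\<^esub> \<odot>\<^bsub>?H\<^esub> f = f" by (auto simp: hom_space_def cl extensional_def)
  qed
  moreover have "field K" ..
  ultimately show ?thesis by (rule vectorspace.intro)
qed

text \<open>Let \<open>V C\<close> be the maps vanishing on \<open>C\<close>. For a generating set
  \<open>B\<close> it is zero, and evaluation at \<open>b\<close> maps \<open>V C\<close> to the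
  finite-dimensional \<open>N\<close> with kernel \<open>V (insert b C)\<close>. Dropping the
  generators one by one reaches the whole Hom space.\<close>

lemma hom_space_fin_dim:
  assumes M: "fg_module A M" and N: "fg_module A N"
  shows "vectorspace.fin_dim K (hom_space A M N)"
proof -
  interpret M: left_module A M by (rule fg_moduleD[OF M])
  interpret N: left_module A N by (rule fg_moduleD[OF N])
  let ?H = "hom_space A M N"
  interpret H: vectorspace K ?H by (rule hom_space_vectorspace[OF fg_moduleD[OF M] fg_moduleD[OF N]])
  obtain B where B: "finite B" "B \<subseteq> carrier M"
    "\<And>L. is_submodule A L M \<Longrightarrow> B \<subseteq> L \<Longrightarrow> L = carrier M"
    using M unfolding fg_module_def finitely_generated_def by blast
  define V where "V C = {f \<in> carrier ?H. \<forall>b\<in>C. f b = \<zero>\<^bsub>N\<^esub>}" for C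
  have sV: "subspace K (V C) ?H" if "C \<subseteq> carrier M" for C
  proof (rule H.subspaceI)
    show "\<zero>\<^bsub>?H\<^esub> \<in> V C" using that H.M.zero_closed unfolding V_def by (auto simp: hom_space_def)
    show "f \<oplus>\<^bsub>?H\<^esub> g \<in> V C" if "f \<in> V C" "g \<in> V C" for f g
      using that \<open>C \<subseteq> carrier M\<close> H.M.a_closed[of f g] unfolding V_def by (auto simp: hom_space_def)
    show "c \<odot>\<^bsub>?H\<^esub> f \<in> V C" if "c \<in> carrier K" "f \<in> V C" for c f
      using that \<open>C \<subseteq> carrier M\<close> H.smult_closed[of c f] unfolding V_def by (auto simp: hom_space_def)
  qed (auto simp: V_def)
  have VB: "V B = {\<zero>\<^bsub>?H\<^esub>}"
  proof -
    have "f = \<zero>\<^bsub>?H\<^esub>" if f: "f \<in> V B" for f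
    proof -
      have fh: "f \<in> module_hom A M N" "f \<in> extensional (carrier M)" using f by (auto simp: V_def hom_space_def)
      have "kern M N f = carrier M"
        by (intro B(3) submod_kern[OF fg_moduleD[OF M] fg_moduleD[OF N] fh(1)]) (use f B(2) in \<open>auto simp: V_def\<close>)
      then show ?thesis using fh(2) by (auto simp: hom_space_def extensional_def fun_eq_iff)
    qed
    moreover have "\<zero>\<^bsub>?H\<^esub> \<in> V B" using sV[OF B(2)] H.is_module LinearCombinations.submodule.zero_closed by blast
    ultimately show ?thesis by blast
  qed
  have step: "vectorspace.fin_dim K (H.vs (V C))" if fd: "vectorspace.fin_dim K (H.vs (V (insert b C)))"
    and C: "insert b C \<subseteq> carrier M" for b C
  proof -
    have CM: "C \<subseteq> carrier M" and b: "b \<in> carrier M" using C by auto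
    have v1: "vectorspace K (H.vs (V C))" by (rule H.subspace_is_vs[OF sV[OF CM]])
    have v2: "vectorspace K (scalar_module A N)" by (rule scalar_vectorspace[OF fg_moduleD[OF N]])
    have lin: "linear_map K (H.vs (V C)) (scalar_module A N) (\<lambda>f. f b)"
      by (rule linear_mapI[OF v1 v2]) (use b in \<open>auto simp: V_def hom_space_def scalar_module_def hom_closed\<close>)
    have mh: "mod_hom K (H.vs (V C)) (scalar_module A N) (\<lambda>f. f b)"
      using lin by (simp add: linear_map_def)
    have "mod_hom.ker (H.vs (V C)) (scalar_module A N) (\<lambda>f. f b) = V (insert b C)"
      unfolding mod_hom.ker_def[OF mh] by (auto simp: V_def scalar_module_def)
    then show ?thesis
      by (intro fin_dim_of_kernel[OF lin fg_fin_dim[OF N]]) (use fd in simp)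
  qed
  have "vectorspace.fin_dim K (H.vs (V (B - C)))" if "finite C" "C \<subseteq> B" for C
    using that
  proof (induction C rule: finite_induct)
    case empty
    interpret v: vectorspace K "H.vs (V B)" by (rule H.subspace_is_vs[OF sV[OF B(2)]])
    have "v.span {} = V B" using v.span_empty VB by simp
    then have "v.fin_dim" unfolding v.fin_dim_def by (intro exI[of _ "{}"]) simp
    then show ?case by simp
  next
    case (insert x C)
    have "insert x (B - insert x C) = B - C" using insert by auto
    then show ?case using insert B(2) by (intro step[of x "B - insert x C"]) auto
  qed
  from this[OF B(1) subset_refl] have "vectorspace.fin_dim K (H.vs (V {}))" by simp
  moreover have "V {} = carrier ?H" by (simp add: V_def)
  ultimately show ?thesis by simp
qed

end

subsection \<open>Dimensions of Hom spaces and projective modules\<close>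

definition hdim :: "'k ring \<Rightarrow> ('k, 'a) module \<Rightarrow> ('a, 'm) module \<Rightarrow> ('a, 'n) module \<Rightarrow> nat" where
  "hdim K A M N = vectorspace.dim K (hom_space A M N)"

text \<open>The regular module has the elements of the algebra as its carrier; this is a copy of it
  inside the universe of \<open>mod_cat\<close>, where projectivity is defined.\<close>

definition free_module :: "('k, 'a) module \<Rightarrow> ('a, nat \<Rightarrow> 'k) module" where
  "free_module A = (SOME F. F \<in> mod_cat A \<and> isomorphic A (regular_module A) F)"

lemma kern_zero_iff_inj:
  assumes M: "left_module R M" and N: "left_module R N" and f: "f \<in> module_hom R M N"
  shows "kern M N f = {\<zero>\<^bsub>M\<^esub>} \<longleftrightarrow> inj_on f (carrier M)"
proof
  assume "kern M N f = {\<zero>\<^bsub>M\<^esub>}"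
  then show "inj_on f (carrier M)" by (intro inj_on_kern[OF M N f]) blast
next
  interpret M: left_module R M by (rule M)
  assume "inj_on f (carrier M)"
  then have "x = \<zero>\<^bsub>M\<^esub>" if "x \<in> carrier M" "f x = \<zero>\<^bsub>N\<^esub>" for x
    using that hom_zero[OF M N f] by (intro inj_onD[of f "carrier M"]) simp_all
  then show "kern M N f = {\<zero>\<^bsub>M\<^esub>}" using hom_zero[OF M N f] M.M.zero_closed by blast
qed

lemma left_module_regular:
  fixes A :: "('k, 'a) module"
  assumes "ring A"
  shows "left_module A (regular_module A)"
proof -
  interpret A: ring A by fact
  have "abelian_group (regular_module A)"
  proof (rule abelian_groupI)
    show "\<exists>y\<in>carrier (regular_module A). y \<oplus>\<^bsub>regular_module A\<^esub> x = \<zero>\<^bsub>regular_module A\<^esub>"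
      if "x \<in> carrier (regular_module A)" for x
      using that A.l_neg by (intro bexI[of _ "\<ominus>\<^bsub>A\<^esub> x"]) (simp_all add: regular_module_def)
  qed (simp_all add: regular_module_def A.a_ac)
  then show ?thesis
    by (intro left_moduleI assms) (simp_all add: regular_module_def A.m_assoc A.l_distr A.r_distr)
qed

context fd_algebra begin

lemma mod_lm: "M \<in> mod_cat A \<Longrightarrow> left_module A M"
  by (simp add: mod_cat_def)

lemma mod_fg: "M \<in> mod_cat A \<Longrightarrow> fg_module A M"
  by (simp add: mod_cat_iff)

lemma mod_sub: "M \<in> mod_cat A \<Longrightarrow> is_submodule A L M \<Longrightarrow> sub M L \<in> mod_cat A"
  using fg_sub mod_cat_iff by blast

lemma fg_quotient_module:
  assumes M: "fg_module A M" and L: "is_submodule A L M"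
  shows "fg_module A (quotient_module M L)"
  using fg_image[OF M left_module.quotient_module(1)[OF fg_moduleD[OF M] L]
      left_module.quotient_module(2,3)[OF fg_moduleD[OF M] L]] .

text \<open>The elements of \<open>quotient_module\<close> are sets of elements, so a copy
  \<open>Q\<close> in \<open>mod_cat\<close> is provided together with the projection. The
  isomorphism is kept because stability speaks of \<open>quotient_module\<close> itself.\<close>

lemma mod_quotient:
  assumes M: "fg_module A M" and L: "is_submodule A L M"
  obtains Q p where "Q \<in> mod_cat A" "p \<in> module_hom A M Q" "p ` carrier M = carrier Q" "kern M Q p = L"
    "isomorphic A (quotient_module M L) Q"
proof -
  note q = left_module.quotient_module[OF fg_moduleD[OF M] L]
  obtain Q f where Q: "Q \<in> mod_cat A" "f \<in> module_isos A (quotient_module M L) Q"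
    using mod_cat_transport[OF fg_quotient_module[OF M L]] by blast
  have f: "f \<in> module_hom A (quotient_module M L) Q" "bij_betw f (carrier (quotient_module M L)) (carrier Q)"
    using Q(2) by (auto simp: module_isos_def)
  let ?p = "\<lambda>x. f (L +>\<^bsub>M\<^esub> x)"
  have 1: "?p \<in> module_hom A M Q" by (rule hom_comp[OF q(2) f(1)])
  have 2: "?p ` carrier M = carrier Q"
    using f(2) q(3) unfolding bij_betw_def by (metis image_image)
  have "f y = \<zero>\<^bsub>Q\<^esub> \<longleftrightarrow> y = \<zero>\<^bsub>quotient_module M L\<^esub>" if "y \<in> carrier (quotient_module M L)" for y
    using hom_zero[OF q(1) mod_lm[OF Q(1)] f(1)] f(2) that
      abelian_monoid.zero_closed[of "quotient_module M L"] q(1)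
    unfolding bij_betw_def inj_on_def left_module_def abelian_group_def by metis
  then have 3: "kern M Q ?p = L" using q(4) hom_closed[OF q(2)] by auto
  have "isomorphic A (quotient_module M L) Q" using Q(2) by (auto simp: isomorphic_def)
  then show ?thesis using that Q(1) 1 2 3 by blast
qed

lemma mod_biproduct:
  assumes M: "M \<in> mod_cat A" and N: "N \<in> mod_cat A"
  obtains D i1 i2 p1 p2 where "D \<in> mod_cat A"
    "i1 \<in> module_hom A M D" "i2 \<in> module_hom A N D" "p1 \<in> module_hom A D M" "p2 \<in> module_hom A D N"
    "\<And>x. x \<in> carrier M \<Longrightarrow> p1 (i1 x) = x" "\<And>x. x \<in> carrier M \<Longrightarrow> p2 (i1 x) = \<zero>\<^bsub>N\<^esub>"
    "\<And>y. y \<in> carrier N \<Longrightarrow> p1 (i2 y) = \<zero>\<^bsub>M\<^esub>" "\<And>y. y \<in> carrier N \<Longrightarrow> p2 (i2 y) = y"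
    "\<And>z. z \<in> carrier D \<Longrightarrow> i1 (p1 z) \<oplus>\<^bsub>D\<^esub> i2 (p2 z) = z"
proof -
  interpret M: left_module A M by (rule mod_lm[OF M])
  interpret N: left_module A N by (rule mod_lm[OF N])
  let ?P = "prod_module M N"
  note P = prod_module[OF mod_lm[OF M] mod_lm[OF N]]
  obtain D f where D: "D \<in> mod_cat A" "f \<in> module_isos A ?P D"
    using mod_cat_transport[OF fg_prod[OF mod_fg[OF M] mod_fg[OF N]]] by blast
  have f: "f \<in> module_hom A ?P D" "bij_betw f (carrier ?P) (carrier D)"
    using D(2) by (auto simp: module_isos_def)
  let ?g = "inv_into (carrier ?P) f"
  have g: "?g \<in> module_hom A D ?P" by (rule hom_inverse[OF f P(1)])
  have gf: "?g (f z) = z" if "z \<in> carrier ?P" for z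
    using f(2) that by (simp add: bij_betw_def)
  have fg: "f (?g z) = z" if "z \<in> carrier D" for z
    using f(2) that by (simp add: bij_betw_def f_inv_into_f)
  have c: "(x, y) \<in> carrier ?P" if "x \<in> carrier M" "y \<in> carrier N" for x y
    using that by (simp add: prod_module_def)
  show ?thesis
  proof (rule that[of D "\<lambda>x. f (x, \<zero>\<^bsub>N\<^esub>)" "\<lambda>y. f (\<zero>\<^bsub>M\<^esub>, y)" "\<lambda>z. fst (?g z)" "\<lambda>z. snd (?g z)"])
    show "D \<in> mod_cat A" by fact
    show "(\<lambda>x. f (x, \<zero>\<^bsub>N\<^esub>)) \<in> module_hom A M D" by (rule hom_comp[OF P(4) f(1)])
    show "(\<lambda>y. f (\<zero>\<^bsub>M\<^esub>, y)) \<in> module_hom A N D" by (rule hom_comp[OF P(5) f(1)])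
    show "(\<lambda>z. fst (?g z)) \<in> module_hom A D M" by (rule hom_comp[OF g P(2)])
    show "(\<lambda>z. snd (?g z)) \<in> module_hom A D N" by (rule hom_comp[OF g P(3)])
  next
    fix z assume z: "z \<in> carrier D"
    have gz: "fst (?g z) \<in> carrier M" "snd (?g z) \<in> carrier N"
      using hom_closed[OF g z] by (auto simp: prod_module_def)
    have "f (fst (?g z), \<zero>\<^bsub>N\<^esub>) \<oplus>\<^bsub>D\<^esub> f (\<zero>\<^bsub>M\<^esub>, snd (?g z)) = f (?g z)"
      using gz module_hom_add[OF f(1) c[of "fst (?g z)" "\<zero>\<^bsub>N\<^esub>"] c[of "\<zero>\<^bsub>M\<^esub>" "snd (?g z)"]]
      by (simp add: prod_module_def)
    then show "f (fst (?g z), \<zero>\<^bsub>N\<^esub>) \<oplus>\<^bsub>D\<^esub> f (\<zero>\<^bsub>M\<^esub>, snd (?g z)) = z" using fg[OF z] by simp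
  qed (simp_all add: gf c)
qed

section \<open>Projective modules and exactness of Hom\<close>

lemma projective_mod: "projective A Q \<Longrightarrow> Q \<in> mod_cat A"
  by (simp add: projective_def)

lemma projectiveD:
  assumes "projective A Q" "M \<in> mod_cat A" "N \<in> mod_cat A" "g \<in> module_hom A M N" "h \<in> module_hom A Q N"
    "g ` carrier M = carrier N"
  shows "\<exists>l\<in>module_hom A Q M. \<forall>x\<in>carrier Q. g (l x) = h x"
  using assms unfolding projective_def by blast

text \<open>Projectivity is tested against modules of \<open>mod_cat\<close>. Conjugating the given
  epimorphism by isomorphisms into \<open>mod_cat\<close> extends the lifting property to finitely
  generated modules on any type.\<close>

lemma projective_lift:
  assumes Q: "projective A Q" and M: "fg_module A M" and N: "fg_module A N"
    and g: "g \<in> module_hom A M N" "g ` carrier M = carrier N" and h: "h \<in> module_hom A Q N"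
  obtains l where "l \<in> module_hom A Q M" "\<And>x. x \<in> carrier Q \<Longrightarrow> g (l x) = h x"
proof -
  obtain M' a where M': "M' \<in> mod_cat A" "a \<in> module_isos A M M'" using mod_cat_transport[OF M] by blast
  obtain N' b where N': "N' \<in> mod_cat A" "b \<in> module_isos A N N'" using mod_cat_transport[OF N] by blast
  have a: "a \<in> module_hom A M M'" "bij_betw a (carrier M) (carrier M')" using M'(2) by (auto simp: module_isos_def)
  have b: "b \<in> module_hom A N N'" "bij_betw b (carrier N) (carrier N')" using N'(2) by (auto simp: module_isos_def)
  let ?a = "inv_into (carrier M) a"
  have ai: "?a \<in> module_hom A M' M" by (rule hom_inverse[OF a fg_moduleD[OF M]])
  have g': "(\<lambda>x. b (g (?a x))) \<in> module_hom A M' N'" by (rule hom_comp[OF hom_comp[OF ai g(1)] b(1)])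
  have "?a ` carrier M' = carrier M"
    using bij_betw_inv_into[OF a(2)] by (simp add: bij_betw_def)
  then have "b ` g ` ?a ` carrier M' = carrier N'"
    using g(2) b(2) by (simp add: bij_betw_def)
  then have s: "(\<lambda>x. b (g (?a x))) ` carrier M' = carrier N'" by (simp only: image_image)
  from projectiveD[OF Q M'(1) N'(1) g' hom_comp[OF h b(1)] s]
  obtain l where l: "l \<in> module_hom A Q M'" "\<And>x. x \<in> carrier Q \<Longrightarrow> b (g (?a (l x))) = b (h x)"
    by blast
  have "g (?a (l x)) = h x" if x: "x \<in> carrier Q" for x
  proof -
    have "g (?a (l x)) \<in> carrier N" "h x \<in> carrier N"
      using x hom_closed[OF l(1)] hom_closed[OF ai] hom_closed[OF g(1)] hom_closed[OF h] by auto
    then show ?thesis using l(2)[OF x] inj_onD[OF bij_betw_imp_inj_on[OF b(2)]] by blast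
  qed
  then show ?thesis using that[of "\<lambda>x. ?a (l x)"] hom_comp[OF l(1) ai] by blast
qed

lemma hdim_zero_iff:
  assumes M: "fg_module A M" and N: "fg_module A N"
  shows "hdim K A M N = 0 \<longleftrightarrow> (\<forall>h\<in>module_hom A M N. \<forall>x\<in>carrier M. h x = \<zero>\<^bsub>N\<^esub>)"
proof -
  interpret H: vectorspace K "hom_space A M N"
    by (rule hom_space_vectorspace[OF fg_moduleD[OF M] fg_moduleD[OF N]])
  have z: "hdim K A M N = 0 \<longleftrightarrow> carrier (hom_space A M N) = {\<zero>\<^bsub>hom_space A M N\<^esub>}"
    unfolding hdim_def by (rule H.dim_zero_iff[OF hom_space_fin_dim[OF M N]])
  show ?thesis
  proof
    assume "hdim K A M N = 0"
    then have c: "carrier (hom_space A M N) = {\<zero>\<^bsub>hom_space A M N\<^esub>}" using z by simp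
    show "\<forall>h\<in>module_hom A M N. \<forall>x\<in>carrier M. h x = \<zero>\<^bsub>N\<^esub>"
    proof (intro ballI)
      fix h x assume h: "h \<in> module_hom A M N" and x: "x \<in> carrier M"
      have "restrict h (carrier M) \<in> module_hom A M N" by (rule hom_cong[OF h fg_moduleD[OF M]]) simp
      then have "restrict h (carrier M) \<in> carrier (hom_space A M N)" by (simp add: hom_space_def)
      then have "restrict h (carrier M) = \<zero>\<^bsub>hom_space A M N\<^esub>" using c by blast
      from fun_cong[OF this, of x] show "h x = \<zero>\<^bsub>N\<^esub>" using x by (simp add: hom_space_def)
    qed
  next
    assume a: "\<forall>h\<in>module_hom A M N. \<forall>x\<in>carrier M. h x = \<zero>\<^bsub>N\<^esub>"
    have "h = \<zero>\<^bsub>hom_space A M N\<^esub>" if "h \<in> carrier (hom_space A M N)" for h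
    proof -
      have "h \<in> module_hom A M N" "h \<in> extensional (carrier M)" using that by (auto simp: hom_space_def)
      then show ?thesis using a by (auto simp: hom_space_def extensional_def fun_eq_iff)
    qed
    then show "hdim K A M N = 0" using z H.M.zero_closed by blast
  qed
qed

text \<open>Rank-nullity for precomposition with \<open>f\<close>, restricted to a subspace
  \<open>S\<close>. The subspace is a parameter because the result is applied twice to a
  presentation: to all maps from \<open>P\<close>, and then to the maps that vanish on the image of
  \<open>Q\<close>, which stand for the maps from the cokernel.\<close>

lemma hdim_precompose_onto:
  assumes M: "fg_module A M" and M': "fg_module A M'" and N: "fg_module A N"
    and f: "f \<in> module_hom A M' M" and S: "subspace K S (hom_space A M N)"
    and onto: "\<And>h. h \<in> module_hom A M' N \<Longrightarrow> \<exists>l\<in>S. \<forall>x\<in>carrier M'. h x = l (f x)"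
  shows "vectorspace.dim K ((hom_space A M N)\<lparr>carrier := S\<rparr>) =
    hdim K A M' N + vectorspace.dim K ((hom_space A M N)\<lparr>carrier := {l \<in> S. \<forall>x\<in>carrier M'. l (f x) = \<zero>\<^bsub>N\<^esub>}\<rparr>)"
proof -
  interpret N: left_module A N by (rule fg_moduleD[OF N])
  let ?V = "(hom_space A M N)\<lparr>carrier := S\<rparr>" and ?W = "hom_space A M' N"
  let ?f = "\<lambda>h. \<lambda>x\<in>carrier M'. h (f x)"
  interpret H: vectorspace K "hom_space A M N"
    by (rule hom_space_vectorspace[OF fg_moduleD[OF M] fg_moduleD[OF N]])
  have V: "vectorspace K ?V" by (rule H.subspace_is_vs[OF S])
  have W: "vectorspace K ?W" by (rule hom_space_vectorspace[OF fg_moduleD[OF M'] fg_moduleD[OF N]])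
  have SH: "h \<in> module_hom A M N" if "h \<in> S" for h
    using S that unfolding subspace_def LinearCombinations.submodule_def by (auto simp: hom_space_def)
  have fc: "f x \<in> carrier M" if "x \<in> carrier M'" for x using hom_closed[OF f that] .
  have lin: "linear_map K ?V ?W ?f"
  proof (rule linear_mapI[OF V W])
    fix h assume "h \<in> carrier ?V"
    then have "h \<in> module_hom A M N" using SH by simp
    from hom_cong[OF hom_comp[OF f this] fg_moduleD[OF M'], of "?f h"]
    show "?f h \<in> carrier ?W" by (simp add: hom_space_def)
  qed (auto simp: hom_space_def fc)
  interpret L: linear_map K ?V ?W ?f by fact
  have fd: "vectorspace.fin_dim K ?V"
    by (rule H.fin_dim_subspace[OF S hom_space_fin_dim[OF M N]])
  have "?f ` carrier ?V = carrier ?W"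
  proof
    show "?f ` carrier ?V \<subseteq> carrier ?W" using L.f_im by blast
    show "carrier ?W \<subseteq> ?f ` carrier ?V"
    proof
      fix h assume "h \<in> carrier ?W"
      then have h: "h \<in> module_hom A M' N" "h \<in> extensional (carrier M')" by (auto simp: hom_space_def)
      obtain l where l: "l \<in> S" "\<And>x. x \<in> carrier M' \<Longrightarrow> h x = l (f x)" using onto[OF h(1)] by blast
      have "h = ?f l" using l(2) h(2) by (auto simp: extensional_def fun_eq_iff)
      then show "h \<in> ?f ` carrier ?V" using l(1) by (intro image_eqI[of _ _ l]) simp_all
    qed
  qed
  then have im: "L.imT = carrier ?W" by (simp add: L.im_def)
  have ker: "L.kerT = {l \<in> S. \<forall>x\<in>carrier M'. l (f x) = \<zero>\<^bsub>N\<^esub>}"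
  proof -
    have "?f l = (\<lambda>x\<in>carrier M'. \<zero>\<^bsub>N\<^esub>) \<longleftrightarrow> (\<forall>x\<in>carrier M'. l (f x) = \<zero>\<^bsub>N\<^esub>)" for l
      by (auto simp: fun_eq_iff restrict_def)
    then show ?thesis unfolding L.ker_def by (simp add: hom_space_def)
  qed
  show ?thesis using L.rank_nullity[OF fd] unfolding im ker hdim_def by simp
qed

lemma hom_space_subspace_self:
  assumes "left_module A M" "left_module A N"
  shows "subspace K (carrier (hom_space A M N)) (hom_space A M N)"
proof -
  interpret H: vectorspace K "hom_space A M N" by (rule hom_space_vectorspace[OF assms])
  show ?thesis by (rule H.subspaceI) auto
qed

text \<open>Rank-nullity for composition with \<open>f\<close>: projectivity makes it surjective,
  and its kernel consists of the maps into the kernel of \<open>f\<close>. The additivity of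
  dimensions, multiplicities and linear forms all rests on this identity.\<close>

lemma hdim_exact:
  assumes Q: "projective A Q" and M: "fg_module A M" and N: "fg_module A N"
    and f: "f \<in> module_hom A M N" "f ` carrier M = carrier N"
  shows "hdim K A Q M = hdim K A Q (sub M (kern M N f)) + hdim K A Q N"
proof -
  note q = mod_fg[OF projective_mod[OF Q]]
  note ql = fg_moduleD[OF q]
  interpret M: left_module A M by (rule fg_moduleD[OF M])
  interpret N: left_module A N by (rule fg_moduleD[OF N])
  let ?k = "kern M N f" and ?f = "\<lambda>h. \<lambda>x\<in>carrier Q. f (h x)"
  let ?V = "hom_space A Q M" and ?W = "hom_space A Q N"
  note V = hom_space_vectorspace[OF ql fg_moduleD[OF M]]
  note W = hom_space_vectorspace[OF ql fg_moduleD[OF N]]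
  have lin: "linear_map K ?V ?W ?f"
  proof (rule linear_mapI[OF V W])
    fix h assume "h \<in> carrier ?V"
    then have "h \<in> module_hom A Q M" by (simp add: hom_space_def)
    from hom_cong[OF hom_comp[OF this f(1)] ql, of "?f h"]
    show "?f h \<in> carrier ?W" by (simp add: hom_space_def)
  next
    fix h g assume "h \<in> carrier ?V" "g \<in> carrier ?V"
    then have h: "h \<in> module_hom A Q M" "g \<in> module_hom A Q M" by (simp_all add: hom_space_def)
    show "?f (h \<oplus>\<^bsub>?V\<^esub> g) = ?f h \<oplus>\<^bsub>?W\<^esub> ?f g"
      using module_hom_add[OF f(1)] hom_closed[OF h(1)] hom_closed[OF h(2)] by (auto simp: hom_space_def)
  next
    fix c h assume c: "c \<in> carrier K" and "h \<in> carrier ?V"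
    then have h: "h \<in> module_hom A Q M" by (simp add: hom_space_def)
    show "?f (c \<odot>\<^bsub>?V\<^esub> h) = c \<odot>\<^bsub>?W\<^esub> ?f h"
      using module_hom_smult[OF f(1)] hom_closed[OF h] c by (auto simp: hom_space_def)
  qed
  interpret L: linear_map K ?V ?W ?f by fact
  have "?f ` carrier ?V = carrier ?W"
  proof
    show "?f ` carrier ?V \<subseteq> carrier ?W" using L.f_im by blast
    show "carrier ?W \<subseteq> ?f ` carrier ?V"
    proof
      fix h assume "h \<in> carrier ?W"
      then have h: "h \<in> module_hom A Q N" "h \<in> extensional (carrier Q)" by (auto simp: hom_space_def)
      obtain l where l: "l \<in> module_hom A Q M" "\<And>x. x \<in> carrier Q \<Longrightarrow> f (l x) = h x"
        using projective_lift[OF Q M N f h(1)] by blast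
      have "restrict l (carrier Q) \<in> module_hom A Q M" by (rule hom_cong[OF l(1) ql]) simp
      moreover have "h = ?f (restrict l (carrier Q))"
        using l(2) h(2) by (auto simp: extensional_def fun_eq_iff)
      ultimately show "h \<in> ?f ` carrier ?V"
        by (intro image_eqI[of _ _ "restrict l (carrier Q)"]) (simp_all add: hom_space_def)
    qed
  qed
  then have im: "L.imT = carrier ?W" by (simp add: L.im_def)
  have "L.kerT = carrier (hom_space A Q (sub M ?k))" (is "?l = ?r")
  proof
    show "?r \<subseteq> ?l"
    proof
      fix h assume "h \<in> ?r"
      then have h: "h \<in> module_hom A Q (sub M ?k)" "h \<in> extensional (carrier Q)" by (auto simp: hom_space_def)
      have "h \<in> module_hom A Q M"
        by (rule hom_comp[OF h(1) M.hom_incl[OF submod_kern[OF fg_moduleD[OF M] fg_moduleD[OF N] f(1)]]])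
      moreover have "f (h x) = \<zero>\<^bsub>N\<^esub>" if "x \<in> carrier Q" for x using hom_closed[OF h(1) that] by simp
      then have "?f h = (\<lambda>x\<in>carrier Q. \<zero>\<^bsub>N\<^esub>)" by (rule restrict_ext)
      ultimately show "h \<in> ?l" using h(2) unfolding L.ker_def by (simp add: hom_space_def)
    qed
    show "?l \<subseteq> ?r"
    proof
      fix h assume h: "h \<in> ?l"
      then have hm: "h \<in> module_hom A Q M" "h \<in> extensional (carrier Q)" unfolding L.ker_def by (auto simp: hom_space_def)
      have "?f h = (\<lambda>x\<in>carrier Q. \<zero>\<^bsub>N\<^esub>)" using h unfolding L.ker_def by (simp add: hom_space_def)
      from fun_cong[OF this] have "f (h x) = \<zero>\<^bsub>N\<^esub>" if "x \<in> carrier Q" for x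
        using that by (metis (no_types, lifting) restrict_apply')
      then have "h ` carrier Q \<subseteq> ?k" using hom_closed[OF hm(1)] by auto
      then show "h \<in> ?r" using hm M.hom_into_sub[OF hm(1)] by (simp add: hom_space_def)
    qed
  qed
  then have ker: "?V\<lparr>carrier := L.kerT\<rparr> = hom_space A Q (sub M ?k)" by (simp add: hom_space_def)
  show ?thesis using L.rank_nullity[OF hom_space_fin_dim[OF q M]] unfolding im ker hdim_def by simp
qed

lemma hdim_sub_zero:
  assumes Q: "fg_module A Q" and M: "fg_module A M"
  shows "hdim K A Q (sub M {\<zero>\<^bsub>M\<^esub>}) = 0"
  using hdim_zero_iff[OF Q fg_sub[OF M left_module.submod_zero[OF fg_moduleD[OF M]]]]
  by (auto dest: hom_closed)

lemma hdim_iso: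
  assumes Q: "projective A Q" and M: "fg_module A M" and N: "fg_module A N" and "isomorphic A M N"
  shows "hdim K A Q M = hdim K A Q N"
proof -
  obtain f where f: "f \<in> module_hom A M N" "bij_betw f (carrier M) (carrier N)"
    using assms(4) by (auto simp: isomorphic_def module_isos_def)
  have z: "f \<zero>\<^bsub>M\<^esub> = \<zero>\<^bsub>N\<^esub>" by (rule hom_zero[OF fg_moduleD[OF M] fg_moduleD[OF N] f(1)])
  interpret M: left_module A M by (rule fg_moduleD[OF M])
  have "kern M N f = {\<zero>\<^bsub>M\<^esub>}"
    using kern_zero_iff_inj[OF fg_moduleD[OF M] fg_moduleD[OF N] f(1)] f(2) by (simp add: bij_betw_def)
  then show ?thesis
    using hdim_exact[OF Q M N f(1)] f(2) hdim_sub_zero[OF mod_fg[OF projective_mod[OF Q]] M]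
    by (simp add: bij_betw_def)
qed

section \<open>The free module of rank one and dimension\<close>

abbreviation F where "F \<equiv> free_module A"

lemma fg_regular: "fg_module A (regular_module A)"
proof -
  interpret M: left_module A "regular_module A" by (rule left_module_regular[OF ring_A])
  have "L = carrier (regular_module A)" if L: "is_submodule A L (regular_module A)" "{\<one>\<^bsub>A\<^esub>} \<subseteq> L" for L
  proof -
    note D = M.submodD[OF L(1)]
    have "x \<in> L" if "x \<in> carrier A" for x
      using D(4)[of x "\<one>\<^bsub>A\<^esub>"] that L(2) by (simp add: regular_module_def)
    then show ?thesis using D(1) by (auto simp: regular_module_def)
  qed
  moreover have "{\<one>\<^bsub>A\<^esub>} \<subseteq> carrier (regular_module A)" by (simp add: regular_module_def)
  ultimately show ?thesis unfolding fg_module_def finitely_generated_def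
    using left_module_regular[OF ring_A] by blast
qed

lemma free_module: "F \<in> mod_cat A" "isomorphic A (regular_module A) F"
proof -
  obtain N f where "N \<in> mod_cat A" "f \<in> module_isos A (regular_module A) N"
    using mod_cat_transport[OF fg_regular] by blast
  then have "\<exists>F. F \<in> mod_cat A \<and> isomorphic A (regular_module A) F" by (auto simp: isomorphic_def)
  from someI_ex[OF this] show "F \<in> mod_cat A" "isomorphic A (regular_module A) F"
    unfolding free_module_def by auto
qed

text \<open>The image of the unit of the algebra under an isomorphism from the regular module:
  \<open>F\<close> is free on this element.\<close>

definition gen :: "nat \<Rightarrow> 'k" where
  "gen = (SOME f. f \<in> module_isos A (regular_module A) F) \<one>\<^bsub>A\<^esub>"

lemma gen_closed: "gen \<in> carrier F" and gen_gen: "x \<in> carrier F \<Longrightarrow> \<exists>a\<in>carrier A. x = a \<odot>\<^bsub>F\<^esub> gen"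
  and gen_hom: "left_module A M \<Longrightarrow> m \<in> carrier M \<Longrightarrow> \<exists>h\<in>module_hom A F M. h gen = m"
proof -
  let ?R = "regular_module A"
  define f where "f = (SOME f. f \<in> module_isos A ?R F)"
  have "f \<in> module_isos A ?R F" unfolding f_def
    using free_module(2) unfolding isomorphic_def by (intro someI_ex[of "\<lambda>f. f \<in> module_isos A ?R F"]) blast
  then have f: "f \<in> module_hom A ?R F" "bij_betw f (carrier ?R) (carrier F)" by (auto simp: module_isos_def)
  have e: "gen = f \<one>\<^bsub>A\<^esub>" by (simp add: gen_def f_def)
  have 1: "\<one>\<^bsub>A\<^esub> \<in> carrier ?R" by (simp add: regular_module_def)
  show "gen \<in> carrier F" unfolding e by (rule hom_closed[OF f(1) 1])
  show "\<exists>a\<in>carrier A. x = a \<odot>\<^bsub>F\<^esub> gen" if x: "x \<in> carrier F"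
  proof -
    obtain a where a: "a \<in> carrier ?R" "x = f a" using x f(2) by (auto simp: bij_betw_def)
    have aA: "a \<in> carrier A" using a(1) by (simp add: regular_module_def)
    have "f (a \<odot>\<^bsub>?R\<^esub> \<one>\<^bsub>A\<^esub>) = a \<odot>\<^bsub>F\<^esub> gen" unfolding e by (rule module_hom_smult[OF f(1) aA 1])
    then show ?thesis using a aA by (intro bexI[of _ a]) (simp_all add: regular_module_def)
  qed
  show "\<exists>h\<in>module_hom A F M. h gen = m" if M: "left_module A M" and m: "m \<in> carrier M"
  proof -
    interpret M: left_module A M by (rule M)
    have "(\<lambda>a. a \<odot>\<^bsub>M\<^esub> m) \<in> module_hom A ?R M"
      using m by (intro homI) (simp_all add: regular_module_def M.smult_l_distr M.smult_assoc)
    from hom_comp[OF hom_inverse[OF f left_module_regular[OF ring_A]] this]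
    have "(\<lambda>x. inv_into (carrier ?R) f x \<odot>\<^bsub>M\<^esub> m) \<in> module_hom A F M" .
    moreover have "inv_into (carrier ?R) f gen = \<one>\<^bsub>A\<^esub>"
      unfolding e using f(2) 1 by (simp add: bij_betw_def)
    ultimately show ?thesis using m by (intro bexI[of _ "\<lambda>x. inv_into (carrier ?R) f x \<odot>\<^bsub>M\<^esub> m"]) simp_all
  qed
qed

lemma gen_unique:
  assumes "h \<in> module_hom A F M" "h' \<in> module_hom A F M" "h gen = h' gen" "x \<in> carrier F"
  shows "h x = h' x"
proof -
  obtain a where a: "a \<in> carrier A" "x = a \<odot>\<^bsub>F\<^esub> gen" using gen_gen assms(4) by blast
  show ?thesis using module_hom_smult[OF assms(1) a(1) gen_closed] module_hom_smult[OF assms(2) a(1) gen_closed]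
    a(2) assms(3) by simp
qed

lemma projective_free: "projective A F"
  unfolding projective_def
proof (intro conjI ballI impI)
  show "F \<in> mod_cat A" by (rule free_module)
  fix M N g h assume M: "M \<in> mod_cat A" and g: "g \<in> module_hom A M N" and h: "h \<in> module_hom A F N"
    and s: "g ` carrier M = carrier N"
  have "h gen \<in> g ` carrier M" unfolding s by (rule hom_closed[OF h gen_closed])
  then obtain m where m: "m \<in> carrier M" "g m = h gen" by auto
  obtain l where l: "l \<in> module_hom A F M" "l gen = m" using gen_hom[OF mod_lm[OF M] m(1)] by blast
  have "g (l x) = h x" if "x \<in> carrier F" for x
    by (rule gen_unique[OF hom_comp[OF l(1) g] h _ that]) (simp add: l(2) m(2))
  then show "\<exists>l\<in>module_hom A F M. \<forall>x\<in>carrier F. g (l x) = h x" using l(1) by blast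
qed

text \<open>Evaluation at \<open>gen\<close> identifies maps \<open>F\<close> to \<open>M\<close>
  with elements of \<open>M\<close>, so this is the dimension of \<open>M\<close> over the field.
  Written as a Hom dimension it is additive by \<open>hdim_exact\<close>, and it measures size in
  all extremal arguments below.\<close>

abbreviation dm where "dm \<equiv> hdim K A F"

lemma dm_zero_iff:
  assumes M: "fg_module A M"
  shows "dm M = 0 \<longleftrightarrow> carrier M = {\<zero>\<^bsub>M\<^esub>}"
proof -
  interpret M: left_module A M by (rule fg_moduleD[OF M])
  show ?thesis unfolding hdim_zero_iff[OF mod_fg[OF free_module(1)] M]
  proof
    assume z: "\<forall>h\<in>module_hom A F M. \<forall>x\<in>carrier F. h x = \<zero>\<^bsub>M\<^esub>"
    have "m = \<zero>\<^bsub>M\<^esub>" if "m \<in> carrier M" for m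
      using gen_hom[OF fg_moduleD[OF M] that] z gen_closed by blast
    then show "carrier M = {\<zero>\<^bsub>M\<^esub>}" using M.M.zero_closed by blast
  next
    assume "carrier M = {\<zero>\<^bsub>M\<^esub>}"
    then show "\<forall>h\<in>module_hom A F M. \<forall>x\<in>carrier F. h x = \<zero>\<^bsub>M\<^esub>" using hom_closed by fastforce
  qed
qed

lemma dm_surj:
  assumes M: "fg_module A M" and N: "fg_module A N" and f: "f \<in> module_hom A M N" "f ` carrier M = carrier N"
  shows "dm N \<le> dm M" "dm M \<le> dm N \<Longrightarrow> inj_on f (carrier M)"
proof -
  note e = hdim_exact[OF projective_free M N f]
  show "dm N \<le> dm M" using e by simp
  assume "dm M \<le> dm N"
  then have "dm (sub M (kern M N f)) = 0" using e by simp
  then have "kern M N f = {\<zero>\<^bsub>M\<^esub>}"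
    using dm_zero_iff[OF fg_sub[OF M submod_kern[OF fg_moduleD[OF M] fg_moduleD[OF N] f(1)]]] by simp
  then show "inj_on f (carrier M)" using kern_zero_iff_inj[OF fg_moduleD[OF M] fg_moduleD[OF N] f(1)] by simp
qed

lemma hdim_sub_le:
  assumes Q: "projective A Q" and M: "fg_module A M" and L: "is_submodule A L M"
  obtains N where "N \<in> mod_cat A" "isomorphic A (quotient_module M L) N"
    "hdim K A Q M = hdim K A Q (sub M L) + hdim K A Q N"
proof -
  obtain N p where N: "N \<in> mod_cat A" "p \<in> module_hom A M N" "p ` carrier M = carrier N" "kern M N p = L"
    "isomorphic A (quotient_module M L) N"
    by (rule mod_quotient[OF M L])
  show ?thesis using that[OF N(1,5)] hdim_exact[OF Q M mod_fg[OF N(1)] N(2,3)] N(4) by simp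
qed

lemma dm_sub:
  assumes M: "fg_module A M" and L: "is_submodule A L M"
  shows "dm (sub M L) \<le> dm M" "L \<noteq> carrier M \<Longrightarrow> dm (sub M L) < dm M"
proof -
  obtain N p where N: "N \<in> mod_cat A" "p \<in> module_hom A M N" "p ` carrier M = carrier N" "kern M N p = L"
    by (rule mod_quotient[OF M L])
  have e: "dm M = dm (sub M L) + dm N" using hdim_exact[OF projective_free M mod_fg[OF N(1)] N(2,3)] N(4) by simp
  then show "dm (sub M L) \<le> dm M" by simp
  assume "L \<noteq> carrier M"
  then have "carrier N \<noteq> {\<zero>\<^bsub>N\<^esub>}" using N(3,4) by blast
  then have "dm N \<noteq> 0" using dm_zero_iff[OF mod_fg[OF N(1)]] by simp
  then show "dm (sub M L) < dm M" using e by simp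
qed

lemma image_factor_dm:
  assumes M: "fg_module A M" and N: "fg_module A N" and f: "f \<in> module_hom A M N"
  shows "fg_module A (sub N (f ` carrier M))" "f \<in> module_hom A M (sub N (f ` carrier M))"
    "dm (sub N (f ` carrier M)) \<le> dm M"
proof -
  note s = submod_im[OF fg_moduleD[OF M] fg_moduleD[OF N] f]
  show 1: "fg_module A (sub N (f ` carrier M))" by (rule fg_sub[OF N s])
  show 2: "f \<in> module_hom A M (sub N (f ` carrier M))"
    by (rule left_module.hom_into_sub[OF fg_moduleD[OF N] f subset_refl])
  show "dm (sub N (f ` carrier M)) \<le> dm M" by (rule dm_surj(1)[OF M 1 2]) simp
qed

lemma hom_funpow: "f \<in> module_hom A M M \<Longrightarrow> (f ^^ n) \<in> module_hom A M M"
proof (induction n)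
  case 0 show ?case using hom_id[of A M] by (simp add: id_def)
next
  case (Suc n) then show ?case using hom_comp[of "f ^^ n" A M M f M] by (simp add: comp_def)
qed

text \<open>Take the exponent with the smallest image. The corresponding power \<open>g\<close> of
  \<open>f\<close> then maps this image bijectively onto itself, and \<open>g\<close> followed by
  the inverse of that bijection is a projection \<open>e\<close> onto the stable image.\<close>

lemma fitting:
  assumes M: "M \<in> mod_cat A" and f: "f \<in> module_hom A M M"
  obtains k e where "e \<in> module_hom A M M" "\<And>x. x \<in> carrier M \<Longrightarrow> e x \<in> (f ^^ Suc k) ` carrier M"
    "\<And>y. y \<in> (f ^^ Suc k) ` carrier M \<Longrightarrow> e y = y"
proof -
  interpret M: left_module A M by (rule mod_lm[OF M])
  note fgM = mod_fg[OF M]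
  define I where "I k = (f ^^ Suc k) ` carrier M" for k
  obtain k where k: "\<And>j. dm (sub M (I k)) \<le> dm (sub M (I j))"
    using ex_has_least_nat[of "\<lambda>_. True" 0 "\<lambda>k. dm (sub M (I k))"] by blast
  define g where "g = f ^^ Suc k"
  have g: "g \<in> module_hom A M M" unfolding g_def by (rule hom_funpow[OF f])
  have sI: "is_submodule A (I j) M" for j unfolding I_def by (rule submod_im[OF mod_lm[OF M] mod_lm[OF M] hom_funpow[OF f]])
  note IM = M.submodD(1)[OF sI]
  \<comment> \<open>\<open>I j\<close> is the image of the power \<open>Suc j\<close>, so applying
    \<open>g\<close> to \<open>I k\<close> gives the power \<open>2 * Suc k\<close>, that is
    \<open>I (Suc (k + k))\<close>.\<close>
  have "Suc (Suc (k + k)) = Suc k + Suc k" by simp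
  then have "f ^^ Suc (Suc (k + k)) = g \<circ> g" unfolding g_def by (simp only: funpow_add)
  then have gI: "g ` I k = I (Suc (k + k))" unfolding I_def g_def[symmetric] by (simp only: image_comp)
  have sub: "I (Suc (k + k)) \<subseteq> I k" using gI[symmetric] IM[of k] unfolding I_def g_def by blast
  have eq: "g ` I k = I k"
  proof (rule ccontr)
    assume "g ` I k \<noteq> I k"
    then have "dm (sub (sub M (I k)) (I (Suc (k+k)))) < dm (sub M (I k))"
      using gI by (intro dm_sub(2)[OF fg_sub[OF fgM sI] M.submod_sub[OF sI sI sub]]) auto
    then show False using k[of "Suc (k + k)"] by simp
  qed
  let ?S = "sub M (I k)"
  have S: "fg_module A ?S" by (rule fg_sub[OF fgM sI])
  have gS: "g \<in> module_hom A ?S ?S"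
    using M.hom_into_sub[OF M.hom_restrict_dom[OF sI g]] eq by simp
  have bij: "bij_betw g (carrier ?S) (carrier ?S)"
    using dm_surj(2)[OF S S gS] eq by (simp add: bij_betw_def)
  let ?h = "inv_into (carrier ?S) g"
  have h: "?h \<in> module_hom A ?S ?S" by (rule hom_inverse[OF gS bij fg_moduleD[OF S]])
  have gMS: "g \<in> module_hom A M ?S" by (rule M.hom_into_sub[OF g]) (simp add: I_def g_def)
  have "(\<lambda>x. ?h (g x)) \<in> module_hom A M M" by (rule hom_comp[OF hom_comp[OF gMS h] M.hom_incl[OF sI]])
  moreover have "?h (g x) \<in> I k" if "x \<in> carrier M" for x
    using hom_closed[OF hom_comp[OF gMS h] that] by simp
  moreover have "?h (g y) = y" if "y \<in> I k" for y
    using bij that by (simp add: bij_betw_def)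
  ultimately show ?thesis using that[of "\<lambda>x. ?h (g x)" k] unfolding I_def by blast
qed

end

subsection \<open>Torsion classes and relative projectivity\<close>

definition biproduct :: "('a, 'r) ring_scheme \<Rightarrow> ('a, 'm) module \<Rightarrow> ('a, 'n) module \<Rightarrow> ('a, 'd) module
    \<Rightarrow> ('m \<Rightarrow> 'd) \<Rightarrow> ('n \<Rightarrow> 'd) \<Rightarrow> ('d \<Rightarrow> 'm) \<Rightarrow> ('d \<Rightarrow> 'n) \<Rightarrow> bool" where
  "biproduct A M N D i1 i2 p1 p2 \<longleftrightarrow>
    i1 \<in> module_hom A M D \<and> i2 \<in> module_hom A N D \<and> p1 \<in> module_hom A D M \<and> p2 \<in> module_hom A D N \<and>
    (\<forall>x\<in>carrier M. p1 (i1 x) = x \<and> p2 (i1 x) = \<zero>\<^bsub>N\<^esub>) \<and>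
    (\<forall>y\<in>carrier N. p1 (i2 y) = \<zero>\<^bsub>M\<^esub> \<and> p2 (i2 y) = y) \<and>
    (\<forall>z\<in>carrier D. i1 (p1 z) \<oplus>\<^bsub>D\<^esub> i2 (p2 z) = z)"

lemma biproductD:
  assumes "biproduct A M N D i1 i2 p1 p2"
  shows "i1 \<in> module_hom A M D" "i2 \<in> module_hom A N D" "p1 \<in> module_hom A D M" "p2 \<in> module_hom A D N"
    "\<And>x. x \<in> carrier M \<Longrightarrow> p1 (i1 x) = x" "\<And>x. x \<in> carrier M \<Longrightarrow> p2 (i1 x) = \<zero>\<^bsub>N\<^esub>"
    "\<And>y. y \<in> carrier N \<Longrightarrow> p1 (i2 y) = \<zero>\<^bsub>M\<^esub>" "\<And>y. y \<in> carrier N \<Longrightarrow> p2 (i2 y) = y"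
    "\<And>z. z \<in> carrier D \<Longrightarrow> i1 (p1 z) \<oplus>\<^bsub>D\<^esub> i2 (p2 z) = z"
  using assms unfolding biproduct_def by blast+

lemma biproduct_pair:
  assumes b: "biproduct A M N D i1 i2 p1 p2" and D: "left_module A D" and M: "left_module A M" and N: "left_module A N"
    and f: "f \<in> module_hom A Z M" and g: "g \<in> module_hom A Z N"
  obtains h where "h \<in> module_hom A Z D" "\<And>x. x \<in> carrier Z \<Longrightarrow> p1 (h x) = f x" "\<And>x. x \<in> carrier Z \<Longrightarrow> p2 (h x) = g x"
proof -
  note B = biproductD[OF b]
  interpret D: left_module A D by fact
  interpret M: left_module A M by fact
  interpret N: left_module A N by fact
  let ?h = "\<lambda>x. i1 (f x) \<oplus>\<^bsub>D\<^esub> i2 (g x)"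
  have h: "?h \<in> module_hom A Z D" by (rule D.hom_plus[OF hom_comp[OF f B(1)] hom_comp[OF g B(2)]])
  have "p1 (?h x) = f x \<and> p2 (?h x) = g x" if x: "x \<in> carrier Z" for x
    using hom_closed[OF f x] hom_closed[OF g x] hom_closed[OF B(1) hom_closed[OF f x]]
      hom_closed[OF B(2) hom_closed[OF g x]]
    by (simp add: module_hom_add[OF B(3)] module_hom_add[OF B(4)] B(5-8))
  then show ?thesis using that h by blast
qed

definition torsion_class :: "('k, 'a) module \<Rightarrow> ('a, nat \<Rightarrow> 'k) module set \<Rightarrow> bool" where
  "torsion_class A T \<longleftrightarrow> T \<subseteq> mod_cat A \<and>
    (\<forall>M\<in>T. \<forall>N\<in>mod_cat A. \<forall>f\<in>module_hom A M N. f ` carrier M = carrier N \<longrightarrow> N \<in> T) \<and>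
    (\<forall>M\<in>mod_cat A. \<forall>N\<in>T. \<forall>f\<in>module_hom A M N.
       f ` carrier M = carrier N \<and> sub M (kern M N f) \<in> T \<longrightarrow> M \<in> T)"

definition perp :: "('k, 'a) module \<Rightarrow> ('a, nat \<Rightarrow> 'k) module set \<Rightarrow> ('a, nat \<Rightarrow> 'k) module set" where
  "perp A Z = {M \<in> mod_cat A. \<forall>X\<in>Z. \<forall>f\<in>module_hom A M X. \<forall>x\<in>carrier M. f x = \<zero>\<^bsub>X\<^esub>}"

text \<open>Ext-projectivity in \<open>T\<close>, expressed by lifting along those epimorphisms of
  \<open>T\<close> whose kernel is again in \<open>T\<close>.\<close>

definition rel_projective ::
  "('k, 'a) module \<Rightarrow> ('a, nat \<Rightarrow> 'k) module set \<Rightarrow> ('a, nat \<Rightarrow> 'k) module \<Rightarrow> bool" where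
  "rel_projective A T W \<longleftrightarrow> W \<in> T \<and>
    (\<forall>E\<in>T. \<forall>V\<in>T. \<forall>g\<in>module_hom A E V. \<forall>h\<in>module_hom A W V.
       g ` carrier E = carrier V \<and> sub E (kern E V g) \<in> T \<longrightarrow>
       (\<exists>l\<in>module_hom A W E. \<forall>x\<in>carrier W. g (l x) = h x))"

lemma rel_projectiveD:
  assumes "rel_projective A T W" "E \<in> T" "V \<in> T" "g \<in> module_hom A E V" "h \<in> module_hom A W V"
    "g ` carrier E = carrier V" "sub E (kern E V g) \<in> T"
  obtains l where "l \<in> module_hom A W E" "\<And>x. x \<in> carrier W \<Longrightarrow> g (l x) = h x"
  using bspec[OF bspec[OF bspec[OF bspec[OF conjunct2[OF assms(1)[unfolded rel_projective_def]]
    assms(2)] assms(3)] assms(4)] assms(5)] assms(6,7) by blast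

lemma retract_surj:
  assumes "r \<in> module_hom A W Z" "s \<in> module_hom A Z W" "\<And>x. x \<in> carrier Z \<Longrightarrow> r (s x) = x"
  shows "r ` carrier W = carrier Z"
proof
  show "r ` carrier W \<subseteq> carrier Z" using hom_closed[OF assms(1)] by blast
  show "carrier Z \<subseteq> r ` carrier W"
  proof
    fix x assume x: "x \<in> carrier Z"
    have "r (s x) \<in> r ` carrier W" using hom_closed[OF assms(2) x] by (rule imageI)
    then show "x \<in> r ` carrier W" unfolding assms(3)[OF x] .
  qed
qed

lemma rel_projective_mem: "rel_projective A T W \<Longrightarrow> W \<in> T"
  by (simp add: rel_projective_def)

lemma rel_projective_mono: "rel_projective A T W \<Longrightarrow> T' \<subseteq> T \<Longrightarrow> W \<in> T' \<Longrightarrow> rel_projective A T' W"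
  unfolding rel_projective_def by blast

text \<open>Finite sums of maps factoring through \<open>U\<close>. Together with the identity they express membership in
  add(U) without choosing a power of \<open>U\<close>.\<close>

inductive sum_through :: "('a, 'r) ring_scheme \<Rightarrow> ('a, 'u) module \<Rightarrow> ('a, 'm) module \<Rightarrow> ('a, 'n) module
    \<Rightarrow> ('m \<Rightarrow> 'n) \<Rightarrow> bool" for A U M N where
  zero: "sum_through A U M N (\<lambda>x. \<zero>\<^bsub>N\<^esub>)"
| step: "sum_through A U M N h \<Longrightarrow> i \<in> module_hom A M U \<Longrightarrow> p \<in> module_hom A U N \<Longrightarrow>
    sum_through A U M N (\<lambda>x. h x \<oplus>\<^bsub>N\<^esub> p (i x))"

definition through :: "('a, 'r) ring_scheme \<Rightarrow> ('a, 'u) module \<Rightarrow> ('a, 'm) module \<Rightarrow> ('a, 'n) module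
    \<Rightarrow> ('m \<Rightarrow> 'n) \<Rightarrow> bool" where
  "through A U M N h \<longleftrightarrow> (\<exists>h'. sum_through A U M N h' \<and> (\<forall>x\<in>carrier M. h x = h' x))"

abbreviation in_add :: "('a, 'r) ring_scheme \<Rightarrow> ('a, 'u) module \<Rightarrow> ('a, 'm) module \<Rightarrow> bool" where
  "in_add A U M \<equiv> through A U M M (\<lambda>x. x)"

lemma sum_through_hom:
  assumes "sum_through A U M N h" and M: "left_module A M" and N: "left_module A N"
  shows "h \<in> module_hom A M N"
  using assms(1)
  by induction (auto intro: left_module.hom_const_zero[OF N M] left_module.hom_plus[OF N] hom_comp)

lemma sum_through_plus:
  assumes N: "left_module A N" and M: "left_module A M" and "sum_through A U M N h" and "sum_through A U M N g"
  shows "through A U M N (\<lambda>x. h x \<oplus>\<^bsub>N\<^esub> g x)"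
  using assms(4)
proof induction
  interpret N: left_module A N by fact
  case zero
  then show ?case unfolding through_def using assms(3) hom_closed[OF sum_through_hom[OF assms(3) M N]]
    by (intro exI[of _ h]) simp
next
  interpret N: left_module A N by fact
  case (step g i p)
  then obtain k where k: "sum_through A U M N k" "\<And>x. x \<in> carrier M \<Longrightarrow> h x \<oplus>\<^bsub>N\<^esub> g x = k x"
    unfolding through_def by blast
  have "h x \<oplus>\<^bsub>N\<^esub> (g x \<oplus>\<^bsub>N\<^esub> p (i x)) = k x \<oplus>\<^bsub>N\<^esub> p (i x)" if x: "x \<in> carrier M" for x
    using k(2)[OF x, symmetric] hom_closed[OF sum_through_hom[OF assms(3) M N] x]
      hom_closed[OF sum_through_hom[OF step(1) M N] x] hom_closed[OF hom_comp[OF step(2,3)] x]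
    by (simp add: N.M.a_assoc)
  then show ?case unfolding through_def using sum_through.step[OF k(1) step(2,3)] by blast
qed

lemma through_plus:
  assumes N: "left_module A N" and M: "left_module A M" and "through A U M N h" and "through A U M N g"
  shows "through A U M N (\<lambda>x. h x \<oplus>\<^bsub>N\<^esub> g x)"
proof -
  obtain h' g' where *: "sum_through A U M N h'" "\<And>x. x \<in> carrier M \<Longrightarrow> h x = h' x"
    "sum_through A U M N g'" "\<And>x. x \<in> carrier M \<Longrightarrow> g x = g' x"
    using assms(3,4) unfolding through_def by blast
  obtain k where "sum_through A U M N k" "\<And>x. x \<in> carrier M \<Longrightarrow> h' x \<oplus>\<^bsub>N\<^esub> g' x = k x"
    using sum_through_plus[OF N M *(1,3)] unfolding through_def by blast
  then show ?thesis unfolding through_def using *(2,4) by (intro exI[of _ k]) simp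
qed

lemma through_single:
  assumes N: "left_module A N" and i: "i \<in> module_hom A M U" and p: "p \<in> module_hom A U N"
  shows "through A U M N (\<lambda>x. p (i x))"
proof -
  interpret N: left_module A N by fact
  show ?thesis unfolding through_def
    using sum_through.step[OF sum_through.zero i p] hom_closed[OF hom_comp[OF i p]]
    by (intro exI[of _ "\<lambda>x. \<zero>\<^bsub>N\<^esub> \<oplus>\<^bsub>N\<^esub> p (i x)"]) simp
qed

lemma sum_through_map:
  assumes N': "left_module A N'" and M': "left_module A M'"
    and "sum_through A U M N h"
    and f: "f \<in> module_hom A M' M" and g: "g \<in> module_hom A N N'" and N: "left_module A N" and M: "left_module A M"
    and U: "\<And>i p. i \<in> module_hom A M U \<Longrightarrow> p \<in> module_hom A U N \<Longrightarrow> through A U' M' N' (\<lambda>x. g (p (i (f x))))"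
  shows "through A U' M' N' (\<lambda>x. g (h (f x)))"
  using assms(3)
proof induction
  case zero
  then show ?case unfolding through_def using hom_zero[OF N N' g]
    by (intro exI[of _ "\<lambda>x. \<zero>\<^bsub>N'\<^esub>"]) (simp add: sum_through.zero)
next
  case (step h i p)
  have "through A U' M' N' (\<lambda>x. g (h (f x)) \<oplus>\<^bsub>N'\<^esub> g (p (i (f x))))"
    by (rule through_plus[OF N' M' step(4) U[OF step(2,3)]])
  moreover have "g (h (f x) \<oplus>\<^bsub>N\<^esub> p (i (f x))) = g (h (f x)) \<oplus>\<^bsub>N'\<^esub> g (p (i (f x)))" if x: "x \<in> carrier M'" for x
    by (rule module_hom_add[OF g hom_closed[OF sum_through_hom[OF step(1) M N] hom_closed[OF f x]]
        hom_closed[OF hom_comp[OF step(2,3)] hom_closed[OF f x]]])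
  ultimately show ?case unfolding through_def by simp
qed

text \<open>Exchanges the intermediate module: it suffices to treat a single composite through
  \<open>U\<close>, since sums of maps through \<open>U'\<close> are closed under addition.
  Transitivity of \<open>in_add\<close> is one instance; the replacement of \<open>U\<close> by its
  approximation in the descent is another.\<close>

lemma through_map:
  assumes N': "left_module A N'" and M': "left_module A M'" and h: "through A U M N h"
    and f: "f \<in> module_hom A M' M" and g: "g \<in> module_hom A N N'" and N: "left_module A N" and M: "left_module A M"
    and U: "\<And>i p. i \<in> module_hom A M U \<Longrightarrow> p \<in> module_hom A U N \<Longrightarrow> through A U' M' N' (\<lambda>x. g (p (i (f x))))"
  shows "through A U' M' N' (\<lambda>x. g (h (f x)))"
proof -
  obtain h' where h': "sum_through A U M N h'" "\<And>x. x \<in> carrier M \<Longrightarrow> h x = h' x"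
    using h unfolding through_def by blast
  have "through A U' M' N' (\<lambda>x. g (h' (f x)))" by (rule sum_through_map[OF N' M' h'(1) f g N M U])
  then show ?thesis unfolding through_def using h'(2) hom_closed[OF f] by simp
qed

lemma through_conj:
  assumes N': "left_module A N'" and M': "left_module A M'" and h: "through A U M N h"
    and f: "f \<in> module_hom A M' M" and g: "g \<in> module_hom A N N'" and N: "left_module A N" and M: "left_module A M"
  shows "through A U M' N' (\<lambda>x. g (h (f x)))"
  by (rule through_map[OF N' M' h f g N M])
    (rule through_single[OF N' hom_comp[OF f] hom_comp[OF _ g]])

lemma in_add_retract:
  assumes "in_add A U W" "left_module A W" "left_module A Z" "s \<in> module_hom A Z W" "r \<in> module_hom A W Z"
    "\<And>x. x \<in> carrier Z \<Longrightarrow> r (s x) = x"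
  shows "in_add A U Z"
proof -
  have "through A U Z Z (\<lambda>x. r (s x))"
    by (rule through_conj[OF assms(3,3,1,4,5,2,2)])
  then show ?thesis unfolding through_def using assms(6) by simp
qed

lemma in_add_self: "left_module A U \<Longrightarrow> in_add A U U"
  using through_single[OF _ hom_id hom_id] .

lemma in_add_trans:
  assumes "in_add A V W" "in_add A U V" and W: "left_module A W" and V: "left_module A V"
  shows "in_add A U W"
  by (rule through_map[OF W W assms(1) hom_id hom_id W W])
    (rule through_conj[OF W W assms(2) _ _ V V])

lemma in_add_biproduct:
  assumes b: "biproduct A M N D i1 i2 p1 p2" and D: "left_module A D" and M: "left_module A M" and N: "left_module A N"
    and "in_add A U M" "in_add A U N"
  shows "in_add A U D"
proof -
  note B = biproductD[OF b]
  have "through A U D D (\<lambda>x. i1 (p1 x) \<oplus>\<^bsub>D\<^esub> i2 (p2 x))"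
    by (rule through_plus[OF D D through_conj[OF D D assms(5) B(3,1) M M] through_conj[OF D D assms(6) B(4,2) N N]])
  then show ?thesis unfolding through_def using B(9) by simp
qed

text \<open>The identity of \<open>W\<close> is a sum of maps through \<open>U\<close>. If
  \<open>g\<close> vanished on the image of every map from \<open>U\<close>, it would vanish on each
  summand and hence everywhere.\<close>

lemma in_add_nonzero:
  assumes W: "in_add A U W" "left_module A W" and L: "left_module A L" and g: "g \<in> module_hom A W L"
    and x: "x \<in> carrier W" "g x \<noteq> \<zero>\<^bsub>L\<^esub>"
  obtains p u where "p \<in> module_hom A U W" "u \<in> carrier U" "g (p u) \<noteq> \<zero>\<^bsub>L\<^esub>"
proof (rule ccontr)
  assume n: "\<not> thesis"
  obtain h where h: "sum_through A U W W h" "\<And>x. x \<in> carrier W \<Longrightarrow> x = h x"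
    using W(1) unfolding through_def by blast
  interpret L: left_module A L by fact
  have "g (h x) = \<zero>\<^bsub>L\<^esub>"
    using h(1)
  proof induction
    case zero show ?case by (rule hom_zero[OF W(2) L g])
  next
    case (step h i p)
    have "g (p (i x)) = \<zero>\<^bsub>L\<^esub>" using n that[OF step(3) hom_closed[OF step(2) x(1)]] by blast
    then show ?case
      using step(4) module_hom_add[OF g hom_closed[OF sum_through_hom[OF step(1) W(2) W(2)] x(1)]
          hom_closed[OF hom_comp[OF step(2,3)] x(1)]] by simp
  qed
  then show False using h(2)[OF x(1)] x(2) by simp
qed

text \<open>The linear span of \<open>B\<close>, as a predicate on functions that is insensitive to
  values outside the carrier. Lifting and factorization properties of spanning maps extend to all
  maps by induction over it.\<close>

inductive lin_gen :: "'k ring \<Rightarrow> ('k, 'a) module \<Rightarrow> ('a, 'm) module \<Rightarrow> ('a, 'n) module \<Rightarrow> ('m \<Rightarrow> 'n) set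
    \<Rightarrow> ('m \<Rightarrow> 'n) \<Rightarrow> bool" for K A M N B where
  zero: "lin_gen K A M N B (\<lambda>x. \<zero>\<^bsub>N\<^esub>)"
| base: "b \<in> B \<Longrightarrow> lin_gen K A M N B b"
| add: "lin_gen K A M N B f \<Longrightarrow> lin_gen K A M N B g \<Longrightarrow> lin_gen K A M N B (\<lambda>x. f x \<oplus>\<^bsub>N\<^esub> g x)"
| scale: "c \<in> carrier K \<Longrightarrow> lin_gen K A M N B f \<Longrightarrow> lin_gen K A M N B (\<lambda>x. (c \<odot>\<^bsub>A\<^esub> \<one>\<^bsub>A\<^esub>) \<odot>\<^bsub>N\<^esub> f x)"
| cong: "lin_gen K A M N B f \<Longrightarrow> (\<And>x. x \<in> carrier M \<Longrightarrow> g x = f x) \<Longrightarrow> lin_gen K A M N B g"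

section \<open>Closure properties of torsion classes and Ext-projective modules\<close>

context fd_algebra begin

lemma biproduct_exists:
  assumes "M \<in> mod_cat A" and "N \<in> mod_cat A"
  obtains D i1 i2 p1 p2 where "D \<in> mod_cat A" "biproduct A M N D i1 i2 p1 p2"
proof (rule mod_biproduct[OF assms])
  fix D i1 i2 p1 p2
  assume "D \<in> mod_cat A" "i1 \<in> module_hom A M D" "i2 \<in> module_hom A N D" "p1 \<in> module_hom A D M" "p2 \<in> module_hom A D N"
    "\<And>x. x \<in> carrier M \<Longrightarrow> p1 (i1 x) = x" "\<And>x. x \<in> carrier M \<Longrightarrow> p2 (i1 x) = \<zero>\<^bsub>N\<^esub>"
    "\<And>y. y \<in> carrier N \<Longrightarrow> p1 (i2 y) = \<zero>\<^bsub>M\<^esub>" "\<And>y. y \<in> carrier N \<Longrightarrow> p2 (i2 y) = y"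
    "\<And>z. z \<in> carrier D \<Longrightarrow> i1 (p1 z) \<oplus>\<^bsub>D\<^esub> i2 (p2 z) = z"
  then show thesis using that[of D i1 i2 p1 p2] unfolding biproduct_def by blast
qed

lemma torsionD:
  assumes "torsion_class A T"
  shows "M \<in> T \<Longrightarrow> M \<in> mod_cat A"
    and "M \<in> T \<Longrightarrow> N \<in> mod_cat A \<Longrightarrow> f \<in> module_hom A M N \<Longrightarrow> f ` carrier M = carrier N \<Longrightarrow> N \<in> T"
    and "M \<in> mod_cat A \<Longrightarrow> N \<in> T \<Longrightarrow> f \<in> module_hom A M N \<Longrightarrow> f ` carrier M = carrier N \<Longrightarrow>
      sub M (kern M N f) \<in> T \<Longrightarrow> M \<in> T"
  using assms unfolding torsion_class_def by blast+

lemma torsion_image: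
  assumes T: "torsion_class A T" and M: "M \<in> T" and N: "N \<in> mod_cat A" and f: "f \<in> module_hom A M N"
  shows "sub N (f ` carrier M) \<in> T"
proof -
  note Mm = torsionD(1)[OF T M]
  note i = image_factor_dm[OF mod_fg[OF Mm] mod_fg[OF N] f]
  show ?thesis by (rule torsionD(2)[OF T M _ i(2)]) (use i(1) in \<open>simp_all add: mod_cat_iff\<close>)
qed

lemma torsion_biproduct:
  assumes T: "torsion_class A T" and b: "biproduct A M N D i1 i2 p1 p2" and D: "D \<in> mod_cat A"
    and M: "M \<in> T" and N: "N \<in> T"
  shows "D \<in> T"
proof -
  note B = biproductD[OF b]
  note Mm = mod_lm[OF torsionD(1)[OF T M]]
  interpret D: left_module A D by (rule mod_lm[OF D])
  have "kern D M p1 = i2 ` carrier N"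
  proof
    show "i2 ` carrier N \<subseteq> kern D M p1" using B(7) hom_closed[OF B(2)] by blast
    show "kern D M p1 \<subseteq> i2 ` carrier N"
    proof
      fix z assume z: "z \<in> kern D M p1"
      then have zD: "z \<in> carrier D" by simp
      have "i1 (p1 z) = \<zero>\<^bsub>D\<^esub>" using z hom_zero[OF Mm mod_lm[OF D] B(1)] by simp
      then have "z = i2 (p2 z)" using B(9)[OF zD] hom_closed[OF B(2) hom_closed[OF B(4) zD]] by simp
      then show "z \<in> i2 ` carrier N" using hom_closed[OF B(4) zD] by blast
    qed
  qed
  then have "sub D (kern D M p1) \<in> T" using torsion_image[OF T N D B(2)] by simp
  moreover have "p1 ` carrier D = carrier M" by (rule retract_surj[OF B(3,1)]) (rule B(5))
  ultimately show ?thesis using torsionD(3)[OF T D M B(3)] by blast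
qed

lemma perp_mod: "M \<in> perp A Z \<Longrightarrow> M \<in> mod_cat A"
  by (simp add: perp_def)

lemma perpD: "M \<in> perp A Z \<Longrightarrow> X \<in> Z \<Longrightarrow> f \<in> module_hom A M X \<Longrightarrow> x \<in> carrier M \<Longrightarrow> f x = \<zero>\<^bsub>X\<^esub>"
  unfolding perp_def by blast

text \<open>For extensions: a map to \<open>X\<close> vanishes on the kernel, so it factors through
  the quotient module, and there it vanishes as well.\<close>

lemma perp_torsion:
  assumes Z: "Z \<subseteq> mod_cat A"
  shows "torsion_class A (perp A Z)"
  unfolding torsion_class_def
proof (intro conjI ballI impI)
  show "perp A Z \<subseteq> mod_cat A" by (auto simp: perp_def)
next
  fix M N f assume M: "M \<in> perp A Z" and N: "N \<in> mod_cat A" and f: "f \<in> module_hom A M N" "f ` carrier M = carrier N"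
  have "g y = \<zero>\<^bsub>X\<^esub>" if X: "X \<in> Z" and g: "g \<in> module_hom A N X" and y: "y \<in> carrier N" for X g y
  proof -
    obtain x where "x \<in> carrier M" "y = f x" using y f(2) by blast
    then show ?thesis using perpD[OF M X hom_comp[OF f(1) g]] by blast
  qed
  then show "N \<in> perp A Z" using N unfolding perp_def by blast
next
  fix M N f assume M: "M \<in> mod_cat A" and N: "N \<in> perp A Z" and f: "f \<in> module_hom A M N"
    and s: "f ` carrier M = carrier N \<and> sub M (kern M N f) \<in> perp A Z"
  interpret M: left_module A M by (rule mod_lm[OF M])
  note Nl = mod_lm[OF perp_mod[OF N]]
  have "g y = \<zero>\<^bsub>X\<^esub>" if X: "X \<in> Z" and g: "g \<in> module_hom A M X" and y: "y \<in> carrier M" for X g y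
  proof -
    have Xl: "left_module A X" using X Z mod_lm by blast
    have k: "g x = \<zero>\<^bsub>X\<^esub>" if "x \<in> carrier M" "f x = \<zero>\<^bsub>N\<^esub>" for x
      using perpD[OF conjunct2[OF s] X M.hom_restrict_dom[OF submod_kern[OF mod_lm[OF M] Nl f] g], of x] that by simp
    obtain g' where g': "g' \<in> module_hom A N X" "\<And>x. x \<in> carrier M \<Longrightarrow> g' (f x) = g x"
      using hom_factor[OF mod_lm[OF M] Nl Xl g f conjunct1[OF s] k] by blast
    show ?thesis using perpD[OF N X g'(1) hom_closed[OF f y]] g'(2)[OF y] by simp
  qed
  then show "M \<in> perp A Z" using M unfolding perp_def by blast
qed

lemma mod_torsion: "torsion_class A (mod_cat A)"
  unfolding torsion_class_def by blast

lemma rel_projective_retract: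
  assumes T: "torsion_class A T" and W: "rel_projective A T W" and Z: "Z \<in> mod_cat A"
    and s: "s \<in> module_hom A Z W" and r: "r \<in> module_hom A W Z" and rs: "\<And>x. x \<in> carrier Z \<Longrightarrow> r (s x) = x"
  shows "rel_projective A T Z"
  unfolding rel_projective_def
proof (intro conjI ballI impI)
  have "r ` carrier W = carrier Z" by (rule retract_surj[OF r s]) (rule rs)
  then show "Z \<in> T" by (rule torsionD(2)[OF T rel_projective_mem[OF W] Z r])
  fix E V g h assume a: "E \<in> T" "V \<in> T" "g \<in> module_hom A E V" "h \<in> module_hom A Z V"
    "g ` carrier E = carrier V \<and> sub E (kern E V g) \<in> T"
  obtain l where l: "l \<in> module_hom A W E" "\<And>x. x \<in> carrier W \<Longrightarrow> g (l x) = h (r x)"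
    using rel_projectiveD[OF W a(1-3) hom_comp[OF r a(4)]] a(5) by blast
  show "\<exists>l\<in>module_hom A Z E. \<forall>x\<in>carrier Z. g (l x) = h x"
    using hom_comp[OF s l(1)] l(2) hom_closed[OF s] rs by (intro bexI[of _ "\<lambda>x. l (s x)"]) simp_all
qed

lemma rel_projective_biproduct:
  assumes T: "torsion_class A T" and b: "biproduct A M N D i1 i2 p1 p2" and D: "D \<in> mod_cat A"
    and M: "rel_projective A T M" and N: "rel_projective A T N"
  shows "rel_projective A T D"
  unfolding rel_projective_def
proof (intro conjI ballI impI)
  note B = biproductD[OF b]
  show "D \<in> T" by (rule torsion_biproduct[OF T b D rel_projective_mem[OF M] rel_projective_mem[OF N]])
  fix E V g h assume a: "E \<in> T" "V \<in> T" "g \<in> module_hom A E V" "h \<in> module_hom A D V"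
    "g ` carrier E = carrier V \<and> sub E (kern E V g) \<in> T"
  obtain l where l: "l \<in> module_hom A M E" "\<And>x. x \<in> carrier M \<Longrightarrow> g (l x) = h (i1 x)"
    using rel_projectiveD[OF M a(1-3) hom_comp[OF B(1) a(4)]] a(5) by blast
  obtain k where k: "k \<in> module_hom A N E" "\<And>x. x \<in> carrier N \<Longrightarrow> g (k x) = h (i2 x)"
    using rel_projectiveD[OF N a(1-3) hom_comp[OF B(2) a(4)]] a(5) by blast
  interpret E: left_module A E by (rule mod_lm[OF torsionD(1)[OF T a(1)]])
  show "\<exists>l\<in>module_hom A D E. \<forall>x\<in>carrier D. g (l x) = h x"
  proof (intro bexI ballI)
    show "(\<lambda>x. l (p1 x) \<oplus>\<^bsub>E\<^esub> k (p2 x)) \<in> module_hom A D E"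
      by (rule E.hom_plus[OF hom_comp[OF B(3) l(1)] hom_comp[OF B(4) k(1)]])
    fix x assume x: "x \<in> carrier D"
    note c = hom_closed[OF B(3) x] hom_closed[OF B(4) x]
    have "g (l (p1 x) \<oplus>\<^bsub>E\<^esub> k (p2 x)) = h (i1 (p1 x)) \<oplus>\<^bsub>V\<^esub> h (i2 (p2 x))"
      using module_hom_add[OF a(3) hom_closed[OF l(1) c(1)] hom_closed[OF k(1) c(2)]] l(2)[OF c(1)] k(2)[OF c(2)] by simp
    also have "\<dots> = h (i1 (p1 x) \<oplus>\<^bsub>D\<^esub> i2 (p2 x))"
      using module_hom_add[OF a(4) hom_closed[OF B(1) c(1)] hom_closed[OF B(2) c(2)]] by simp
    finally show "g (l (p1 x) \<oplus>\<^bsub>E\<^esub> k (p2 x)) = h x" using B(9)[OF x] by simp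
  qed
qed

text \<open>All kernels lie in \<open>mod_cat\<close>, so for the torsion class of all modules the
  condition on the kernel is automatic. Results on Ext-projective modules thereby apply to
  projective ones.\<close>

lemma projective_iff: "projective A Q \<longleftrightarrow> rel_projective A (mod_cat A) Q"
proof -
  have "sub E (kern E V g) \<in> mod_cat A" if "E \<in> mod_cat A" "V \<in> mod_cat A" "g \<in> module_hom A E V" for E V g
    using mod_sub[OF that(1) submod_kern[OF mod_lm mod_lm]] that by blast
  then show ?thesis unfolding projective_def rel_projective_def by blast
qed

lemma hom_scale:
  assumes N: "left_module A N" and c: "c \<in> carrier K" and f: "f \<in> module_hom A M N"
  shows "(\<lambda>x. sc c \<odot>\<^bsub>N\<^esub> f x) \<in> module_hom A M N"
proof -
  interpret N: left_module A N by fact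
  show ?thesis
    using c hom_closed[OF f] module_hom_add[OF f] module_hom_smult[OF f]
    by (intro homI) (simp_all add: N.smult_r_distr sc_commute[OF N])
qed

text \<open>Reduces statements on all maps between two modules to finitely many maps, which can be
  handled one at a time by enlarging a direct sum.\<close>

lemma hom_finite_span:
  assumes M: "fg_module A M" and N: "fg_module A N"
  obtains B where "finite B" "B \<subseteq> module_hom A M N"
    "\<And>f. f \<in> module_hom A M N \<Longrightarrow> lin_gen K A M N B f"
proof -
  let ?H = "hom_space A M N"
  interpret H: vectorspace K ?H by (rule hom_space_vectorspace[OF fg_moduleD[OF M] fg_moduleD[OF N]])
  obtain B where B: "finite B" "B \<subseteq> carrier ?H" "H.span B = carrier ?H"
    using hom_space_fin_dim[OF M N] unfolding H.fin_dim_def by blast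
  have BH: "B \<subseteq> module_hom A M N" using B(2) by (auto simp: hom_space_def)
  let ?P = "lin_gen K A M N B"
  have "?P f" if f: "f \<in> module_hom A M N" for f
  proof -
    have "subspace K {h \<in> carrier ?H. ?P h} ?H"
    proof (rule H.subspaceI)
      have "?P \<zero>\<^bsub>?H\<^esub>" by (rule lin_gen.cong[OF lin_gen.zero]) (simp add: hom_space_def)
      then show "\<zero>\<^bsub>?H\<^esub> \<in> {h \<in> carrier ?H. ?P h}" using H.M.zero_closed by blast
      show "v \<oplus>\<^bsub>?H\<^esub> w \<in> {h \<in> carrier ?H. ?P h}" if vw: "v \<in> {h \<in> carrier ?H. ?P h}" "w \<in> {h \<in> carrier ?H. ?P h}" for v w
      proof -
        have "?P (v \<oplus>\<^bsub>?H\<^esub> w)" by (rule lin_gen.cong[OF lin_gen.add[of _ _ _ _ _ v w]]) (use vw in \<open>simp_all add: hom_space_def\<close>)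
        then show ?thesis using vw H.M.a_closed by blast
      qed
      show "c \<odot>\<^bsub>?H\<^esub> v \<in> {h \<in> carrier ?H. ?P h}" if c: "c \<in> carrier K" and v: "v \<in> {h \<in> carrier ?H. ?P h}" for c v
      proof -
        have "?P (c \<odot>\<^bsub>?H\<^esub> v)" by (rule lin_gen.cong[OF lin_gen.scale[OF c, of _ _ _ _ v]]) (use v in \<open>simp_all add: hom_space_def\<close>)
        then show ?thesis using v c H.smult_closed by blast
      qed
    qed blast
    moreover have "B \<subseteq> {h \<in> carrier ?H. ?P h}" using B(2) lin_gen.base by blast
    ultimately have "H.span B \<subseteq> {h \<in> carrier ?H. ?P h}" by (intro H.span_is_subset H.is_module)
    moreover have "restrict f (carrier M) \<in> carrier ?H"
      using hom_cong[OF f fg_moduleD[OF M], of "restrict f (carrier M)"] by (simp add: hom_space_def)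
    ultimately have "?P (restrict f (carrier M))" using B(3) by blast
    then show "?P f" by (rule lin_gen.cong) simp
  qed
  then show ?thesis using that[OF B(1) BH] by blast
qed

subsection \<open>Bricks\<close>

lemma ring_End_alg:
  assumes X: "fg_module A X"
  shows "ring (End_alg A X)"
proof -
  interpret X: left_module A X by (rule fg_moduleD[OF X])
  let ?E = "End_alg A X"
  interpret H: vectorspace K "hom_space A X X" by (rule hom_space_vectorspace[OF fg_moduleD[OF X] fg_moduleD[OF X]])
  have h: "h x \<in> carrier X" if "h \<in> module_hom A X X" "x \<in> carrier X" for h x by (rule hom_closed[OF that])
  have hadd: "h (x \<oplus>\<^bsub>X\<^esub> y) = h x \<oplus>\<^bsub>X\<^esub> h y" if "h \<in> module_hom A X X" "x \<in> carrier X" "y \<in> carrier X" for h x y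
    by (rule module_hom_add[OF that])
  show ?thesis
  proof (rule ringI)
    have "add_monoid ?E = add_monoid (hom_space A X X)" by (simp add: End_alg_def hom_space_def)
    then show "abelian_group ?E"
      using H.M.abelian_group_axioms unfolding abelian_group_def abelian_monoid_def abelian_group_axioms_def by simp
    show "monoid ?E"
    proof (rule monoidI)
      fix f g assume fg: "f \<in> carrier ?E" "g \<in> carrier ?E"
      then have "f \<in> module_hom A X X" "g \<in> module_hom A X X" by (simp_all add: End_alg_def)
      from hom_cong[OF hom_comp[OF this(2,1)] fg_moduleD[OF X], of "compose (carrier X) f g"]
      show "f \<otimes>\<^bsub>?E\<^esub> g \<in> carrier ?E" by (simp add: End_alg_def compose_def)
    next
      from hom_cong[OF hom_id fg_moduleD[OF X], of "\<lambda>x\<in>carrier X. x"]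
      show "\<one>\<^bsub>?E\<^esub> \<in> carrier ?E" by (simp add: End_alg_def)
    next
      fix f g k assume "f \<in> carrier ?E" "g \<in> carrier ?E" "k \<in> carrier ?E"
      then show "(f \<otimes>\<^bsub>?E\<^esub> g) \<otimes>\<^bsub>?E\<^esub> k = f \<otimes>\<^bsub>?E\<^esub> (g \<otimes>\<^bsub>?E\<^esub> k)"
        by (auto simp: End_alg_def compose_def h)
    next
      fix f assume "f \<in> carrier ?E"
      then have f: "f \<in> module_hom A X X" "f \<in> extensional (carrier X)" by (simp_all add: End_alg_def)
      then show "\<one>\<^bsub>?E\<^esub> \<otimes>\<^bsub>?E\<^esub> f = f" "f \<otimes>\<^bsub>?E\<^esub> \<one>\<^bsub>?E\<^esub> = f"
        by (auto simp: End_alg_def compose_def extensional_def fun_eq_iff h)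
    qed
  next
    fix f g k assume "f \<in> carrier ?E" "g \<in> carrier ?E" "k \<in> carrier ?E"
    then have f: "f \<in> module_hom A X X" "g \<in> module_hom A X X" "k \<in> module_hom A X X" by (simp_all add: End_alg_def)
    show "(f \<oplus>\<^bsub>?E\<^esub> g) \<otimes>\<^bsub>?E\<^esub> k = f \<otimes>\<^bsub>?E\<^esub> k \<oplus>\<^bsub>?E\<^esub> g \<otimes>\<^bsub>?E\<^esub> k"
      using h[OF f(3)] by (auto simp: End_alg_def compose_def)
    show "k \<otimes>\<^bsub>?E\<^esub> (f \<oplus>\<^bsub>?E\<^esub> g) = k \<otimes>\<^bsub>?E\<^esub> f \<oplus>\<^bsub>?E\<^esub> k \<otimes>\<^bsub>?E\<^esub> g"
      using h[OF f(1)] h[OF f(2)] hadd[OF f(3)] by (auto simp: End_alg_def compose_def)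
  qed
qed

text \<open>The inverse of a bijective homomorphism is a homomorphism, so the units of
  \<open>End_alg\<close> are exactly the bijective endomorphisms. Later arguments use bricks in this
  form, where bijectivity can be read off dimensions.\<close>

lemma brick_iff:
  "X \<in> bricks A \<longleftrightarrow> X \<in> mod_cat A \<and> carrier X \<noteq> {\<zero>\<^bsub>X\<^esub>} \<and>
    (\<forall>f\<in>module_hom A X X. (\<exists>x\<in>carrier X. f x \<noteq> \<zero>\<^bsub>X\<^esub>) \<longrightarrow> bij_betw f (carrier X) (carrier X))"
proof (cases "X \<in> mod_cat A")
  case False
  then show ?thesis by (simp add: bricks_def)
next
  case True
  note X = mod_lm[OF True]
  interpret X: left_module A X by (rule X)
  let ?E = "End_alg A X" and ?C = "carrier X"
  have R: "ring ?E" by (rule ring_End_alg[OF mod_fg[OF True]])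
  have one: "\<one>\<^bsub>?E\<^esub> \<noteq> \<zero>\<^bsub>?E\<^esub> \<longleftrightarrow> ?C \<noteq> {\<zero>\<^bsub>X\<^esub>}"
  proof
    assume n: "\<one>\<^bsub>?E\<^esub> \<noteq> \<zero>\<^bsub>?E\<^esub>"
    show "?C \<noteq> {\<zero>\<^bsub>X\<^esub>}"
    proof
      assume "?C = {\<zero>\<^bsub>X\<^esub>}"
      then have "\<one>\<^bsub>?E\<^esub> = \<zero>\<^bsub>?E\<^esub>" by (simp add: End_alg_def) (rule restrict_ext, simp)
      then show False using n by simp
    qed
  next
    assume "?C \<noteq> {\<zero>\<^bsub>X\<^esub>}"
    then obtain x where x: "x \<in> ?C" "x \<noteq> \<zero>\<^bsub>X\<^esub>" using X.M.zero_closed by blast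
    show "\<one>\<^bsub>?E\<^esub> \<noteq> \<zero>\<^bsub>?E\<^esub>"
    proof
      assume "\<one>\<^bsub>?E\<^esub> = \<zero>\<^bsub>?E\<^esub>"
      from fun_cong[OF this, of x] show False using x by (simp add: End_alg_def)
    qed
  qed
  have nz: "f \<noteq> \<zero>\<^bsub>?E\<^esub> \<longleftrightarrow> (\<exists>x\<in>?C. f x \<noteq> \<zero>\<^bsub>X\<^esub>)" if "f \<in> carrier ?E" for f
    using that by (auto simp: End_alg_def extensional_def fun_eq_iff)
  have unit: "f \<in> Units ?E \<longleftrightarrow> bij_betw f ?C ?C" if fE: "f \<in> carrier ?E" for f
  proof
    have f: "f \<in> module_hom A X X" using fE by (simp add: End_alg_def)
    assume "f \<in> Units ?E"
    then obtain g where gE: "g \<in> carrier ?E" and gf: "g \<otimes>\<^bsub>?E\<^esub> f = \<one>\<^bsub>?E\<^esub>" "f \<otimes>\<^bsub>?E\<^esub> g = \<one>\<^bsub>?E\<^esub>"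
      unfolding Units_def by blast
    have g: "g \<in> module_hom A X X" using gE by (simp add: End_alg_def)
    have "g (f x) = x" "f (g x) = x" if "x \<in> ?C" for x
      using fun_cong[OF gf(1), of x] fun_cong[OF gf(2), of x] that by (simp_all add: End_alg_def compose_def)
    then show "bij_betw f ?C ?C"
      using hom_closed[OF f] hom_closed[OF g] by (intro bij_betwI[of _ _ _ g]) auto
  next
    have f: "f \<in> module_hom A X X" using fE by (simp add: End_alg_def)
    assume b: "bij_betw f ?C ?C"
    let ?g = "restrict (inv_into ?C f) ?C"
    have "?g \<in> module_hom A X X" by (rule hom_cong[OF hom_inverse[OF f b X] X]) simp
    then have g: "?g \<in> carrier ?E" by (simp add: End_alg_def)
    have i: "inv_into ?C f (f x) = x" "f (inv_into ?C f x) = x" if "x \<in> ?C" for x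
      by (rule bij_betw_inv_into_left[OF b that], rule bij_betw_inv_into_right[OF b that])
    have "compose ?C ?g f = (\<lambda>x\<in>?C. x)"
      unfolding compose_def
    proof (rule restrict_ext)
      fix x assume x: "x \<in> ?C"
      show "?g (f x) = x" using i(1)[OF x] hom_closed[OF f x] by simp
    qed
    moreover have "compose ?C f ?g = (\<lambda>x\<in>?C. x)"
      unfolding compose_def
    proof (rule restrict_ext)
      fix x assume x: "x \<in> ?C"
      show "f (?g x) = x" using i(2)[OF x] x by simp
    qed
    ultimately have "?g \<otimes>\<^bsub>?E\<^esub> f = \<one>\<^bsub>?E\<^esub>" "f \<otimes>\<^bsub>?E\<^esub> ?g = \<one>\<^bsub>?E\<^esub>" by (simp_all add: End_alg_def)
    then show "f \<in> Units ?E" using fE g unfolding Units_def by blast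
  qed
  have uc: "Units ?E \<subseteq> carrier ?E" unfolding Units_def by blast
  show ?thesis
  proof
    assume "X \<in> bricks A"
    then have d: "\<one>\<^bsub>?E\<^esub> \<noteq> \<zero>\<^bsub>?E\<^esub>" "Units ?E = carrier ?E - {\<zero>\<^bsub>?E\<^esub>}"
      by (auto simp: bricks_def division_algebra_def)
    have "bij_betw f ?C ?C" if f: "f \<in> module_hom A X X" and n: "\<exists>x\<in>?C. f x \<noteq> \<zero>\<^bsub>X\<^esub>" for f
    proof -
      have fE: "restrict f ?C \<in> carrier ?E"
        using hom_cong[OF f X, of "restrict f ?C"] by (simp add: End_alg_def)
      have "restrict f ?C \<noteq> \<zero>\<^bsub>?E\<^esub>" unfolding nz[OF fE] using n by auto
      then have "restrict f ?C \<in> Units ?E" using d(2) fE by blast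
      then have "bij_betw (restrict f ?C) ?C ?C" using unit[OF fE] by blast
      then show ?thesis by (rule iffD1[OF bij_betw_cong, rotated]) simp
    qed
    then show "X \<in> mod_cat A \<and> ?C \<noteq> {\<zero>\<^bsub>X\<^esub>} \<and>
      (\<forall>f\<in>module_hom A X X. (\<exists>x\<in>?C. f x \<noteq> \<zero>\<^bsub>X\<^esub>) \<longrightarrow> bij_betw f ?C ?C)" using True one d(1) by blast
  next
    assume b: "X \<in> mod_cat A \<and> ?C \<noteq> {\<zero>\<^bsub>X\<^esub>} \<and>
      (\<forall>f\<in>module_hom A X X. (\<exists>x\<in>?C. f x \<noteq> \<zero>\<^bsub>X\<^esub>) \<longrightarrow> bij_betw f ?C ?C)"
    have "f \<in> Units ?E \<longleftrightarrow> f \<in> carrier ?E - {\<zero>\<^bsub>?E\<^esub>}" for f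
    proof
      assume f: "f \<in> Units ?E"
      then have fE: "f \<in> carrier ?E" using uc by blast
      have bij: "bij_betw f ?C ?C" using unit[OF fE] f by blast
      obtain y where y: "y \<in> ?C" "y \<noteq> \<zero>\<^bsub>X\<^esub>" using b X.M.zero_closed by blast
      have "y \<in> f ` ?C" unfolding bij_betw_imp_surj_on[OF bij] by (rule y(1))
      then obtain x where x: "x \<in> ?C" "y = f x" by (rule imageE)
      then have "f \<noteq> \<zero>\<^bsub>?E\<^esub>" unfolding nz[OF fE] using y(2) by (intro bexI[of _ x]) simp_all
      then show "f \<in> carrier ?E - {\<zero>\<^bsub>?E\<^esub>}" using fE by simp
    next
      assume f: "f \<in> carrier ?E - {\<zero>\<^bsub>?E\<^esub>}"
      then have fE: "f \<in> carrier ?E" and "f \<in> module_hom A X X" by (auto simp: End_alg_def)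
      then show "f \<in> Units ?E" using unit[OF fE] nz[OF fE] f b by blast
    qed
    then have "Units ?E = carrier ?E - {\<zero>\<^bsub>?E\<^esub>}" by blast
    then show "X \<in> bricks A" using True R one b unfolding bricks_def division_algebra_def by blast
  qed
qed

lemma brick_mod: "X \<in> bricks A \<Longrightarrow> X \<in> mod_cat A"
  by (simp add: bricks_def)

lemma brick_nonzero: "X \<in> bricks A \<Longrightarrow> \<exists>x\<in>carrier X. x \<noteq> \<zero>\<^bsub>X\<^esub>"
  using brick_iff[of X] abelian_monoid.zero_closed[of X] mod_lm[of X]
  unfolding left_module_def abelian_group_def by blast

text \<open>A nonzero endomorphism with image of least dimension has a brick as its image.\<close>

lemma brick_factor:
  assumes M: "M \<in> mod_cat A" and n: "x \<in> carrier M" "x \<noteq> \<zero>\<^bsub>M\<^esub>"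
  obtains e where "e \<in> module_hom A M M" "sub M (e ` carrier M) \<in> bricks A"
proof -
  interpret M: left_module A M by (rule mod_lm[OF M])
  note fgM = mod_fg[OF M]
  let ?P = "\<lambda>e. e \<in> module_hom A M M \<and> (\<exists>x\<in>carrier M. e x \<noteq> \<zero>\<^bsub>M\<^esub>)"
  have "?P (\<lambda>x. x)" using hom_id n by blast
  then obtain e where e: "?P e" and min: "\<And>g. ?P g \<Longrightarrow> dm (sub M (e ` carrier M)) \<le> dm (sub M (g ` carrier M))"
    using ex_has_least_nat[of ?P "\<lambda>x. x" "\<lambda>e. dm (sub M (e ` carrier M))"] by blast
  have eh: "e \<in> module_hom A M M" using e by blast
  let ?I = "e ` carrier M"
  let ?B = "sub M ?I"
  have sI: "is_submodule A ?I M" by (rule submod_im[OF mod_lm[OF M] mod_lm[OF M] eh])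
  have B: "?B \<in> mod_cat A" by (rule mod_sub[OF M sI])
  have eB: "e \<in> module_hom A M ?B" by (rule M.hom_into_sub[OF eh subset_refl])
  have "bij_betw g (carrier ?B) (carrier ?B)" if g: "g \<in> module_hom A ?B ?B" and ng: "\<exists>x\<in>carrier ?B. g x \<noteq> \<zero>\<^bsub>?B\<^esub>" for g
  proof -
    let ?J = "g ` ?I"
    \<comment> \<open>\<open>g\<close> after \<open>e\<close> is again a nonzero endomorphism of
      \<open>M\<close>, with image inside \<open>?B\<close>. Minimality forces this image to be all
      of \<open>?B\<close>, and a surjective endomorphism is bijective by dimension.\<close>
    have ge: "(\<lambda>x. g (e x)) \<in> module_hom A M M" by (rule hom_comp[OF hom_comp[OF eB g] M.hom_incl[OF sI]])
    have "?P (\<lambda>x. g (e x))" using ge ng by auto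
    from min[OF this] have le: "dm ?B \<le> dm (sub M ?J)" by (simp add: image_image)
    have sJ: "is_submodule A ?J ?B" using submod_im[OF mod_lm[OF B] mod_lm[OF B] g] by simp
    have "?J = carrier ?B"
    proof (rule ccontr)
      assume "?J \<noteq> carrier ?B"
      from dm_sub(2)[OF mod_fg[OF B] sJ this] show False using le by simp
    qed
    then show ?thesis using dm_surj(2)[OF mod_fg[OF B] mod_fg[OF B] g] by (simp add: bij_betw_def)
  qed
  moreover have "carrier ?B \<noteq> {\<zero>\<^bsub>?B\<^esub>}" using e by auto
  ultimately have "?B \<in> bricks A" unfolding brick_iff using B by blast
  then show ?thesis using that eh by blast
qed

end

subsection \<open>Removing the last brick of a torsion class\<close>

lemma greatest_nat:
  fixes m :: "'b \<Rightarrow> nat"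
  assumes "P a" "\<And>x. P x \<Longrightarrow> m x \<le> b"
  obtains x where "P x" "\<And>y. P y \<Longrightarrow> m y \<le> m x"
proof -
  have "\<forall>x. P x \<longrightarrow> m x < Suc b" using assms(2) by (simp add: less_Suc_eq_le)
  from ex_has_greatest_nat[of P a m, OF assms(1) this] show ?thesis using that by blast
qed

lemma least_nat:
  fixes m :: "'b \<Rightarrow> nat"
  assumes "P a"
  obtains x where "P x" "\<And>y. P y \<Longrightarrow> m x \<le> m y"
  using ex_has_least_nat[of P a m, OF assms] that by blast

lemma surjE: "f ` C = D \<Longrightarrow> y \<in> D \<Longrightarrow> (\<And>x. x \<in> C \<Longrightarrow> y = f x \<Longrightarrow> thesis) \<Longrightarrow> thesis"
  by blast

definition left_approx :: "('k, 'a) module \<Rightarrow> ('a, nat \<Rightarrow> 'k) module set \<Rightarrow> ('a, nat \<Rightarrow> 'k) module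
    \<Rightarrow> ('a, nat \<Rightarrow> 'k) module \<Rightarrow> ((nat \<Rightarrow> 'k) \<Rightarrow> nat \<Rightarrow> 'k) \<Rightarrow> bool" where
  "left_approx A T U V f \<longleftrightarrow> V \<in> T \<and> f \<in> module_hom A U V \<and>
    (\<forall>M\<in>T. \<forall>g\<in>module_hom A U M. \<exists>k\<in>module_hom A V M. \<forall>x\<in>carrier U. g x = k (f x))"

lemma left_approxD:
  assumes "left_approx A T U V f" "M \<in> T" "g \<in> module_hom A U M"
  obtains k where "k \<in> module_hom A V M" "\<And>x. x \<in> carrier U \<Longrightarrow> g x = k (f x)"
  using assms unfolding left_approx_def by blast

lemma (in fd_algebra) fitting_ex:
  assumes M: "M \<in> mod_cat A" and f: "f \<in> module_hom A M M"
  shows "\<exists>k e. e \<in> module_hom A M M \<and> (\<forall>x\<in>carrier M. e x \<in> (f ^^ Suc k) ` carrier M) \<and>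
    (\<forall>y\<in>(f ^^ Suc k) ` carrier M. e y = y)"
proof (rule fitting[OF M f])
  fix e k assume "e \<in> module_hom A M M" "\<And>x. x \<in> carrier M \<Longrightarrow> e x \<in> (f ^^ Suc k) ` carrier M"
    "\<And>y. y \<in> (f ^^ Suc k) ` carrier M \<Longrightarrow> e y = y"
  then have "e \<in> module_hom A M M \<and> (\<forall>x\<in>carrier M. e x \<in> (f ^^ Suc k) ` carrier M) \<and>
    (\<forall>y\<in>(f ^^ Suc k) ` carrier M. e y = y)" by (intro conjI ballI)
  then show ?thesis by (intro exI)
qed

text \<open>What matters is that the kernel stays in \<open>T\<close>, so that Ext-projective
  modules lift along \<open>m\<close>. Smallness of \<open>W\<close> is imposed separately, by
  choosing a cover of least dimension.\<close>

definition rel_projective_cover ::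
  "('k, 'a) module \<Rightarrow> ('a, nat \<Rightarrow> 'k) module set \<Rightarrow> ('a, nat \<Rightarrow> 'k) module
    \<Rightarrow> ('a, nat \<Rightarrow> 'k) module \<Rightarrow> ((nat \<Rightarrow> 'k) \<Rightarrow> nat \<Rightarrow> 'k) \<Rightarrow> bool" where
  "rel_projective_cover A T M W m \<longleftrightarrow> rel_projective A T W \<and> m \<in> module_hom A W M \<and>
    m ` carrier W = carrier M \<and> sub W (kern W M m) \<in> T"

text \<open>The substitute for a support tau-tilting module: \<open>U\<close> is an Ext-projective generator of \<open>T\<close>, and
  the free module of rank one has a left approximation by an Ext-projective module of \<open>T\<close>.\<close>

definition progenerator :: "('k, 'a) module \<Rightarrow> ('a, nat \<Rightarrow> 'k) module set \<Rightarrow> ('a, nat \<Rightarrow> 'k) module \<Rightarrow> bool" where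
  "progenerator A T U \<longleftrightarrow> rel_projective A T U \<and>
    (\<forall>M\<in>T. \<exists>W m. rel_projective_cover A T M W m) \<and>
    (\<forall>W. rel_projective A T W \<longrightarrow> in_add A U W) \<and>
    (\<exists>Y f. rel_projective A T Y \<and> left_approx A T (free_module A) Y f)"

section \<open>Maps to the brick that is removed\<close>

text \<open>\<open>X\<close> is terminal among the bricks of \<open>T\<close>. Equal dimension is
  the form in which this is used: it turns an inclusion of a brick into \<open>X\<close>, or a
  surjection of a brick onto \<open>X\<close>, into a bijection.\<close>

locale torsion_step = fd_algebra K A for K :: "'k ring" and A :: "('k, 'a) module" +
  fixes T :: "('a, nat \<Rightarrow> 'k) module set" and X :: "('a, nat \<Rightarrow> 'k) module"
  assumes T: "torsion_class A T" and XT: "X \<in> T" and X: "X \<in> bricks A"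
    and last_brick: "\<And>B f x. \<lbrakk>B \<in> bricks A; B \<in> T; f \<in> module_hom A B X; x \<in> carrier B; f x \<noteq> \<zero>\<^bsub>X\<^esub>\<rbrakk>
      \<Longrightarrow> hdim K A (free_module A) B = hdim K A (free_module A) X"
begin

definition T' where "T' = {M \<in> T. \<forall>f\<in>module_hom A M X. \<forall>x\<in>carrier M. f x = \<zero>\<^bsub>X\<^esub>}"

lemmas Tm = torsionD(1)[OF T] and Tq = torsionD(2)[OF T] and Te = torsionD(3)[OF T]

lemma Tl: "M \<in> T \<Longrightarrow> left_module A M" using mod_lm[OF Tm] .
lemma Tf: "M \<in> T \<Longrightarrow> fg_module A M" using mod_fg[OF Tm] .

lemma T'T: "M \<in> T' \<Longrightarrow> M \<in> T"
  by (simp add: T'_def)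

lemma T'_zero: "M \<in> T' \<Longrightarrow> f \<in> module_hom A M X \<Longrightarrow> x \<in> carrier M \<Longrightarrow> f x = \<zero>\<^bsub>X\<^esub>"
  unfolding T'_def by blast

lemma T'_eq: "T' = T \<inter> perp A {X}"
  unfolding T'_def perp_def using Tm by blast

lemma T'_torsion: "torsion_class A T'"
proof -
  have "torsion_class A (perp A {X})" using perp_torsion[of "{X}"] Tm[OF XT] by blast
  then show ?thesis using T unfolding T'_eq torsion_class_def by blast
qed

text \<open>The image of \<open>f\<close> lies in \<open>T\<close> and contains a brick of
  \<open>T\<close>. Included in \<open>X\<close>, this brick has a nonzero map to \<open>X\<close>,
  hence the dimension of \<open>X\<close>, and so fills \<open>X\<close>.\<close>

lemma hom_to_X_onto:
  assumes Y: "Y \<in> T" and f: "f \<in> module_hom A Y X" and x: "x \<in> carrier Y" "f x \<noteq> \<zero>\<^bsub>X\<^esub>"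
  shows "f ` carrier Y = carrier X"
proof -
  interpret X: left_module A X by (rule Tl[OF XT])
  let ?I = "f ` carrier Y"
  have I: "sub X ?I \<in> T" by (rule torsion_image[OF T Y Tm[OF XT] f])
  have sI: "is_submodule A ?I X" by (rule submod_im[OF Tl[OF Y] Tl[OF XT] f])
  have "f x \<in> carrier (sub X ?I)" "f x \<noteq> \<zero>\<^bsub>sub X ?I\<^esub>" using x by simp_all
  from brick_factor[OF Tm[OF I] this] obtain e where e: "e \<in> module_hom A (sub X ?I) (sub X ?I)"
    "sub (sub X ?I) (e ` carrier (sub X ?I)) \<in> bricks A" .
  let ?J = "e ` ?I"
  have B: "sub X ?J \<in> bricks A" using e(2) by simp
  have BT: "sub X ?J \<in> T" using torsion_image[OF T I Tm[OF I] e(1)] by simp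
  have JI: "?J \<subseteq> ?I" using hom_closed[OF e(1)] by auto
  have sJ: "is_submodule A ?J X"
    using X.submod_trans[OF sI submod_im[OF Tl[OF I] Tl[OF I] e(1)]] by simp
  obtain y where y: "y \<in> carrier (sub X ?J)" "y \<noteq> \<zero>\<^bsub>sub X ?J\<^esub>" using brick_nonzero[OF B] by blast
  have "dm (sub X ?J) = dm X"
    by (rule last_brick[OF B BT X.hom_incl[OF sJ] y(1)]) (use y(2) in simp)
  then have "?J = carrier X" using dm_sub(2)[OF Tf[OF XT] sJ] by fastforce
  then show ?thesis using JI X.submodD(1)[OF sI] by blast
qed

text \<open>Divide \<open>Y\<close> by a largest submodule \<open>L\<close> of the kernel that lies
  in \<open>T\<close>, and let \<open>w\<close> be the induced map from the quotient
  \<open>V\<close>. The kernel of \<open>w\<close> contains no nonzero submodule from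
  \<open>T\<close>, so a brick in the image of an endomorphism of \<open>V\<close> is not killed by
  \<open>w\<close> and maps isomorphically onto \<open>X\<close>. Thus \<open>w\<close> splits. Its
  kernel is then an image of \<open>V\<close>, hence in \<open>T\<close> and zero, so that
  \<open>L\<close> is the whole kernel.\<close>

lemma kern_to_X:
  assumes Y: "Y \<in> T" and v: "v \<in> module_hom A Y X" "v ` carrier Y = carrier X"
  shows "sub Y (kern Y X v) \<in> T"
proof -
  interpret X: left_module A X by (rule Tl[OF XT])
  interpret Y: left_module A Y by (rule Tl[OF Y])
  let ?N = "kern Y X v"
  let ?P = "\<lambda>L. is_submodule A L Y \<and> L \<subseteq> ?N \<and> sub Y L \<in> T"
  have "?P {\<zero>\<^bsub>Y\<^esub>}"
  proof (intro conjI)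
    have "(\<lambda>x. \<zero>\<^bsub>Y\<^esub>) ` carrier Y = {\<zero>\<^bsub>Y\<^esub>}" using Y.M.zero_closed by blast
    then show "sub Y {\<zero>\<^bsub>Y\<^esub>} \<in> T"
      using torsion_image[OF T Y Tm[OF Y] Y.hom_const_zero[OF Tl[OF Y]]] by simp
  qed (use Y.submod_zero hom_zero[OF Tl[OF Y] Tl[OF XT] v(1)] in auto)
  moreover have "dm (sub Y L) \<le> dm Y" if "?P L" for L using dm_sub(1)[OF Tf[OF Y]] that by blast
  ultimately obtain L where L: "?P L" and max: "\<And>L'. ?P L' \<Longrightarrow> dm (sub Y L') \<le> dm (sub Y L)"
    using greatest_nat[of ?P "{\<zero>\<^bsub>Y\<^esub>}" "\<lambda>L. dm (sub Y L)" "dm Y"] by blast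
  have sL: "is_submodule A L Y" and LN: "L \<subseteq> ?N" and LT: "sub Y L \<in> T" using L by blast+
  obtain V p where V: "V \<in> mod_cat A" "p \<in> module_hom A Y V" "p ` carrier Y = carrier V" "kern Y V p = L"
    by (rule mod_quotient[OF Tf[OF Y] sL])
  have VT: "V \<in> T" by (rule Tq[OF Y V(1-3)])
  interpret V: left_module A V by (rule mod_lm[OF V(1)])
  have pk: "v x = \<zero>\<^bsub>X\<^esub>" if "x \<in> carrier Y" "p x = \<zero>\<^bsub>V\<^esub>" for x using that V(4) LN by blast
  obtain w where w: "w \<in> module_hom A V X" "\<And>x. x \<in> carrier Y \<Longrightarrow> w (p x) = v x"
    using hom_factor[OF Tl[OF Y] mod_lm[OF V(1)] Tl[OF XT] v(1) V(2,3) pk] by blast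
  let ?N' = "kern V X w"
  \<comment> \<open>The preimage of \<open>Z\<close> in \<open>Y\<close> is an extension of
    \<open>Z\<close> by \<open>L\<close>, so it lies in \<open>T\<close> and inside the kernel of
    \<open>v\<close>. Maximality of \<open>L\<close> makes it equal to \<open>L\<close>.\<close>
  have noT: "Z = {\<zero>\<^bsub>V\<^esub>}" if Z: "is_submodule A Z V" "Z \<subseteq> ?N'" "sub V Z \<in> T" for Z
  proof -
    let ?Q = "{x \<in> carrier Y. p x \<in> Z}"
    have sQ: "is_submodule A ?Q Y" by (rule submod_vimage[OF Tl[OF Y] mod_lm[OF V(1)] V(2) Z(1)])
    note DZ = V.submodD[OF Z(1)]
    have pQ: "p \<in> module_hom A (sub Y ?Q) (sub V Z)"
      by (rule V.hom_into_sub[OF Y.hom_restrict_dom[OF sQ V(2)]]) auto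
    have "p ` ?Q = Z"
    proof
      show "Z \<subseteq> p ` ?Q"
      proof
        fix z assume z: "z \<in> Z"
        then have "z \<in> carrier V" using DZ(1) by blast
        with V(3) obtain x where "x \<in> carrier Y" "z = p x" by (rule surjE)
        then show "z \<in> p ` ?Q" using z by simp
      qed
    qed auto
    moreover have k: "kern (sub Y ?Q) (sub V Z) p = L" using V(4) DZ(2) by auto
    ultimately have QT: "sub Y ?Q \<in> T"
      by (intro Te[OF mod_sub[OF Tm[OF Y] sQ] Z(3) pQ]) (simp_all add: LT)
    have QN: "?Q \<subseteq> ?N" using Z(2) w(2) by auto
    have le: "dm (sub Y ?Q) \<le> dm (sub Y L)" using max sQ QT QN by blast
    have LQ: "L \<subseteq> ?Q" using V(4) DZ(2) by auto
    have "L = ?Q"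
    proof (rule ccontr)
      assume "L \<noteq> ?Q"
      then have "dm (sub (sub Y ?Q) L) < dm (sub Y ?Q)"
        by (intro dm_sub(2)[OF Tf[OF QT] Y.submod_sub[OF sQ sL LQ]]) simp
      then show False using le by simp
    qed
    then have "\<And>x. x \<in> carrier Y \<Longrightarrow> p x \<in> Z \<Longrightarrow> p x = \<zero>\<^bsub>V\<^esub>" using V(4) by blast
    then have z: "p x \<in> Z \<Longrightarrow> p x = \<zero>\<^bsub>V\<^esub>" if "x \<in> carrier Y" for x using that by blast
    have "z = \<zero>\<^bsub>V\<^esub>" if zZ: "z \<in> Z" for z
    proof -
      have "z \<in> carrier V" using DZ(1) zZ by blast
      with V(3) obtain x where "x \<in> carrier Y" "z = p x" by (rule surjE)
      then show ?thesis using z[of x] zZ by simp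
    qed
    then show ?thesis using DZ(2) by blast
  qed
  obtain z where z: "z \<in> carrier X" "z \<noteq> \<zero>\<^bsub>X\<^esub>" using brick_nonzero[OF X] by blast
  from v(2) z(1) obtain y where y: "y \<in> carrier Y" "z = v y" by (rule surjE)
  have py: "p y \<in> carrier V" by (rule hom_closed[OF V(2) y(1)])
  have "p y \<noteq> \<zero>\<^bsub>V\<^esub>" using pk[OF y(1)] y(2) z(2) by blast
  from brick_factor[OF V(1) py this] obtain e where e: "e \<in> module_hom A V V" "sub V (e ` carrier V) \<in> bricks A" .
  let ?J = "e ` carrier V"
  let ?B = "sub V ?J"
  have sJ: "is_submodule A ?J V" by (rule submod_im[OF mod_lm[OF V(1)] mod_lm[OF V(1)] e(1)])
  have BT: "?B \<in> T" by (rule torsion_image[OF T VT V(1) e(1)])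
  obtain b where b: "b \<in> ?J" "b \<noteq> \<zero>\<^bsub>V\<^esub>" using brick_nonzero[OF e(2)] by auto
  have "\<not> ?J \<subseteq> ?N'" using noT[OF sJ _ BT] b by blast
  then obtain c where c: "c \<in> ?J" "w c \<noteq> \<zero>\<^bsub>X\<^esub>" using V.submodD(1)[OF sJ] by blast
  have wB: "w \<in> module_hom A ?B X" by (rule V.hom_restrict_dom[OF sJ w(1)])
  have cB: "c \<in> carrier ?B" using c by simp
  have wX: "w ` carrier ?B = carrier X" by (rule hom_to_X_onto[OF BT wB cB c(2)])
  have "dm ?B = dm X" by (rule last_brick[OF e(2) BT wB cB c(2)])
  then have bij: "bij_betw w (carrier ?B) (carrier X)"
    using dm_surj(2)[OF Tf[OF BT] Tf[OF XT] wB wX] wX by (simp add: bij_betw_def)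
  let ?s = "inv_into (carrier ?B) w"
  have s: "?s \<in> module_hom A X V" by (rule hom_comp[OF hom_inverse[OF wB bij Tl[OF BT]] V.hom_incl[OF sJ]])
  have ws: "w (?s u) = u" if "u \<in> carrier X" for u by (rule bij_betw_inv_into_right[OF bij that])
  \<comment> \<open>The projection of \<open>V\<close> onto the kernel of \<open>w\<close> along the
    section \<open>?s\<close>. Its image is a quotient of \<open>V\<close>, hence in
    \<open>T\<close>.\<close>
  let ?q = "\<lambda>u. u \<ominus>\<^bsub>V\<^esub> ?s (w u)"
  have q: "?q \<in> module_hom A V V" by (rule V.hom_diff[OF hom_id hom_comp[OF w(1) s]])
  have "w (?q u) = \<zero>\<^bsub>X\<^esub>" if "u \<in> carrier V" for u
    using hom_minus[OF mod_lm[OF V(1)] Tl[OF XT] w(1) that hom_closed[OF hom_comp[OF w(1) s] that]]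
      ws[OF hom_closed[OF w(1) that]] X.minus_self[OF hom_closed[OF w(1) that]] by simp
  then have "?q ` carrier V \<subseteq> ?N'" using hom_closed[OF q] by blast
  from noT[OF submod_im[OF mod_lm[OF V(1)] mod_lm[OF V(1)] q] this torsion_image[OF T VT V(1) q]]
  have q0: "?q u = \<zero>\<^bsub>V\<^esub>" if "u \<in> carrier V" for u using that by blast
  have N'0: "u = \<zero>\<^bsub>V\<^esub>" if u: "u \<in> carrier V" "w u = \<zero>\<^bsub>X\<^esub>" for u
    using q0[OF u(1)] u hom_zero[OF Tl[OF XT] mod_lm[OF V(1)] s] V.minus_zero[OF u(1)] by simp
  have "?N \<subseteq> L"
  proof
    fix x assume x: "x \<in> ?N"
    then have xY: "x \<in> carrier Y" by simp
    have "p x = \<zero>\<^bsub>V\<^esub>" by (rule N'0[OF hom_closed[OF V(2) xY]]) (use x w(2)[OF xY] in simp)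
    then show "x \<in> L" using V(4) xY by blast
  qed
  then have "L = ?N" using LN by blast
  then show ?thesis using LT by simp
qed

lemma kern_restrict:
  assumes "is_submodule A L W"
  shows "kern (sub W L) M m = L \<inter> kern W M m"
  using left_module.submodD(1)[OF _ assms] assms by (auto simp: Module.submodule_def subgroup_def)

section \<open>Covers inside the smaller torsion class\<close>

text \<open>A nonzero map \<open>x\<close> from \<open>W\<close> to \<open>X\<close> cannot vanish
  on the kernel of \<open>m\<close>, since it would then factor through \<open>M\<close> in
  \<open>T'\<close>. Restricted to the kernel it is onto with kernel in \<open>T\<close>, so
  Ext-projectivity of \<open>W\<close> yields an endomorphism \<phi> of \<open>W\<close> with image
  in the kernel of \<open>m\<close> and with \<open>x\<close> unchanged under composition with
  \<phi>. The stable image of \<phi> is a nonzero direct summand killed by \<open>m\<close>;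
  removing it gives a smaller cover.\<close>

lemma cover_reduce:
  assumes M: "M \<in> T'" and W: "rel_projective_cover A T M W m" and nW: "W \<notin> T'"
  obtains W' m' where "rel_projective_cover A T M W' m'" "dm W' < dm W"
proof -
  have WP: "rel_projective A T W" and m: "m \<in> module_hom A W M" "m ` carrier W = carrier M"
    and L: "sub W (kern W M m) \<in> T" using W unfolding rel_projective_cover_def by blast+
  have WT: "W \<in> T" by (rule rel_projective_mem[OF WP])
  have MT: "M \<in> T" by (rule T'T[OF M])
  interpret W: left_module A W by (rule Tl[OF WT])
  interpret M: left_module A M by (rule Tl[OF MT])
  let ?L = "kern W M m"
  have sL: "is_submodule A ?L W" by (rule submod_kern[OF Tl[OF WT] Tl[OF MT] m(1)])
  obtain x z where x: "x \<in> module_hom A W X" and z: "z \<in> carrier W" "x z \<noteq> \<zero>\<^bsub>X\<^esub>"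
    using nW WT unfolding T'_def by blast
  have "\<exists>l\<in>?L. x l \<noteq> \<zero>\<^bsub>X\<^esub>"
  proof (rule ccontr)
    assume "\<not> ?thesis"
    then have k: "x l = \<zero>\<^bsub>X\<^esub>" if "l \<in> carrier W" "m l = \<zero>\<^bsub>M\<^esub>" for l using that by blast
    obtain g where g: "g \<in> module_hom A M X" "\<And>u. u \<in> carrier W \<Longrightarrow> g (m u) = x u"
      using hom_factor[OF Tl[OF WT] Tl[OF MT] Tl[OF XT] x m k] by blast
    show False using T'_zero[OF M g(1) hom_closed[OF m(1) z(1)]] g(2)[OF z(1)] z(2) by simp
  qed
  then obtain l where l: "l \<in> carrier (sub W ?L)" "x l \<noteq> \<zero>\<^bsub>X\<^esub>" by auto
  have xL: "x \<in> module_hom A (sub W ?L) X" by (rule W.hom_restrict_dom[OF sL x])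
  have xo: "x ` carrier (sub W ?L) = carrier X" by (rule hom_to_X_onto[OF L xL l])
  obtain \<phi> where \<phi>: "\<phi> \<in> module_hom A W (sub W ?L)" "\<And>u. u \<in> carrier W \<Longrightarrow> x (\<phi> u) = x u"
    using rel_projectiveD[OF WP L XT xL x xo kern_to_X[OF L xL xo]] by blast
  have \<phi>W: "\<phi> \<in> module_hom A W W" by (rule hom_comp[OF \<phi>(1) W.hom_incl[OF sL]])
  have \<phi>m: "m (\<phi> u) = \<zero>\<^bsub>M\<^esub>" if "u \<in> carrier W" for u using hom_closed[OF \<phi>(1) that] by simp
  obtain k e where e': "e \<in> module_hom A W W" "\<forall>u\<in>carrier W. e u \<in> (\<phi> ^^ Suc k) ` carrier W"
    "\<forall>u\<in>(\<phi> ^^ Suc k) ` carrier W. e u = u"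
    using fitting_ex[OF Tm[OF WT] \<phi>W] by (elim exE conjE) (rule that)
  note e = e'(1) bspec[OF e'(2)] bspec[OF e'(3)]
  have pc: "(\<phi> ^^ j) u \<in> carrier W" if "u \<in> carrier W" for j u using hom_closed[OF hom_funpow[OF \<phi>W] that] .
  have xp: "x ((\<phi> ^^ j) u) = x u" if u: "u \<in> carrier W" for j u
    by (induction j) (simp_all add: \<phi>(2)[OF pc[OF u]])
  have me: "m (e u) = \<zero>\<^bsub>M\<^esub>" if u: "u \<in> carrier W" for u
  proof -
    obtain t where "t \<in> carrier W" "e u = \<phi> ((\<phi> ^^ k) t)" using e(2)[OF u] by auto
    then show ?thesis using \<phi>m[OF pc] by simp
  qed
  \<comment> \<open>\<open>e\<close> projects onto the stable image of \<phi>, where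
    \<open>m\<close> vanishes. Its complement \<open>?q\<close> is idempotent and leaves
    \<open>m\<close> unchanged.\<close>
  let ?q = "\<lambda>u. u \<ominus>\<^bsub>W\<^esub> e u"
  have q: "?q \<in> module_hom A W W" by (rule W.hom_diff[OF hom_id e(1)])
  have qc: "?q u \<in> carrier W" if "u \<in> carrier W" for u using hom_closed[OF q that] .
  have ec: "e u \<in> carrier W" if "u \<in> carrier W" for u using hom_closed[OF e(1) that] .
  have eq0: "e (?q u) = \<zero>\<^bsub>W\<^esub>" if u: "u \<in> carrier W" for u
    using hom_minus[OF Tl[OF WT] Tl[OF WT] e(1) u ec[OF u]] e(3)[OF e(2)[OF u]] W.minus_self[OF ec[OF u]] by simp
  have qq: "?q (?q u) = ?q u" if u: "u \<in> carrier W" for u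
    using eq0[OF u] W.minus_zero[OF qc[OF u]] by simp
  have mq: "m (?q u) = m u" if u: "u \<in> carrier W" for u
    using hom_minus[OF Tl[OF WT] Tl[OF MT] m(1) u ec[OF u]] me[OF u] M.minus_zero[OF hom_closed[OF m(1) u]] by simp
  let ?Q = "?q ` carrier W"
  let ?W = "sub W ?Q"
  have sQ: "is_submodule A ?Q W" by (rule submod_im[OF Tl[OF WT] Tl[OF WT] q])
  have WQ: "?W \<in> mod_cat A" by (rule mod_sub[OF Tm[OF WT] sQ])
  have qW: "?q \<in> module_hom A W ?W" by (rule W.hom_into_sub[OF q subset_refl])
  have qQ: "?q u = u" if "u \<in> ?Q" for u using that qq by blast
  have P: "rel_projective A T ?W"
  proof (rule rel_projective_retract[OF T WP WQ W.hom_incl[OF sQ] qW])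
    fix u assume "u \<in> carrier ?W"
    then have "u \<in> ?Q" by simp
    then show "?q u = u" by (rule qQ)
  qed
  have mW: "m \<in> module_hom A ?W M" by (rule W.hom_restrict_dom[OF sQ m(1)])
  have "m ` ?Q = m ` carrier W"
  proof -
    have "m ` ?Q = (\<lambda>u. m (?q u)) ` carrier W" by (rule image_image)
    also have "\<dots> = m ` carrier W" by (rule image_cong[OF refl mq])
    finally show ?thesis .
  qed
  then have ms: "m ` carrier ?W = carrier M" using m(2) by simp
  have QW: "?Q \<subseteq> carrier W" using qc by blast
  \<comment> \<open>The kernel on the summand is a quotient of the old kernel, hence still in
    \<open>T\<close>.\<close>
  have "kern ?W M m = ?q ` ?L"
  proof
    show "kern ?W M m \<subseteq> ?q ` ?L"
    proof
      fix u assume u: "u \<in> kern ?W M m"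
      then have uQ: "u \<in> ?Q" and "m u = \<zero>\<^bsub>M\<^esub>" by simp_all
      then have "u \<in> ?L" using QW by blast
      then have "?q u \<in> ?q ` ?L" by (rule imageI)
      then show "u \<in> ?q ` ?L" unfolding qQ[OF uQ] .
    qed
    show "?q ` ?L \<subseteq> kern ?W M m" using mq by auto
  qed
  moreover have "sub W (?q ` ?L) \<in> T"
    using torsion_image[OF T L Tm[OF WT] W.hom_restrict_dom[OF sL q]] by simp
  ultimately have kT: "sub ?W (kern ?W M m) \<in> T" by simp
  \<comment> \<open>The stable image is not zero: powers of \<phi> do not change \<open>x\<close>,
    and \<open>x z\<close> is nonzero. As \<open>?q\<close> kills the stable image, it is not the
    identity.\<close>
  have "?Q \<noteq> carrier W"
  proof
    assume Q: "?Q = carrier W"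
    let ?t = "(\<phi> ^^ Suc k) z"
    have t: "?t \<in> carrier W" "?t \<in> (\<phi> ^^ Suc k) ` carrier W" using pc[OF z(1)] z(1) by blast+
    have "?q ?t = ?t" using t(1) qQ Q by blast
    moreover have "?q ?t = \<zero>\<^bsub>W\<^esub>" using e(3)[OF t(2)] W.minus_self[OF t(1)] by simp
    ultimately have "?t = \<zero>\<^bsub>W\<^esub>" by simp
    then have "x ?t = \<zero>\<^bsub>X\<^esub>" using hom_zero[OF Tl[OF WT] Tl[OF XT] x] by simp
    then show False using xp[OF z(1), of "Suc k"] z(2) by simp
  qed
  then have "dm ?W < dm W" by (rule dm_sub(2)[OF Tf[OF WT] sQ])
  moreover have "rel_projective_cover A T M ?W m" unfolding rel_projective_cover_def using P mW ms kT by blast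
  ultimately show ?thesis using that by blast
qed

text \<open>A cover of least dimension admits no further reduction by \<open>cover_reduce\<close>,
  so it lies in \<open>T'\<close>.\<close>

lemma cover_in_T':
  assumes M: "M \<in> T'" and W: "rel_projective_cover A T M W0 m0"
  obtains W m where "rel_projective_cover A T M W m" "W \<in> T'"
proof -
  let ?P = "\<lambda>(W, m). rel_projective_cover A T M W m"
  obtain Wm where Wm: "?P Wm" "\<And>Wm'. ?P Wm' \<Longrightarrow> dm (fst Wm) \<le> dm (fst Wm')"
    using least_nat[of ?P "(W0, m0)" "\<lambda>Wm. dm (fst Wm)"] W by (metis case_prodI)
  obtain W m where e: "Wm = (W, m)" by force
  have P: "rel_projective_cover A T M W m" using Wm(1) e by simp
  have "W \<in> T'"
  proof (rule ccontr)
    assume "W \<notin> T'"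
    from cover_reduce[OF M P this] obtain W' m' where "rel_projective_cover A T M W' m'" "dm W' < dm W" .
    then show False using Wm(2)[of "(W', m')"] e by simp
  qed
  then show ?thesis using that P by blast
qed

text \<open>The torsion radical of \<open>U\<close> for \<open>T'\<close>. For \<open>S\<close> of
  greatest dimension and a map \<open>g\<close> from \<open>M\<close>, the image of the direct sum
  of \<open>S\<close> and \<open>M\<close> in \<open>U\<close> lies in \<open>T'\<close> and
  contains \<open>S\<close>, so it equals \<open>S\<close>.\<close>

lemma largest_T'_submodule:
  assumes U: "U \<in> T"
  obtains S where "is_submodule A S U" "sub U S \<in> T'"
    "\<And>M g. M \<in> T' \<Longrightarrow> g \<in> module_hom A M U \<Longrightarrow> g ` carrier M \<subseteq> S"
proof -
  interpret U: left_module A U by (rule Tl[OF U])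
  let ?P = "\<lambda>L. is_submodule A L U \<and> sub U L \<in> T'"
  have "?P {\<zero>\<^bsub>U\<^esub>}"
  proof (intro conjI)
    have "(\<lambda>x. \<zero>\<^bsub>U\<^esub>) ` carrier U = {\<zero>\<^bsub>U\<^esub>}" using U.M.zero_closed by blast
    then have t: "sub U {\<zero>\<^bsub>U\<^esub>} \<in> T"
      using torsion_image[OF T U Tm[OF U] U.hom_const_zero[OF Tl[OF U]]] by simp
    have "f x = \<zero>\<^bsub>X\<^esub>" if "f \<in> module_hom A (sub U {\<zero>\<^bsub>U\<^esub>}) X" "x \<in> carrier (sub U {\<zero>\<^bsub>U\<^esub>})" for f x
      using hom_zero[OF Tl[OF t] Tl[OF XT] that(1)] that(2) by simp
    then show "sub U {\<zero>\<^bsub>U\<^esub>} \<in> T'" using t unfolding T'_def by blast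
  qed (rule U.submod_zero)
  moreover have "dm (sub U L) \<le> dm U" if "?P L" for L using dm_sub(1)[OF Tf[OF U]] that by blast
  ultimately obtain S where S: "?P S" and max: "\<And>L'. ?P L' \<Longrightarrow> dm (sub U L') \<le> dm (sub U S)"
    using greatest_nat[of ?P "{\<zero>\<^bsub>U\<^esub>}" "\<lambda>L. dm (sub U L)" "dm U"] by blast
  have sS: "is_submodule A S U" and ST: "sub U S \<in> T'" using S by blast+
  show ?thesis
  proof (rule that[OF sS ST])
    fix M g assume M: "M \<in> T'" and g: "g \<in> module_hom A M U"
    note MT = T'T[OF M] and S' = T'T[OF ST]
    obtain D i1 i2 p1 p2 where D: "D \<in> mod_cat A" "biproduct A (sub U S) M D i1 i2 p1 p2"
      by (rule biproduct_exists[OF Tm[OF S'] Tm[OF MT]])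
    note B = biproductD[OF D(2)]
    have DT: "D \<in> T'" by (rule torsion_biproduct[OF T'_torsion D(2,1) ST M])
    let ?h = "\<lambda>z. p1 z \<oplus>\<^bsub>U\<^esub> g (p2 z)"
    have h: "?h \<in> module_hom A D U"
      by (rule U.hom_plus[OF hom_comp[OF B(3) U.hom_incl[OF sS]] hom_comp[OF B(4) g]])
    let ?J = "?h ` carrier D"
    have sJ: "is_submodule A ?J U" by (rule submod_im[OF mod_lm[OF D(1)] Tl[OF U] h])
    have JT: "sub U ?J \<in> T'" by (rule torsion_image[OF T'_torsion DT Tm[OF U] h])
    have SU: "S \<subseteq> carrier U" by (rule U.submodD(1)[OF sS])
    have SJ: "S \<subseteq> ?J"
    proof
      fix s assume s: "s \<in> S"
      then have sc: "s \<in> carrier (sub U S)" by simp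
      have "?h (i1 s) = s"
        using B(5)[OF sc] B(6)[OF sc] hom_zero[OF Tl[OF MT] Tl[OF U] g] s SU by auto
      moreover have "?h (i1 s) \<in> ?J" by (rule imageI[OF hom_closed[OF B(1) sc]])
      ultimately show "s \<in> ?J" by (simp only:)
    qed
    have gJ: "g ` carrier M \<subseteq> ?J"
    proof
      fix y assume "y \<in> g ` carrier M"
      then obtain x where x: "x \<in> carrier M" "y = g x" by blast
      have "?h (i2 x) = y" using B(7)[OF x(1)] B(8)[OF x(1)] x(2) hom_closed[OF g x(1)] by simp
      moreover have "?h (i2 x) \<in> ?J" by (rule imageI[OF hom_closed[OF B(2) x(1)]])
      ultimately show "y \<in> ?J" by (simp only:)
    qed
    have "S = ?J"
    proof (rule ccontr)
      assume "S \<noteq> ?J"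
      then have "dm (sub (sub U ?J) S) < dm (sub U ?J)"
        by (intro dm_sub(2)[OF Tf[OF T'T[OF JT]] U.submod_sub[OF sJ sS SJ]]) simp
      then show False using max[of ?J] sJ JT by simp
    qed
    then show "g ` carrier M \<subseteq> S" using gJ by simp
  qed
qed

end

lemma through_cong: "through A U M N h \<Longrightarrow> (\<And>x. x \<in> carrier M \<Longrightarrow> g x = h x) \<Longrightarrow> through A U M N g"
  unfolding through_def by auto

lemma left_approxI:
  assumes "V \<in> T" "f \<in> module_hom A U V"
    and "\<And>M g. M \<in> T \<Longrightarrow> g \<in> module_hom A U M \<Longrightarrow> \<exists>k\<in>module_hom A V M. \<forall>x\<in>carrier U. g x = k (f x)"
  shows "left_approx A T U V f"
  using assms unfolding left_approx_def by blast

section \<open>The progenerator of the smaller torsion class\<close>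

context torsion_step begin

lemma T'm: "M \<in> T' \<Longrightarrow> M \<in> mod_cat A" and T'l: "M \<in> T' \<Longrightarrow> left_module A M" and T'f: "M \<in> T' \<Longrightarrow> fg_module A M"
  using Tm Tl Tf T'T by blast+

text \<open>The maps from \<open>U\<close> to \<open>W\<close> are spanned by finitely many. These
  are collected into one map to a direct sum \<open>V\<close> of copies of \<open>W\<close>, and
  factoring through that map survives linear combinations.\<close>

lemma common_factor:
  assumes U: "U \<in> T" and W: "rel_projective A T W" "W \<in> T'"
  obtains V f where "rel_projective A T V" "V \<in> T'" "f \<in> module_hom A U V"
    "\<And>h. h \<in> module_hom A U W \<Longrightarrow> \<exists>k\<in>module_hom A V W. \<forall>x\<in>carrier U. h x = k (f x)"
proof -
  interpret W: left_module A W by (rule T'l[OF W(2)])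
  let ?Q = "\<lambda>V f h. \<exists>k\<in>module_hom A V W. \<forall>x\<in>carrier U. h x = k (f x)"
  let ?R = "\<lambda>V f. rel_projective A T V \<and> V \<in> T' \<and> f \<in> module_hom A U V"
  obtain B where B: "finite B" "B \<subseteq> module_hom A U W" and
    span: "\<And>h. h \<in> module_hom A U W \<Longrightarrow> lin_gen K A U W B h"
    using hom_finite_span[OF Tf[OF U] T'f[OF W(2)]] by blast
  have "C \<subseteq> module_hom A U W \<longrightarrow> (\<exists>V f. ?R V f \<and> (\<forall>h\<in>C. ?Q V f h))" if "finite C" for C
    using that
  proof (induction C rule: finite_induct)
    case empty
    show ?case using W W.hom_const_zero[OF Tl[OF U]] by blast
  next
    case (insert h C)
    show ?case
    proof
      assume hC: "insert h C \<subseteq> module_hom A U W"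
      then obtain V f where V: "?R V f" "\<forall>h\<in>C. ?Q V f h" using insert.IH by blast
      have h: "h \<in> module_hom A U W" using hC by blast
      have V': "rel_projective A T V" "V \<in> T'" "f \<in> module_hom A U V" using V(1) by blast+
      obtain D i1 i2 p1 p2 where D: "D \<in> mod_cat A" "biproduct A V W D i1 i2 p1 p2"
        by (rule biproduct_exists[OF T'm[OF V'(2)] T'm[OF W(2)]])
      note b = biproductD[OF D(2)]
      obtain d where d: "d \<in> module_hom A U D" "\<And>x. x \<in> carrier U \<Longrightarrow> p1 (d x) = f x"
        "\<And>x. x \<in> carrier U \<Longrightarrow> p2 (d x) = h x"
        using biproduct_pair[OF D(2) mod_lm[OF D(1)] T'l[OF V'(2)] T'l[OF W(2)] V'(3) h] by blast
      have "?R D d"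
        using rel_projective_biproduct[OF T D(2,1) V'(1) W(1)] torsion_biproduct[OF T'_torsion D(2,1) V'(2) W(2)] d(1)
        by blast
      moreover have "?Q D d g" if g: "g \<in> insert h C" for g
      proof (cases "g = h")
        case True
        then show ?thesis using b(4) d(3) by (intro bexI[of _ p2]) simp_all
      next
        case False
        then obtain k where k: "k \<in> module_hom A V W" "\<And>x. x \<in> carrier U \<Longrightarrow> g x = k (f x)"
          using V(2) g by blast
        then show ?thesis using hom_comp[OF b(3) k(1)] d(2) by (intro bexI[of _ "\<lambda>x. k (p1 x)"]) simp_all
      qed
      ultimately show "\<exists>V f. ?R V f \<and> (\<forall>h\<in>insert h C. ?Q V f h)" by blast
    qed
  qed
  from this[OF B(1)] B(2) obtain V f where V: "?R V f" "\<forall>h\<in>B. ?Q V f h" by blast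
  have Vl: "left_module A V" using V(1) T'l by blast
  have "?Q V f h" if "lin_gen K A U W B h" for h
    using that
  proof induction
    case zero
    show ?case by (intro bexI[OF _ W.hom_const_zero[OF Vl]]) simp
  next
    case (base b)
    then show ?case using V(2) by blast
  next
    case (add g g')
    then obtain k k' where k: "k \<in> module_hom A V W" "\<And>x. x \<in> carrier U \<Longrightarrow> g x = k (f x)"
      "k' \<in> module_hom A V W" "\<And>x. x \<in> carrier U \<Longrightarrow> g' x = k' (f x)" by blast
    then show ?case by (intro bexI[OF _ W.hom_plus[OF k(1,3)]]) simp
  next
    case (scale c g)
    then obtain k where k: "k \<in> module_hom A V W" "\<And>x. x \<in> carrier U \<Longrightarrow> g x = k (f x)" by blast
    then show ?case by (intro bexI[OF _ hom_scale[OF W.left_module_axioms scale(1) k(1)]]) simp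
  next
    case (cong g g')
    then show ?case by simp
  qed
  then have "?Q V f h" if "h \<in> module_hom A U W" for h using span[OF that] by blast
  then show ?thesis using that V(1) by blast
qed

context
  fixes U
  assumes U: "progenerator A T U"
begin

lemma UP: "rel_projective A T U"
  using U unfolding progenerator_def by blast

lemma UT: "U \<in> T"
  by (rule rel_projective_mem[OF UP])

lemma enough: "M \<in> T \<Longrightarrow> \<exists>W m. rel_projective_cover A T M W m"
  using U unfolding progenerator_def by blast

lemma add_U: "rel_projective A T W \<Longrightarrow> in_add A U W"
  using U unfolding progenerator_def by blast

lemma coverD:
  assumes "rel_projective_cover A T'' M W m"
  shows "rel_projective A T'' W" "m \<in> module_hom A W M" "m ` carrier W = carrier M" "sub W (kern W M m) \<in> T''"
  using assms unfolding rel_projective_cover_def by blast+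

text \<open>A map from \<open>U\<close> to \<open>M\<close> in \<open>T'\<close> lifts to an Ext-projective cover \<open>W\<close> of \<open>M\<close> lying in \<open>T'\<close>. Since \<open>W\<close> is
  in add(U), the map factors through the largest submodule of \<open>U\<close> in \<open>T'\<close>, which does not depend on \<open>M\<close>.\<close>

lemma left_approximation_exists:
  obtains V f where "rel_projective A T V" "left_approx A T' U V f"
proof -
  obtain S where S: "is_submodule A S U" "sub U S \<in> T'"
    "\<And>M g. M \<in> T' \<Longrightarrow> g \<in> module_hom A M U \<Longrightarrow> g ` carrier M \<subseteq> S"
    using largest_T'_submodule[OF UT] by blast
  interpret U: left_module A U by (rule Tl[OF UT])
  have ST: "sub U S \<in> T" by (rule T'T[OF S(2)])
  obtain W m where W: "rel_projective_cover A T (sub U S) W m" "W \<in> T'"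
    using enough[OF ST] cover_in_T'[OF S(2)] by blast
  note WD = coverD[OF W(1)]
  note WT = rel_projective_mem[OF WD(1)]
  obtain V f where V: "rel_projective A T V" "V \<in> T'" "f \<in> module_hom A U V"
    "\<And>h. h \<in> module_hom A U W \<Longrightarrow> \<exists>k\<in>module_hom A V W. \<forall>x\<in>carrier U. h x = k (f x)"
    using common_factor[OF UT WD(1) W(2)] by blast
  have mU: "m \<in> module_hom A W U" by (rule hom_comp[OF WD(2) U.hom_incl[OF S(1)]])
  \<comment> \<open>\<open>W\<close> covers the submodule \<open>S\<close>. As \<open>U\<close> is
    Ext-projective, an endomorphism with image in \<open>S\<close> lifts to \<open>W\<close>, and
    maps from \<open>U\<close> to \<open>W\<close> factor through \<open>f\<close>.\<close>
  have fS: "\<exists>k\<in>module_hom A V U. \<forall>x\<in>carrier U. h x = k (f x)"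
    if h: "h \<in> module_hom A U U" "h ` carrier U \<subseteq> S" for h
  proof -
    obtain l where l: "l \<in> module_hom A U W" "\<And>x. x \<in> carrier U \<Longrightarrow> m (l x) = h x"
      using rel_projectiveD[OF UP WT ST WD(2) U.hom_into_sub[OF h] WD(3,4)] by blast
    obtain k where k: "k \<in> module_hom A V W" "\<And>x. x \<in> carrier U \<Longrightarrow> l x = k (f x)" using V(4)[OF l(1)] by blast
    show ?thesis using hom_comp[OF k(1) mU] l(2) k(2) by (intro bexI[of _ "\<lambda>x. m (k x)"]) auto
  qed
  have "left_approx A T' U V f"
  proof (rule left_approxI[OF V(2,3)])
    fix M g assume M: "M \<in> T'" and g: "g \<in> module_hom A U M"
    have MT: "M \<in> T" by (rule T'T[OF M])
    obtain N n where N: "rel_projective_cover A T M N n" "N \<in> T'"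
      using enough[OF MT] cover_in_T'[OF M] by blast
    note ND = coverD[OF N(1)]
    have NT: "N \<in> T" by (rule T'T[OF N(2)])
    obtain l where l: "l \<in> module_hom A U N" "\<And>x. x \<in> carrier U \<Longrightarrow> n (l x) = g x"
      using rel_projectiveD[OF UP NT MT ND(2) g ND(3,4)] by blast
    obtain h where h: "sum_through A U N N h" "\<And>x. x \<in> carrier N \<Longrightarrow> x = h x"
      using add_U[OF ND(1)] unfolding through_def by blast
    interpret N: left_module A N by (rule Tl[OF NT])
    from h(1) have "\<exists>k\<in>module_hom A V N. \<forall>x\<in>carrier U. h (l x) = k (f x)"
    proof induction
      case zero
      show ?case by (intro bexI[OF _ N.hom_const_zero[OF T'l[OF V(2)]]]) simp
    next
      case (step h i p)
      then obtain k where k: "k \<in> module_hom A V N" "\<And>x. x \<in> carrier U \<Longrightarrow> h (l x) = k (f x)" by blast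
      have "(\<lambda>x. i (l x)) ` carrier U \<subseteq> S"
        using S(3)[OF N(2) step(2)] hom_closed[OF l(1)] by blast
      from fS[OF hom_comp[OF l(1) step(2)] this]
      obtain j where j: "j \<in> module_hom A V U" "\<And>x. x \<in> carrier U \<Longrightarrow> i (l x) = j (f x)" by blast
      show ?case using N.hom_plus[OF k(1) hom_comp[OF j(1) step(3)]] k(2) j(2)
        by (intro bexI[of _ "\<lambda>x. k x \<oplus>\<^bsub>N\<^esub> p (j x)"]) simp_all
    qed
    then obtain k where k: "k \<in> module_hom A V N" "\<And>x. x \<in> carrier U \<Longrightarrow> h (l x) = k (f x)" by blast
    have "g x = n (k (f x))" if x: "x \<in> carrier U" for x
      using l(2)[OF x] h(2)[OF hom_closed[OF l(1) x]] k(2)[OF x] by simp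
    then show "\<exists>k\<in>module_hom A V M. \<forall>x\<in>carrier U. g x = k (f x)"
      using hom_comp[OF k(1) ND(2)] by (intro bexI[of _ "\<lambda>x. n (k x)"]) simp_all
  qed
  then show ?thesis using that V(1) by blast
qed

text \<open>To lift \<open>h\<close> along \<open>g\<close>, lift its composite with
  \<open>c\<close> to a map \<open>l\<close> on \<open>V\<close>. On the image of \<open>f\<close>,
  \<open>l\<close> takes values in the kernel of \<open>g\<close>, which lies in \<open>T'\<close>;
  by the approximation property it agrees there with a map \<open>k\<close> from \<open>V\<close>
  into this kernel. The difference of \<open>l\<close> and \<open>k\<close> vanishes on the image of
  \<open>f\<close> and descends to \<open>C\<close>.\<close>

lemma rel_projective_cokernel:
  assumes V: "rel_projective A T' V" and f: "left_approx A T' U V f"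
    and C: "C \<in> mod_cat A" "c \<in> module_hom A V C" "c ` carrier V = carrier C" "kern V C c = f ` carrier U"
  shows "rel_projective A T' C"
  unfolding rel_projective_def
proof (intro conjI ballI impI)
  note VT = rel_projective_mem[OF V]
  have fh: "f \<in> module_hom A U V" using f by (simp add: left_approx_def)
  show CT: "C \<in> T'" by (rule torsionD(2)[OF T'_torsion VT C(1-3)])
  fix E D g h assume E: "E \<in> T'" and D: "D \<in> T'" and g: "g \<in> module_hom A E D" and h: "h \<in> module_hom A C D"
    and gs: "g ` carrier E = carrier D \<and> sub E (kern E D g) \<in> T'"
  interpret E: left_module A E by (rule T'l[OF E])
  interpret D: left_module A D by (rule T'l[OF D])
  interpret C: left_module A C by (rule T'l[OF CT])
  have cf: "c (f x) = \<zero>\<^bsub>C\<^esub>" if "x \<in> carrier U" for x using C(4) that by blast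
  obtain l where l: "l \<in> module_hom A V E" "\<And>x. x \<in> carrier V \<Longrightarrow> g (l x) = h (c x)"
    using rel_projectiveD[OF V E D g hom_comp[OF C(2) h]] gs by blast
  have "(\<lambda>x. l (f x)) ` carrier U \<subseteq> kern E D g"
    using hom_closed[OF hom_comp[OF fh l(1)]] l(2)[OF hom_closed[OF fh]] cf hom_zero[OF T'l[OF CT] T'l[OF D] h] by auto
  then have lf: "(\<lambda>x. l (f x)) \<in> module_hom A U (sub E (kern E D g))"
    by (rule E.hom_into_sub[OF hom_comp[OF fh l(1)]])
  obtain k where k: "k \<in> module_hom A V (sub E (kern E D g))" "\<And>x. x \<in> carrier U \<Longrightarrow> l (f x) = k (f x)"
    using left_approxD[OF f conjunct2[OF gs] lf] by blast
  have kE: "k \<in> module_hom A V E" by (rule hom_comp[OF k(1) E.hom_incl[OF submod_kern[OF T'l[OF E] T'l[OF D] g]]])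
  let ?d = "\<lambda>x. l x \<ominus>\<^bsub>E\<^esub> k x"
  have d: "?d \<in> module_hom A V E" by (rule E.hom_diff[OF l(1) kE])
  have gd: "g (?d x) = h (c x)" if x: "x \<in> carrier V" for x
  proof -
    have "g (k x) = \<zero>\<^bsub>D\<^esub>" using hom_closed[OF k(1) x] by simp
    then show ?thesis
      using hom_minus[OF T'l[OF E] T'l[OF D] g hom_closed[OF l(1) x] hom_closed[OF kE x]] l(2)[OF x]
        D.minus_zero[OF hom_closed[OF hom_comp[OF C(2) h] x]] by simp
  qed
  have dk: "?d x = \<zero>\<^bsub>E\<^esub>" if x: "x \<in> carrier V" "c x = \<zero>\<^bsub>C\<^esub>" for x
  proof -
    have "x \<in> f ` carrier U" using C(4) x by blast
    then obtain y where y: "y \<in> carrier U" "x = f y" by (rule imageE)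
    then show ?thesis using k(2)[OF y(1)] E.minus_self[OF hom_closed[OF l(1) x(1)]] by simp
  qed
  obtain s where s: "s \<in> module_hom A C E" "\<And>x. x \<in> carrier V \<Longrightarrow> s (c x) = ?d x"
    using hom_factor[OF T'l[OF VT] T'l[OF CT] T'l[OF E] d C(2,3) dk] by blast
  have "g (s y) = h y" if y: "y \<in> carrier C" for y
  proof -
    from C(3) y obtain x where "x \<in> carrier V" "y = c x" by (rule surjE)
    then show ?thesis using s(2) gd by simp
  qed
  then show "\<exists>l\<in>module_hom A C E. \<forall>x\<in>carrier C. g (l x) = h x" using s(1) by blast
qed

text \<open>The new module is the sum of the approximation \<open>V\<close> of \<open>U\<close> and
  its cokernel \<open>C\<close>, as in mutation of tilting modules. \<open>V\<close> accounts for
  the Ext-projective modules of \<open>T\<close> that already lie in \<open>T'\<close>;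
  \<open>C\<close> serves to bring the kernels of covers from \<open>T\<close> down to
  \<open>T'\<close>.\<close>

lemma progenerator_step: "\<exists>U'. progenerator A T' U'"
proof -
  obtain V f where VP: "rel_projective A T V" and f: "left_approx A T' U V f"
    by (rule left_approximation_exists)
  have VT': "V \<in> T'" and fh: "f \<in> module_hom A U V" using f by (auto simp: left_approx_def)
  have VP': "rel_projective A T' V" by (rule rel_projective_mono[OF VP _ VT']) (use T'T in blast)
  have VT: "V \<in> T" by (rule T'T[OF VT'])
  obtain C c where C: "C \<in> mod_cat A" "c \<in> module_hom A V C" "c ` carrier V = carrier C" "kern V C c = f ` carrier U"
    by (rule mod_quotient[OF Tf[OF VT] submod_im[OF Tl[OF UT] Tl[OF VT] fh]])
  have CP: "rel_projective A T' C" by (rule rel_projective_cokernel[OF VP' f C])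
  have CT': "C \<in> T'" by (rule rel_projective_mem[OF CP])
  have CT: "C \<in> T" by (rule T'T[OF CT'])
  obtain D i1 i2 p1 p2 where D: "D \<in> mod_cat A" "biproduct A V C D i1 i2 p1 p2"
    by (rule biproduct_exists[OF T'm[OF VT'] C(1)])
  note b = biproductD[OF D(2)]
  have DP: "rel_projective A T' D" by (rule rel_projective_biproduct[OF T'_torsion D(2,1) VP' CP])
  note Dl = mod_lm[OF D(1)] and Vl = T'l[OF VT'] and Cl = T'l[OF CT']
  have DV: "in_add A D V" by (rule in_add_retract[OF in_add_self[OF Dl] Dl Vl b(1,3)]) (rule b(5))
  have DC: "in_add A D C" by (rule in_add_retract[OF in_add_self[OF Dl] Dl Cl b(2,4)]) (rule b(8))
  \<comment> \<open>The identity of \<open>W\<close> is a sum of maps through \<open>U\<close>. As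
    \<open>W\<close> is in \<open>T'\<close>, the second half of each summand factors through
    \<open>f\<close>, which exchanges \<open>U\<close> for \<open>V\<close>.\<close>
  have DW: "in_add A D W" if W: "rel_projective A T W" "W \<in> T'" for W
  proof -
    note Wl = T'l[OF W(2)]
    have "in_add A V W"
    proof (rule through_map[OF Wl Wl add_U[OF W(1)] hom_id hom_id Wl Wl])
      fix i p assume i: "i \<in> module_hom A W U" and p: "p \<in> module_hom A U W"
      obtain k where k: "k \<in> module_hom A V W" "\<And>x. x \<in> carrier U \<Longrightarrow> p x = k (f x)"
        using left_approxD[OF f W(2) p] by blast
      show "through A V W W (\<lambda>x. p (i x))"
        by (rule through_cong[OF through_single[OF Wl hom_comp[OF i fh] k(1)]]) (simp add: k(2) hom_closed[OF i])
    qed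
    then show ?thesis by (rule in_add_trans[OF _ DV Wl Vl])
  qed
  \<comment> \<open>A cover of \<open>M\<close> by a module of \<open>T'\<close> has its kernel in
    \<open>T\<close>, but possibly not in \<open>T'\<close>. Copies of \<open>C\<close> are added to
    it until every map from \<open>C\<close> to \<open>M\<close> lifts to the cover; the kernel then
    has no nonzero map to \<open>X\<close>.\<close>
  have cov: "\<exists>W m. rel_projective_cover A T' M W m \<and> in_add A D W" if M: "M \<in> T'" for M
  proof -
    have MT: "M \<in> T" by (rule T'T[OF M])
    interpret M: left_module A M by (rule T'l[OF M])
    interpret C: left_module A C by (rule T'l[OF CT'])
    let ?Q = "\<lambda>W m h. \<exists>l\<in>module_hom A C W. \<forall>x\<in>carrier C. m (l x) = h x"
    let ?R = "\<lambda>W m. rel_projective A T' W \<and> in_add A D W \<and> m \<in> module_hom A W M \<and>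
      m ` carrier W = carrier M \<and> sub W (kern W M m) \<in> T"
    obtain B where B: "finite B" "B \<subseteq> module_hom A C M" and
      span: "\<And>h. h \<in> module_hom A C M \<Longrightarrow> lin_gen K A C M B h"
      using hom_finite_span[OF T'f[OF CT'] T'f[OF M]] by blast
    have "H \<subseteq> module_hom A C M \<longrightarrow> (\<exists>W m. ?R W m \<and> (\<forall>h\<in>H. ?Q W m h))" if "finite H" for H
      using that
    proof (induction H rule: finite_induct)
      case empty
      obtain W m where W: "rel_projective_cover A T M W m" "W \<in> T'"
        using enough[OF MT] cover_in_T'[OF M] by blast
      note WD = coverD[OF W(1)]
      have "rel_projective A T' W" by (rule rel_projective_mono[OF WD(1) _ W(2)]) (use T'T in blast)
      then show ?case using WD(2-4) DW[OF WD(1) W(2)] by blast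
    next
      case (insert h H)
      show ?case
      proof
        assume hH: "insert h H \<subseteq> module_hom A C M"
        then obtain W m where R: "?R W m" and Q: "\<forall>h\<in>H. ?Q W m h" using insert.IH by blast
        have h: "h \<in> module_hom A C M" using hH by blast
        have WP: "rel_projective A T' W" and DaW: "in_add A D W" and m: "m \<in> module_hom A W M" "m ` carrier W = carrier M"
          and k: "sub W (kern W M m) \<in> T" using R by blast+
        have WT': "W \<in> T'" by (rule rel_projective_mem[OF WP])
        note Wl = T'l[OF WT']
        interpret W: left_module A W by (rule Wl)
        obtain E j1 j2 q1 q2 where E: "E \<in> mod_cat A" "biproduct A W C E j1 j2 q1 q2"
          by (rule biproduct_exists[OF T'm[OF WT'] C(1)])
        note e = biproductD[OF E(2)]
        note El = mod_lm[OF E(1)]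
        interpret E: left_module A E by (rule El)
        let ?m = "\<lambda>z. m (q1 z) \<oplus>\<^bsub>M\<^esub> h (q2 z)"
        have m': "?m \<in> module_hom A E M" by (rule M.hom_plus[OF hom_comp[OF e(3) m(1)] hom_comp[OF e(4) h]])
        have mj1: "?m (j1 w) = m w" if w: "w \<in> carrier W" for w
          using e(5)[OF w] e(6)[OF w] hom_zero[OF Cl T'l[OF M] h] hom_closed[OF m(1) w] by simp
        have mj2: "?m (j2 x) = h x" if x: "x \<in> carrier C" for x
          using e(7)[OF x] e(8)[OF x] hom_zero[OF Wl T'l[OF M] m(1)] hom_closed[OF h x] by simp
        have s: "?m ` carrier E = carrier M"
        proof
          show "?m ` carrier E \<subseteq> carrier M" using hom_closed[OF m'] by blast
          show "carrier M \<subseteq> ?m ` carrier E"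
          proof
            fix y assume "y \<in> carrier M"
            with m(2) obtain w where w: "w \<in> carrier W" "y = m w" by (rule surjE)
            have "?m (j1 w) \<in> ?m ` carrier E" by (rule imageI[OF hom_closed[OF e(1) w(1)]])
            then show "y \<in> ?m ` carrier E" unfolding mj1[OF w(1)] w(2) .
          qed
        qed
        let ?K = "kern E M ?m"
        have sK: "is_submodule A ?K E" by (rule submod_kern[OF El T'l[OF M] m'])
        \<comment> \<open>The kernel stays in \<open>T\<close> when \<open>C\<close> is added: it
          projects onto \<open>C\<close>, because \<open>m\<close> is onto, and the kernel of this
          projection is a copy of the old kernel.\<close>
        have q2K: "q2 \<in> module_hom A (sub E ?K) C" by (rule E.hom_restrict_dom[OF sK e(4)])
        have q2s: "q2 ` carrier (sub E ?K) = carrier C"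
        proof
          show "q2 ` carrier (sub E ?K) \<subseteq> carrier C" using hom_closed[OF q2K] by blast
          show "carrier C \<subseteq> q2 ` carrier (sub E ?K)"
          proof
            fix x assume x: "x \<in> carrier C"
            have "\<ominus>\<^bsub>M\<^esub> h x \<in> carrier M" using hom_closed[OF h x] by simp
            with m(2) obtain w where w: "w \<in> carrier W" "\<ominus>\<^bsub>M\<^esub> h x = m w" by (rule surjE)
            let ?z = "j1 w \<oplus>\<^bsub>E\<^esub> j2 x"
            note jc = hom_closed[OF e(1) w(1)] hom_closed[OF e(2) x]
            have "?m ?z = ?m (j1 w) \<oplus>\<^bsub>M\<^esub> ?m (j2 x)" by (rule module_hom_add[OF m' jc])
            then have "?m ?z = \<zero>\<^bsub>M\<^esub>"
              unfolding mj1[OF w(1)] mj2[OF x] w(2)[symmetric] using M.M.l_neg[OF hom_closed[OF h x]] by simp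
            moreover have "q2 ?z = x" using module_hom_add[OF e(4) jc] e(6)[OF w(1)] e(8)[OF x] x by simp
            ultimately show "x \<in> q2 ` carrier (sub E ?K)" using jc by (intro image_eqI[of _ _ ?z]) simp_all
          qed
        qed
        have "kern (sub E ?K) C q2 = j1 ` kern W M m"
        proof
          show "j1 ` kern W M m \<subseteq> kern (sub E ?K) C q2"
            using mj1 e(6) hom_closed[OF e(1)] by auto
          show "kern (sub E ?K) C q2 \<subseteq> j1 ` kern W M m"
          proof
            fix z assume "z \<in> kern (sub E ?K) C q2"
            then have "z \<in> ?K \<inter> kern E C q2" unfolding kern_restrict[OF sK] .
            then have z: "z \<in> carrier E" "?m z = \<zero>\<^bsub>M\<^esub>" "q2 z = \<zero>\<^bsub>C\<^esub>" by blast+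
            have w: "q1 z \<in> carrier W" by (rule hom_closed[OF e(3) z(1)])
            have zj: "z = j1 (q1 z)"
              using e(9)[OF z(1)] z(3) hom_zero[OF Cl El e(2)] hom_closed[OF e(1) w] by simp
            have "m (q1 z) = \<zero>\<^bsub>M\<^esub>" using z(2,3) hom_zero[OF Cl T'l[OF M] h] hom_closed[OF m(1) w] by simp
            then have "q1 z \<in> kern W M m" using w by simp
            then show "z \<in> j1 ` kern W M m" by (intro image_eqI[of z j1 "q1 z"] zj)
          qed
        qed
        moreover have "j1 \<in> module_hom A (sub W (kern W M m)) E"
          by (rule W.hom_restrict_dom[OF submod_kern[OF Wl T'l[OF M] m(1)] e(1)])
        ultimately have "sub (sub E ?K) (kern (sub E ?K) C q2) \<in> T"
          using torsion_image[OF T k E(1)] by simp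
        then have KT: "sub E ?K \<in> T" by (rule Te[OF mod_sub[OF E(1) sK] CT q2K q2s])
        have EP: "rel_projective A T' E" by (rule rel_projective_biproduct[OF T'_torsion E(2,1) WP CP])
        have DE: "in_add A D E" by (rule in_add_biproduct[OF E(2) El Wl Cl DaW DC])
        have "?Q E ?m g" if g: "g \<in> insert h H" for g
        proof (cases "g = h")
          case True
          then show ?thesis using e(2) mj2 by blast
        next
          case False
          then obtain l where l: "l \<in> module_hom A C W" "\<And>x. x \<in> carrier C \<Longrightarrow> m (l x) = g x" using Q g by blast
          then show ?thesis using hom_comp[OF l(1) e(1)] mj1[OF hom_closed[OF l(1)]]
            by (intro bexI[of _ "\<lambda>x. j1 (l x)"]) simp_all
        qed
        then show "\<exists>W m. ?R W m \<and> (\<forall>h\<in>insert h H. ?Q W m h)"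
          using EP DE m' s KT by blast
      qed
    qed
    from this[OF B(1)] B(2) obtain W m where R: "?R W m" and QB: "\<forall>h\<in>B. ?Q W m h" by blast
    have WP: "rel_projective A T' W" and m: "m \<in> module_hom A W M" "m ` carrier W = carrier M"
      and k: "sub W (kern W M m) \<in> T" using R by blast+
    have WT': "W \<in> T'" by (rule rel_projective_mem[OF WP])
    note Wl = T'l[OF WT']
    interpret W: left_module A W by (rule Wl)
    have "?Q W m h" if "lin_gen K A C M B h" for h
      using that
    proof induction
      case zero
      show ?case by (intro bexI[OF _ W.hom_const_zero[OF Cl]]) (simp add: hom_zero[OF Wl T'l[OF M] m(1)])
    next
      case (base b)
      then show ?case using QB by blast
    next
      case (add g g')
      then obtain l l' where l: "l \<in> module_hom A C W" "\<And>x. x \<in> carrier C \<Longrightarrow> m (l x) = g x"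
        "l' \<in> module_hom A C W" "\<And>x. x \<in> carrier C \<Longrightarrow> m (l' x) = g' x" by blast
      have e: "m (l x \<oplus>\<^bsub>W\<^esub> l' x) = g x \<oplus>\<^bsub>M\<^esub> g' x" if x: "x \<in> carrier C" for x
        using module_hom_add[OF m(1) hom_closed[OF l(1) x] hom_closed[OF l(3) x]] l(2)[OF x] l(4)[OF x] by simp
      show ?case by (rule bexI[OF _ W.hom_plus[OF l(1,3)]]) (rule ballI, rule e)
    next
      case (scale a g)
      then obtain l where l: "l \<in> module_hom A C W" "\<And>x. x \<in> carrier C \<Longrightarrow> m (l x) = g x" by blast
      have e: "m (sc a \<odot>\<^bsub>W\<^esub> l x) = sc a \<odot>\<^bsub>M\<^esub> g x" if x: "x \<in> carrier C" for x
        using module_hom_smult[OF m(1) sc_closed[OF scale(1)] hom_closed[OF l(1) x]] l(2)[OF x] by simp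
      show ?case by (rule bexI[OF _ hom_scale[OF Wl scale(1) l(1)]]) (rule ballI, rule e)
    next
      case (cong g g')
      then show ?case by simp
    qed
    then have Q: "?Q W m h" if "h \<in> module_hom A C M" for h using span[OF that] by blast
    let ?L = "kern W M m"
    have sL: "is_submodule A ?L W" by (rule submod_kern[OF Wl T'l[OF M] m(1)])
    \<comment> \<open>A nonzero map \<open>x\<close> from the kernel to \<open>X\<close> would be
      nonzero on the image of some map from \<open>U\<close>. That map, taken into \<open>W\<close>,
      extends along \<open>f\<close> to \<open>h0\<close> on \<open>V\<close>. The composite of
      \<open>m\<close> and \<open>h0\<close> vanishes on the image of \<open>f\<close>, so it
      descends to \<open>C\<close> and lifts back to \<open>W\<close>. Subtracting the lift moves
      \<open>h0\<close> into the kernel without changing it on the image of \<open>f\<close>, and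
      composition with \<open>x\<close> gives a nonzero map from \<open>V\<close> in
      \<open>T'\<close> to \<open>X\<close>.\<close>
    have LT': "sub W ?L \<in> T'"
    proof (rule ccontr)
      assume "sub W ?L \<notin> T'"
      then obtain x y where x: "x \<in> module_hom A (sub W ?L) X" and y: "y \<in> carrier (sub W ?L)" "x y \<noteq> \<zero>\<^bsub>X\<^esub>"
        using k unfolding T'_def by blast
      obtain W1 w where W1: "rel_projective_cover A T (sub W ?L) W1 w" using enough[OF k] by blast
      note WD = coverD[OF W1]
      note W1l = Tl[OF rel_projective_mem[OF WD(1)]]
      from WD(3) y(1) obtain y' where y': "y' \<in> carrier W1" "y = w y'" by (rule surjE)
      obtain p u where p: "p \<in> module_hom A U W1" and u: "u \<in> carrier U" and xu: "x (w (p u)) \<noteq> \<zero>\<^bsub>X\<^esub>"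
        using in_add_nonzero[OF add_U[OF WD(1)] W1l Tl[OF XT] hom_comp[OF WD(2) x] y'(1)] y(2) y'(2) by blast
      have wp: "(\<lambda>t. w (p t)) \<in> module_hom A U (sub W ?L)" by (rule hom_comp[OF p WD(2)])
      obtain h0 where h0: "h0 \<in> module_hom A V W" "\<And>t. t \<in> carrier U \<Longrightarrow> w (p t) = h0 (f t)"
        using left_approxD[OF f WT' hom_comp[OF wp W.hom_incl[OF sL]]] by blast
      have mh: "m (h0 v) = \<zero>\<^bsub>M\<^esub>" if v: "v \<in> carrier V" "c v = \<zero>\<^bsub>C\<^esub>" for v
      proof -
        have "v \<in> f ` carrier U" using C(4) v by blast
        then obtain t where t: "t \<in> carrier U" "v = f t" by (rule imageE)
        then show ?thesis using h0(2)[OF t(1)] hom_closed[OF wp t(1)] by simp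
      qed
      obtain r where r: "r \<in> module_hom A C M" "\<And>v. v \<in> carrier V \<Longrightarrow> r (c v) = m (h0 v)"
        using hom_factor[OF Vl Cl T'l[OF M] hom_comp[OF h0(1) m(1)] C(2,3) mh] by blast
      obtain l where l: "l \<in> module_hom A C W" "\<And>t. t \<in> carrier C \<Longrightarrow> m (l t) = r t" using Q[OF r(1)] by blast
      let ?d = "\<lambda>v. h0 v \<ominus>\<^bsub>W\<^esub> l (c v)"
      have d: "?d \<in> module_hom A V W" by (rule W.hom_diff[OF h0(1) hom_comp[OF C(2) l(1)]])
      have "m (?d v) = \<zero>\<^bsub>M\<^esub>" if v: "v \<in> carrier V" for v
        using hom_minus[OF Wl T'l[OF M] m(1) hom_closed[OF h0(1) v] hom_closed[OF hom_comp[OF C(2) l(1)] v]]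
          l(2)[OF hom_closed[OF C(2) v]] r(2)[OF v] M.minus_self[OF hom_closed[OF hom_comp[OF h0(1) m(1)] v]] by simp
      then have "?d ` carrier V \<subseteq> ?L" using hom_closed[OF d] by blast
      then have dL: "?d \<in> module_hom A V (sub W ?L)" by (rule W.hom_into_sub[OF d])
      have fu: "f u \<in> carrier V" by (rule hom_closed[OF fh u])
      have "c (f u) = \<zero>\<^bsub>C\<^esub>" using C(4) u by blast
      then have "?d (f u) = w (p u)"
        using h0(2)[OF u] hom_zero[OF Cl Wl l(1)] W.minus_zero[OF hom_closed[OF h0(1) fu]] by simp
      then show False using T'_zero[OF VT' hom_comp[OF dL x] fu] xu by simp
    qed
    show ?thesis unfolding rel_projective_cover_def using R WP m LT' by blast
  qed
  have addD: "in_add A D Z" if Z: "rel_projective A T' Z" for Z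
  proof -
    have ZT: "Z \<in> T'" by (rule rel_projective_mem[OF Z])
    obtain W m where W: "rel_projective_cover A T' Z W m" "in_add A D W" using cov[OF ZT] by blast
    note WD = coverD[OF W(1)]
    have WT: "W \<in> T'" by (rule rel_projective_mem[OF WD(1)])
    obtain l where l: "l \<in> module_hom A Z W" "\<And>x. x \<in> carrier Z \<Longrightarrow> m (l x) = x"
      using rel_projectiveD[OF Z WT ZT WD(2) hom_id WD(3,4)] by blast
    show ?thesis by (rule in_add_retract[OF W(2) T'l[OF WT] T'l[OF ZT] l(1) WD(2)]) (rule l(2))
  qed
  obtain Y a where Y: "rel_projective A T Y" and a: "left_approx A T F Y a"
    using U unfolding progenerator_def by blast
  have YT: "Y \<in> T" by (rule rel_projective_mem[OF Y])
  obtain h where h: "sum_through A U Y Y h" "\<And>x. x \<in> carrier Y \<Longrightarrow> x = h x"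
    using add_U[OF Y] unfolding through_def by blast
  \<comment> \<open>\<open>Y\<close> approximates \<open>F\<close> in \<open>T\<close>, so what
    remains is to approximate \<open>Y\<close> in \<open>T'\<close>. The target grows along the sum
    that expresses the identity of \<open>Y\<close> through \<open>U\<close>, each summand
    contributing one copy of \<open>V\<close>.\<close>
  let ?S = "\<lambda>h V' f'. rel_projective A T V' \<and> V' \<in> T' \<and> f' \<in> module_hom A Y V' \<and>
    (\<forall>M\<in>T'. \<forall>g\<in>module_hom A Y M. \<exists>k\<in>module_hom A V' M. \<forall>x\<in>carrier Y. g (h x) = k (f' x))"
  from h(1) have "\<exists>V' f'. ?S h V' f'"
  proof induction
    case zero
    interpret V: left_module A V by (rule Vl)
    have "\<exists>k\<in>module_hom A V M. \<forall>x\<in>carrier Y. g \<zero>\<^bsub>Y\<^esub> = k \<zero>\<^bsub>V\<^esub>"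
      if M: "M \<in> T'" and g: "g \<in> module_hom A Y M" for M g
      by (intro bexI[OF _ left_module.hom_const_zero[OF T'l[OF M] Vl]]) (simp add: hom_zero[OF Tl[OF YT] T'l[OF M] g])
    then show ?case using VP VT' V.hom_const_zero[OF Tl[OF YT]] by blast
  next
    case (step h i p)
    obtain V' f' where S: "?S h V' f'" using step(4) by blast
    have V': "rel_projective A T V'" "V' \<in> T'" "f' \<in> module_hom A Y V'" using S by blast+
    obtain E j1 j2 q1 q2 where E: "E \<in> mod_cat A" "biproduct A V' V E j1 j2 q1 q2"
      by (rule biproduct_exists[OF T'm[OF V'(2)] T'm[OF VT']])
    note e = biproductD[OF E(2)]
    obtain d where d: "d \<in> module_hom A Y E" "\<And>x. x \<in> carrier Y \<Longrightarrow> q1 (d x) = f' x"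
      "\<And>x. x \<in> carrier Y \<Longrightarrow> q2 (d x) = f (i x)"
      using biproduct_pair[OF E(2) mod_lm[OF E(1)] T'l[OF V'(2)] Vl V'(3) hom_comp[OF step(2) fh]] by blast
    have "\<exists>k\<in>module_hom A E M. \<forall>x\<in>carrier Y. g (h x \<oplus>\<^bsub>Y\<^esub> p (i x)) = k (d x)"
      if M: "M \<in> T'" and g: "g \<in> module_hom A Y M" for M g
    proof -
      interpret M: left_module A M by (rule T'l[OF M])
      obtain k where k: "k \<in> module_hom A V' M" "\<And>x. x \<in> carrier Y \<Longrightarrow> g (h x) = k (f' x)" using S M g by blast
      obtain k' where k': "k' \<in> module_hom A V M" "\<And>x. x \<in> carrier U \<Longrightarrow> g (p x) = k' (f x)"
        using left_approxD[OF f M hom_comp[OF step(3) g]] by blast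
      have "g (h x \<oplus>\<^bsub>Y\<^esub> p (i x)) = k (q1 (d x)) \<oplus>\<^bsub>M\<^esub> k' (q2 (d x))" if x: "x \<in> carrier Y" for x
        using module_hom_add[OF g hom_closed[OF sum_through_hom[OF step(1) Tl[OF YT] Tl[OF YT]] x]
            hom_closed[OF hom_comp[OF step(2,3)] x]] k(2)[OF x] k'(2)[OF hom_closed[OF step(2) x]] d(2,3)[OF x] by simp
      then show ?thesis using M.hom_plus[OF hom_comp[OF e(3) k(1)] hom_comp[OF e(4) k'(1)]]
        by (intro bexI[of _ "\<lambda>z. k (q1 z) \<oplus>\<^bsub>M\<^esub> k' (q2 z)"]) simp_all
    qed
    then have "?S (\<lambda>x. h x \<oplus>\<^bsub>Y\<^esub> p (i x)) E d"
      using rel_projective_biproduct[OF T E(2,1) V'(1) VP] torsion_biproduct[OF T'_torsion E(2,1) V'(2) VT'] d(1) by blast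
    then show ?case by blast
  qed
  then obtain V' f' where S: "?S h V' f'" by blast
  have V': "rel_projective A T V'" "V' \<in> T'" "f' \<in> module_hom A Y V'" using S by blast+
  have ah: "a \<in> module_hom A F Y" using a by (simp add: left_approx_def)
  have "left_approx A T' F V' (\<lambda>x. f' (a x))"
  proof (rule left_approxI[OF V'(2) hom_comp[OF ah V'(3)]])
    fix M g assume M: "M \<in> T'" and g: "g \<in> module_hom A F M"
    obtain k where k: "k \<in> module_hom A Y M" "\<And>x. x \<in> carrier F \<Longrightarrow> g x = k (a x)"
      using left_approxD[OF a T'T[OF M] g] by blast
    obtain k' where k': "k' \<in> module_hom A V' M" "\<And>x. x \<in> carrier Y \<Longrightarrow> k (h x) = k' (f' x)" using S M k(1) by blast
    have "g x = k' (f' (a x))" if x: "x \<in> carrier F" for x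
      using k(2)[OF x] k'(2)[OF hom_closed[OF ah x]] h(2)[OF hom_closed[OF ah x], symmetric] by simp
    then show "\<exists>k\<in>module_hom A V' M. \<forall>x\<in>carrier F. g x = k (f' (a x))" using k'(1) by blast
  qed
  moreover have "rel_projective A T' V'" by (rule rel_projective_mono[OF V'(1) _ V'(2)]) (use T'T in blast)
  ultimately have "progenerator A T' D" unfolding progenerator_def using DP cov addD by blast
  then show ?thesis by blast
qed

end

end

lemma carrier_sub: "carrier (sub M L) = L"
  by simp

lemma (in vectorspace) dim_subspace_le:
  assumes W: "subspace K W V" and fd: "fin_dim"
  shows "vectorspace.dim K (vs W) \<le> dim"
proof -
  interpret w: vectorspace K "vs W" by (rule subspace_is_vs[OF W])
  have sm: "LinearCombinations.submodule K W V" using W by (rule is_module)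
  have WV: "W \<subseteq> carrier V" using sm by (simp add: LinearCombinations.submodule_def)
  obtain b where b: "finite b" "w.basis b" using w.finite_basis_exists[OF fin_dim_subspace[OF W fd]] by blast
  have bW: "b \<subseteq> W" "w.lin_indpt b" using b(2) by (auto simp: w.basis_def)
  have "lin_indpt b" using bW(2) span_li_not_depend(2)[OF bW(1) sm] by simp
  then have "card b \<le> dim" using li_le_dim(2)[OF fd subset_trans[OF bW(1) WV]] by blast
  then show ?thesis using w.dim_basis[OF b] by simp
qed

lemma linear_map_inj_dim_le:
  assumes lin: "linear_map K V W f" and fV: "vectorspace.fin_dim K V" and fW: "vectorspace.fin_dim K W"
    and inj: "inj_on f (carrier V)"
  shows "vectorspace.dim K V \<le> vectorspace.dim K W"
proof -
  interpret V: vectorspace K V using lin by (simp add: linear_map_def)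
  interpret W: vectorspace K W using lin by (simp add: linear_map_def)
  interpret T: linear_map K V W f by fact
  show ?thesis
    using T.rank_nullity[OF fV] T.inj_imp_dim_ker0[OF inj] W.dim_subspace_le[OF T.imT_is_subspace fW] by simp
qed

subsection \<open>The linear form of a torsion class\<close>

text \<open>For a presentation \<open>Q \<rightarrow> P \<rightarrow> Y \<rightarrow> 0\<close> of an Ext-projective approximation \<open>A \<rightarrow> Y\<close> in \<open>T\<close>,
  \<open>dim Hom(P, M) - dim Hom(Q, M)\<close> is \<open>dim Hom(Y, M) \<ge> dim Hom(A, M)\<close> for \<open>M\<close> in \<open>T\<close>, and at most \<open>0\<close> for \<open>M\<close>
  torsion-free. Doubling it and subtracting \<open>dim M = dim Hom(A, M)\<close> makes both signs strict.\<close>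

definition theta_form :: "'k ring \<Rightarrow> ('k, 'a) module \<Rightarrow> ('a, 'p) module \<Rightarrow> ('a, 'q) module \<Rightarrow> ('a, 'm) module \<Rightarrow> real" where
  "theta_form K A P Q M =
    2 * real (hdim K A P M) - 2 * real (hdim K A Q M) - real (hdim K A (free_module A) M)"

section \<open>All modules as a torsion class, and projective presentations\<close>

context fd_algebra begin

text \<open>The start of the descent. Covers are direct sums of copies of \<open>F\<close>, one more
  for each generator of \<open>M\<close>, and the free module approximates itself.\<close>

lemma progenerator_mod: "progenerator A (mod_cat A) F"
proof -
  note Fl = mod_lm[OF free_module(1)]
  have FP: "rel_projective A (mod_cat A) F" using projective_free projective_iff by blast
  have cov: "\<exists>W m. rel_projective_cover A (mod_cat A) M W m \<and> in_add A F W" if M: "M \<in> mod_cat A" for M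
  proof -
    interpret M: left_module A M by (rule mod_lm[OF M])
    obtain B where B: "finite B" "B \<subseteq> carrier M"
      "\<And>L. is_submodule A L M \<Longrightarrow> B \<subseteq> L \<Longrightarrow> L = carrier M"
      using mod_fg[OF M] unfolding fg_module_def finitely_generated_def by blast
    let ?R = "\<lambda>W m. rel_projective A (mod_cat A) W \<and> in_add A F W \<and> m \<in> module_hom A W M"
    have "C \<subseteq> carrier M \<longrightarrow> (\<exists>W m. ?R W m \<and> C \<subseteq> m ` carrier W)" if "finite C" for C
      using that
    proof (induction C rule: finite_induct)
      case empty
      show ?case using FP in_add_self[OF Fl] M.hom_const_zero[OF Fl] by blast
    next
      case (insert c C)
      show ?case
      proof
        assume cC: "insert c C \<subseteq> carrier M"
        then obtain W m where R: "?R W m" and Cm: "C \<subseteq> m ` carrier W" using insert.IH by blast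
        have WP: "rel_projective A (mod_cat A) W" and Wa: "in_add A F W" and m: "m \<in> module_hom A W M"
          using R by blast+
        have Wm: "W \<in> mod_cat A" by (rule rel_projective_mem[OF WP])
        have cM: "c \<in> carrier M" using cC by blast
        obtain h where h: "h \<in> module_hom A F M" "h gen = c" using gen_hom[OF mod_lm[OF M] cM] by blast
        obtain D i1 i2 p1 p2 where D: "D \<in> mod_cat A" "biproduct A W F D i1 i2 p1 p2"
          by (rule biproduct_exists[OF Wm free_module(1)])
        note b = biproductD[OF D(2)]
        let ?m = "\<lambda>z. m (p1 z) \<oplus>\<^bsub>M\<^esub> h (p2 z)"
        have m': "?m \<in> module_hom A D M" by (rule M.hom_plus[OF hom_comp[OF b(3) m] hom_comp[OF b(4) h(1)]])
        have e1: "?m (i1 w) = m w" if w: "w \<in> carrier W" for w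
          using b(5)[OF w] b(6)[OF w] hom_zero[OF Fl mod_lm[OF M] h(1)] hom_closed[OF m w] by simp
        have e2: "?m (i2 gen) = c"
          using b(7)[OF gen_closed] b(8)[OF gen_closed] hom_zero[OF mod_lm[OF Wm] mod_lm[OF M] m] h(2) cM by simp
        have "y \<in> ?m ` carrier D" if y: "y \<in> insert c C" for y
        proof (cases "y = c")
          case True
          have "?m (i2 gen) \<in> ?m ` carrier D" by (rule imageI[OF hom_closed[OF b(2) gen_closed]])
          then show ?thesis unfolding e2 True .
        next
          case False
          then have "y \<in> m ` carrier W" using y Cm by blast
          then obtain w where w: "w \<in> carrier W" "y = m w" by (rule imageE)
          have "?m (i1 w) \<in> ?m ` carrier D" by (rule imageI[OF hom_closed[OF b(1) w(1)]])
          then show ?thesis unfolding e1[OF w(1)] w(2) .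
        qed
        then have "insert c C \<subseteq> ?m ` carrier D" by blast
        moreover have "?R D ?m"
          using rel_projective_biproduct[OF mod_torsion D(2,1) WP FP] m'
            in_add_biproduct[OF D(2) mod_lm[OF D(1)] mod_lm[OF Wm] Fl Wa in_add_self[OF Fl]] by blast
        ultimately show "\<exists>W m. ?R W m \<and> insert c C \<subseteq> m ` carrier W" by blast
      qed
    qed
    from this[OF B(1)] B(2) obtain W m where R: "?R W m" and Bm: "B \<subseteq> m ` carrier W" by blast
    have WP: "rel_projective A (mod_cat A) W" and m: "m \<in> module_hom A W M" using R by blast+
    have Wm: "W \<in> mod_cat A" by (rule rel_projective_mem[OF WP])
    have "m ` carrier W = carrier M" by (rule B(3)[OF submod_im[OF mod_lm[OF Wm] mod_lm[OF M] m] Bm])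
    moreover have "sub W (kern W M m) \<in> mod_cat A"
      by (rule mod_sub[OF Wm submod_kern[OF mod_lm[OF Wm] mod_lm[OF M] m]])
    ultimately show ?thesis unfolding rel_projective_cover_def using R by blast
  qed
  have "in_add A F Z" if Z: "rel_projective A (mod_cat A) Z" for Z
  proof -
    have Zm: "Z \<in> mod_cat A" by (rule rel_projective_mem[OF Z])
    obtain W m where W: "rel_projective_cover A (mod_cat A) Z W m" "in_add A F W" using cov[OF Zm] by blast
    have WP: "rel_projective A (mod_cat A) W" "m \<in> module_hom A W Z" "m ` carrier W = carrier Z"
      "sub W (kern W Z m) \<in> mod_cat A" using W(1) unfolding rel_projective_cover_def by blast+
    have Wm: "W \<in> mod_cat A" by (rule rel_projective_mem[OF WP(1)])
    obtain l where l: "l \<in> module_hom A Z W" "\<And>x. x \<in> carrier Z \<Longrightarrow> m (l x) = x"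
      using rel_projectiveD[OF Z Wm Zm WP(2) hom_id WP(3,4)] by blast
    show ?thesis by (rule in_add_retract[OF W(2) mod_lm[OF Wm] mod_lm[OF Zm] l(1) WP(2)]) (rule l(2))
  qed
  moreover have "left_approx A (mod_cat A) F F (\<lambda>x. x)"
    by (rule left_approxI[OF free_module(1) hom_id]) blast
  ultimately show ?thesis unfolding progenerator_def using FP cov by blast
qed

lemma enough_projectives:
  assumes M: "M \<in> mod_cat A"
  obtains Q q where "projective A Q" "q \<in> module_hom A Q M" "q ` carrier Q = carrier M"
proof -
  obtain W m where "rel_projective_cover A (mod_cat A) M W m"
    using progenerator_mod M unfolding progenerator_def by blast
  then show ?thesis using that unfolding rel_projective_cover_def projective_iff by blast
qed

lemma kernel_subspace:
  assumes M: "left_module A M" and N: "left_module A N" and f: "f \<in> module_hom A M' M"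
  shows "subspace K {l \<in> carrier (hom_space A M N). \<forall>x\<in>carrier M'. l (f x) = \<zero>\<^bsub>N\<^esub>} (hom_space A M N)"
proof -
  interpret H: vectorspace K "hom_space A M N" by (rule hom_space_vectorspace[OF M N])
  interpret N: left_module A N by (rule N)
  let ?S = "{l \<in> carrier (hom_space A M N). \<forall>x\<in>carrier M'. l (f x) = \<zero>\<^bsub>N\<^esub>}"
  have fc: "f x \<in> carrier M" if "x \<in> carrier M'" for x by (rule hom_closed[OF f that])
  show ?thesis
  proof (rule H.subspaceI)
    have "\<forall>x\<in>carrier M'. \<zero>\<^bsub>hom_space A M N\<^esub> (f x) = \<zero>\<^bsub>N\<^esub>" by (simp add: hom_space_def fc)
    then show "\<zero>\<^bsub>hom_space A M N\<^esub> \<in> ?S" using H.M.zero_closed by blast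
    fix v assume v: "v \<in> ?S"
    show "v \<oplus>\<^bsub>hom_space A M N\<^esub> w \<in> ?S" if w: "w \<in> ?S" for w
    proof -
      have "\<forall>x\<in>carrier M'. (v \<oplus>\<^bsub>hom_space A M N\<^esub> w) (f x) = \<zero>\<^bsub>N\<^esub>" using v w by (simp add: hom_space_def fc)
      then show ?thesis using v w H.M.a_closed by blast
    qed
    show "c \<odot>\<^bsub>hom_space A M N\<^esub> v \<in> ?S" if c: "c \<in> carrier K" for c
    proof -
      have "\<forall>x\<in>carrier M'. (c \<odot>\<^bsub>hom_space A M N\<^esub> v) (f x) = \<zero>\<^bsub>N\<^esub>" using v c by (simp add: hom_space_def fc)
      then show ?thesis using v c H.smult_closed by blast
    qed
  qed blast
qed

lemma precompose_linear:
  assumes M: "left_module A M" and M': "left_module A M'" and N: "left_module A N" and f: "f \<in> module_hom A M' M"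
  shows "linear_map K (hom_space A M N) (hom_space A M' N) (\<lambda>h. \<lambda>x\<in>carrier M'. h (f x))"
proof (rule linear_mapI[OF hom_space_vectorspace[OF M N] hom_space_vectorspace[OF M' N]])
  fix h assume "h \<in> carrier (hom_space A M N)"
  then have "h \<in> module_hom A M N" by (simp add: hom_space_def)
  from hom_cong[OF hom_comp[OF f this] M', of "\<lambda>x\<in>carrier M'. h (f x)"]
  show "(\<lambda>x\<in>carrier M'. h (f x)) \<in> carrier (hom_space A M' N)" by (simp add: hom_space_def)
qed (auto simp: hom_space_def hom_closed[OF f])

lemma hdim_le_of_injective:
  assumes M: "fg_module A M" and M': "fg_module A M'" and N: "fg_module A N" and f: "f \<in> module_hom A M' M"
    and inj: "\<And>h x. h \<in> module_hom A M N \<Longrightarrow> (\<And>z. z \<in> carrier M' \<Longrightarrow> h (f z) = \<zero>\<^bsub>N\<^esub>) \<Longrightarrow> x \<in> carrier M \<Longrightarrow> h x = \<zero>\<^bsub>N\<^esub>"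
  shows "hdim K A M N \<le> hdim K A M' N"
proof -
  note Ml = fg_moduleD[OF M] and Nl = fg_moduleD[OF N]
  interpret N: left_module A N by (rule Nl)
  have "inj_on (\<lambda>h. \<lambda>x\<in>carrier M'. h (f x)) (carrier (hom_space A M N))"
  proof (rule inj_onI)
    fix g h assume g: "g \<in> carrier (hom_space A M N)" and h: "h \<in> carrier (hom_space A M N)"
      and eq: "(\<lambda>x\<in>carrier M'. g (f x)) = (\<lambda>x\<in>carrier M'. h (f x))"
    have gh: "g \<in> module_hom A M N" "h \<in> module_hom A M N" "g \<in> extensional (carrier M)" "h \<in> extensional (carrier M)"
      using g h by (auto simp: hom_space_def)
    have z: "g (f z) \<ominus>\<^bsub>N\<^esub> h (f z) = \<zero>\<^bsub>N\<^esub>" if z: "z \<in> carrier M'" for z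
      using fun_cong[OF eq, of z] z N.minus_self[OF hom_closed[OF gh(2) hom_closed[OF f z]]] by simp
    have "g x \<ominus>\<^bsub>N\<^esub> h x = \<zero>\<^bsub>N\<^esub>" if x: "x \<in> carrier M" for x
      by (rule inj[OF N.hom_diff[OF gh(1,2)] z x])
    then have "g x = h x" if x: "x \<in> carrier M" for x
      using N.minus_eq_zeroD[OF hom_closed[OF gh(1) x] hom_closed[OF gh(2) x]] x by blast
    then show "g = h" by (rule extensionalityI[OF gh(3,4)])
  qed
  from linear_map_inj_dim_le[OF precompose_linear[OF Ml fg_moduleD[OF M'] Nl f] hom_space_fin_dim[OF M N]
      hom_space_fin_dim[OF M' N] this]
  show ?thesis unfolding hdim_def .
qed

text \<open>The presentation \<open>Q \<rightarrow> P\<close> of \<open>Y\<close> has least possible \<open>Q\<close>. Hence Ext-projectivity of \<open>Y\<close> in \<open>T\<close>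
  makes every map from \<open>Q\<close> to a module in \<open>T\<close> extend to \<open>P\<close>.\<close>

lemma presentation_extend:
  assumes T: "torsion_class A T" and Y: "rel_projective A T Y"
    and P: "projective A P" and q: "q \<in> module_hom A P Y" "q ` carrier P = carrier Y"
    and Q: "projective A Q" and p: "p \<in> module_hom A Q (sub P (kern P Y q))" "p ` carrier Q = kern P Y q"
    and min: "\<And>Q' p'. projective A Q' \<Longrightarrow> p' \<in> module_hom A Q' (sub P (kern P Y q)) \<Longrightarrow>
      p' ` carrier Q' = kern P Y q \<Longrightarrow> dm Q \<le> dm Q'"
    and M: "M \<in> T" and g: "g \<in> module_hom A Q M"
  shows "\<exists>h\<in>module_hom A P M. \<forall>z\<in>carrier Q. g z = h (p z)"
proof -
  have YT: "Y \<in> T" by (rule rel_projective_mem[OF Y])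
  have Ym: "Y \<in> mod_cat A" and Mm: "M \<in> mod_cat A" using torsionD(1)[OF T] YT M by blast+
  note Pm = projective_mod[OF P] and Qm = projective_mod[OF Q]
  note Pl = mod_lm[OF Pm] and Ql = mod_lm[OF Qm] and Yl = mod_lm[OF Ym] and Ml = mod_lm[OF Mm]
  interpret P: left_module A P by (rule Pl)
  interpret Q: left_module A Q by (rule Ql)
  interpret M: left_module A M by (rule Ml)
  interpret Y: left_module A Y by (rule Yl)
  let ?\<Omega> = "kern P Y q"
  have s\<Omega>: "is_submodule A ?\<Omega> P" by (rule submod_kern[OF Pl Yl q(1)])
  have pP: "p \<in> module_hom A Q P" by (rule hom_comp[OF p(1) P.hom_incl[OF s\<Omega>]])
  have qp: "q (p z) = \<zero>\<^bsub>Y\<^esub>" if "z \<in> carrier Q" for z using hom_closed[OF p(1) that] by simp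
  obtain D i1 i2 p1 p2 where D: "D \<in> mod_cat A" "biproduct A P M D i1 i2 p1 p2"
    by (rule biproduct_exists[OF Pm Mm])
  note b = biproductD[OF D(2)]
  note Dl = mod_lm[OF D(1)]
  interpret D: left_module A D by (rule Dl)
  \<comment> \<open>The cokernel \<open>E\<close> of this map is the pushout of \<open>p\<close> and
    \<open>g\<close>. It is an extension of \<open>Y\<close> by a quotient of \<open>M\<close>,
    hence lies in \<open>T\<close>; the map \<open>?u\<close> from \<open>M\<close> to it need not
    be injective.\<close>
  let ?r = "\<lambda>z. i1 (p z) \<ominus>\<^bsub>D\<^esub> i2 (g z)"
  have r: "?r \<in> module_hom A Q D" by (rule D.hom_diff[OF hom_comp[OF pP b(1)] hom_comp[OF g b(2)]])
  have pz: "p z \<in> carrier P" and gz: "g z \<in> carrier M" if "z \<in> carrier Q" for z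
    using hom_closed[OF pP that] hom_closed[OF g that] by blast+
  have i1c: "i1 x \<in> carrier D" if "x \<in> carrier P" for x by (rule hom_closed[OF b(1) that])
  have i2c: "i2 x \<in> carrier D" if "x \<in> carrier M" for x by (rule hom_closed[OF b(2) that])
  have p1r: "p1 (?r z) = p z" if z: "z \<in> carrier Q" for z
    using hom_minus[OF Dl Pl b(3) i1c[OF pz[OF z]] i2c[OF gz[OF z]]] b(5)[OF pz[OF z]] b(7)[OF gz[OF z]]
      P.minus_zero[OF pz[OF z]] by simp
  have p2r: "p2 (?r z) = \<ominus>\<^bsub>M\<^esub> g z" if z: "z \<in> carrier Q" for z
    using hom_minus[OF Dl Ml b(4) i1c[OF pz[OF z]] i2c[OF gz[OF z]]] b(6)[OF pz[OF z]] b(8)[OF gz[OF z]] gz[OF z]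
    by (simp add: a_minus_def)
  obtain E e where E: "E \<in> mod_cat A" "e \<in> module_hom A D E" "e ` carrier D = carrier E" "kern D E e = ?r ` carrier Q"
    by (rule mod_quotient[OF mod_fg[OF D(1)] submod_im[OF Ql Dl r]])
  note El = mod_lm[OF E(1)]
  interpret E: left_module A E by (rule El)
  have qp1: "(\<lambda>d. q (p1 d)) \<in> module_hom A D Y" by (rule hom_comp[OF b(3) q(1)])
  have kk: "q (p1 d) = \<zero>\<^bsub>Y\<^esub>" if d: "d \<in> carrier D" "e d = \<zero>\<^bsub>E\<^esub>" for d
  proof -
    have "d \<in> ?r ` carrier Q" using E(4) d by blast
    then obtain z where z: "z \<in> carrier Q" "d = ?r z" by (rule imageE)
    show ?thesis unfolding z(2) p1r[OF z(1)] by (rule qp[OF z(1)])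
  qed
  obtain t where t: "t \<in> module_hom A E Y" "\<And>d. d \<in> carrier D \<Longrightarrow> t (e d) = q (p1 d)"
    using hom_factor[OF Dl El Yl qp1 E(2,3) kk] by blast
  have ts: "t ` carrier E = carrier Y"
  proof
    show "t ` carrier E \<subseteq> carrier Y" using hom_closed[OF t(1)] by blast
    show "carrier Y \<subseteq> t ` carrier E"
    proof
      fix y assume "y \<in> carrier Y"
      with q(2) obtain x where x: "x \<in> carrier P" "y = q x" by (rule surjE)
      have "t (e (i1 x)) = y" using t(2)[OF i1c[OF x(1)]] b(5)[OF x(1)] x(2) by simp
      moreover have "t (e (i1 x)) \<in> t ` carrier E" by (rule imageI[OF hom_closed[OF E(2) i1c[OF x(1)]]])
      ultimately show "y \<in> t ` carrier E" by simp
    qed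
  qed
  let ?u = "\<lambda>y. e (i2 y)"
  have u: "?u \<in> module_hom A M E" by (rule hom_comp[OF b(2) E(2)])
  have ku: "kern E Y t = ?u ` carrier M"
  proof
    show "?u ` carrier M \<subseteq> kern E Y t"
    proof
      fix v assume "v \<in> ?u ` carrier M"
      then obtain y where y: "y \<in> carrier M" "v = ?u y" by (rule imageE)
      have "t v = q (p1 (i2 y))" unfolding y(2) by (rule t(2)[OF i2c[OF y(1)]])
      also have "\<dots> = \<zero>\<^bsub>Y\<^esub>" unfolding b(7)[OF y(1)] by (rule hom_zero[OF Pl Yl q(1)])
      finally show "v \<in> kern E Y t" using hom_closed[OF u y(1)] y(2) by simp
    qed
    show "kern E Y t \<subseteq> ?u ` carrier M"
    proof
      fix v assume "v \<in> kern E Y t"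
      then have v: "v \<in> carrier E" "t v = \<zero>\<^bsub>Y\<^esub>" by blast+
      from E(3) v(1) obtain d where d: "d \<in> carrier D" "v = e d" by (rule surjE)
      have "q (p1 d) = \<zero>\<^bsub>Y\<^esub>" using t(2)[OF d(1)] v(2) d(2) by simp
      then have "p1 d \<in> ?\<Omega>" using hom_closed[OF b(3) d(1)] by blast
      with p(2) obtain z where z: "z \<in> carrier Q" "p1 d = p z" by (rule surjE)
      let ?y = "g z \<oplus>\<^bsub>M\<^esub> p2 d"
      have p2d: "p2 d \<in> carrier M" by (rule hom_closed[OF b(4) d(1)])
      have y: "?y \<in> carrier M" using gz[OF z(1)] p2d by simp
      have "d = i1 (p z) \<oplus>\<^bsub>D\<^esub> i2 (p2 d)" using b(9)[OF d(1)] z(2) by simp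
      also have "\<dots> = ?r z \<oplus>\<^bsub>D\<^esub> i2 ?y"
        using module_hom_add[OF b(2) gz[OF z(1)] p2d] i1c[OF pz[OF z(1)]] i2c[OF gz[OF z(1)]] i2c[OF p2d]
        by (simp add: a_minus_def D.M.a_assoc D.M.r_neg1 D.M.r_neg2)
      finally have "e d = e (?r z) \<oplus>\<^bsub>E\<^esub> ?u ?y"
        using module_hom_add[OF E(2) hom_closed[OF r z(1)] i2c[OF y]] by simp
      moreover have "e (?r z) = \<zero>\<^bsub>E\<^esub>" using E(4) z(1) by blast
      ultimately have "v = ?u ?y" using d(2) hom_closed[OF u y] by simp
      then show "v \<in> ?u ` carrier M" using y by (rule image_eqI)
    qed
  qed
  have kT: "sub E (kern E Y t) \<in> T" unfolding ku by (rule torsion_image[OF T M E(1) u])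
  have ET: "E \<in> T" by (rule torsionD(3)[OF T E(1) YT t(1) ts kT])
  \<comment> \<open>Ext-projectivity of \<open>Y\<close>, applied to the identity, splits the
    pushout extension.\<close>
  obtain s where s: "s \<in> module_hom A Y E" "\<And>y. y \<in> carrier Y \<Longrightarrow> t (s y) = y"
    using rel_projectiveD[OF Y ET YT t(1) hom_id ts kT] by blast
  \<comment> \<open>Correcting the map from \<open>P\<close> by the section moves it into the image
    of \<open>M\<close>, from where projectivity of \<open>P\<close> lifts it to a map
    \<open>h\<close> into \<open>M\<close>.\<close>
  let ?d = "\<lambda>x. e (i1 x) \<ominus>\<^bsub>E\<^esub> s (q x)"
  have d: "?d \<in> module_hom A P E" by (rule E.hom_diff[OF hom_comp[OF b(1) E(2)] hom_comp[OF q(1) s(1)]])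
  have "t (?d x) = \<zero>\<^bsub>Y\<^esub>" if x: "x \<in> carrier P" for x
    using hom_minus[OF El Yl t(1) hom_closed[OF E(2) i1c[OF x]] hom_closed[OF hom_comp[OF q(1) s(1)] x]]
      t(2)[OF i1c[OF x]] b(5)[OF x] s(2)[OF hom_closed[OF q(1) x]] Y.minus_self[OF hom_closed[OF q(1) x]] by simp
  then have "?d ` carrier P \<subseteq> kern E Y t" using hom_closed[OF d] by blast
  then have dk: "?d \<in> module_hom A P (sub E (kern E Y t))" by (rule E.hom_into_sub[OF d])
  have uk: "?u \<in> module_hom A M (sub E (kern E Y t))" by (rule E.hom_into_sub[OF u]) (simp only: ku subset_refl)
  have us: "?u ` carrier M = carrier (sub E (kern E Y t))" using ku by simp
  obtain h where h: "h \<in> module_hom A P M" "\<And>x. x \<in> carrier P \<Longrightarrow> ?u (h x) = ?d x"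
    using projective_lift[OF P mod_fg[OF Mm] mod_fg[OF torsionD(1)[OF T kT]] uk us dk] by blast
  \<comment> \<open>The two candidates agree after composition with \<open>?u\<close>; this
    difference lies in the kernel of \<open>?u\<close>. Minimality of \<open>Q\<close> is what makes
    it vanish.\<close>
  let ?g = "\<lambda>z. g z \<ominus>\<^bsub>M\<^esub> h (p z)"
  have g1: "?g \<in> module_hom A Q M" by (rule M.hom_diff[OF g hom_comp[OF pP h(1)]])
  have ug: "?u (?g z) = \<zero>\<^bsub>E\<^esub>" if z: "z \<in> carrier Q" for z
  proof -
    have "e (?r z) = \<zero>\<^bsub>E\<^esub>" using E(4) z by blast
    then have "e (i1 (p z)) \<ominus>\<^bsub>E\<^esub> ?u (g z) = \<zero>\<^bsub>E\<^esub>"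
      using hom_minus[OF Dl El E(2) i1c[OF pz[OF z]] i2c[OF gz[OF z]]] by simp
    then have 1: "e (i1 (p z)) = ?u (g z)"
      by (rule E.minus_eq_zeroD[OF hom_closed[OF E(2) i1c[OF pz[OF z]]] hom_closed[OF u gz[OF z]]])
    have "?u (h (p z)) = e (i1 (p z))"
      using h(2)[OF pz[OF z]] qp[OF z] hom_zero[OF Yl El s(1)] E.minus_zero[OF hom_closed[OF E(2) i1c[OF pz[OF z]]]] by simp
    then show ?thesis
      using hom_minus[OF Ml El u gz[OF z] hom_closed[OF hom_comp[OF pP h(1)] z]] 1
        E.minus_self[OF hom_closed[OF u gz[OF z]]] by simp
  qed
  \<comment> \<open>The kernel of the difference still maps onto \<open>?\<Omega>\<close>: a value
    killed by \<open>?u\<close> comes from some \<open>w\<close> in the kernel of \<open>p\<close>,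
    and adding \<open>w\<close> to \<open>z\<close> cancels the difference without changing
    \<open>p z\<close>.\<close>
  let ?L = "kern Q M ?g"
  have sL: "is_submodule A ?L Q" by (rule submod_kern[OF Ql Ml g1])
  have onL: "p ` ?L = ?\<Omega>"
  proof
    show "p ` ?L \<subseteq> ?\<Omega>" using hom_closed[OF p(1)] by auto
    show "?\<Omega> \<subseteq> p ` ?L"
    proof
      fix x assume "x \<in> ?\<Omega>"
      with p(2) obtain z where z: "z \<in> carrier Q" "x = p z" by (rule surjE)
      have gc: "?g z \<in> carrier M" by (rule hom_closed[OF g1 z(1)])
      have "i2 (?g z) \<in> ?r ` carrier Q" using E(4) ug[OF z(1)] i2c[OF gc] by blast
      then obtain w where w: "w \<in> carrier Q" "i2 (?g z) = ?r w" by (rule imageE)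
      have pw: "p w = \<zero>\<^bsub>P\<^esub>" using p1r[OF w(1)] w(2) b(7)[OF gc] by simp
      have "?g z = \<ominus>\<^bsub>M\<^esub> g w" using p2r[OF w(1)] w(2) b(8)[OF gc] by simp
      moreover have "?g w = g w" using pw hom_zero[OF Pl Ml h(1)] M.minus_zero[OF gz[OF w(1)]] by simp
      ultimately have "?g (z \<oplus>\<^bsub>Q\<^esub> w) = \<zero>\<^bsub>M\<^esub>"
        using module_hom_add[OF g1 z(1) w(1)] M.M.l_neg[OF gz[OF w(1)]] by simp
      then have "z \<oplus>\<^bsub>Q\<^esub> w \<in> ?L" using z(1) w(1) by blast
      moreover have "x = p (z \<oplus>\<^bsub>Q\<^esub> w)" using module_hom_add[OF pP z(1) w(1)] pw z pz[OF z(1)] by simp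
      ultimately show "x \<in> p ` ?L" by (intro image_eqI[of x p "z \<oplus>\<^bsub>Q\<^esub> w"])
    qed
  qed
  \<comment> \<open>Lifting \<open>p\<close> along its restriction to \<open>?L\<close> gives an
    endomorphism of \<open>Q\<close> with image in \<open>?L\<close> that preserves
    \<open>p\<close>. Its stable image is a projective summand still mapping onto
    \<open>?\<Omega>\<close>, so by minimality it is \<open>Q\<close>, and therefore
    \<open>?L\<close> is \<open>Q\<close>.\<close>
  have pL: "p \<in> module_hom A (sub Q ?L) (sub P ?\<Omega>)" by (rule Q.hom_restrict_dom[OF sL p(1)])
  obtain \<phi> where \<phi>: "\<phi> \<in> module_hom A Q (sub Q ?L)" "\<And>z. z \<in> carrier Q \<Longrightarrow> p (\<phi> z) = p z"
    using projective_lift[OF Q mod_fg[OF mod_sub[OF Qm sL]] mod_fg[OF mod_sub[OF Pm s\<Omega>]] pL _ p(1)] onL by auto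
  have \<phi>Q: "\<phi> \<in> module_hom A Q Q" by (rule hom_comp[OF \<phi>(1) Q.hom_incl[OF sL]])
  obtain k f where f': "f \<in> module_hom A Q Q" "\<forall>x\<in>carrier Q. f x \<in> (\<phi> ^^ Suc k) ` carrier Q"
    "\<forall>x\<in>(\<phi> ^^ Suc k) ` carrier Q. f x = x"
    using fitting_ex[OF Qm \<phi>Q] by (elim exE conjE) (rule that)
  note f = f'(1) bspec[OF f'(2)] bspec[OF f'(3)]
  let ?I = "(\<phi> ^^ Suc k) ` carrier Q"
  have \<phi>c: "(\<phi> ^^ j) z \<in> carrier Q" if "z \<in> carrier Q" for j z by (rule hom_closed[OF hom_funpow[OF \<phi>Q] that])
  have p\<phi>: "p ((\<phi> ^^ j) z) = p z" if z: "z \<in> carrier Q" for j z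
    by (induction j) (simp_all add: \<phi>(2)[OF \<phi>c[OF z]])
  have sI: "is_submodule A ?I Q" by (rule submod_im[OF Ql Ql hom_funpow[OF \<phi>Q]])
  have Im: "sub Q ?I \<in> mod_cat A" by (rule mod_sub[OF Qm sI])
  have fI: "f \<in> module_hom A Q (sub Q ?I)" by (rule Q.hom_into_sub[OF f(1)]) (use f(2) in blast)
  have "rel_projective A (mod_cat A) (sub Q ?I)"
  proof (rule rel_projective_retract[OF mod_torsion _ Im Q.hom_incl[OF sI] fI])
    show "rel_projective A (mod_cat A) Q" using Q projective_iff by blast
    fix x assume "x \<in> carrier (sub Q ?I)"
    then have "x \<in> ?I" unfolding carrier_sub .
    then show "f x = x" by (rule f(3))
  qed
  then have IP: "projective A (sub Q ?I)" using projective_iff by blast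
  have "p ` carrier (sub Q ?I) = ?\<Omega>"
  proof -
    have "p ` carrier (sub Q ?I) = (\<lambda>z. p ((\<phi> ^^ Suc k) z)) ` carrier Q"
      by (simp only: carrier_sub image_image)
    also have "\<dots> = p ` carrier Q" by (rule image_cong[OF refl p\<phi>])
    finally show ?thesis using p(2) by simp
  qed
  from min[OF IP Q.hom_restrict_dom[OF sI p(1)] this] have "dm Q \<le> dm (sub Q ?I)" .
  then have IQ: "?I = carrier Q" using dm_sub(2)[OF mod_fg[OF Qm] sI] by fastforce
  have "g z = h (p z)" if z: "z \<in> carrier Q" for z
  proof -
    have "z \<in> ?I" using IQ z by blast
    then obtain x where x: "x \<in> carrier Q" "z = (\<phi> ^^ Suc k) x" by (rule imageE)
    have "z = \<phi> ((\<phi> ^^ k) x)" using x(2) by simp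
    then have "z \<in> carrier (sub Q ?L)" using hom_closed[OF \<phi>(1) \<phi>c[OF x(1)]] by simp
    then have "?g z = \<zero>\<^bsub>M\<^esub>" by simp
    then show ?thesis by (rule M.minus_eq_zeroD[OF gz[OF z] hom_closed[OF hom_comp[OF pP h(1)] z]])
  qed
  then show ?thesis using h(1) by blast
qed

text \<open>On \<open>T\<close> the two surjections, from maps on \<open>P\<close> to maps on
  \<open>Q\<close> and from maps on \<open>Y\<close> to maps on \<open>F\<close>, bound the form
  below by \<open>dm\<close>. For a torsion-free module the absence of maps from \<open>Y\<close>
  bounds it above by the negative of \<open>dm\<close>.\<close>

lemma theta_form_exists:
  assumes T: "torsion_class A T" and U: "progenerator A T U"
  obtains P Q where "projective A P" "projective A Q"
    "\<And>M. M \<in> T \<Longrightarrow> carrier M \<noteq> {\<zero>\<^bsub>M\<^esub>} \<Longrightarrow> theta_form K A P Q M > 0"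
    "\<And>N. N \<in> mod_cat A \<Longrightarrow> carrier N \<noteq> {\<zero>\<^bsub>N\<^esub>} \<Longrightarrow>
      (\<And>Y f y. Y \<in> T \<Longrightarrow> f \<in> module_hom A Y N \<Longrightarrow> y \<in> carrier Y \<Longrightarrow> f y = \<zero>\<^bsub>N\<^esub>) \<Longrightarrow> theta_form K A P Q N < 0"
proof -
  obtain Y a where Y: "rel_projective A T Y" and a: "left_approx A T F Y a"
    using U unfolding progenerator_def by blast
  have YT: "Y \<in> T" by (rule rel_projective_mem[OF Y])
  have Ym: "Y \<in> mod_cat A" by (rule torsionD(1)[OF T YT])
  have ah: "a \<in> module_hom A F Y" using a by (simp add: left_approx_def)
  obtain P q where P: "projective A P" and q: "q \<in> module_hom A P Y" "q ` carrier P = carrier Y"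
    by (rule enough_projectives[OF Ym])
  note Pm = projective_mod[OF P]
  note Pl = mod_lm[OF Pm] and Yl = mod_lm[OF Ym]
  interpret P: left_module A P by (rule Pl)
  let ?\<Omega> = "kern P Y q"
  have s\<Omega>: "is_submodule A ?\<Omega> P" by (rule submod_kern[OF Pl Yl q(1)])
  have \<Omega>: "sub P ?\<Omega> \<in> mod_cat A" by (rule mod_sub[OF Pm s\<Omega>])
  let ?C = "\<lambda>(Q, p). projective A Q \<and> p \<in> module_hom A Q (sub P ?\<Omega>) \<and> p ` carrier Q = ?\<Omega>"
  obtain Q0 p0 where "projective A Q0" "p0 \<in> module_hom A Q0 (sub P ?\<Omega>)" "p0 ` carrier Q0 = carrier (sub P ?\<Omega>)"
    by (rule enough_projectives[OF \<Omega>])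
  then have "?C (Q0, p0)" by simp
  \<comment> \<open>\<open>Q\<close> is chosen of least dimension among projective modules mapping
    onto \<open>?\<Omega>\<close>, as \<open>presentation_extend\<close> asks.\<close>
  then obtain Qp where Qp: "?C Qp" "\<And>Qp'. ?C Qp' \<Longrightarrow> dm (fst Qp) \<le> dm (fst Qp')"
    using least_nat[of ?C "(Q0, p0)" "\<lambda>Qp. dm (fst Qp)"] by blast
  obtain Q p where e: "Qp = (Q, p)" by force
  have Q: "projective A Q" and p: "p \<in> module_hom A Q (sub P ?\<Omega>)" "p ` carrier Q = ?\<Omega>"
    using Qp(1) unfolding e by blast+
  have min: "dm Q \<le> dm Q'" if "projective A Q'" "p' \<in> module_hom A Q' (sub P ?\<Omega>)" "p' ` carrier Q' = ?\<Omega>" for Q' p'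
    using Qp(2)[of "(Q', p')"] that unfolding e by simp
  note Qm = projective_mod[OF Q]
  note Pf = mod_fg[OF Pm] and Qf = mod_fg[OF Qm] and Ff = mod_fg[OF free_module(1)]
  have pP: "p \<in> module_hom A Q P" by (rule hom_comp[OF p(1) P.hom_incl[OF s\<Omega>]])
  have qp: "q (p z) = \<zero>\<^bsub>Y\<^esub>" if "z \<in> carrier Q" for z using hom_closed[OF p(1) that] by simp
  obtain b where b: "b \<in> module_hom A F P" "\<And>x. x \<in> carrier F \<Longrightarrow> q (b x) = a x"
    using projective_lift[OF projective_free Pf mod_fg[OF Ym] q ah] by blast
  show ?thesis
  proof (rule that[OF P Q])
    fix M assume M: "M \<in> T" and nz: "carrier M \<noteq> {\<zero>\<^bsub>M\<^esub>}"
    have Mm: "M \<in> mod_cat A" by (rule torsionD(1)[OF T M])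
    note Mf = mod_fg[OF Mm] and Ml = mod_lm[OF Mm]
    let ?H = "hom_space A P M"
    let ?S = "{l \<in> carrier ?H. \<forall>x\<in>carrier Q. l (p x) = \<zero>\<^bsub>M\<^esub>}"
    have ex: "\<exists>l\<in>carrier ?H. \<forall>x\<in>carrier Q. h x = l (p x)" if h: "h \<in> module_hom A Q M" for h
    proof -
      have "\<exists>l\<in>module_hom A P M. \<forall>z\<in>carrier Q. h z = l (p z)"
        by (rule presentation_extend[OF T Y P q Q p _ M h]) (rule min)
      then obtain l where l: "l \<in> module_hom A P M" "\<And>z. z \<in> carrier Q \<Longrightarrow> h z = l (p z)" by blast
      have "restrict l (carrier P) \<in> carrier ?H"
        using hom_cong[OF l(1) Pl, of "restrict l (carrier P)"] by (simp add: hom_space_def)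
      then show ?thesis using l(2) hom_closed[OF pP] by (intro bexI[of _ "restrict l (carrier P)"]) simp_all
    qed
    from hdim_precompose_onto[OF Pf Qf Mf pP hom_space_subspace_self[OF Pl Ml] ex]
    have 1: "hdim K A P M = hdim K A Q M + vectorspace.dim K (?H\<lparr>carrier := ?S\<rparr>)" by (simp add: hdim_def)
    \<comment> \<open>\<open>?S\<close> stands for the maps from \<open>Y\<close> to
      \<open>M\<close>, viewed on \<open>P\<close>. Since \<open>a\<close> is an approximation and
      \<open>b\<close> lifts it to \<open>P\<close>, restriction of \<open>?S\<close> along
      \<open>b\<close> reaches every map from \<open>F\<close> to \<open>M\<close>.\<close>
    have ex2: "\<exists>l\<in>?S. \<forall>x\<in>carrier F. h x = l (b x)" if h: "h \<in> module_hom A F M" for h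
    proof -
      obtain k where k: "k \<in> module_hom A Y M" "\<And>x. x \<in> carrier F \<Longrightarrow> h x = k (a x)"
        using left_approxD[OF a M h] by blast
      let ?l = "\<lambda>x\<in>carrier P. k (q x)"
      have "?l \<in> module_hom A P M" by (rule hom_cong[OF hom_comp[OF q(1) k(1)] Pl]) simp
      moreover have "?l (p z) = \<zero>\<^bsub>M\<^esub>" if z: "z \<in> carrier Q" for z
        using hom_closed[OF pP z] qp[OF z] hom_zero[OF Yl Ml k(1)] by simp
      ultimately have "?l \<in> ?S" by (simp add: hom_space_def)
      moreover have "h x = ?l (b x)" if x: "x \<in> carrier F" for x
        using k(2)[OF x] b(2)[OF x] hom_closed[OF b(1) x] by simp
      ultimately show ?thesis by blast
    qed
    from hdim_precompose_onto[OF Pf Ff Mf b(1) kernel_subspace[OF Pl Ml pP] ex2]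
    have "dm M \<le> vectorspace.dim K (?H\<lparr>carrier := ?S\<rparr>)" by simp
    then have "hdim K A P M \<ge> hdim K A Q M + dm M" using 1 by simp
    moreover have "dm M > 0" using dm_zero_iff[OF Mf] nz by simp
    ultimately show "theta_form K A P Q M > 0" unfolding theta_form_def by linarith
  next
    fix N assume Nm: "N \<in> mod_cat A" and nz: "carrier N \<noteq> {\<zero>\<^bsub>N\<^esub>}"
      and z: "\<And>Y f y. Y \<in> T \<Longrightarrow> f \<in> module_hom A Y N \<Longrightarrow> y \<in> carrier Y \<Longrightarrow> f y = \<zero>\<^bsub>N\<^esub>"
    note Nf = mod_fg[OF Nm] and Nl = mod_lm[OF Nm]
    \<comment> \<open>A map from \<open>P\<close> that vanishes on the image of \<open>Q\<close>
      descends to \<open>Y\<close>, and \<open>Y\<close> in \<open>T\<close> has only zero maps to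
      \<open>N\<close>.\<close>
    have "hdim K A P N \<le> hdim K A Q N"
    proof (rule hdim_le_of_injective[OF Pf Qf Nf pP])
      fix h x assume h: "h \<in> module_hom A P N" and hp: "\<And>z. z \<in> carrier Q \<Longrightarrow> h (p z) = \<zero>\<^bsub>N\<^esub>"
        and x: "x \<in> carrier P"
      have hk: "h y = \<zero>\<^bsub>N\<^esub>" if "y \<in> carrier P" "q y = \<zero>\<^bsub>Y\<^esub>" for y
      proof -
        have "y \<in> ?\<Omega>" using that by blast
        with p(2) obtain w where "w \<in> carrier Q" "y = p w" by (rule surjE)
        then show ?thesis using hp by simp
      qed
      obtain k where k: "k \<in> module_hom A Y N" "\<And>y. y \<in> carrier P \<Longrightarrow> k (q y) = h y"
        using hom_factor[OF Pl Yl Nl h q hk] by blast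
      show "h x = \<zero>\<^bsub>N\<^esub>" using z[OF YT k(1) hom_closed[OF q(1) x]] k(2)[OF x] by simp
    qed
    moreover have "dm N > 0" using dm_zero_iff[OF Nf] nz by simp
    ultimately show "theta_form K A P Q N < 0" unfolding theta_form_def by linarith
  qed
qed

end

subsection \<open>Composition multiplicities and the Euler form\<close>

lemma first_isomorphism:
  assumes M: "left_module R M" and N: "left_module R N"
    and f: "f \<in> module_hom R M N" "f ` carrier M = carrier N"
  shows "isomorphic R (quotient_module M (kern M N f)) N"
proof -
  interpret M: left_module R M by fact
  let ?L = "kern M N f"
  let ?Q = "quotient_module M ?L" and ?p = "\<lambda>x. ?L +>\<^bsub>M\<^esub> x"
  note q = M.quotient_module[OF submod_kern[OF M N f(1)]]
  interpret Q: left_module R ?Q by (rule q(1))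
  have k: "f x = \<zero>\<^bsub>N\<^esub>" if "x \<in> carrier M" "?p x = \<zero>\<^bsub>?Q\<^esub>" for x using q(4) that by blast
  obtain g where g: "g \<in> module_hom R ?Q N" "\<And>x. x \<in> carrier M \<Longrightarrow> g (?p x) = f x"
    using hom_factor[OF M q(1) N f(1) q(2,3) k] by blast
  have "inj_on g (carrier ?Q)"
  proof (rule inj_on_kern[OF q(1) N g(1)])
    fix y assume y: "y \<in> carrier ?Q" "g y = \<zero>\<^bsub>N\<^esub>"
    from q(3) y(1) obtain x where x: "x \<in> carrier M" "y = ?p x" by (rule surjE)
    then have "x \<in> ?L" using g(2)[OF x(1)] y(2) by simp
    then show "y = \<zero>\<^bsub>?Q\<^esub>" using q(4) x(2) by blast
  qed
  moreover have "g ` carrier ?Q = carrier N"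
  proof -
    have "g ` carrier ?Q = (\<lambda>x. g (?p x)) ` carrier M" unfolding q(3)[symmetric] by (rule image_image)
    also have "\<dots> = f ` carrier M" by (rule image_cong[OF refl g(2)])
    finally show ?thesis using f(2) by simp
  qed
  ultimately show ?thesis using g(1) by (auto simp: isomorphic_def module_isos_def bij_betw_def)
qed

lemma isoE:
  assumes "isomorphic R M N" "left_module R M"
  obtains f g where "f \<in> module_hom R M N" "g \<in> module_hom R N M"
    "\<And>x. x \<in> carrier M \<Longrightarrow> g (f x) = x" "\<And>y. y \<in> carrier N \<Longrightarrow> f (g y) = y"
proof -
  obtain f where f: "f \<in> module_hom R M N" "bij_betw f (carrier M) (carrier N)"
    using assms(1) by (auto simp: isomorphic_def module_isos_def)
  show ?thesis
    by (rule that[OF f(1) hom_inverse[OF f assms(2)]])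
      (rule bij_betw_inv_into_left[OF f(2)], assumption, rule bij_betw_inv_into_right[OF f(2)])
qed

lemma simple_nonzero: "simple_module R M \<Longrightarrow> \<exists>x\<in>carrier M. x \<noteq> \<zero>\<^bsub>M\<^esub>"
proof (rule ccontr)
  assume S: "simple_module R M" and n: "\<not> ?thesis"
  then interpret M: left_module R M by (simp add: simple_module_def)
  have "carrier M = {\<zero>\<^bsub>M\<^esub>}" using n M.submodD(2)[OF M.submod_carrier] by blast
  then show False using S by (simp add: simple_module_def)
qed

lemma simple_hom:
  assumes M: "left_module R M" and S: "simple_module R S" and f: "f \<in> module_hom R M S"
    and x: "x \<in> carrier M" "f x \<noteq> \<zero>\<^bsub>S\<^esub>"
  shows "f ` carrier M = carrier S"
proof -
  have Sl: "left_module R S" using S by (simp add: simple_module_def)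
  have "f ` carrier M = {\<zero>\<^bsub>S\<^esub>} \<or> f ` carrier M = carrier S"
    using S submod_im[OF M Sl f] unfolding simple_module_def by blast
  then show ?thesis using x by blast
qed

lemma simple_iso:
  assumes "simple_module R M" "isomorphic R M N" and N: "left_module R N"
  shows "simple_module R N"
proof -
  have M: "left_module R M" using assms(1) by (simp add: simple_module_def)
  obtain f g where f: "f \<in> module_hom R M N" and g: "g \<in> module_hom R N M"
    and gf: "\<And>x. x \<in> carrier M \<Longrightarrow> g (f x) = x" and fg: "\<And>y. y \<in> carrier N \<Longrightarrow> f (g y) = y"
    using isoE[OF assms(2) M] by blast
  interpret N: left_module R N by (rule N)
  have "carrier N \<noteq> {\<zero>\<^bsub>N\<^esub>}"
  proof
    assume z: "carrier N = {\<zero>\<^bsub>N\<^esub>}"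
    obtain x where x: "x \<in> carrier M" "x \<noteq> \<zero>\<^bsub>M\<^esub>" using simple_nonzero[OF assms(1)] by blast
    have "f x = \<zero>\<^bsub>N\<^esub>" using hom_closed[OF f x(1)] z by blast
    then show False using gf[OF x(1)] hom_zero[OF N M g] x(2) by simp
  qed
  moreover have "L = {\<zero>\<^bsub>N\<^esub>} \<or> L = carrier N" if L: "is_submodule R L N" for L
  proof -
    have LN: "L \<subseteq> carrier N" by (rule N.submodD(1)[OF L])
    have fgL: "L = f ` g ` L" using fg LN by force
    have "g ` L = {\<zero>\<^bsub>M\<^esub>} \<or> g ` L = carrier M"
      using assms(1) submod_image[OF N M g L] unfolding simple_module_def by blast
    then show ?thesis
    proof
      assume "g ` L = {\<zero>\<^bsub>M\<^esub>}"
      then show ?thesis using fgL hom_zero[OF M N f] by simp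
    next
      assume "g ` L = carrier M"
      then show ?thesis using fgL retract_surj[OF f g fg] by simp
    qed
  qed
  ultimately show ?thesis using N unfolding simple_module_def by blast
qed

lemma projective_cover_hom:
  assumes c: "projective_cover A P S" and P: "left_module A P" and S: "simple_module A S" and T: "simple_module A T"
    and g: "g \<in> module_hom A P T" "x \<in> carrier P" "g x \<noteq> \<zero>\<^bsub>T\<^esub>"
  shows "isomorphic A S T"
proof -
  have Sl: "left_module A S" and Tl: "left_module A T" using S T by (simp_all add: simple_module_def)
  interpret P: left_module A P by (rule P)
  interpret T: left_module A T by (rule Tl)
  obtain p where p: "p \<in> module_hom A P S" "p ` carrier P = carrier S"
    and sf: "\<And>L. is_submodule A L P \<Longrightarrow> set_add P (a_kernel P S p) L = carrier P \<Longrightarrow> L = carrier P"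
    using c unfolding projective_cover_def by blast
  have ak: "a_kernel P S p = kern P S p" by (simp add: a_kernel_def')
  let ?G = "kern P T g"
  have sG: "is_submodule A ?G P" by (rule submod_kern[OF P Tl g(1)])
  have sk: "is_submodule A (kern P S p) P" by (rule submod_kern[OF P Sl p(1)])
  have gs: "g ` carrier P = carrier T" by (rule simple_hom[OF P T g(1), of x]) (rule g(2), rule g(3))
  have kG: "kern P S p \<subseteq> ?G"
  proof (rule ccontr)
    assume "\<not> ?thesis"
    then obtain y where y: "y \<in> carrier P" "p y = \<zero>\<^bsub>S\<^esub>" "g y \<noteq> \<zero>\<^bsub>T\<^esub>" by blast
    have "g ` carrier (sub P (kern P S p)) = carrier T"
      by (rule simple_hom[OF P.left_module_sub[OF sk] T P.hom_restrict_dom[OF sk g(1)], of y]) (use y in simp_all)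
    then have gk: "g ` kern P S p = carrier T" by simp
    have "set_add P (kern P S p) ?G = carrier P"
    proof
      show "set_add P (kern P S p) ?G \<subseteq> carrier P" unfolding set_add_def' by auto
      show "carrier P \<subseteq> set_add P (kern P S p) ?G"
      proof
        fix z assume z: "z \<in> carrier P"
        from gk hom_closed[OF g(1) z] obtain w where w: "w \<in> kern P S p" "g z = g w" by (rule surjE)
        have wP: "w \<in> carrier P" using w(1) by blast
        have "g (z \<ominus>\<^bsub>P\<^esub> w) = \<zero>\<^bsub>T\<^esub>"
          using hom_minus[OF P Tl g(1) z wP] w(2) T.minus_self[OF hom_closed[OF g(1) wP]] by simp
        then have zw: "z \<ominus>\<^bsub>P\<^esub> w \<in> ?G" using z wP by simp
        have "z = w \<oplus>\<^bsub>P\<^esub> (z \<ominus>\<^bsub>P\<^esub> w)"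
          using P.minus_add_cancel[OF z wP] P.M.a_comm[OF P.M.minus_closed[OF z wP] wP] by simp
        then show "z \<in> set_add P (kern P S p) ?G" unfolding set_add_def' using w(1) zw by blast
      qed
    qed
    then have "?G = carrier P" using sf[OF sG] ak by simp
    then show False using g(2,3) by blast
  qed
  have k: "g y = \<zero>\<^bsub>T\<^esub>" if "y \<in> carrier P" "p y = \<zero>\<^bsub>S\<^esub>" for y using kG that by blast
  obtain h where h: "h \<in> module_hom A S T" "\<And>y. y \<in> carrier P \<Longrightarrow> h (p y) = g y"
    using hom_factor[OF P Sl Tl g(1) p k] by blast
  have px: "p x \<in> carrier S" by (rule hom_closed[OF p(1) g(2)])
  have hx: "h (p x) \<noteq> \<zero>\<^bsub>T\<^esub>" using h(2)[OF g(2)] g(3) by simp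
  have hs: "h ` carrier S = carrier T" by (rule simple_hom[OF Sl T h(1), of "p x"]) (rule px, rule hx)
  have "kern S T h = {\<zero>\<^bsub>S\<^esub>} \<or> kern S T h = carrier S"
    using S submod_kern[OF Sl Tl h(1)] unfolding simple_module_def by blast
  then have "kern S T h = {\<zero>\<^bsub>S\<^esub>}" using px hx by blast
  then have "inj_on h (carrier S)" using kern_zero_iff_inj[OF Sl Tl h(1)] by simp
  then show ?thesis using h(1) hs by (auto simp: isomorphic_def module_isos_def bij_betw_def)
qed

section \<open>Composition series\<close>

context fd_algebra begin

lemma hdim_quotient:
  assumes Q: "projective A Q" and M: "fg_module A M" and L: "is_submodule A L M"
  shows "hdim K A Q M = hdim K A Q (sub M L) + hdim K A Q (quotient_module M L)"
proof -
  obtain N where N: "N \<in> mod_cat A" "isomorphic A (quotient_module M L) N"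
    "hdim K A Q M = hdim K A Q (sub M L) + hdim K A Q N"
    by (rule hdim_sub_le[OF Q M L])
  then show ?thesis using hdim_iso[OF Q fg_quotient_module[OF M L] mod_fg[OF N(1)] N(2)] by simp
qed

text \<open>A proper submodule of greatest dimension is maximal, so its quotient is simple; it has
  smaller dimension than \<open>M\<close> and is handled by induction.\<close>

lemma composition_series_exists:
  assumes "fg_module A M"
  shows "\<exists>Ls. composition_series A M Ls"
  using assms
proof (induction "dm M" arbitrary: M rule: less_induct)
  case less
  note M = less.prems
  note Ml = fg_moduleD[OF M]
  interpret M: left_module A M by (rule Ml)
  show ?case
  proof (cases "carrier M = {\<zero>\<^bsub>M\<^esub>}")
    case True
    then have "composition_series A M [{\<zero>\<^bsub>M\<^esub>}]"
      using M.submod_zero by (simp add: composition_series_def)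
    then show ?thesis by blast
  next
    case False
    let ?P = "\<lambda>L. is_submodule A L M \<and> L \<noteq> carrier M"
    have "?P {\<zero>\<^bsub>M\<^esub>}" using M.submod_zero False by blast
    moreover have "dm (sub M L) \<le> dm M" if "?P L" for L using dm_sub(1)[OF M] that by blast
    ultimately obtain L where L: "?P L" and max: "\<And>L'. ?P L' \<Longrightarrow> dm (sub M L') \<le> dm (sub M L)"
      using greatest_nat[of ?P "{\<zero>\<^bsub>M\<^esub>}" "\<lambda>L. dm (sub M L)" "dm M"] by blast
    have sL: "is_submodule A L M" and Lc: "L \<noteq> carrier M" using L by blast+
    let ?Q = "quotient_module M L" and ?p = "\<lambda>x. L +>\<^bsub>M\<^esub> x"
    note q = M.quotient_module[OF sL]
    interpret Q: left_module A ?Q by (rule q(1))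
    have "carrier ?Q \<noteq> {\<zero>\<^bsub>?Q\<^esub>}"
    proof
      assume "carrier ?Q = {\<zero>\<^bsub>?Q\<^esub>}"
      then have "kern M ?Q ?p = carrier M" using hom_closed[OF q(2)] by blast
      then show False using q(4) Lc by blast
    qed
    moreover have "Z = {\<zero>\<^bsub>?Q\<^esub>} \<or> Z = carrier ?Q" if Z: "is_submodule A Z ?Q" for Z
    proof (rule ccontr)
      assume n: "\<not> ?thesis"
      let ?V = "{x \<in> carrier M. ?p x \<in> Z}"
      note D = Q.submodD[OF Z]
      have sV: "is_submodule A ?V M" by (rule submod_vimage[OF Ml q(1,2) Z])
      have LV: "L \<subseteq> ?V"
      proof
        fix x assume "x \<in> L"
        then have "x \<in> carrier M \<and> ?p x = \<zero>\<^bsub>?Q\<^esub>" using q(4) by blast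
        then show "x \<in> ?V" using D(2) by simp
      qed
      have "?V \<noteq> carrier M"
      proof
        assume V: "?V = carrier M"
        have "y \<in> Z" if y: "y \<in> carrier ?Q" for y
        proof -
          from q(3) y obtain x where "x \<in> carrier M" "y = ?p x" by (rule surjE)
          then show ?thesis using V by blast
        qed
        then show False using n D(1) by blast
      qed
      then have le: "dm (sub M ?V) \<le> dm (sub M L)" using max sV by blast
      have "L = ?V"
      proof (rule ccontr)
        assume "L \<noteq> ?V"
        then have "dm (sub (sub M ?V) L) < dm (sub M ?V)"
          by (intro dm_sub(2)[OF fg_sub[OF M sV] M.submod_sub[OF sV sL LV]]) simp
        then show False using le by simp
      qed
      have "y = \<zero>\<^bsub>?Q\<^esub>" if y: "y \<in> Z" for y
      proof -
        have "y \<in> carrier ?Q" using y D(1) by blast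
        with q(3) obtain x where x: "x \<in> carrier M" "y = ?p x" by (rule surjE)
        then have "x \<in> L" using \<open>L = ?V\<close> y by blast
        then show ?thesis using q(4) x(2) by blast
      qed
      then show False using n D(2) by blast
    qed
    ultimately have simple: "simple_module A ?Q" using q(1) unfolding simple_module_def by blast
    obtain Ls where Ls: "composition_series A (sub M L) Ls"
      using less.hyps[OF dm_sub(2)[OF M sL Lc] fg_sub[OF M sL]] by blast
    have ne: "Ls \<noteq> []" "hd Ls = {\<zero>\<^bsub>M\<^esub>}" "last Ls = L" "\<And>X. X \<in> set Ls \<Longrightarrow> is_submodule A X (sub M L)"
      and st: "\<And>i. Suc i < length Ls \<Longrightarrow> Ls ! i \<subset> Ls ! Suc i \<and>
        simple_module A (quotient_module (sub M (Ls ! Suc i)) (Ls ! i))"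
      using Ls unfolding composition_series_def by simp_all
    have "composition_series A M (Ls @ [carrier M])"
      unfolding composition_series_def
    proof (intro conjI ballI allI impI)
      show "Ls @ [carrier M] \<noteq> []" by simp
      show "hd (Ls @ [carrier M]) = {\<zero>\<^bsub>M\<^esub>}" using ne(1,2) by simp
      show "last (Ls @ [carrier M]) = carrier M" by simp
      show "is_submodule A X M" if "X \<in> set (Ls @ [carrier M])" for X
        using that ne(4) M.submod_trans[OF sL] M.submod_carrier by auto
      fix i assume i: "Suc i < length (Ls @ [carrier M])"
      have "(Ls @ [carrier M]) ! i \<subset> (Ls @ [carrier M]) ! Suc i \<and>
        simple_module A (quotient_module (sub M ((Ls @ [carrier M]) ! Suc i)) ((Ls @ [carrier M]) ! i))"
      proof (cases "Suc i < length Ls")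
        case True
        then show ?thesis using st[OF True] by (simp add: nth_append)
      next
        case False
        then have "Suc i = length Ls" using i by simp
        then have "(Ls @ [carrier M]) ! i = L" "(Ls @ [carrier M]) ! Suc i = carrier M"
          using ne(1,3) by (simp_all add: nth_append last_conv_nth flip: \<open>Suc i = length Ls\<close>)
        then show ?thesis using simple M.submodD(1)[OF sL] Lc by auto
      qed
      then show "(Ls @ [carrier M]) ! i \<subset> (Ls @ [carrier M]) ! Suc i"
        "simple_module A (quotient_module (sub M ((Ls @ [carrier M]) ! Suc i)) ((Ls @ [carrier M]) ! i))" by blast+
    qed
    then show ?thesis by blast
  qed
qed

lemma composition_series_hdim:
  assumes Q: "projective A Q" and M: "fg_module A M" and Ls: "composition_series A M Ls"
  shows "hdim K A Q M = (\<Sum>i | Suc i < length Ls. hdim K A Q (quotient_module (sub M (Ls ! Suc i)) (Ls ! i)))"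
proof -
  interpret M: left_module A M by (rule fg_moduleD[OF M])
  have ne: "Ls \<noteq> []" "hd Ls = {\<zero>\<^bsub>M\<^esub>}" "last Ls = carrier M" "\<And>X. X \<in> set Ls \<Longrightarrow> is_submodule A X M"
    and st: "\<And>i. Suc i < length Ls \<Longrightarrow> Ls ! i \<subset> Ls ! Suc i"
    using Ls unfolding composition_series_def by blast+
  have *: "k < length Ls \<longrightarrow> hdim K A Q (sub M (Ls ! k)) =
    (\<Sum>i<k. hdim K A Q (quotient_module (sub M (Ls ! Suc i)) (Ls ! i)))" for k
  proof (induction k)
    case 0
    show ?case using hdim_sub_zero[OF mod_fg[OF projective_mod[OF Q]] M] ne(1,2) by (simp add: hd_conv_nth)
  next
    case (Suc k)
    show ?case
    proof
      assume k: "Suc k < length Ls"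
      have s: "is_submodule A (Ls ! k) M" "is_submodule A (Ls ! Suc k) M" using k ne(4) by simp_all
      have le: "Ls ! k \<subseteq> Ls ! Suc k" using st[OF k] by blast
      show "hdim K A Q (sub M (Ls ! Suc k)) =
        (\<Sum>i<Suc k. hdim K A Q (quotient_module (sub M (Ls ! Suc i)) (Ls ! i)))"
        using hdim_quotient[OF Q fg_sub[OF M s(2)] M.submod_sub[OF s(2,1) le]] Suc k by simp
    qed
  qed
  have "Ls ! (length Ls - 1) = carrier M" using ne(1,3) by (simp add: last_conv_nth)
  moreover have "{i. Suc i < length Ls} = {..<length Ls - 1}" by auto
  ultimately show ?thesis using *[of "length Ls - 1"] ne(1) by simp
qed

lemma iso_class_self: "M \<in> mod_cat A \<Longrightarrow> M \<in> iso_class A M"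
  by (simp add: iso_class_def isomorphic_refl)

lemma iso_class_eq_iff:
  assumes "M \<in> mod_cat A" "N \<in> mod_cat A"
  shows "iso_class A M = iso_class A N \<longleftrightarrow> isomorphic A M N"
proof
  assume "iso_class A M = iso_class A N"
  then have "N \<in> iso_class A M" using iso_class_self[OF assms(2)] by simp
  then show "isomorphic A M N" by (simp add: iso_class_def)
next
  assume i: "isomorphic A M N"
  then have "isomorphic A N M" by (rule isomorphic_sym[OF _ mod_lm[OF assms(1)]])
  then show "iso_class A M = iso_class A N"
    using i isomorphic_trans[of A M N] isomorphic_trans[of A N M] unfolding iso_class_def by blast
qed

text \<open>\<open>End_alg\<close> and \<open>hom_space\<close> differ only in their multiplicative
  fields, so the identity is a linear bijection between them. The identity endomorphism of a nonzero
  module shows that the dimension is not zero.\<close>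

lemma End_dim_pos:
  assumes X: "X \<in> mod_cat A" and n: "x \<in> carrier X" "x \<noteq> \<zero>\<^bsub>X\<^esub>"
  shows "vectorspace.dim K (End_alg A X) > 0"
proof -
  note Xf = mod_fg[OF X] and Xl = mod_lm[OF X]
  let ?H = "hom_space A X X" and ?E = "End_alg A X"
  interpret H: vectorspace K ?H by (rule hom_space_vectorspace[OF Xl Xl])
  have eq: "carrier ?E = carrier ?H" "add ?E = add ?H" "smult ?E = smult ?H"
    by (simp_all add: End_alg_def hom_space_def)
  have "module K ?E"
  proof (rule moduleI)
    show "cring K" ..
    show "abelian_group ?E" using ring_End_alg[OF Xf] by (rule ring.is_abelian_group)
  qed (simp_all add: eq H.smult_l_distr H.smult_r_distr H.smult_assoc1)
  moreover have "field K" ..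
  ultimately have E: "vectorspace K ?E" by (rule vectorspace.intro)
  have "linear_map K ?H ?E (\<lambda>x. x)"
    by (rule linear_mapI[OF hom_space_vectorspace[OF Xl Xl] E]) (simp_all add: eq)
  then interpret L: linear_map K ?H ?E "\<lambda>x. x" .
  have "vectorspace.dim K ?H = vectorspace.dim K ?E"
    by (rule L.dim_eq[OF hom_space_fin_dim[OF Xf Xf]]) (simp_all add: eq)
  moreover have "hdim K A X X \<noteq> 0"
  proof
    assume "hdim K A X X = 0"
    then have "\<forall>h\<in>module_hom A X X. \<forall>x\<in>carrier X. h x = \<zero>\<^bsub>X\<^esub>" unfolding hdim_zero_iff[OF Xf Xf] .
    from bspec[OF bspec[OF this hom_id] n(1)] show False using n(2) by simp
  qed
  ultimately show ?thesis by (simp add: hdim_def)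
qed

end

section \<open>Multiplicities and linear forms over the given simple modules\<close>

locale covers = fd_algebra K A for K :: "'k ring" and A :: "('k, 'a) module" +
  fixes n :: nat and S P :: "nat \<Rightarrow> ('a, nat \<Rightarrow> 'k) module"
  assumes covers: "simples_with_covers A n S P"
begin

lemma S_mod: "i \<in> {1..n} \<Longrightarrow> S i \<in> mod_cat A" and S_simple: "i \<in> {1..n} \<Longrightarrow> simple_module A (S i)"
  and P_cover: "i \<in> {1..n} \<Longrightarrow> projective_cover A (P i) (S i)"
  and S_inj: "i \<in> {1..n} \<Longrightarrow> j \<in> {1..n} \<Longrightarrow> isomorphic A (S i) (S j) \<Longrightarrow> i = j"
  and S_all: "M \<in> mod_cat A \<Longrightarrow> simple_module A M \<Longrightarrow> \<exists>i\<in>{1..n}. isomorphic A M (S i)"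
  using covers unfolding simples_with_covers_def by blast+

lemma P_proj: "i \<in> {1..n} \<Longrightarrow> projective A (P i)"
  using P_cover unfolding projective_cover_def by blast

lemma P_hom: "i \<in> {1..n} \<Longrightarrow> j \<in> {1..n} \<Longrightarrow> g \<in> module_hom A (P i) (S j) \<Longrightarrow> x \<in> carrier (P i) \<Longrightarrow>
    g x \<noteq> \<zero>\<^bsub>S j\<^esub> \<Longrightarrow> i = j"
  using S_inj[of i j] projective_cover_hom[OF P_cover[of i] mod_lm[OF projective_mod[OF P_proj[of i]]] S_simple[of i] S_simple[of j]]
  by blast

lemma cover_map:
  assumes i: "i \<in> {1..n}"
  obtains p x where "p \<in> module_hom A (P i) (S i)" "x \<in> carrier (P i)" "p x \<noteq> \<zero>\<^bsub>S i\<^esub>"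
proof -
  obtain p where p: "p \<in> module_hom A (P i) (S i)" "p ` carrier (P i) = carrier (S i)"
    using P_cover[OF i] unfolding projective_cover_def by blast
  obtain y where y: "y \<in> carrier (S i)" "y \<noteq> \<zero>\<^bsub>S i\<^esub>" using simple_nonzero[OF S_simple[OF i]] by blast
  from p(2) y(1) obtain x where "x \<in> carrier (P i)" "y = p x" by (rule surjE)
  then show ?thesis using that p(1) y(2) by blast
qed

lemma hdim_P_S: "i \<in> {1..n} \<Longrightarrow> j \<in> {1..n} \<Longrightarrow> hdim K A (P i) (S j) = 0 \<longleftrightarrow> i \<noteq> j"
proof -
  assume i: "i \<in> {1..n}" and j: "j \<in> {1..n}"
  note z = hdim_zero_iff[OF mod_fg[OF projective_mod[OF P_proj[OF i]]] mod_fg[OF S_mod[OF j]]]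
  show ?thesis
  proof
    assume 0: "hdim K A (P i) (S j) = 0"
    obtain p x where "p \<in> module_hom A (P i) (S i)" "x \<in> carrier (P i)" "p x \<noteq> \<zero>\<^bsub>S i\<^esub>" by (rule cover_map[OF i])
    then show "i \<noteq> j" using 0 z by blast
  next
    assume "i \<noteq> j"
    have "g x = \<zero>\<^bsub>S j\<^esub>" if "g \<in> module_hom A (P i) (S j)" "x \<in> carrier (P i)" for g x
      by (rule ccontr) (use P_hom[OF i j that] \<open>i \<noteq> j\<close> in simp)
    then show "hdim K A (P i) (S j) = 0" unfolding z by (intro ballI)
  qed
qed

text \<open>Moving the cover map of \<open>P j\<close> along the isomorphism gives a nonzero map
  from \<open>P i\<close> to \<open>S j\<close>. This makes the classes of the \<open>P i\<close>
  distinct, so that coefficients on them can be prescribed independently.\<close>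

lemma P_inj:
  assumes i: "i \<in> {1..n}" and j: "j \<in> {1..n}" and iso: "isomorphic A (P i) (P j)"
  shows "i = j"
proof -
  note Pl = mod_lm[OF projective_mod[OF P_proj]]
  obtain f g where f: "f \<in> module_hom A (P i) (P j)" and g: "g \<in> module_hom A (P j) (P i)"
    and fg: "\<And>y. y \<in> carrier (P j) \<Longrightarrow> f (g y) = y"
  proof (rule isoE[OF iso Pl[OF i]])
    fix f g
    assume "f \<in> module_hom A (P i) (P j)" "g \<in> module_hom A (P j) (P i)"
      and "\<And>y. y \<in> carrier (P j) \<Longrightarrow> f (g y) = y"
    then show ?thesis by (rule that[of f g])
  qed
  obtain p x where p: "p \<in> module_hom A (P j) (S j)" "x \<in> carrier (P j)" "p x \<noteq> \<zero>\<^bsub>S j\<^esub>" by (rule cover_map[OF j])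
  show ?thesis by (rule P_hom[OF i j hom_comp[OF f p(1)] hom_closed[OF g p(2)]]) (simp add: fg[OF p(2)] p(3))
qed

lemma hdim_simple:
  assumes Q: "projective A Q" and T: "fg_module A T" "simple_module A T"
  shows "hdim K A Q T = (\<Sum>i\<in>{1..n}. (if isomorphic A T (S i) then 1 else 0) * hdim K A Q (S i))"
proof -
  obtain T' f where T': "T' \<in> mod_cat A" "f \<in> module_isos A T T'" by (rule mod_cat_transport[OF T(1)])
  have iT: "isomorphic A T T'" using T'(2) by (auto simp: isomorphic_def)
  obtain i where i: "i \<in> {1..n}" "isomorphic A T' (S i)"
    using S_all[OF T'(1) simple_iso[OF T(2) iT mod_lm[OF T'(1)]]] by blast
  have iTS: "isomorphic A T (S i)" by (rule isomorphic_trans[OF iT i(2)])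
  have u: "isomorphic A T (S j) \<longleftrightarrow> j = i" if j: "j \<in> {1..n}" for j
    using S_inj[OF i(1) j isomorphic_trans[OF isomorphic_sym[OF iTS fg_moduleD[OF T(1)]]]] iTS by blast
  have "(\<Sum>j\<in>{1..n}. (if isomorphic A T (S j) then 1 else 0) * hdim K A Q (S j)) =
    (\<Sum>j\<in>{1..n}. if j = i then hdim K A Q (S i) else 0)"
    by (rule sum.cong[OF refl]) (use u in auto)
  also have "\<dots> = hdim K A Q (S i)" using i(1) by simp
  also have "\<dots> = hdim K A Q T" by (rule hdim_iso[OF Q T(1) mod_fg[OF S_mod[OF i(1)]] iTS, symmetric])
  finally show ?thesis by simp
qed

lemma series_count:
  assumes Q: "projective A Q" and M: "fg_module A M" and Ls: "composition_series A M Ls"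
  shows "hdim K A Q M = (\<Sum>i\<in>{1..n}. card {k. Suc k < length Ls \<and>
    isomorphic A (quotient_module (sub M (Ls ! Suc k)) (Ls ! k)) (S i)} * hdim K A Q (S i))"
proof -
  interpret M: left_module A M by (rule fg_moduleD[OF M])
  let ?f = "\<lambda>k. quotient_module (sub M (Ls ! Suc k)) (Ls ! k)"
  let ?I = "{k. Suc k < length Ls}"
  have fin: "finite ?I" by (rule finite_subset[of _ "{..<length Ls}"]) auto
  have f: "fg_module A (?f k) \<and> simple_module A (?f k)" if k: "k \<in> ?I" for k
  proof -
    have s: "is_submodule A (Ls ! k) M" "is_submodule A (Ls ! Suc k) M" and le: "Ls ! k \<subseteq> Ls ! Suc k"
      and si: "simple_module A (?f k)"
      using Ls k unfolding composition_series_def by auto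
    show ?thesis using fg_quotient_module[OF fg_sub[OF M s(2)] M.submod_sub[OF s(2,1) le]] si by blast
  qed
  have "hdim K A Q M = (\<Sum>k\<in>?I. \<Sum>i\<in>{1..n}. (if isomorphic A (?f k) (S i) then 1 else 0) * hdim K A Q (S i))"
    unfolding composition_series_hdim[OF Q M Ls]
    by (rule sum.cong[OF refl]) (use f hdim_simple[OF Q] in blast)
  also have "\<dots> = (\<Sum>i\<in>{1..n}. \<Sum>k\<in>?I. (if isomorphic A (?f k) (S i) then 1 else 0) * hdim K A Q (S i))"
    by (rule sum.swap)
  also have "\<dots> = (\<Sum>i\<in>{1..n}. card {k \<in> ?I. isomorphic A (?f k) (S i)} * hdim K A Q (S i))"
  proof (rule sum.cong[OF refl])
    fix i
    have "card {k \<in> ?I. isomorphic A (?f k) (S i)} = (\<Sum>k\<in>?I. if isomorphic A (?f k) (S i) then 1 else 0)"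
      using fin by (simp add: sum.If_cases Int_def)
    then show "(\<Sum>k\<in>?I. (if isomorphic A (?f k) (S i) then 1 else 0) * hdim K A Q (S i)) =
      card {k \<in> ?I. isomorphic A (?f k) (S i)} * hdim K A Q (S i)" by (simp only: sum_distrib_right)
  qed
  finally show ?thesis by simp
qed

text \<open>Since \<open>Hom(P i, S j) = 0\<close> for distinct \<open>i\<close> and \<open>j\<close>, the additive function \<open>dim Hom(P i, -)\<close> computes the
  multiplicity of \<open>S i\<close> in any composition series; this replaces the Jordan-Hoelder theorem.\<close>

lemma jh_mult_eq:
  assumes i: "i \<in> {1..n}" and M: "fg_module A M" and Ls: "composition_series A M Ls"
  shows "jh_mult A M (S i) = card {k. Suc k < length Ls \<and>
    isomorphic A (quotient_module (sub M (Ls ! Suc k)) (Ls ! k)) (S i)}"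
proof -
  let ?c = "\<lambda>Ls. card {k. Suc k < length Ls \<and> isomorphic A (quotient_module (sub M (Ls ! Suc k)) (Ls ! k)) (S i)}"
  have c: "?c Ls * hdim K A (P i) (S i) = hdim K A (P i) M" if "composition_series A M Ls" for Ls
  proof -
    have "hdim K A (P i) M = (\<Sum>j\<in>{1..n}. if j = i then ?c Ls * hdim K A (P i) (S i) else 0)"
      unfolding series_count[OF P_proj[OF i] M that]
    proof (rule sum.cong[OF refl])
      fix j assume j: "j \<in> {1..n}"
      show "card {k. Suc k < length Ls \<and> isomorphic A (quotient_module (sub M (Ls ! Suc k)) (Ls ! k)) (S j)} *
        hdim K A (P i) (S j) = (if j = i then ?c Ls * hdim K A (P i) (S i) else 0)"
        using hdim_P_S[OF i j] by simp
    qed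
    then show ?thesis using i by simp
  qed
  have "hdim K A (P i) (S i) \<noteq> 0" using hdim_P_S[OF i i] by blast
  then have "?c Ls' = ?c Ls" if "composition_series A M Ls'" for Ls'
    using trans[OF c[OF that] c[OF Ls, symmetric]] by (simp only: mult_cancel2) simp
  then show ?thesis unfolding jh_mult_def using Ls by (intro the_equality) blast+
qed

text \<open>The function given by maps from a projective module depends on the class in K_0(mod A)
  alone. This is why a form built from arbitrary projectives can be rewritten in the basis of the
  \<open>P i\<close>.\<close>

lemma hdim_jh:
  assumes Q: "projective A Q" and M: "fg_module A M"
  shows "hdim K A Q M = (\<Sum>i\<in>{1..n}. jh_mult A M (S i) * hdim K A Q (S i))"
proof -
  obtain Ls where Ls: "composition_series A M Ls" using composition_series_exists[OF M] by blast
  show ?thesis unfolding series_count[OF Q M Ls]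
    by (rule sum.cong[OF refl]) (simp only: jh_mult_eq[OF _ M Ls])
qed

text \<open>Only the summand of \<open>S i\<close> survives in \<open>hdim_jh\<close> for
  \<open>P i\<close>. In this form multiplicities inherit additivity and invariance under
  isomorphism from Hom dimensions.\<close>

lemma jh_mult_hdim:
  assumes i: "i \<in> {1..n}" and M: "fg_module A M"
  shows "real (jh_mult A M (S i)) = real (hdim K A (P i) M) / real (hdim K A (P i) (S i))"
proof -
  have "hdim K A (P i) M = (\<Sum>j\<in>{1..n}. if j = i then jh_mult A M (S i) * hdim K A (P i) (S i) else 0)"
    unfolding hdim_jh[OF P_proj[OF i] M] by (rule sum.cong[OF refl]) (use hdim_P_S[OF i] in auto)
  then have "hdim K A (P i) M = jh_mult A M (S i) * hdim K A (P i) (S i)" using i by simp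
  moreover have "hdim K A (P i) (S i) \<noteq> 0" using hdim_P_S[OF i i] by blast
  ultimately show ?thesis by simp
qed

abbreviation edim where "edim i \<equiv> real (vectorspace.dim K (End_alg A (S i)))"

lemma theta_value_sum:
  "theta_value K A n S P \<theta> M = (\<Sum>i\<in>{1..n}. \<theta> (iso_class A (P i)) * real (jh_mult A M (S i)) * edim i)"
proof -
  have k: "K0_class A n S M (iso_class A (S j)) = real (jh_mult A M (S j))" if j: "j \<in> {1..n}" for j
  proof -
    have "K0_class A n S M (iso_class A (S j)) = (\<Sum>i\<in>{1..n}. if i = j then real (jh_mult A M (S j)) else 0)"
      unfolding K0_class_def
    proof (rule sum.cong[OF refl])
      fix i assume i: "i \<in> {1..n}"
      have "iso_class A (S j) = iso_class A (S i) \<longleftrightarrow> i = j"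
        using S_inj[OF j i] iso_class_eq_iff[OF S_mod[OF j] S_mod[OF i]] by auto
      then show "real (jh_mult A M (S i)) * (if iso_class A (S j) = iso_class A (S i) then 1 else 0) =
        (if i = j then real (jh_mult A M (S j)) else 0)" by simp
    qed
    then show ?thesis using j by simp
  qed
  have "(\<Sum>j\<in>{1..n}. \<theta> (iso_class A (P i)) * K0_class A n S M (iso_class A (S j)) * (if i = j then edim j else 0)) =
    \<theta> (iso_class A (P i)) * real (jh_mult A M (S i)) * edim i" if i: "i \<in> {1..n}" for i
  proof -
    have "(\<Sum>j\<in>{1..n}. \<theta> (iso_class A (P i)) * K0_class A n S M (iso_class A (S j)) * (if i = j then edim j else 0)) =
      (\<Sum>j\<in>{1..n}. if j = i then \<theta> (iso_class A (P i)) * real (jh_mult A M (S i)) * edim i else 0)"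
      by (rule sum.cong[OF refl]) (use k in auto)
    then show ?thesis using i by simp
  qed
  then show ?thesis unfolding theta_value_def euler_form_def by (intro sum.cong[OF refl])
qed

lemma theta_value_additive:
  assumes M: "fg_module A M" and L: "is_submodule A L M"
  shows "theta_value K A n S P \<theta> M = theta_value K A n S P \<theta> (sub M L) + theta_value K A n S P \<theta> (quotient_module M L)"
  unfolding theta_value_sum sum.distrib[symmetric]
proof (rule sum.cong[OF refl])
  fix i assume i: "i \<in> {1..n}"
  have "real (jh_mult A M (S i)) = real (jh_mult A (sub M L) (S i)) + real (jh_mult A (quotient_module M L) (S i))"
    unfolding jh_mult_hdim[OF i M] jh_mult_hdim[OF i fg_sub[OF M L]] jh_mult_hdim[OF i fg_quotient_module[OF M L]]
      hdim_quotient[OF P_proj[OF i] M L] by (simp add: add_divide_distrib)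
  then show "\<theta> (iso_class A (P i)) * real (jh_mult A M (S i)) * edim i =
    \<theta> (iso_class A (P i)) * real (jh_mult A (sub M L) (S i)) * edim i +
    \<theta> (iso_class A (P i)) * real (jh_mult A (quotient_module M L) (S i)) * edim i" by (simp add: algebra_simps)
qed

lemma theta_value_iso:
  assumes M: "fg_module A M" and N: "fg_module A N" and "isomorphic A M N"
  shows "theta_value K A n S P \<theta> M = theta_value K A n S P \<theta> N"
  unfolding theta_value_sum
  by (rule sum.cong[OF refl]) (simp only: jh_mult_hdim[OF _ M] jh_mult_hdim[OF _ N] hdim_iso[OF P_proj M N assms(3)])

text \<open>Both sides are determined by their values on the simple modules. The coefficient at
  \<open>P i\<close> is the value on \<open>S i\<close> divided by the dimension of the endomorphism
  algebra of \<open>S i\<close>, which cancels the weight in the Euler form.\<close>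

lemma theta_realize:
  assumes "projective A P1" "projective A Q1" "projective A P2" "projective A Q2"
  obtains \<theta> where "\<theta> \<in> K0_proj A n P" "\<And>M :: ('a, nat \<Rightarrow> 'k) module. fg_module A M \<Longrightarrow>
    theta_value K A n S P \<theta> M = a * theta_form K A P1 Q1 M + b * theta_form K A P2 Q2 M"
proof -
  define v where "v i = a * theta_form K A P1 Q1 (S i) + b * theta_form K A P2 Q2 (S i)" for i
  define \<theta> where "\<theta> c = (\<Sum>i\<in>{1..n}. if c = iso_class A (P i) then v i / edim i else 0)" for c
  have t: "\<theta> (iso_class A (P j)) = v j / edim j" if j: "j \<in> {1..n}" for j
  proof -
    have "\<theta> (iso_class A (P j)) = (\<Sum>i\<in>{1..n}. if i = j then v j / edim j else 0)"
      unfolding \<theta>_def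
    proof (rule sum.cong[OF refl])
      fix i assume i: "i \<in> {1..n}"
      have "iso_class A (P j) = iso_class A (P i) \<longleftrightarrow> i = j"
        using P_inj[OF j i] iso_class_eq_iff[OF projective_mod[OF P_proj[OF j]] projective_mod[OF P_proj[OF i]]] by auto
      then show "(if iso_class A (P j) = iso_class A (P i) then v i / edim i else 0) = (if i = j then v j / edim j else 0)"
        by simp
    qed
    then show ?thesis using j by simp
  qed
  have e: "edim i \<noteq> 0" if i: "i \<in> {1..n}" for i
  proof -
    obtain x where "x \<in> carrier (S i)" "x \<noteq> \<zero>\<^bsub>S i\<^esub>" using simple_nonzero[OF S_simple[OF i]] by blast
    then show ?thesis using End_dim_pos[OF S_mod[OF i]] by simp
  qed
  have "theta_value K A n S P \<theta> M = a * theta_form K A P1 Q1 M + b * theta_form K A P2 Q2 M"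
    if M: "fg_module A M" for M :: "('a, nat \<Rightarrow> 'k) module"
  proof -
    have tf: "theta_form K A P' Q' M = (\<Sum>i\<in>{1..n}. real (jh_mult A M (S i)) * theta_form K A P' Q' (S i))"
      if "projective A P'" "projective A Q'" for P' Q'
      unfolding theta_form_def hdim_jh[OF that(1) M] hdim_jh[OF that(2) M] hdim_jh[OF projective_free M]
      by (simp add: sum_distrib_left sum_subtractf right_diff_distrib mult.left_commute)
    have "theta_value K A n S P \<theta> M = (\<Sum>i\<in>{1..n}. v i * real (jh_mult A M (S i)))"
      unfolding theta_value_sum
    proof (rule sum.cong[OF refl])
      fix i assume i: "i \<in> {1..n}"
      show "\<theta> (iso_class A (P i)) * real (jh_mult A M (S i)) * edim i = v i * real (jh_mult A M (S i))"
        unfolding t[OF i] using e[OF i] by simp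
    qed
    then show ?thesis unfolding tf[OF assms(1,2)] tf[OF assms(3,4)] v_def
      by (simp add: sum_distrib_left sum.distrib algebra_simps)
  qed
  moreover have "\<theta> \<in> K0_proj A n P" unfolding K0_proj_def \<theta>_def by (auto intro!: sum.neutral)
  ultimately show ?thesis using that by blast
qed

end

subsection \<open>Consistent sequences\<close>

text \<open>Numbers decrease along \<open>R\<close>, so an element without incoming arrows takes the
  highest number \<open>card S - 1\<close>; the remaining elements are numbered by
  induction.\<close>

lemma topological_numbering:
  assumes "finite S" "acyclic R"
  obtains h :: "'b \<Rightarrow> nat" where "inj_on h S" "\<And>a. a \<in> S \<Longrightarrow> h a < card S"
    "\<And>a b. a \<in> S \<Longrightarrow> b \<in> S \<Longrightarrow> (a, b) \<in> R \<Longrightarrow> h b < h a"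
proof -
  have "\<exists>h :: 'b \<Rightarrow> nat. inj_on h S \<and> (\<forall>a\<in>S. h a < card S) \<and> (\<forall>a\<in>S. \<forall>b\<in>S. (a, b) \<in> R \<longrightarrow> h b < h a)"
    using assms(1)
  proof (induction "card S" arbitrary: S)
    case 0
    then show ?case by simp
  next
    case (Suc k)
    let ?r = "R \<inter> S \<times> S"
    have "finite ?r" using Suc.prems by simp
    moreover have "acyclic ?r" by (rule acyclic_subset[OF assms(2)]) simp
    ultimately have wf: "wf ?r" by (rule finite_acyclic_wf)
    obtain x where "x \<in> S" using Suc.hyps(2) by fastforce
    then obtain m where m: "m \<in> S" and min: "\<And>y. (y, m) \<in> ?r \<Longrightarrow> y \<notin> S" by (rule wfE_min[OF wf]) blast
    have src: "(a, m) \<notin> R" if "a \<in> S" for a using min[of a] m that by blast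
    have k: "k = card (S - {m})" using Suc.hyps(2) Suc.prems m by simp
    from Suc.hyps(1)[OF k] Suc.prems obtain h :: "'b \<Rightarrow> nat" where h: "inj_on h (S - {m})"
      "\<And>a. a \<in> S - {m} \<Longrightarrow> h a < k"
      "\<And>a b. a \<in> S - {m} \<Longrightarrow> b \<in> S - {m} \<Longrightarrow> (a, b) \<in> R \<Longrightarrow> h b < h a"
      unfolding k[symmetric] by auto
    let ?h = "h(m := k)"
    have lt: "?h a < ?h m" if "a \<in> S" "a \<noteq> m" for a using h(2)[of a] that by simp
    have "inj_on ?h S"
    proof (rule inj_onI)
      fix a b assume ab: "a \<in> S" "b \<in> S" "?h a = ?h b"
      show "a = b"
      proof (cases "a = m \<or> b = m")
        case True
        then show ?thesis using lt[OF ab(1)] lt[OF ab(2)] ab(3) by (metis less_irrefl)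
      next
        case False
        then show ?thesis using inj_onD[OF h(1), of a b] ab by simp
      qed
    qed
    moreover have "?h a < card S" if "a \<in> S" for a
      using h(2)[of a] that Suc.hyps(2) by (cases "a = m") auto
    moreover have "?h b < ?h a" if "a \<in> S" "b \<in> S" "(a, b) \<in> R" for a b
    proof -
      have "b \<noteq> m" using src that by blast
      then show ?thesis using lt[of b] h(3)[of a b] that by (cases "a = m") auto
    qed
    ultimately show ?case by blast
  qed
  then show ?thesis using that by blast
qed

section \<open>From weakly consistent sequences to directedness\<close>

context covers begin

abbreviation "tv \<equiv> theta_value K A n S P"

lemma stable_zero: "stable K A n S P \<theta> M \<Longrightarrow> tv \<theta> M = 0"
  and stable_pos: "stable K A n S P \<theta> M \<Longrightarrow> is_submodule A L M \<Longrightarrow> L \<noteq> {\<zero>\<^bsub>M\<^esub>} \<Longrightarrow> L \<noteq> carrier M \<Longrightarrow>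
    tv \<theta> (quotient_module M L) > 0"
  by (simp_all add: stable_def)

text \<open>A brick that is a quotient of \<open>X a\<close> and a submodule of \<open>X b\<close> separates \<open>a\<close> from \<open>b\<close>.\<close>

lemma weakly_consistent_hom:
  assumes X: "X \<in> J \<rightarrow> bricks A" and bij: "bij_betw (\<lambda>j. iso_class A (X j)) J (brick_classes A)"
    and lin: "linear_order_on J r"
    and neg: "\<And>i j. i \<in> J \<Longrightarrow> j \<in> J \<Longrightarrow> (i, j) \<in> r \<Longrightarrow> i \<noteq> j \<Longrightarrow> tv (\<theta> i) (X j) < 0"
    and nonneg: "\<And>i j. i \<in> J \<Longrightarrow> j \<in> J \<Longrightarrow> (j, i) \<in> r \<Longrightarrow> i \<noteq> j \<Longrightarrow> tv (\<theta> i) (X j) \<ge> 0"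
    and st: "\<And>i. i \<in> J \<Longrightarrow> stable K A n S P (\<theta> i) (X i)"
    and a: "a \<in> J" and b: "b \<in> J"
    and f: "f \<in> module_hom A (X a) (X b)" and x: "x \<in> carrier (X a)" "f x \<noteq> \<zero>\<^bsub>X b\<^esub>"
    and ni: "\<not> bij_betw f (carrier (X a)) (carrier (X b))"
  shows "(b, a) \<in> r \<and> b \<noteq> a"
proof -
  have Xm: "X i \<in> mod_cat A" if "i \<in> J" for i using X that brick_mod by blast
  let ?M = "X a" and ?N = "X b"
  note Ml = mod_lm[OF Xm[OF a]] and Nl = mod_lm[OF Xm[OF b]]
  note Mf = mod_fg[OF Xm[OF a]] and Nf = mod_fg[OF Xm[OF b]]
  interpret M: left_module A ?M by (rule Ml)
  interpret N: left_module A ?N by (rule Nl)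
  let ?I = "f ` carrier ?M"
  have sI: "is_submodule A ?I ?N" by (rule submod_im[OF Ml Nl f])
  have Im: "sub ?N ?I \<in> mod_cat A" by (rule mod_sub[OF Xm[OF b] sI])
  note Il = mod_lm[OF Im]
  have "f x \<in> carrier (sub ?N ?I)" "f x \<noteq> \<zero>\<^bsub>sub ?N ?I\<^esub>" using x by simp_all
  then obtain e where e: "e \<in> module_hom A (sub ?N ?I) (sub ?N ?I)" and B0: "sub (sub ?N ?I) (e ` carrier (sub ?N ?I)) \<in> bricks A"
    by (rule brick_factor[OF Im])
  let ?L = "e ` ?I"
  let ?B = "sub ?N ?L"
  have B: "?B \<in> bricks A" using B0 by simp
  have Bm: "?B \<in> mod_cat A" by (rule brick_mod[OF B])
  note Bl = mod_lm[OF Bm] and Bf = mod_fg[OF Bm]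
  have sL: "is_submodule A ?L ?N"
    using N.submod_trans[OF sI] submod_im[OF Il Il e] by simp
  have LI: "?L \<subseteq> ?I" using hom_closed[OF e] by auto
  let ?g = "\<lambda>x. e (f x)"
  have g: "?g \<in> module_hom A ?M ?B"
  proof (rule homI)
    have fI: "f \<in> module_hom A ?M (sub ?N ?I)" by (rule N.hom_into_sub[OF f]) simp
    have h: "?g \<in> module_hom A ?M (sub ?N ?I)" by (rule hom_comp[OF fI e])
    show "?g y \<in> carrier ?B" if "y \<in> carrier ?M" for y using that by simp
    show "?g (y \<oplus>\<^bsub>?M\<^esub> z) = ?g y \<oplus>\<^bsub>?B\<^esub> ?g z" if "y \<in> carrier ?M" "z \<in> carrier ?M" for y z
      using module_hom_add[OF h that] by simp
    show "?g (c \<odot>\<^bsub>?M\<^esub> y) = c \<odot>\<^bsub>?B\<^esub> ?g y" if "c \<in> carrier A" "y \<in> carrier ?M" for c y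
      using module_hom_smult[OF h that] by simp
  qed
  have gs: "?g ` carrier ?M = carrier ?B" by (simp add: image_image)
  have Bn: "?L \<noteq> {\<zero>\<^bsub>?N\<^esub>}" using brick_nonzero[OF B] by auto
  have "iso_class A ?B \<in> brick_classes A" using B by (simp add: brick_classes_def)
  \<comment> \<open>The brick \<open>?B\<close> need not be a chosen representative; its class
    determines the index \<open>c\<close>, and stability conditions for \<open>X c\<close> transfer
    by isomorphism.\<close>
  with bij_betw_imp_surj_on[OF bij] obtain c where c: "c \<in> J" "iso_class A ?B = iso_class A (X c)" by (rule surjE)
  have uniq: "i = c" if "i \<in> J" "isomorphic A (X i) ?B" for i
  proof -
    have "iso_class A (X i) = iso_class A (X c)" unfolding c(2)[symmetric] iso_class_eq_iff[OF Xm[OF that(1)] Bm] by (rule that(2))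
    then show ?thesis using inj_onD[OF bij_betw_imp_inj_on[OF bij]] that(1) c(1) by blast
  qed
  have iso: "isomorphic A (X c) ?B" using c(2)[symmetric] iso_class_eq_iff[OF Xm[OF c(1)] Bm] by simp
  have tB: "tv t (X c) = tv t ?B" for t by (rule theta_value_iso[OF mod_fg[OF Xm[OF c(1)]] Bf iso])
  have total: "(i, j) \<in> r \<or> (j, i) \<in> r" if "i \<in> J" "j \<in> J" "i \<noteq> j" for i j
    using lin that by (auto simp: linear_order_on_def total_on_def)
  \<comment> \<open>Either the map onto \<open>?B\<close> is injective and \<open>c = a\<close>, or
    \<open>?B\<close> is a proper quotient of \<open>X a\<close>. Stability then gives
    \<open>X c\<close> a positive value, which \<open>neg\<close> forbids for indices after
    \<open>a\<close>.\<close>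
  have ca: "(c, a) \<in> r \<and> c \<noteq> a \<or> c = a \<and> inj_on f (carrier ?M)"
  proof (cases "kern ?M ?B ?g = {\<zero>\<^bsub>?M\<^esub>}")
    case True
    then have i: "inj_on ?g (carrier ?M)" using kern_zero_iff_inj[OF Ml Bl g] by simp
    have "isomorphic A ?M ?B" using g i gs by (auto simp: isomorphic_def module_isos_def bij_betw_def)
    moreover have "inj_on f (carrier ?M)" using i by (auto simp: inj_on_def)
    ultimately show ?thesis using uniq[OF a] by blast
  next
    case False
    have "kern ?M ?B ?g \<noteq> carrier ?M"
    proof
      assume "kern ?M ?B ?g = carrier ?M"
      then have z: "?g y = \<zero>\<^bsub>?N\<^esub>" if "y \<in> carrier ?M" for y using that by auto
      have "?L = (\<lambda>y. \<zero>\<^bsub>?N\<^esub>) ` carrier ?M" unfolding image_image by (rule image_cong[OF refl z])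
      moreover have "carrier ?M \<noteq> {}" using x(1) by blast
      ultimately show False using Bn by (simp add: image_constant_conv)
    qed
    then have "tv (\<theta> a) (quotient_module ?M (kern ?M ?B ?g)) > 0"
      by (rule stable_pos[OF st[OF a] submod_kern[OF Ml Bl g] False])
    also have "tv (\<theta> a) (quotient_module ?M (kern ?M ?B ?g)) = tv (\<theta> a) (X c)"
      unfolding tB by (rule theta_value_iso[OF fg_quotient_module[OF Mf submod_kern[OF Ml Bl g]] Bf first_isomorphism[OF Ml Bl g gs]])
    finally have pos: "tv (\<theta> a) (X c) > 0" .
    then have "c \<noteq> a" using stable_zero[OF st[OF a]] by force
    moreover have "(a, c) \<notin> r" using neg[OF a c(1)] pos \<open>c \<noteq> a\<close> by force
    ultimately show ?thesis using total[OF a c(1)] by blast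
  qed
  \<comment> \<open>Dually, a proper submodule of \<open>X b\<close> has the negative of the value
    of its quotient. Stability makes it strictly negative, so the bound in \<open>nonneg\<close>
    already excludes that \<open>c\<close> comes before \<open>b\<close>.\<close>
  have bc: "(b, c) \<in> r \<and> b \<noteq> c \<or> b = c \<and> ?I = carrier ?N"
  proof (cases "?L = carrier ?N")
    case True
    then have "?I = carrier ?N" using LI N.submodD(1)[OF sI] by simp
    moreover have "?B = ?N" using True by simp
    ultimately show ?thesis using uniq[OF b] isomorphic_refl[of A ?N] by simp
  next
    case False
    have "tv (\<theta> b) (quotient_module ?N ?L) > 0" by (rule stable_pos[OF st[OF b] sL Bn False])
    moreover have "tv (\<theta> b) ?N = tv (\<theta> b) ?B + tv (\<theta> b) (quotient_module ?N ?L)"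
      by (rule theta_value_additive[OF Nf sL])
    ultimately have ng: "tv (\<theta> b) (X c) < 0" unfolding tB using stable_zero[OF st[OF b]] by simp
    then have "b \<noteq> c" using stable_zero[OF st[OF b]] by force
    moreover have "(c, b) \<notin> r" using nonneg[OF b c(1)] ng \<open>b \<noteq> c\<close> by force
    ultimately show ?thesis using total[OF b c(1)] by blast
  qed
  have "trans r" "antisym r" using lin by (auto simp: linear_order_on_def partial_order_on_def preorder_on_def)
  \<comment> \<open>If \<open>a\<close>, \<open>b\<close> and \<open>c\<close> coincided,
    \<open>f\<close> would be injective and onto; hence at least one of the two comparisons is
    strict.\<close>
  moreover have "\<not> (inj_on f (carrier ?M) \<and> ?I = carrier ?N)" using ni by (simp add: bij_betw_def)
  ultimately show ?thesis using ca bc transD[of r b c a] antisymD[of r b a] antisymD[of r b c] by auto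
qed

text \<open>The arrows of a cycle are moved to the representatives \<open>X\<close> by isomorphisms,
  which keeps them nonzero and not bijective. Each arrow then strictly lowers the index, while the
  two ends of the cycle have the same index.\<close>

lemma weakly_consistent_directed:
  assumes "admits_weakly_consistent_sequence K A n S P"
  shows "brick_directed A"
  unfolding brick_directed_def
proof clarify
  fix m Y g assume cyc: "brick_cycle A m Y g"
  obtain J :: "('a, nat \<Rightarrow> 'k) module set set" and r \<theta> X where lin: "linear_order_on J r" and X: "X \<in> J \<rightarrow> bricks A"
    and bij: "bij_betw (\<lambda>j. iso_class A (X j)) J (brick_classes A)"
    and neg: "\<And>i j. i \<in> J \<Longrightarrow> j \<in> J \<Longrightarrow> (i, j) \<in> r \<Longrightarrow> i \<noteq> j \<Longrightarrow> tv (\<theta> i) (X j) < 0"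
    and nonneg: "\<And>i j. i \<in> J \<Longrightarrow> j \<in> J \<Longrightarrow> (j, i) \<in> r \<Longrightarrow> i \<noteq> j \<Longrightarrow> tv (\<theta> i) (X j) \<ge> 0"
    and st: "\<And>i. i \<in> J \<Longrightarrow> stable K A n S P (\<theta> i) (X i)"
    using assms unfolding admits_weakly_consistent_sequence_def weakly_consistent_def by blast
  have Xm: "X i \<in> mod_cat A" if "i \<in> J" for i using X that brick_mod by blast
  have m: "1 \<le> m" and Y: "\<And>i. i \<le> m \<Longrightarrow> Y i \<in> bricks A" and Y0: "isomorphic A (Y 0) (Y m)"
    and g: "\<And>j. j \<in> {1..m} \<Longrightarrow> g j \<in> module_hom A (Y (j - 1)) (Y j)"
    and gn: "\<And>j. j \<in> {1..m} \<Longrightarrow> \<exists>x\<in>carrier (Y (j - 1)). g j x \<noteq> \<zero>\<^bsub>Y j\<^esub>"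
    and gi: "\<And>j. j \<in> {1..m} \<Longrightarrow> g j \<notin> module_isos A (Y (j - 1)) (Y j)"
    using cyc unfolding brick_cycle_def by auto
  have "\<exists>c. c \<in> J \<and> iso_class A (X c) = iso_class A (Y i)" if "i \<le> m" for i
  proof -
    have "iso_class A (Y i) \<in> brick_classes A" using Y[OF that] by (simp add: brick_classes_def)
    with bij_betw_imp_surj_on[OF bij] obtain c where "c \<in> J" "iso_class A (Y i) = iso_class A (X c)" by (rule surjE)
    then show ?thesis by (intro exI[of _ c]) simp
  qed
  then obtain a where a: "\<And>i. i \<le> m \<Longrightarrow> a i \<in> J" "\<And>i. i \<le> m \<Longrightarrow> iso_class A (X (a i)) = iso_class A (Y i)"
    by metis
  have iso: "isomorphic A (X (a i)) (Y i)" if "i \<le> m" for i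
    using a(2)[OF that] iso_class_eq_iff[OF Xm[OF a(1)[OF that]] brick_mod[OF Y[OF that]]] by simp
  have step: "(a (Suc i), a i) \<in> r \<and> a (Suc i) \<noteq> a i" if i: "Suc i \<le> m" for i
  proof -
    have i': "i \<le> m" and j: "Suc i \<in> {1..m}" using i by simp_all
    note Xi = mod_lm[OF Xm[OF a(1)[OF i']]] and Xs = mod_lm[OF Xm[OF a(1)[OF i]]]
    note Ys = mod_lm[OF brick_mod[OF Y[OF i]]]
    have G: "g (Suc i) \<in> module_hom A (Y i) (Y (Suc i))" using g[OF j] by simp
    obtain u where u: "u \<in> module_hom A (X (a i)) (Y i)" "bij_betw u (carrier (X (a i))) (carrier (Y i))"
      using iso[OF i'] by (auto simp: isomorphic_def module_isos_def)
    obtain v where v: "v \<in> module_hom A (Y (Suc i)) (X (a (Suc i)))" "bij_betw v (carrier (Y (Suc i))) (carrier (X (a (Suc i))))"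
      using isomorphic_sym[OF iso[OF i] Xs] by (auto simp: isomorphic_def module_isos_def)
    obtain y where y: "y \<in> carrier (Y i)" "g (Suc i) y \<noteq> \<zero>\<^bsub>Y (Suc i)\<^esub>" using gn[OF j] by auto
    obtain x where x: "x \<in> carrier (X (a i))" "y = u x"
      using bij_betw_imp_surj_on[OF u(2)] y(1) by (rule surjE)
    let ?f = "\<lambda>z. v (g (Suc i) (u z))"
    show ?thesis
    proof (rule weakly_consistent_hom[OF X bij lin])
      show "a i \<in> J" "a (Suc i) \<in> J" by (rule a(1)[OF i'], rule a(1)[OF i])
      show "?f \<in> module_hom A (X (a i)) (X (a (Suc i)))" by (rule hom_comp[OF hom_comp[OF u(1) G] v(1)])
      show "x \<in> carrier (X (a i))" by (rule x(1))
      show "?f x \<noteq> \<zero>\<^bsub>X (a (Suc i))\<^esub>"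
      proof
        assume "?f x = \<zero>\<^bsub>X (a (Suc i))\<^esub>"
        then have "v (g (Suc i) y) = v \<zero>\<^bsub>Y (Suc i)\<^esub>" using hom_zero[OF Ys Xs v(1)] x(2) by simp
        moreover have "\<zero>\<^bsub>Y (Suc i)\<^esub> \<in> carrier (Y (Suc i))"
          using left_module.submodD(2)[OF Ys left_module.submod_carrier[OF Ys]] .
        ultimately have "g (Suc i) y = \<zero>\<^bsub>Y (Suc i)\<^esub>"
          using inj_onD[OF bij_betw_imp_inj_on[OF v(2)]] hom_closed[OF G y(1)] by blast
        then show False using y(2) by simp
      qed
      show "\<not> bij_betw ?f (carrier (X (a i))) (carrier (X (a (Suc i))))"
      proof
        assume "bij_betw ?f (carrier (X (a i))) (carrier (X (a (Suc i))))"
        then have "bij_betw (v \<circ> (g (Suc i) \<circ> u)) (carrier (X (a i))) (carrier (X (a (Suc i))))"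
          by (simp add: comp_def)
        moreover have "(g (Suc i) \<circ> u) ` carrier (X (a i)) \<subseteq> carrier (Y (Suc i))"
          using hom_closed[OF hom_comp[OF u(1) G]] by auto
        ultimately have "bij_betw (g (Suc i) \<circ> u) (carrier (X (a i))) (carrier (Y (Suc i)))"
          using bij_betw_comp_iff2[OF v(2)] by blast
        then have "bij_betw (g (Suc i)) (carrier (Y i)) (carrier (Y (Suc i)))"
          using bij_betw_comp_iff[OF u(2)] by blast
        then show False using gi[OF j] G by (simp add: module_isos_def)
      qed
    qed (rule neg nonneg st; assumption)+
  qed
  have tr: "trans r" and as: "antisym r" using lin by (auto simp: linear_order_on_def partial_order_on_def preorder_on_def)
  have *: "Suc i \<le> m \<longrightarrow> (a (Suc i), a 0) \<in> r \<and> a (Suc i) \<noteq> a 0" for i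
  proof (induction i)
    case 0
    then show ?case using step[of 0] by simp
  next
    case (Suc i)
    show ?case
    proof
      assume i: "Suc (Suc i) \<le> m"
      then have "(a (Suc i), a 0) \<in> r \<and> a (Suc i) \<noteq> a 0" using Suc by simp
      then show "(a (Suc (Suc i)), a 0) \<in> r \<and> a (Suc (Suc i)) \<noteq> a 0"
        using step[OF i] transD[OF tr] antisymD[OF as] by metis
    qed
  qed
  have "a m \<noteq> a 0" using *[of "m - 1"] m by simp
  moreover have "iso_class A (X (a 0)) = iso_class A (X (a m))"
    using a(2)[of 0] a(2)[of m] Y0 iso_class_eq_iff[OF brick_mod[OF Y[of 0]] brick_mod[OF Y[of m]]] by simp
  then have "a 0 = a m" using inj_onD[OF bij_betw_imp_inj_on[OF bij]] a(1)[of 0] a(1)[of m] by blast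
  ultimately show False by simp
qed

section \<open>From directedness to a consistent sequence\<close>

text \<open>A closed path of the relation is a brick-cycle: consecutive indices differ and
  representatives of different classes are not isomorphic, so none of the chosen maps is an
  isomorphism.\<close>

lemma directed_acyclic:
  assumes dir: "brick_directed A" and X: "\<And>c. c \<in> C \<Longrightarrow> X c \<in> bricks A"
    and inj: "\<And>c d. c \<in> C \<Longrightarrow> d \<in> C \<Longrightarrow> isomorphic A (X c) (X d) \<Longrightarrow> c = d"
  shows "acyclic {(c, d). c \<in> C \<and> d \<in> C \<and> c \<noteq> d \<and>
    (\<exists>f\<in>module_hom A (X c) (X d). \<exists>x\<in>carrier (X c). f x \<noteq> \<zero>\<^bsub>X d\<^esub>)}" (is "acyclic ?R")
proof (rule acyclicI, rule allI, rule notI)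
  fix c assume "(c, c) \<in> ?R\<^sup>+"
  then obtain m where m: "0 < m" "(c, c) \<in> ?R ^^ m" unfolding trancl_power by blast
  then obtain p where p: "p 0 = c" "p m = c" "\<And>i. i < m \<Longrightarrow> (p i, p (Suc i)) \<in> ?R"
    unfolding relpow_fun_conv by blast
  have "\<exists>f. f \<in> module_hom A (X (p (j - 1))) (X (p j)) \<and> (\<exists>x\<in>carrier (X (p (j - 1))). f x \<noteq> \<zero>\<^bsub>X (p j)\<^esub>)"
    if "j \<in> {1..m}" for j
  proof -
    have "j - 1 < m" "Suc (j - 1) = j" using that by auto
    then show ?thesis using p(3)[of "j - 1"] by auto
  qed
  then obtain f where f: "\<And>j. j \<in> {1..m} \<Longrightarrow> f j \<in> module_hom A (X (p (j - 1))) (X (p j))"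
    "\<And>j. j \<in> {1..m} \<Longrightarrow> \<exists>x\<in>carrier (X (p (j - 1))). f j x \<noteq> \<zero>\<^bsub>X (p j)\<^esub>"
    by metis
  have pC: "p i \<in> C" if "i \<le> m" for i
  proof (cases "i < m")
    case True
    then show ?thesis using p(3) by blast
  next
    case False
    then have "p i = p 0" using that p(1,2) by simp
    then show ?thesis using p(3)[OF m(1)] by auto
  qed
  have "f j \<notin> module_isos A (X (p (j - 1))) (X (p j))" if j: "j \<in> {1..m}" for j
  proof
    have j': "j - 1 < m" "Suc (j - 1) = j" using j by auto
    assume "f j \<in> module_isos A (X (p (j - 1))) (X (p j))"
    then have "p (j - 1) = p j" using j by (intro inj pC) (auto simp: isomorphic_def)
    moreover have "p (j - 1) \<noteq> p (Suc (j - 1))" using p(3)[OF j'(1)] by blast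
    ultimately show False using j'(2) by simp
  qed
  then have "brick_cycle A m (\<lambda>i. X (p i)) f"
    unfolding brick_cycle_def using f X[OF pC] m(1) isomorphic_refl[of A "X c"] by (auto simp: p(1,2))
  then show False using dir unfolding brick_directed_def by blast
qed

lemma directed_consistent:
  assumes fin: "brick_finite A" and dir: "brick_directed A"
  shows "admits_consistent_sequence K A n S P"
proof -
  let ?J = "brick_classes A"
  define X where "X c = (SOME M. M \<in> bricks A \<and> iso_class A M = c)" for c
  have X: "X c \<in> bricks A \<and> iso_class A (X c) = c" if c: "c \<in> ?J" for c
  proof -
    have "\<exists>M. M \<in> bricks A \<and> iso_class A M = c" using c unfolding brick_classes_def by blast
    then show ?thesis unfolding X_def by (rule someI_ex)
  qed
  then have Xb: "X c \<in> bricks A" and Xc: "iso_class A (X c) = c" and Xm: "X c \<in> mod_cat A" if "c \<in> ?J" for c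
    using that brick_mod by blast+
  have Xn: "carrier (X c) \<noteq> {\<zero>\<^bsub>X c\<^esub>}" if "c \<in> ?J" for c using Xb[OF that] unfolding brick_iff by blast
  have inj: "c = d" if "c \<in> ?J" "d \<in> ?J" "isomorphic A (X c) (X d)" for c d
    using Xc[OF that(1)] Xc[OF that(2)] iso_class_eq_iff[OF Xm[OF that(1)] Xm[OF that(2)]] that(3) by simp
  define R where "R = {(c, d). c \<in> ?J \<and> d \<in> ?J \<and> c \<noteq> d \<and>
    (\<exists>f\<in>module_hom A (X c) (X d). \<exists>x\<in>carrier (X c). f x \<noteq> \<zero>\<^bsub>X d\<^esub>)}"
  have "acyclic R" unfolding R_def by (rule directed_acyclic[OF dir Xb inj])
  moreover have "finite ?J" using fin by (simp add: brick_finite_def)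
  ultimately obtain h :: "('a, nat \<Rightarrow> 'k) module set \<Rightarrow> nat" where h_inj: "inj_on h ?J" and h_card: "\<And>c. c \<in> ?J \<Longrightarrow> h c < card ?J"
    and h_R: "\<And>c d. c \<in> ?J \<Longrightarrow> d \<in> ?J \<Longrightarrow> (c, d) \<in> R \<Longrightarrow> h d < h c"
    using topological_numbering[of ?J R] by metis
  have h: "h d < h c" if "c \<in> ?J" "d \<in> ?J" "c \<noteq> d" "f \<in> module_hom A (X c) (X d)" "x \<in> carrier (X c)" "f x \<noteq> \<zero>\<^bsub>X d\<^esub>"
    for c d f x
  proof (rule h_R[OF that(1,2)])
    show "(c, d) \<in> R" unfolding R_def using that by blast
  qed
  \<comment> \<open>Numbers run from 0 to \<open>card ?J - 1\<close>. \<open>T (Suc (h c))\<close>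
    still contains \<open>X c\<close>, and \<open>T (h c)\<close> is what remains after its
    removal.\<close>
  define T where "T k = perp A (X ` {c \<in> ?J. k \<le> h c})" for k
  have T: "torsion_class A (T k)" for k unfolding T_def using Xm by (intro perp_torsion) blast
  have T_zero: "f x = \<zero>\<^bsub>X c\<^esub>" if "M \<in> T k" "c \<in> ?J" "k \<le> h c" "f \<in> module_hom A M (X c)" "x \<in> carrier M" for M k c f x
  proof (rule perpD[OF _ _ that(4,5)])
    show "M \<in> perp A (X ` {c \<in> ?J. k \<le> h c})" using that(1) by (simp add: T_def)
    show "X c \<in> X ` {c \<in> ?J. k \<le> h c}" using that(2,3) by blast
  qed
  have TI: "M \<in> T k" if "M \<in> mod_cat A"
    "\<And>c f x. c \<in> ?J \<Longrightarrow> k \<le> h c \<Longrightarrow> f \<in> module_hom A M (X c) \<Longrightarrow> x \<in> carrier M \<Longrightarrow> f x = \<zero>\<^bsub>X c\<^esub>" for M k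
    unfolding T_def perp_def using that by auto
  have X_T: "X c \<in> T k" if c: "c \<in> ?J" "h c < k" for c k
  proof (rule TI[OF Xm[OF c(1)]])
    fix d f x assume d: "d \<in> ?J" "k \<le> h d" and f: "f \<in> module_hom A (X c) (X d)" "x \<in> carrier (X c)"
    show "f x = \<zero>\<^bsub>X d\<^esub>"
    proof (rule ccontr)
      assume "f x \<noteq> \<zero>\<^bsub>X d\<^esub>"
      moreover have "c \<noteq> d" using c(2) d(2) by auto
      ultimately have "h d < h c" using h[OF c(1) d(1) _ f] by blast
      then show False using c(2) d(2) by simp
    qed
  qed
  have T_mono: "T k \<subseteq> T (Suc k)" for k unfolding T_def perp_def by auto
  have T_step: "T (h c) = T (Suc (h c)) \<inter> perp A {X c}" if c: "c \<in> ?J" for c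
  proof -
    have "{d \<in> ?J. h c \<le> h d} = insert c {d \<in> ?J. Suc (h c) \<le> h d}"
      using c inj_onD[OF h_inj, of c] by (auto simp: Suc_le_eq le_less)
    then show ?thesis unfolding T_def perp_def by auto
  qed
  have step: "torsion_step K A (T (Suc (h c))) (X c)" if c: "c \<in> ?J" for c
  proof
    show "torsion_class A (T (Suc (h c)))" by (rule T)
    show "X c \<in> T (Suc (h c))" using X_T[OF c] by simp
    show "X c \<in> bricks A" by (rule Xb[OF c])
    fix B f x assume B: "B \<in> bricks A" "B \<in> T (Suc (h c))" and f: "f \<in> module_hom A B (X c)" "x \<in> carrier B" "f x \<noteq> \<zero>\<^bsub>X c\<^esub>"
    note Bm = brick_mod[OF B(1)]
    define d where "d = iso_class A B"
    have d: "d \<in> ?J" using B(1) by (simp add: brick_classes_def d_def)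
    have "isomorphic A (X d) B" using Xc[OF d] iso_class_eq_iff[OF Xm[OF d] Bm] by (simp add: d_def)
    then obtain u v where u: "u \<in> module_hom A (X d) B" and v: "v \<in> module_hom A B (X d)"
      and vu: "\<And>y. y \<in> carrier (X d) \<Longrightarrow> v (u y) = y" and uv: "\<And>y. y \<in> carrier B \<Longrightarrow> u (v y) = y"
      using isoE[OF _ mod_lm[OF Xm[OF d]], of B] by metis
    have vx: "v x \<in> carrier (X d)" by (rule hom_closed[OF v f(2)])
    have fx: "f (u (v x)) \<noteq> \<zero>\<^bsub>X c\<^esub>" using f(3) uv[OF f(2)] by simp
    \<comment> \<open>For another brick a nonzero map to \<open>X c\<close> forces
      \<open>h c < h d\<close>. But then \<open>B\<close>, being in \<open>T (Suc (h c))\<close>,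
      has no nonzero map to \<open>X d\<close>, although the two are isomorphic.\<close>
    have "d = c"
    proof (rule ccontr)
      assume "d \<noteq> c"
      then have "h c < h d" using h[OF d c _ hom_comp[OF u f(1)] vx fx] by simp
      then have "v x = \<zero>\<^bsub>X d\<^esub>" using T_zero[OF B(2) d _ v f(2)] by simp
      then have "f (u (v x)) = \<zero>\<^bsub>X c\<^esub>"
        using hom_zero[OF mod_lm[OF Xm[OF d]] mod_lm[OF Xm[OF c]] hom_comp[OF u f(1)]] by simp
      then show False using fx by simp
    qed
    then have "isomorphic A (X c) B" using \<open>isomorphic A (X d) B\<close> by simp
    then show "hdim K A (free_module A) B = hdim K A (free_module A) (X c)"
      using hdim_iso[OF projective_free mod_fg[OF Xm[OF c]] mod_fg[OF Bm]] by simp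
  qed
  \<comment> \<open>Descending induction from \<open>card ?J\<close>: all numbers are smaller, so
    \<open>T (card ?J)\<close> is defined by an empty set of bricks and consists of all
    modules.\<close>
  have prog: "\<exists>U. progenerator A (T k) U" if "k \<le> card ?J" for k
    using that
  proof (induction rule: inc_induct)
    case base
    have "{c \<in> ?J. card ?J \<le> h c} = {}" using h_card by force
    then have "T (card ?J) = perp A (X ` {})" by (simp only: T_def)
    then have "T (card ?J) = mod_cat A" by (simp add: perp_def)
    then show ?case using progenerator_mod by auto
  next
    case (step k)
    show ?case
    proof (cases "\<exists>c\<in>?J. h c = k")
      case True
      then obtain c where c: "c \<in> ?J" "h c = k" by blast
      interpret t: torsion_step K A "T (Suc k)" "X c" using \<open>\<And>c. c \<in> ?J \<Longrightarrow> torsion_step K A (T (Suc (h c))) (X c)\<close>[OF c(1)] c(2) by simp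
      have "t.T' = T k" using T_step[OF c(1)] c(2) t.T'_eq by simp
      then show ?thesis using step.IH t.progenerator_step by metis
    next
      case False
      then have "{c \<in> ?J. k \<le> h c} = {c \<in> ?J. Suc k \<le> h c}" by (auto simp: Suc_le_eq le_less)
      then show ?thesis using step.IH by (simp add: T_def)
    qed
  qed
  have "\<exists>\<theta>. \<theta> \<in> K0_proj A n P \<and> tv \<theta> (X c) = 0 \<and> (\<forall>M\<in>T (h c). carrier M \<noteq> {\<zero>\<^bsub>M\<^esub>} \<longrightarrow> tv \<theta> M > 0) \<and>
      (\<forall>d\<in>?J. h c < h d \<longrightarrow> tv \<theta> (X d) < 0)" if c: "c \<in> ?J" for c
  proof -
    have "h c \<le> card ?J" "Suc (h c) \<le> card ?J" using h_card[OF c] by simp_all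
    then obtain U0 U1 where U: "progenerator A (T (h c)) U0" "progenerator A (T (Suc (h c))) U1" using prog by blast
    obtain P0 Q0 where p0: "projective A P0" "projective A Q0"
      and pos0: "\<And>M. M \<in> T (h c) \<Longrightarrow> carrier M \<noteq> {\<zero>\<^bsub>M\<^esub>} \<Longrightarrow> theta_form K A P0 Q0 M > 0"
      and neg0: "\<And>N. N \<in> mod_cat A \<Longrightarrow> carrier N \<noteq> {\<zero>\<^bsub>N\<^esub>} \<Longrightarrow>
        (\<And>Y f y. Y \<in> T (h c) \<Longrightarrow> f \<in> module_hom A Y N \<Longrightarrow> y \<in> carrier Y \<Longrightarrow> f y = \<zero>\<^bsub>N\<^esub>) \<Longrightarrow> theta_form K A P0 Q0 N < 0"
      using theta_form_exists[OF T U(1)] by metis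
    obtain P1 Q1 where p1: "projective A P1" "projective A Q1"
      and pos1: "\<And>M. M \<in> T (Suc (h c)) \<Longrightarrow> carrier M \<noteq> {\<zero>\<^bsub>M\<^esub>} \<Longrightarrow> theta_form K A P1 Q1 M > 0"
      and neg1: "\<And>N. N \<in> mod_cat A \<Longrightarrow> carrier N \<noteq> {\<zero>\<^bsub>N\<^esub>} \<Longrightarrow>
        (\<And>Y f y. Y \<in> T (Suc (h c)) \<Longrightarrow> f \<in> module_hom A Y N \<Longrightarrow> y \<in> carrier Y \<Longrightarrow> f y = \<zero>\<^bsub>N\<^esub>) \<Longrightarrow> theta_form K A P1 Q1 N < 0"
      using theta_form_exists[OF T U(2)] by metis
    have n0: "theta_form K A P0 Q0 (X d) < 0" if d: "d \<in> ?J" "h c \<le> h d" for d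
      by (rule neg0[OF Xm[OF d(1)] Xn[OF d(1)]]) (rule T_zero[OF _ d])
    have n1: "theta_form K A P1 Q1 (X d) < 0" if d: "d \<in> ?J" "Suc (h c) \<le> h d" for d
      by (rule neg1[OF Xm[OF d(1)] Xn[OF d(1)]]) (rule T_zero[OF _ d])
    \<comment> \<open>The coefficients are the values of the other form on \<open>X c\<close>, up to
      sign, so the combination cancels there. Both are positive because \<open>X c\<close> lies in
      \<open>T (Suc (h c))\<close> and receives no nonzero map from \<open>T (h c)\<close>.\<close>
    define a where "a = - theta_form K A P0 Q0 (X c)"
    define b where "b = theta_form K A P1 Q1 (X c)"
    have a: "a > 0" unfolding a_def using n0[OF c] by simp
    have b: "b > 0" unfolding b_def using pos1[OF X_T[OF c] Xn[OF c]] by simp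
    obtain \<theta> where \<theta>: "\<theta> \<in> K0_proj A n P" "\<And>M :: ('a, nat \<Rightarrow> 'k) module. fg_module A M \<Longrightarrow>
        tv \<theta> M = a * theta_form K A P1 Q1 M + b * theta_form K A P0 Q0 M"
      using theta_realize[OF p1 p0, of a b] by metis
    have "tv \<theta> (X c) = 0" unfolding \<theta>(2)[OF mod_fg[OF Xm[OF c]]] a_def b_def by simp
    moreover have "tv \<theta> M > 0" if M: "M \<in> T (h c)" "carrier M \<noteq> {\<zero>\<^bsub>M\<^esub>}" for M
    proof -
      have "fg_module A M" by (rule mod_fg[OF torsionD(1)[OF T M(1)]])
      moreover have "M \<in> T (Suc (h c))" using M(1) T_mono by blast
      ultimately show ?thesis
        using a b pos0[OF M] pos1[OF _ M(2)] by (simp add: \<theta>(2) add_pos_pos)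
    qed
    moreover have "tv \<theta> (X d) < 0" if d: "d \<in> ?J" "h c < h d" for d
      unfolding \<theta>(2)[OF mod_fg[OF Xm[OF d(1)]]]
      using a b n0[OF d(1)] n1[OF d(1)] d(2) by (intro add_neg_neg mult_pos_neg) simp_all
    ultimately show ?thesis using \<theta>(1) by blast
  qed
  then have "\<forall>c\<in>?J. \<exists>\<theta>. \<theta> \<in> K0_proj A n P \<and> tv \<theta> (X c) = 0 \<and> (\<forall>M\<in>T (h c). carrier M \<noteq> {\<zero>\<^bsub>M\<^esub>} \<longrightarrow> tv \<theta> M > 0) \<and>
      (\<forall>d\<in>?J. h c < h d \<longrightarrow> tv \<theta> (X d) < 0)" by blast
  from bchoice[OF this] obtain \<theta> where \<theta>: "\<And>c. c \<in> ?J \<Longrightarrow> \<theta> c \<in> K0_proj A n P" "\<And>c. c \<in> ?J \<Longrightarrow> tv (\<theta> c) (X c) = 0"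
    "\<And>c M. c \<in> ?J \<Longrightarrow> M \<in> T (h c) \<Longrightarrow> carrier M \<noteq> {\<zero>\<^bsub>M\<^esub>} \<Longrightarrow> tv (\<theta> c) M > 0"
    "\<And>c d. c \<in> ?J \<Longrightarrow> d \<in> ?J \<Longrightarrow> h c < h d \<Longrightarrow> tv (\<theta> c) (X d) < 0"
    by blast
  have stable: "stable K A n S P (\<theta> c) (X c)" if c: "c \<in> ?J" for c
    unfolding stable_def
  proof (intro conjI allI impI)
    show "tv (\<theta> c) (X c) = 0" by (rule \<theta>(2)[OF c])
    fix L assume L: "is_submodule A L (X c) \<and> L \<noteq> {\<zero>\<^bsub>X c\<^esub>} \<and> L \<noteq> carrier (X c)"
    then have sL: "is_submodule A L (X c)" by blast
    note Xf = mod_fg[OF Xm[OF c]] and Xl = mod_lm[OF Xm[OF c]]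
    interpret X: left_module A "X c" by (rule Xl)
    obtain Q p where Q: "Q \<in> mod_cat A" and p: "p \<in> module_hom A (X c) Q" "p ` carrier (X c) = carrier Q" "kern (X c) Q p = L"
      and iso: "isomorphic A (quotient_module (X c) L) Q"
      by (rule mod_quotient[OF Xf sL])
    note Ql = mod_lm[OF Q]
    obtain l where l: "l \<in> L" "l \<noteq> \<zero>\<^bsub>X c\<^esub>" using L X.submodD(2)[OF sL] by blast
    have lX: "l \<in> carrier (X c)" "p l = \<zero>\<^bsub>Q\<^esub>" using l(1) p(3) by blast+
    \<comment> \<open>A nonzero map from \<open>Q\<close> to \<open>X d\<close> with
      \<open>h c \<le> h d\<close> gives a nonzero map from \<open>X c\<close> to \<open>X d\<close>
      that kills \<open>l\<close>. The numbering leaves only \<open>d = c\<close>, where a nonzero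
      endomorphism of a brick is injective.\<close>
    have "Q \<in> T (h c)"
    proof (rule TI[OF Q], rule ccontr)
      fix d g y assume d: "d \<in> ?J" "h c \<le> h d" and g: "g \<in> module_hom A Q (X d)" "y \<in> carrier Q" "g y \<noteq> \<zero>\<^bsub>X d\<^esub>"
      from p(2) g(2) obtain x where x: "x \<in> carrier (X c)" "y = p x" by (rule surjE)
      have gp: "(\<lambda>x. g (p x)) \<in> module_hom A (X c) (X d)" by (rule hom_comp[OF p(1) g(1)])
      have gx: "g (p x) \<noteq> \<zero>\<^bsub>X d\<^esub>" using g(3) x(2) by simp
      have "d = c"
      proof (rule ccontr)
        assume "d \<noteq> c"
        then have "h d < h c" using h[OF c d(1) _ gp x(1) gx] by simp
        then show False using d(2) by simp
      qed
      have gl: "g (p l) = \<zero>\<^bsub>X d\<^esub>" using lX(2) hom_zero[OF Ql mod_lm[OF Xm[OF d(1)]] g(1)] by simp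
      have "\<forall>f\<in>module_hom A (X c) (X c). (\<exists>x\<in>carrier (X c). f x \<noteq> \<zero>\<^bsub>X c\<^esub>) \<longrightarrow> bij_betw f (carrier (X c)) (carrier (X c))"
        using Xb[OF c] by (simp add: brick_iff)
      moreover have "\<exists>x\<in>carrier (X c). g (p x) \<noteq> \<zero>\<^bsub>X c\<^esub>"
        by (rule bexI[of _ x]) (use gx x(1) \<open>d = c\<close> in simp_all)
      ultimately have "bij_betw (\<lambda>x. g (p x)) (carrier (X c)) (carrier (X c))"
        using gp[unfolded \<open>d = c\<close>] by simp
      then have i: "inj_on (\<lambda>x. g (p x)) (carrier (X c))" by (rule bij_betw_imp_inj_on)
      have "g (p \<zero>\<^bsub>X c\<^esub>) = \<zero>\<^bsub>X d\<^esub>" by (rule hom_zero[OF Xl mod_lm[OF Xm[OF d(1)]] gp])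
      then have "g (p l) = g (p \<zero>\<^bsub>X c\<^esub>)" using gl by simp
      then have "l = \<zero>\<^bsub>X c\<^esub>" by (rule inj_onD[OF i]) (use lX(1) X.submodD(2)[OF X.submod_carrier] in simp_all)
      then show False using l(2) by simp
    qed
    moreover have "carrier Q \<noteq> {\<zero>\<^bsub>Q\<^esub>}"
    proof
      assume "carrier Q = {\<zero>\<^bsub>Q\<^esub>}"
      then have "kern (X c) Q p = carrier (X c)" using hom_closed[OF p(1)] by blast
      then show False using p(3) L by simp
    qed
    ultimately have "tv (\<theta> c) Q > 0" by (rule \<theta>(3)[OF c])
    then show "tv (\<theta> c) (quotient_module (X c) L) > 0"
      using theta_value_iso[OF fg_quotient_module[OF Xf sL] mod_fg[OF Q] iso] by simp
  qed
  define r where "r = {(c, d). c \<in> ?J \<and> d \<in> ?J \<and> h c \<le> h d}"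
  have "linear_order_on ?J r"
    unfolding linear_order_on_def partial_order_on_def preorder_on_def refl_on_def trans_def antisym_def total_on_def r_def
    using inj_onD[OF h_inj] by auto
  moreover have "\<theta> \<in> ?J \<rightarrow> K0_proj A n P" using \<theta>(1) by blast
  moreover have "consistent K A n S P ?J r \<theta>"
    unfolding consistent_def
  proof (intro exI[of _ X] conjI ballI impI)
    show "X \<in> ?J \<rightarrow> bricks A" using Xb by blast
    show "bij_betw (\<lambda>c. iso_class A (X c)) ?J ?J" by (rule bij_betwI'[OF _ _ bexI]) (auto simp: Xc)
  next
    fix c d assume cd: "c \<in> ?J" "d \<in> ?J" "(c, d) \<in> r \<and> c \<noteq> d"
    then have "h c < h d" using inj_onD[OF h_inj, of c d] by (auto simp: r_def le_less)
    then show "tv (\<theta> c) (X d) < 0" by (rule \<theta>(4)[OF cd(1,2)])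
  next
    fix c d assume cd: "c \<in> ?J" "d \<in> ?J" "(d, c) \<in> r \<and> c \<noteq> d"
    then have "h d < h c" using inj_onD[OF h_inj, of c d] by (auto simp: r_def le_less)
    \<comment> \<open>Bricks with a smaller number lie in \<open>T (h c)\<close>, where the form is
      strictly positive; this gives consistency and not just the weak version.\<close>
    then show "tv (\<theta> c) (X d) > 0" by (intro \<theta>(3)[OF cd(1) X_T[OF cd(2)] Xn[OF cd(2)]])
  next
    fix c assume "c \<in> ?J"
    then show "stable K A n S P (\<theta> c) (X c)" by (rule stable)
  qed
  ultimately show ?thesis unfolding admits_consistent_sequence_def by blast
qed

lemma consistent_weakly:
  assumes "admits_consistent_sequence K A n S P"
  shows "admits_weakly_consistent_sequence K A n S P"
proof -
  obtain J :: "('a, nat \<Rightarrow> 'k) module set set" and r \<theta> where "linear_order_on J r" "\<theta> \<in> J \<rightarrow> K0_proj A n P" and c: "consistent K A n S P J r \<theta>"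
    using assms unfolding admits_consistent_sequence_def by blast
  moreover have "weakly_consistent K A n S P J r \<theta>"
    using c unfolding consistent_def weakly_consistent_def by (blast intro: less_imp_le)
  ultimately show ?thesis unfolding admits_weakly_consistent_sequence_def by blast
qed

end

theorem theorem1p10:
  fixes K :: "'k ring" and A :: "('k, 'a) module"
    and n :: nat and S P :: "nat \<Rightarrow> ('a, nat \<Rightarrow> 'k) module"
  assumes "fd_algebra K A"
    and "simples_with_covers A n S P"
    and "brick_finite A"
  shows "(brick_directed A \<longleftrightarrow> admits_consistent_sequence K A n S P) \<and>
    (admits_consistent_sequence K A n S P \<longleftrightarrow> admits_weakly_consistent_sequence K A n S P)"
proof -
  interpret covers K A n S P using assms(1,2) by (simp add: covers_def covers_axioms_def)
  show ?thesis
    using directed_consistent[OF assms(3)] consistent_weakly weakly_consistent_directed by blast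
qed

end
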